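(* Let $F$ be a field of characteristic different from $2$ and let $q$ be an anisotropic form over $F$ that has maximal splitting but is not a Pfister neighbour. Let $n$ be a positive integer and let $\pi\simeq\langle 1,x_1\rangle\otimes\cdots\otimes\langle 1,x_n\rangle$ over the iterated Laurent series field $F((x_1))\ldots((x_n))$. Then the form $\pi\otimes q$ over $F((x_1))\ldots((x_n))$ has maximal splitting but is not a Pfister neighbour.
   Context: "Form" means regular (nondegenerate) quadratic form of finite dimension. Forms over $F$ are viewed over $F((x_1))\ldots((x_n))$ by scalar extension when tensored with $\pi$. An $m$-fold Pfister form over a field $E$ is a form isometric to $\langle 1,a_1\rangle\otimes\cdots\otimes\langle 1,a_m\rangle$ with $a_i\in E^\times$ (the $0$-fold Pfister form is $\langle 1\rangle$). $p\subset q$ means $q\simeq p\perp r$ for some form $r$. A form $\tau$ over $E$ is a Pfister neighbour if there is a Pfister form $\theta$ over $E$ and $a\in E^\times$ with $\tau\subset a\theta$ and $\dim\tau>\frac12\dim\theta$. The Witt index $i(q)$ is defined by $q\simeq q_{\mathrm{an}}\perp i(q)\times\langle 1,-1\rangle$ with $q_{\mathrm{an}}$ anisotropic. For an anisotropic form $q$ over $E$ of dimension $d\geq 2$, $E(q)$ is the quotient field of $E[X_1,\ldots,X_d]/(q(X_1,\ldots,X_d))$, and the first Witt index is $i_1(q)=i(q_{E(q)})$. An anisotropic form $q$ has maximal splitting if $\dim q-i_1(q)$ is a power of two ($2^0=1$ included). *)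

theory Defs
  imports "HOL-Algebra.Indexed_Polynomials"
begin

section \<open>Quadratic forms over a field of characteristic different from 2\<close>

text \<open>
  A form of dimension \<open>d\<close> is given by its Gram matrix \<open>g\<close>, indexed by \<open>i, j < d\<close>: it is the
  map \<open>v \<mapsto> (\<Sum>i j. v\<^sub>i g\<^sub>i\<^sub>j v\<^sub>j)\<close> on \<open>K\<^sup>d\<close>. As \<open>2\<close> is invertible, the symmetric matrix is determined
  by the quadratic map. Entries of \<open>g\<close> outside the index range are irrelevant.
\<close>

datatype 'a qform = QForm (qdim: nat) (gram: "nat \<Rightarrow> nat \<Rightarrow> 'a")

definition bilin :: "('a, 'b) ring_scheme \<Rightarrow> 'a qform \<Rightarrow> (nat \<Rightarrow> 'a) \<Rightarrow> (nat \<Rightarrow> 'a) \<Rightarrow> 'a"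
  where "bilin K q v w =
    (\<Oplus>\<^bsub>K\<^esub>i\<in>{..<qdim q}. \<Oplus>\<^bsub>K\<^esub>j\<in>{..<qdim q}. v i \<otimes>\<^bsub>K\<^esub> gram q i j \<otimes>\<^bsub>K\<^esub> w j)"

definition quadratic_form :: "('a, 'b) ring_scheme \<Rightarrow> 'a qform \<Rightarrow> bool"
  where "quadratic_form K q \<longleftrightarrow>
    (\<forall>i<qdim q. \<forall>j<qdim q. gram q i j \<in> carrier K \<and> gram q i j = gram q j i) \<and>
    (\<forall>v \<in> {..<qdim q} \<rightarrow> carrier K.
       (\<forall>w \<in> {..<qdim q} \<rightarrow> carrier K. bilin K q v w = \<zero>\<^bsub>K\<^esub>) \<longrightarrow> (\<forall>i<qdim q. v i = \<zero>\<^bsub>K\<^esub>))"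

definition anisotropic :: "('a, 'b) ring_scheme \<Rightarrow> 'a qform \<Rightarrow> bool"
  where "anisotropic K q \<longleftrightarrow>
    (\<forall>v \<in> {..<qdim q} \<rightarrow> carrier K. bilin K q v v = \<zero>\<^bsub>K\<^esub> \<longrightarrow> (\<forall>i<qdim q. v i = \<zero>\<^bsub>K\<^esub>))"

definition inverse_matrices ::
  "('a, 'b) ring_scheme \<Rightarrow> nat \<Rightarrow> (nat \<Rightarrow> nat \<Rightarrow> 'a) \<Rightarrow> (nat \<Rightarrow> nat \<Rightarrow> 'a) \<Rightarrow> bool"
  where "inverse_matrices K d S T \<longleftrightarrow>
    (\<forall>i<d. \<forall>j<d. S i j \<in> carrier K \<and> T i j \<in> carrier K \<and>
       (\<Oplus>\<^bsub>K\<^esub>k\<in>{..<d}. S i k \<otimes>\<^bsub>K\<^esub> T k j) = (if i = j then \<one>\<^bsub>K\<^esub> else \<zero>\<^bsub>K\<^esub>) \<and>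
       (\<Oplus>\<^bsub>K\<^esub>k\<in>{..<d}. T i k \<otimes>\<^bsub>K\<^esub> S k j) = (if i = j then \<one>\<^bsub>K\<^esub> else \<zero>\<^bsub>K\<^esub>))"

definition isometric :: "('a, 'b) ring_scheme \<Rightarrow> 'a qform \<Rightarrow> 'a qform \<Rightarrow> bool"
  where "isometric K p q \<longleftrightarrow> qdim p = qdim q \<and>
    (\<exists>S T. inverse_matrices K (qdim q) S T \<and>
      (\<forall>i<qdim p. \<forall>j<qdim p. gram p i j = bilin K q (\<lambda>k. T k i) (\<lambda>k. T k j)))"

definition diag_form :: "('a, 'b) ring_scheme \<Rightarrow> 'a list \<Rightarrow> 'a qform"
  where "diag_form K as = QForm (length as) (\<lambda>i j. if i = j then as ! i else \<zero>\<^bsub>K\<^esub>)"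

definition orth_sum :: "('a, 'b) ring_scheme \<Rightarrow> 'a qform \<Rightarrow> 'a qform \<Rightarrow> 'a qform"
  where "orth_sum K p q = QForm (qdim p + qdim q)
    (\<lambda>i j. if i < qdim p \<and> j < qdim p then gram p i j
           else if qdim p \<le> i \<and> qdim p \<le> j then gram q (i - qdim p) (j - qdim p)
           else \<zero>\<^bsub>K\<^esub>)"

text \<open>Kronecker product of Gram matrices: the basis vector with number \<open>i * qdim q + j\<close>
  is \<open>e\<^sub>i \<otimes> e\<^sub>j\<close>.\<close>

definition tensor_form :: "('a, 'b) ring_scheme \<Rightarrow> 'a qform \<Rightarrow> 'a qform \<Rightarrow> 'a qform"
  where "tensor_form K p q = QForm (qdim p * qdim q)
    (\<lambda>i j. gram p (i div qdim q) (j div qdim q) \<otimes>\<^bsub>K\<^esub> gram q (i mod qdim q) (j mod qdim q))"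

definition scale_form :: "('a, 'b) ring_scheme \<Rightarrow> 'a \<Rightarrow> 'a qform \<Rightarrow> 'a qform"
  where "scale_form K a q = QForm (qdim q) (\<lambda>i j. a \<otimes>\<^bsub>K\<^esub> gram q i j)"

definition extend_form :: "('a \<Rightarrow> 'c) \<Rightarrow> 'a qform \<Rightarrow> 'c qform"
  where "extend_form h q = QForm (qdim q) (\<lambda>i j. h (gram q i j))"

definition subform :: "('a, 'b) ring_scheme \<Rightarrow> 'a qform \<Rightarrow> 'a qform \<Rightarrow> bool"
  where "subform K p q \<longleftrightarrow> (\<exists>r. quadratic_form K r \<and> isometric K q (orth_sum K p r))"

definition pfister_form :: "('a, 'b) ring_scheme \<Rightarrow> 'a list \<Rightarrow> 'a qform"
  where "pfister_form K as =
    foldr (\<lambda>a p. tensor_form K (diag_form K [\<one>\<^bsub>K\<^esub>, a]) p) as (diag_form K [\<one>\<^bsub>K\<^esub>])"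

definition is_pfister :: "('a, 'b) ring_scheme \<Rightarrow> nat \<Rightarrow> 'a qform \<Rightarrow> bool"
  where "is_pfister K m q \<longleftrightarrow> quadratic_form K q \<and>
    (\<exists>as. length as = m \<and> set as \<subseteq> carrier K - {\<zero>\<^bsub>K\<^esub>} \<and> isometric K q (pfister_form K as))"

definition pfister_neighbour :: "('a, 'b) ring_scheme \<Rightarrow> 'a qform \<Rightarrow> bool"
  where "pfister_neighbour K \<tau> \<longleftrightarrow>
    (\<exists>m \<theta> a. is_pfister K m \<theta> \<and> a \<in> carrier K - {\<zero>\<^bsub>K\<^esub>} \<and>
      subform K \<tau> (scale_form K a \<theta>) \<and> 2 * qdim \<tau> > qdim \<theta>)"

definition hyperbolic_form :: "('a, 'b) ring_scheme \<Rightarrow> nat \<Rightarrow> 'a qform"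
  where "hyperbolic_form K i = diag_form K (concat (replicate i [\<one>\<^bsub>K\<^esub>, \<ominus>\<^bsub>K\<^esub> \<one>\<^bsub>K\<^esub>]))"

text \<open>Existence and uniqueness of the index below are Witt's decomposition and cancellation
  theorems.\<close>

definition witt_index :: "('a, 'b) ring_scheme \<Rightarrow> 'a qform \<Rightarrow> nat"
  where "witt_index K q = (THE i. \<exists>p. quadratic_form K p \<and> anisotropic K p \<and>
    isometric K q (orth_sum K p (hyperbolic_form K i)))"


section \<open>Function fields of quadratic forms\<close>

text \<open>The polynomial ring \<open>K[X\<^sub>i | i \<in> I]\<close>: a polynomial maps monomials (multisets of indices)
  to coefficients, and multiplication is convolution.\<close>

definition mpoly_ring :: "('a, 'b) ring_scheme \<Rightarrow> 'i set \<Rightarrow> ('i multiset \<Rightarrow> 'a) ring"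
  where "mpoly_ring K I = \<lparr>
    carrier = ring.indexed_pset K I (carrier K),
    monoid.mult = (\<lambda>P Q m. \<Oplus>\<^bsub>K\<^esub>a\<in>{a. a \<subseteq># m}. P a \<otimes>\<^bsub>K\<^esub> Q (m - a)),
    one = ring.indexed_const K \<one>\<^bsub>K\<^esub>,
    zero = ring.indexed_const K \<zero>\<^bsub>K\<^esub>,
    add = ring.indexed_padd K\<rparr>"

definition form_poly :: "('a, 'b) ring_scheme \<Rightarrow> 'a qform \<Rightarrow> nat multiset \<Rightarrow> 'a"
  where "form_poly K q = (let P = mpoly_ring K {..<qdim q} in
    \<Oplus>\<^bsub>P\<^esub>i\<in>{..<qdim q}. \<Oplus>\<^bsub>P\<^esub>j\<in>{..<qdim q}.
      ring.indexed_const K (gram q i j) \<otimes>\<^bsub>P\<^esub> ring.indexed_var K i \<otimes>\<^bsub>P\<^esub> ring.indexed_var K j)"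

text \<open>For a domain \<open>A\<close> and \<open>b \<noteq> 0\<close>, \<open>fraction_class A a b\<close> is the equivalence class of the pairs
  representing \<open>a / b\<close>.\<close>

definition fraction_class :: "('a, 'b) ring_scheme \<Rightarrow> 'a \<Rightarrow> 'a \<Rightarrow> ('a \<times> 'a) set"
  where "fraction_class A a b = {(c, d). c \<in> carrier A \<and> d \<in> carrier A - {\<zero>\<^bsub>A\<^esub>} \<and> a \<otimes>\<^bsub>A\<^esub> d = c \<otimes>\<^bsub>A\<^esub> b}"

definition quotient_field :: "('a, 'b) ring_scheme \<Rightarrow> ('a \<times> 'a) set ring"
  where "quotient_field A = \<lparr>
    carrier = {fraction_class A a b | a b. a \<in> carrier A \<and> b \<in> carrier A - {\<zero>\<^bsub>A\<^esub>}},
    monoid.mult = (\<lambda>U V. \<Union>(a, b)\<in>U. \<Union>(c, d)\<in>V.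
      fraction_class A (a \<otimes>\<^bsub>A\<^esub> c) (b \<otimes>\<^bsub>A\<^esub> d)),
    one = fraction_class A \<one>\<^bsub>A\<^esub> \<one>\<^bsub>A\<^esub>,
    zero = fraction_class A \<zero>\<^bsub>A\<^esub> \<one>\<^bsub>A\<^esub>,
    add = (\<lambda>U V. \<Union>(a, b)\<in>U. \<Union>(c, d)\<in>V.
      fraction_class A (a \<otimes>\<^bsub>A\<^esub> d \<oplus>\<^bsub>A\<^esub> c \<otimes>\<^bsub>A\<^esub> b) (b \<otimes>\<^bsub>A\<^esub> d))\<rparr>"

definition form_ideal :: "('a, 'b) ring_scheme \<Rightarrow> 'a qform \<Rightarrow> (nat multiset \<Rightarrow> 'a) set"
  where "form_ideal K q = PIdl\<^bsub>mpoly_ring K {..<qdim q}\<^esub> (form_poly K q)"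

definition form_coord_ring :: "('a, 'b) ring_scheme \<Rightarrow> 'a qform \<Rightarrow> (nat multiset \<Rightarrow> 'a) set ring"
  where "form_coord_ring K q = mpoly_ring K {..<qdim q} Quot form_ideal K q"

definition function_field ::
  "('a, 'b) ring_scheme \<Rightarrow> 'a qform \<Rightarrow> ((nat multiset \<Rightarrow> 'a) set \<times> (nat multiset \<Rightarrow> 'a) set) set ring"
  where "function_field K q = quotient_field (form_coord_ring K q)"

definition function_field_embed ::
  "('a, 'b) ring_scheme \<Rightarrow> 'a qform \<Rightarrow> 'a \<Rightarrow> ((nat multiset \<Rightarrow> 'a) set \<times> (nat multiset \<Rightarrow> 'a) set) set"
  where "function_field_embed K q a =
    fraction_class (form_coord_ring K q)
      (form_ideal K q +>\<^bsub>mpoly_ring K {..<qdim q}\<^esub> ring.indexed_const K a)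
      \<one>\<^bsub>form_coord_ring K q\<^esub>"

definition first_witt_index :: "('a, 'b) ring_scheme \<Rightarrow> 'a qform \<Rightarrow> nat"
  where "first_witt_index K q =
    witt_index (function_field K q) (extend_form (function_field_embed K q) q)"

text \<open>The first Witt index is only meaningful in dimension at least 2, so maximal splitting
  includes this bound.\<close>

definition maximal_splitting :: "('a, 'b) ring_scheme \<Rightarrow> 'a qform \<Rightarrow> bool"
  where "maximal_splitting K q \<longleftrightarrow> quadratic_form K q \<and> anisotropic K q \<and> 2 \<le> qdim q \<and>
    (\<exists>k. qdim q - first_witt_index K q = 2 ^ k)"


section \<open>Iterated Laurent series fields\<close>

definition laurent_ring :: "('a, 'b) ring_scheme \<Rightarrow> (int \<Rightarrow> 'a) ring"
  where "laurent_ring R = \<lparr>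
    carrier = {f. (\<forall>k. f k \<in> carrier R) \<and> (\<exists>N. \<forall>k<N. f k = \<zero>\<^bsub>R\<^esub>)},
    monoid.mult = (\<lambda>f g k. \<Oplus>\<^bsub>R\<^esub>i\<in>{i. f i \<noteq> \<zero>\<^bsub>R\<^esub> \<and> g (k - i) \<noteq> \<zero>\<^bsub>R\<^esub>}. f i \<otimes>\<^bsub>R\<^esub> g (k - i)),
    one = (\<lambda>k. if k = 0 then \<one>\<^bsub>R\<^esub> else \<zero>\<^bsub>R\<^esub>),
    zero = (\<lambda>k. \<zero>\<^bsub>R\<^esub>),
    add = (\<lambda>f g k. f k \<oplus>\<^bsub>R\<^esub> g k)\<rparr>"

definition laurent_const :: "('a, 'b) ring_scheme \<Rightarrow> 'a \<Rightarrow> int \<Rightarrow> 'a"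
  where "laurent_const R a = (\<lambda>k. if k = 0 then a else \<zero>\<^bsub>R\<^esub>)"

definition laurent_var :: "('a, 'b) ring_scheme \<Rightarrow> int \<Rightarrow> 'a"
  where "laurent_var R = (\<lambda>k. if k = 1 then \<one>\<^bsub>R\<^esub> else \<zero>\<^bsub>R\<^esub>)"

text \<open>A single type hosting \<open>F((x\<^sub>1))\<dots>((x\<^sub>n))\<close> for all \<open>n\<close>; the injective constructors
  \<open>Const\<close> and \<open>Series\<close> are used to transport the ring structures.\<close>

datatype 'a tower = Const 'a | Series "int \<Rightarrow> 'a tower"

primrec iterated_laurent :: "('a, 'b) ring_scheme \<Rightarrow> nat \<Rightarrow> 'a tower ring"
  where
    "iterated_laurent F 0 = image_ring Const F"
  | "iterated_laurent F (Suc n) = image_ring Series (laurent_ring (iterated_laurent F n))"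

primrec iterated_laurent_const :: "('a, 'b) ring_scheme \<Rightarrow> nat \<Rightarrow> 'a \<Rightarrow> 'a tower"
  where
    "iterated_laurent_const F 0 a = Const a"
  | "iterated_laurent_const F (Suc n) a =
      Series (laurent_const (iterated_laurent F n) (iterated_laurent_const F n a))"

primrec iterated_laurent_vars :: "('a, 'b) ring_scheme \<Rightarrow> nat \<Rightarrow> 'a tower list"
  where
    "iterated_laurent_vars F 0 = []"
  | "iterated_laurent_vars F (Suc n) =
      map (\<lambda>x. Series (laurent_const (iterated_laurent F n) x)) (iterated_laurent_vars F n)
      @ [Series (laurent_var (iterated_laurent F n))]"

end

theory Submission
 imports Defs
begin

text \<open>
 Everything is reduced to the relation \<open>emb K p q\<close>: some, not necessarily injective, linear map carries
 \<open>p\<close> to \<open>q\<close>. By induction on \<open>n\<close> it suffices to pass from \<open>q\<close> over \<open>K\<close> to \<open>\<phi> = q \<perp> x q\<close> over \<open>K((x))\<close>.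

 Maximal splitting: \<open>i\<^sub>1(\<phi>) = 2 i\<^sub>1(q)\<close>. The Witt index over the function field is the least one over all
 extensions where the form becomes isotropic. Over \<open>K(q)((x))\<close> Springer's theorem shows that \<open>\<phi>\<close> has Witt
 index \<open>2 i\<^sub>1(q)\<close>. Conversely let \<open>E\<close> be the function field of \<open>\<phi>\<close>. Either \<open>q\<close> is isotropic over \<open>E\<close>, or it becomes
 isotropic over some \<open>E(\<lambda>)\<close> with \<open>\<lambda>\<^sup>2 = x - t \<lambda>\<close>, and taking first components of values transfers an
 embedding into \<open>q\<close> over \<open>E(\<lambda>)\<close> to one into \<open>q \<perp> x q\<close> over \<open>E\<close>.

 Neighbours: a Pfister form over \<open>K((x))\<close> is \<open>\<tau>\<close> or \<open>\<tau> \<perp> c x \<tau>\<close> with \<open>\<tau>\<close> a Pfister form over \<open>K\<close>, and an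
 embedding of \<open>\<phi>\<close> into a multiple of it has residues that embed \<open>q\<close> into a multiple of \<open>\<tau>\<close>.
\<close>

text \<open>Maps need not be injective because injectivity is automatic once the source is regular;
  meanwhile embeddings compose, add, scale and survive base change over any commutative ring.
  Isometry is recovered from equal dimensions, and a Witt index is the largest number of hyperbolic
  planes that embed.

  The obstacle is the function field, given concretely as fractions of a quotient of a polynomial
  ring. All that is known about it, down to its being a field, is read off from one map into an
  iterated Laurent series field: evaluation at a zero of the form whose coordinates other than
  coordinate 0 are algebraically independent. Such zeros exist above every field where the form is
  isotropic, since Hensel's lemma lets one coordinate move by a new variable while coordinate 0
  absorbs the error.

  The parameter \<open>t\<close> in \<open>\<lambda>\<^sup>2 = x - t \<lambda>\<close> makes
  \<open>u + \<lambda> v\<close> isotropic for vectors with \<open>q(u) = - x q(v)\<close> that need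
  not be orthogonal; it drops out of first components, so the transfer still lands in
  \<open>q \<perp> x q\<close>.\<close>

abbreviation hyp where "hyp \<equiv> hyperbolic_form"
abbreviation ext where "ext \<equiv> extend_form"
abbreviation orth where "orth \<equiv> orth_sum"
abbreviation aniso where "aniso \<equiv> anisotropic"
abbreviation regular where "regular \<equiv> quadratic_form"
abbreviation scl where "scl \<equiv> scale_form"

section \<open>Finite sums\<close>

lemma (in abelian_monoid) finsum_swap:
 assumes "finite A" "finite B" and f: "\<And>a b. a \<in> A \<Longrightarrow> b \<in> B \<Longrightarrow> f a b \<in> carrier G"
 shows "(\<Oplus>a\<in>A. \<Oplus>b\<in>B. f a b) = (\<Oplus>b\<in>B. \<Oplus>a\<in>A. f a b)"
 using assms(1) f
proof (induction A rule: finite_induct)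
 case empty
 thus ?case by (simp add: finsum_zero)
next
 case (insert x A)
 have "(\<Oplus>a\<in>insert x A. \<Oplus>b\<in>B. f a b) = (\<Oplus>b\<in>B. f x b) \<oplus> (\<Oplus>a\<in>A. \<Oplus>b\<in>B. f a b)"
  using insert by (subst finsum_insert) (auto intro!: finsum_closed)
 also have "\<dots> = (\<Oplus>b\<in>B. f x b) \<oplus> (\<Oplus>b\<in>B. \<Oplus>a\<in>A. f a b)"
  using insert by simp
 also have "\<dots> = (\<Oplus>b\<in>B. f x b \<oplus> (\<Oplus>a\<in>A. f a b))"
  using insert by (subst finsum_addf) (auto intro!: finsum_closed)
 also have "\<dots> = (\<Oplus>b\<in>B. \<Oplus>a\<in>insert x A. f a b)"
  using insert by (intro finsum_cong') (auto intro!: finsum_closed add.m_closed)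
 finally show ?case .
qed

lemma (in abelian_monoid) finsum_lessThan_add:
 assumes "\<And>i::nat. i < a + b \<Longrightarrow> f i \<in> carrier G"
 shows "(\<Oplus>i\<in>{..<a + b}. f i) = (\<Oplus>i\<in>{..<a}. f i) \<oplus> (\<Oplus>i\<in>{..<b}. f (i + a))"
proof -
 have "{..<a + b} = {..<a} \<union> (\<lambda>i. i + a) ` {..<b}"
 proof (intro equalityI subsetI)
  fix i assume i: "i \<in> {..<a + b}"
  show "i \<in> {..<a} \<union> (\<lambda>i. i + a) ` {..<b}"
  proof (cases "i < a")
   case False
   hence "i = (i - a) + a" "i - a < b" using i by auto
   thus ?thesis by blast
  qed auto
 qed auto
 moreover have "(\<Oplus>i\<in>(\<lambda>i. i + a) ` {..<b}. f i) = (\<Oplus>i\<in>{..<b}. f (i + a))"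
  using assms by (intro finsum_reindex) (auto simp: inj_on_def)
 moreover have "(\<Oplus>i\<in>{..<a} \<union> (\<lambda>i. i + a) ` {..<b}. f i)
   = (\<Oplus>i\<in>{..<a}. f i) \<oplus> (\<Oplus>i\<in>(\<lambda>i. i + a) ` {..<b}. f i)"
  using assms by (intro finsum_Un_disjoint) auto
 ultimately show ?thesis by simp
qed

lemma (in abelian_monoid) finsum_all_zero:
 assumes "\<And>i. i \<in> A \<Longrightarrow> f i = \<zero>"
 shows "finsum G f A = \<zero>"
 using assms by (simp add: add.finprod_one_eqI)

lemma (in abelian_monoid) finsum_delta:
 assumes "finite A" "j \<in> A" "f j \<in> carrier G" "\<And>i. i \<in> A \<Longrightarrow> i \<noteq> j \<Longrightarrow> f i = \<zero>"
 shows "finsum G f A = f j"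
proof -
 have "finsum G f A = finsum G f (insert j (A - {j}))" using assms(2) by (simp add: insert_absorb)
 also have "\<dots> = f j \<oplus> finsum G f (A - {j})"
  using assms by (intro finsum_insert) auto
 also have "finsum G f (A - {j}) = \<zero>" by (rule finsum_all_zero) (use assms in auto)
 finally show ?thesis using assms by simp
qed

lemma (in abelian_monoid) finsum_mono_neutral:
 assumes "finite B" "A \<subseteq> B" "\<And>i. i \<in> A \<Longrightarrow> f i \<in> carrier G" "\<And>i. i \<in> B - A \<Longrightarrow> f i = \<zero>"
 shows "finsum G f B = finsum G f A"
proof -
 have "finsum G f B = finsum G f (A \<union> (B - A))" using assms by (simp add: Un_absorb1)
 also have "\<dots> = finsum G f A \<oplus> finsum G f (B - A)"
  using assms by (intro finsum_Un_disjoint) (auto intro: finite_subset)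
 also have "finsum G f (B - A) = \<zero>" by (rule finsum_all_zero) (use assms in auto)
 finally show ?thesis using assms by (simp add: finsum_closed Pi_def)
qed

lemma (in abelian_group) finsum_uminus:
 assumes "finite A" "\<And>i. i \<in> A \<Longrightarrow> f i \<in> carrier G"
 shows "(\<Oplus>i\<in>A. \<ominus> f i) = \<ominus> finsum G f A"
 using assms
proof (induction A rule: finite_induct)
 case (insert x A)
 thus ?case by (simp add: Pi_def minus_add finsum_closed)
qed (simp add: minus_equality[of \<zero> \<zero>])

lemma ring_hom_cringI2: "cring K \<Longrightarrow> cring M \<Longrightarrow> h \<in> ring_hom K M \<Longrightarrow> ring_hom_cring K M h"
 by (simp add: ring_hom_cring_def ring_hom_cring_axioms_def)

section \<open>Vectors and bilinear forms\<close>

text \<open>Vectors are total functions with every value in the carrier, although a form reads only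
  the coordinates below its dimension: closure, shifting and joining then need no index
  conditions.\<close>

definition vec :: "('a, 'b) ring_scheme \<Rightarrow> ('i \<Rightarrow> 'a) set"
 where "vec K = {v. \<forall>i. v i \<in> carrier K}"

definition vadd :: "('a, 'b) ring_scheme \<Rightarrow> ('i \<Rightarrow> 'a) \<Rightarrow> ('i \<Rightarrow> 'a) \<Rightarrow> 'i \<Rightarrow> 'a"
 where "vadd K v w = (\<lambda>i. v i \<oplus>\<^bsub>K\<^esub> w i)"

definition smul :: "('a, 'b) ring_scheme \<Rightarrow> 'a \<Rightarrow> ('i \<Rightarrow> 'a) \<Rightarrow> 'i \<Rightarrow> 'a"
 where "smul K c v = (\<lambda>i. c \<otimes>\<^bsub>K\<^esub> v i)"

definition lcomb :: "('a, 'b) ring_scheme \<Rightarrow> 'j set \<Rightarrow> ('j \<Rightarrow> 'a) \<Rightarrow> ('j \<Rightarrow> 'i \<Rightarrow> 'a) \<Rightarrow> 'i \<Rightarrow> 'a"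
 where "lcomb K J c w = (\<lambda>k. \<Oplus>\<^bsub>K\<^esub>j\<in>J. c j \<otimes>\<^bsub>K\<^esub> w j k)"

definition uvec :: "('a, 'b) ring_scheme \<Rightarrow> nat \<Rightarrow> nat \<Rightarrow> 'a"
 where "uvec K i = (\<lambda>k. if k = i then \<one>\<^bsub>K\<^esub> else \<zero>\<^bsub>K\<^esub>)"

text \<open>Nondegeneracy is split off: the bilinear calculus needs only a symmetric Gram matrix,
  works over any commutative ring, and the target of an embedding may be degenerate.\<close>

definition sform :: "('a, 'b) ring_scheme \<Rightarrow> 'a qform \<Rightarrow> bool"
 where "sform K q \<longleftrightarrow> (\<forall>i<qdim q. \<forall>j<qdim q. gram q i j \<in> carrier K \<and> gram q i j = gram q j i)"

lemma vecI [intro]: "(\<And>i. v i \<in> carrier K) \<Longrightarrow> v \<in> vec K"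
 by (simp add: vec_def)

lemma vec_closed [simp]: "v \<in> vec K \<Longrightarrow> v i \<in> carrier K"
 by (simp add: vec_def)

lemma regular_sform: "regular K q \<Longrightarrow> sform K q"
 by (simp add: quadratic_form_def sform_def)

context cring
begin

lemma vadd_vec [simp]: "v \<in> vec R \<Longrightarrow> w \<in> vec R \<Longrightarrow> vadd R v w \<in> vec R"
 by (auto simp: vadd_def)

lemma smul_vec [simp]: "c \<in> carrier R \<Longrightarrow> v \<in> vec R \<Longrightarrow> smul R c v \<in> vec R"
 by (auto simp: smul_def)

lemma uvec_vec [simp]: "uvec R i \<in> vec R"
 by (auto simp: uvec_def)

lemma lcomb_vec [simp]: "c \<in> vec R \<Longrightarrow> (\<And>j. w j \<in> vec R) \<Longrightarrow> lcomb R J c w \<in> vec R"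
 by (auto simp: lcomb_def intro!: finsum_closed)

lemma lcomb_insert:
 assumes "finite J" "j \<notin> J" "c \<in> vec R" "\<And>j. w j \<in> vec R"
 shows "lcomb R (insert j J) c w = vadd R (smul R (c j) (w j)) (lcomb R J c w)"
 using assms by (auto simp: lcomb_def vadd_def smul_def)

lemma lcomb_empty: "lcomb R {} c w = (\<lambda>_. \<zero>)"
 by (auto simp: lcomb_def)

lemma gram_closed [simp]: "sform R q \<Longrightarrow> i < qdim q \<Longrightarrow> j < qdim q \<Longrightarrow> gram q i j \<in> carrier R"
 by (simp add: sform_def)

lemma bilin_alt:
 assumes "sform R q" "v \<in> vec R" "w \<in> vec R"
 shows "bilin R q v w = (\<Oplus>i\<in>{..<qdim q}. v i \<otimes> (\<Oplus>j\<in>{..<qdim q}. gram q i j \<otimes> w j))"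
 unfolding bilin_def using assms
 by (intro finsum_cong') (auto simp: finsum_rdistr m_assoc intro!: finsum_closed finsum_cong')

lemma bilin_closed [simp]:
 assumes "sform R q" "v \<in> vec R" "w \<in> vec R"
 shows "bilin R q v w \<in> carrier R"
 unfolding bilin_def using assms by (intro finsum_closed) (auto intro!: finsum_closed)

lemma bilin_sym:
 assumes "sform R q" "v \<in> vec R" "w \<in> vec R"
 shows "bilin R q v w = bilin R q w v"
proof -
 have "bilin R q v w = (\<Oplus>j\<in>{..<qdim q}. \<Oplus>i\<in>{..<qdim q}. v i \<otimes> gram q i j \<otimes> w j)"
  unfolding bilin_def using assms by (intro finsum_swap) auto
 also have "\<dots> = bilin R q w v"
  unfolding bilin_def
 proof (intro finsum_cong')
  fix i assume i: "i \<in> {..<qdim q}"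
  fix j assume j: "j \<in> {..<qdim q}"
  have "gram q i j = gram q j i" using assms i j by (auto simp: sform_def)
  thus "v j \<otimes> gram q j i \<otimes> w i = w i \<otimes> gram q i j \<otimes> v j"
   using assms i j by (simp add: m_ac)
 qed (use assms in "auto intro!: finsum_closed")
 finally show ?thesis .
qed

lemma bilin_add_left:
 assumes "sform R q" "v \<in> vec R" "v' \<in> vec R" "w \<in> vec R"
 shows "bilin R q (vadd R v v') w = bilin R q v w \<oplus> bilin R q v' w"
proof -
 let ?s = "\<lambda>i. \<Oplus>j\<in>{..<qdim q}. gram q i j \<otimes> w j"
 have s: "?s i \<in> carrier R" if "i < qdim q" for i
  using that assms by (intro finsum_closed) auto
 have "bilin R q (vadd R v v') w = (\<Oplus>i\<in>{..<qdim q}. v i \<otimes> ?s i \<oplus> v' i \<otimes> ?s i)"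
  unfolding bilin_alt[OF assms(1) vadd_vec[OF assms(2,3)] assms(4)] using assms s
  by (intro finsum_cong') (auto simp: vadd_def l_distr)
 also have "\<dots> = (\<Oplus>i\<in>{..<qdim q}. v i \<otimes> ?s i) \<oplus> (\<Oplus>i\<in>{..<qdim q}. v' i \<otimes> ?s i)"
  using s assms by (intro finsum_addf) auto
 finally show ?thesis using assms by (simp only: bilin_alt)
qed

lemma bilin_smul_left:
 assumes "sform R q" "v \<in> vec R" "c \<in> carrier R" "w \<in> vec R"
 shows "bilin R q (smul R c v) w = c \<otimes> bilin R q v w"
proof -
 have "bilin R q (smul R c v) w =
   (\<Oplus>i\<in>{..<qdim q}. c \<otimes> (v i \<otimes> (\<Oplus>j\<in>{..<qdim q}. gram q i j \<otimes> w j)))"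
  unfolding bilin_alt[OF assms(1) smul_vec[OF assms(3,2)] assms(4)] using assms
  by (intro finsum_cong') (auto simp: smul_def m_assoc finsum_closed intro!: finsum_closed)
 thus ?thesis using assms by (simp add: bilin_alt finsum_rdistr Pi_def finsum_closed)
qed

lemma bilin_add_right:
 assumes "sform R q" "v \<in> vec R" "v' \<in> vec R" "w \<in> vec R"
 shows "bilin R q w (vadd R v v') = bilin R q w v \<oplus> bilin R q w v'"
 using assms by (simp add: bilin_sym[of q w] bilin_add_left)

lemma bilin_smul_right:
 assumes "sform R q" "v \<in> vec R" "c \<in> carrier R" "w \<in> vec R"
 shows "bilin R q w (smul R c v) = c \<otimes> bilin R q w v"
 using assms by (simp add: bilin_sym[of q w] bilin_smul_left)

lemma bilin_cong:
 assumes "sform R q" "v' \<in> vec R" "w' \<in> vec R"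
  "\<And>i. i < qdim q \<Longrightarrow> v i = v' i" "\<And>i. i < qdim q \<Longrightarrow> w i = w' i"
 shows "bilin R q v w = bilin R q v' w'"
 unfolding bilin_def using assms by (intro finsum_cong') (auto intro!: finsum_closed)

lemma bilin_zero_left:
 assumes "sform R q" "w \<in> vec R" "\<And>i. i < qdim q \<Longrightarrow> v i = \<zero>"
 shows "bilin R q v w = \<zero>"
 unfolding bilin_def using assms by (intro finsum_all_zero) auto

lemma bilin_zero_right:
 assumes "sform R q" "w \<in> vec R" "\<And>i. i < qdim q \<Longrightarrow> v i = \<zero>"
 shows "bilin R q w v = \<zero>"
 unfolding bilin_def using assms by (intro finsum_all_zero) auto

lemma bilin_lcomb_left:
 assumes "finite J" "sform R q" "c \<in> vec R" "\<And>j. v j \<in> vec R" "w \<in> vec R"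
 shows "bilin R q (lcomb R J c v) w = (\<Oplus>j\<in>J. c j \<otimes> bilin R q (v j) w)"
 using assms(1)
proof (induction J rule: finite_induct)
 case empty
 thus ?case using assms by (simp add: lcomb_empty bilin_zero_left)
next
 case (insert j J)
 thus ?case using assms
  by (simp add: lcomb_insert bilin_add_left bilin_smul_left Pi_def)
qed

lemma bilin_lcomb_right:
 assumes "finite J" "sform R q" "c \<in> vec R" "\<And>j. v j \<in> vec R" "w \<in> vec R"
 shows "bilin R q w (lcomb R J c v) = (\<Oplus>j\<in>J. c j \<otimes> bilin R q w (v j))"
 using assms by (simp add: bilin_sym[of q w] bilin_lcomb_left)

lemma lcomb_uvec:
 assumes "v \<in> vec R" "k < d"
 shows "lcomb R {..<d} v (uvec R) k = v k"
proof -
 have "lcomb R {..<d} v (uvec R) k = v k \<otimes> uvec R k k"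
  unfolding lcomb_def using assms by (intro finsum_delta) (auto simp: uvec_def)
 thus ?thesis using assms by (simp add: uvec_def)
qed

lemma bilin_uvec:
 assumes "sform R q" "i < qdim q" "j < qdim q"
 shows "bilin R q (uvec R i) (uvec R j) = gram q i j"
proof -
 have "bilin R q (uvec R i) (uvec R j) =
   uvec R i i \<otimes> (\<Oplus>k\<in>{..<qdim q}. gram q i k \<otimes> uvec R j k)"
  unfolding bilin_alt[OF assms(1) uvec_vec uvec_vec] using assms
  by (intro finsum_delta) (auto simp: uvec_def intro!: finsum_closed)
 also have "(\<Oplus>k\<in>{..<qdim q}. gram q i k \<otimes> uvec R j k) = gram q i j \<otimes> uvec R j j"
  using assms by (intro finsum_delta) (auto simp: uvec_def)
 finally show ?thesis using assms by (simp add: uvec_def)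
qed

lemma bilin_expand:
 assumes "sform R q" "v \<in> vec R" "w \<in> vec R"
 shows "bilin R q v w = (\<Oplus>j\<in>{..<qdim q}. v j \<otimes> bilin R q (uvec R j) w)"
proof -
 have "bilin R q v w = bilin R q (lcomb R {..<qdim q} v (uvec R)) w"
  using assms by (intro bilin_cong) (auto simp: lcomb_uvec)
 thus ?thesis using assms by (simp add: bilin_lcomb_left)
qed

end

section \<open>Embeddings of forms\<close>

definition emb :: "('a, 'b) ring_scheme \<Rightarrow> 'a qform \<Rightarrow> 'a qform \<Rightarrow> bool"
 where "emb K p q \<longleftrightarrow> (\<exists>T. (\<forall>j<qdim p. \<forall>k<qdim q. T j k \<in> carrier K) \<and>
  (\<forall>i<qdim p. \<forall>j<qdim p. gram p i j = bilin K q (T i) (T j)))"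

text \<open>The last clause lets the map factor through the first \<open>d\<close> coordinates;
  vectors in this encoding have infinitely many.\<close>

definition linmap :: "('a, 'b) ring_scheme \<Rightarrow> nat \<Rightarrow> ((nat \<Rightarrow> 'a) \<Rightarrow> (nat \<Rightarrow> 'a)) \<Rightarrow> bool"
 where "linmap K d f \<longleftrightarrow> (\<forall>v\<in>vec K. f v \<in> vec K) \<and>
  (\<forall>v\<in>vec K. \<forall>w\<in>vec K. f (vadd K v w) = vadd K (f v) (f w)) \<and>
  (\<forall>c\<in>carrier K. \<forall>v\<in>vec K. f (smul K c v) = smul K c (f v)) \<and>
  (\<forall>v\<in>vec K. \<forall>w\<in>vec K. (\<forall>i<d. v i = w i) \<longrightarrow> f v = f w)"

context cring
begin

lemma linmap_lcomb_map:
 assumes "\<And>j. T j \<in> vec R"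
 shows "linmap R d (\<lambda>v. lcomb R {..<d} v T)"
 unfolding linmap_def
proof (intro conjI ballI impI)
 fix v w :: "nat \<Rightarrow> 'a" and c assume v: "v \<in> vec R" and w: "w \<in> vec R"
 show "lcomb R {..<d} v T \<in> vec R" using v assms by simp
 show "lcomb R {..<d} (vadd R v w) T = vadd R (lcomb R {..<d} v T) (lcomb R {..<d} w T)"
  using v w assms by (simp add: lcomb_def vadd_def finsum_addf l_distr Pi_def)
 show "lcomb R {..<d} v T = lcomb R {..<d} w T" if "\<forall>i<d. v i = w i"
  using that v w assms unfolding lcomb_def by (intro ext finsum_cong') auto
next
 fix v :: "nat \<Rightarrow> 'a" and c assume v: "v \<in> vec R" and c: "c \<in> carrier R"
 show "lcomb R {..<d} (smul R c v) T = smul R c (lcomb R {..<d} v T)"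
  using v c assms by (simp add: lcomb_def smul_def finsum_rdistr m_assoc Pi_def)
qed

lemma embI:
 assumes "sform R p" and "\<And>v. v \<in> vec R \<Longrightarrow> f v \<in> vec R"
  and "\<And>v w. v \<in> vec R \<Longrightarrow> w \<in> vec R \<Longrightarrow> bilin R q (f v) (f w) = bilin R p v w"
 shows "emb R p q"
 unfolding emb_def using assms
 by (intro exI[of _ "\<lambda>j. f (uvec R j)"]) (auto simp: bilin_uvec)

lemma emb_linmap:
 assumes "emb R p q" "sform R q"
 obtains f where "linmap R (qdim p) f"
  "\<And>v w. v \<in> vec R \<Longrightarrow> w \<in> vec R \<Longrightarrow> bilin R q (f v) (f w) = bilin R p v w"
proof -
 from assms(1) obtain T where T: "\<And>j k. j<qdim p \<Longrightarrow> k<qdim q \<Longrightarrow> T j k \<in> carrier R"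
  "\<And>i j. i<qdim p \<Longrightarrow> j<qdim p \<Longrightarrow> gram p i j = bilin R q (T i) (T j)"
  unfolding emb_def by blast
 \<comment> \<open>Entries outside the index range are arbitrary in \<open>emb\<close>; padding by
   zero turns the rows into vectors without changing any value.\<close>
 define T' where "T' = (\<lambda>j k. if j < qdim p \<and> k < qdim q then T j k else \<zero>)"
 have T': "T' j \<in> vec R" for j using T(1) by (auto simp: T'_def)
 have gT: "gram p i j = bilin R q (T' i) (T' j)" if "i < qdim p" "j < qdim p" for i j
  using that T(2)[OF that] bilin_cong[OF assms(2) T' T', of "T i" i "T j" j]
  by (simp add: T'_def)
 have sp: "sform R p" unfolding sform_def using gT T' bilin_sym[OF assms(2)] assms(2)
  by auto
 show ?thesis
 proof (rule that[OF linmap_lcomb_map[of T']])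
  fix v w :: "nat \<Rightarrow> 'a" assume v: "v \<in> vec R" and w: "w \<in> vec R"
  let ?L = "\<lambda>v. lcomb R {..<qdim p} v T'"
  have "bilin R q (?L v) (?L w) = (\<Oplus>i\<in>{..<qdim p}. v i \<otimes> (\<Oplus>j\<in>{..<qdim p}. w j \<otimes> bilin R q (T' i) (T' j)))"
   using v w T' assms(2)
   by (simp add: bilin_lcomb_left) (intro finsum_cong', auto simp: bilin_lcomb_right)
  also have "\<dots> = bilin R p v w"
   unfolding bilin_alt[OF sp v w]
  proof (intro finsum_cong')
   fix i assume i: "i \<in> {..<qdim p}"
   have "(\<Oplus>j\<in>{..<qdim p}. w j \<otimes> bilin R q (T' i) (T' j)) = (\<Oplus>j\<in>{..<qdim p}. gram p i j \<otimes> w j)"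
    using i gT[of i] w T' assms(2) sp by (intro finsum_cong') (auto simp: m_comm)
   thus "v i \<otimes> (\<Oplus>j\<in>{..<qdim p}. w j \<otimes> bilin R q (T' i) (T' j)) =
     v i \<otimes> (\<Oplus>j\<in>{..<qdim p}. gram p i j \<otimes> w j)" by simp
  qed (use v w sp in "auto intro!: finsum_closed")
  finally show "bilin R q (?L v) (?L w) = bilin R p v w" .
 qed (rule T')
qed

lemma linmapD:
 assumes "linmap R d f"
 shows "v \<in> vec R \<Longrightarrow> f v \<in> vec R"
  and "v \<in> vec R \<Longrightarrow> w \<in> vec R \<Longrightarrow> f (vadd R v w) = vadd R (f v) (f w)"
  and "c \<in> carrier R \<Longrightarrow> v \<in> vec R \<Longrightarrow> f (smul R c v) = smul R c (f v)"
  and "v \<in> vec R \<Longrightarrow> w \<in> vec R \<Longrightarrow> (\<And>i. i < d \<Longrightarrow> v i = w i) \<Longrightarrow> f v = f w"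
 using assms unfolding linmap_def by blast+

lemma linmap_zero:
 assumes "linmap R d f" shows "f (\<lambda>_. \<zero>) = (\<lambda>_. \<zero>)"
proof -
 let ?z = "\<lambda>_::nat. \<zero>"
 have z: "?z \<in> vec R" by auto
 define y where "y = f ?z"
 have y: "y \<in> vec R" unfolding y_def by (rule linmapD(1)[OF assms z])
 have "smul R \<zero> ?z = ?z" by (simp add: smul_def)
 hence "y = smul R \<zero> y" unfolding y_def using linmapD(3)[OF assms zero_closed z] by simp
 hence "y i = \<zero> \<otimes> y i" for i by (metis smul_def)
 thus ?thesis unfolding y_def[symmetric] using y by auto
qed

lemma linmap_lcomb:
 assumes "linmap R d f" "finite J" "c \<in> vec R" "\<And>j. w j \<in> vec R"
 shows "f (lcomb R J c w) = lcomb R J c (\<lambda>j. f (w j))"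
 using assms(2)
proof (induction J rule: finite_induct)
 case empty
 thus ?case using linmap_zero[OF assms(1)] by (simp add: lcomb_empty)
next
 case (insert j J)
 thus ?case using assms by (simp add: lcomb_insert linmapD(1-3)[OF assms(1)])
qed

lemma emb_sform:
 assumes "emb R p q" "sform R q" shows "sform R p"
proof -
 from emb_linmap[OF assms] obtain f where f: "linmap R (qdim p) f" 
  "\<And>v w. v \<in> vec R \<Longrightarrow> w \<in> vec R \<Longrightarrow> bilin R q (f v) (f w) = bilin R p v w" by metis
 from assms(1) obtain T where T: "\<And>j k. j<qdim p \<Longrightarrow> k<qdim q \<Longrightarrow> T j k \<in> carrier R"
  "\<And>i j. i<qdim p \<Longrightarrow> j<qdim p \<Longrightarrow> gram p i j = bilin R q (T i) (T j)"
  unfolding emb_def by blast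
 define T' where "T' = (\<lambda>j k. if j < qdim p \<and> k < qdim q then T j k else \<zero>)"
 have T': "T' j \<in> vec R" for j using T(1) by (auto simp: T'_def)
 have gT: "gram p i j = bilin R q (T' i) (T' j)" if "i < qdim p" "j < qdim p" for i j
  using that T(2)[OF that] bilin_cong[OF assms(2) T' T', of "T i" i "T j" j]
  by (simp add: T'_def)
 show "sform R p" unfolding sform_def using gT T' bilin_sym[OF assms(2)] assms(2) by auto
qed

lemma emb_trans:
 assumes "emb R p q" "emb R q r" "sform R r" shows "emb R p r"
proof -
 have sq: "sform R q" by (rule emb_sform[OF assms(2,3)])
 have sp: "sform R p" by (rule emb_sform[OF assms(1) sq])
 obtain f where f: "linmap R (qdim p) f"
  "\<And>v w. v \<in> vec R \<Longrightarrow> w \<in> vec R \<Longrightarrow> bilin R q (f v) (f w) = bilin R p v w"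
  using emb_linmap[OF assms(1) sq] by metis
 obtain g where g: "linmap R (qdim q) g"
  "\<And>v w. v \<in> vec R \<Longrightarrow> w \<in> vec R \<Longrightarrow> bilin R r (g v) (g w) = bilin R q v w"
  using emb_linmap[OF assms(2,3)] by metis
 show ?thesis
  by (rule embI[OF sp, of "\<lambda>v. g (f v)"]) (use linmapD(1)[OF f(1)] linmapD(1)[OF g(1)] f g in auto)
qed

lemma emb_form_eq:
 assumes "qdim p = qdim q" "\<And>i j. i < qdim q \<Longrightarrow> j < qdim q \<Longrightarrow> gram p i j = gram q i j" "sform R q"
 shows "emb R p q"
 unfolding emb_def using assms
 by (intro exI[of _ "uvec R"]) (auto simp: bilin_uvec)

lemma emb_refl: "sform R q \<Longrightarrow> emb R q q"
 by (rule emb_form_eq) auto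

section \<open>Orthogonal sums and multiples of forms\<close>

lemma sform_orth [simp]: "sform R p \<Longrightarrow> sform R q \<Longrightarrow> sform R (orth R p q)"
 by (auto simp: sform_def orth_sum_def)

lemma sform_scale [simp]: "sform R p \<Longrightarrow> a \<in> carrier R \<Longrightarrow> sform R (scl R a p)"
 by (auto simp: sform_def scale_form_def)

lemma qdim_simps [simp]: "qdim (orth R p q) = qdim p + qdim q"
 "qdim (scl R a p) = qdim p" "qdim (ext h p) = qdim p"
 "qdim (diag_form R as) = length as" "qdim (tensor_form R p q) = qdim p * qdim q"
 by (auto simp: orth_sum_def scale_form_def extend_form_def diag_form_def tensor_form_def)

lemma bilin_scale:
 assumes "sform R q" "a \<in> carrier R" "v \<in> vec R" "w \<in> vec R"
 shows "bilin R (scl R a q) v w = a \<otimes> bilin R q v w"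
proof -
 have "bilin R (scl R a q) v w = (\<Oplus>i\<in>{..<qdim q}. a \<otimes> (\<Oplus>j\<in>{..<qdim q}. v i \<otimes> gram q i j \<otimes> w j))"
  unfolding bilin_def qdim_simps
 proof (intro finsum_cong' refl)
  fix i assume i: "i \<in> {..<qdim q}"
  have "(\<Oplus>j\<in>{..<qdim q}. v i \<otimes> gram (scl R a q) i j \<otimes> w j) =
    (\<Oplus>j\<in>{..<qdim q}. a \<otimes> (v i \<otimes> gram q i j \<otimes> w j))"
   using i assms by (intro finsum_cong') (auto simp: scale_form_def m_ac)
  thus "(\<Oplus>j\<in>{..<qdim q}. v i \<otimes> gram (scl R a q) i j \<otimes> w j) =
    a \<otimes> (\<Oplus>j\<in>{..<qdim q}. v i \<otimes> gram q i j \<otimes> w j)"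
   using i assms by (simp add: finsum_rdistr Pi_def)
 qed (use assms in "auto intro!: finsum_closed")
 thus ?thesis unfolding bilin_def using assms by (simp add: finsum_rdistr Pi_def finsum_closed)
qed

lemma bilin_orth:
 assumes "sform R p" "sform R q" "v \<in> vec R" "w \<in> vec R"
 shows "bilin R (orth R p q) v w =
  bilin R p v w \<oplus> bilin R q (\<lambda>i. v (i + qdim p)) (\<lambda>i. w (i + qdim p))"
proof -
 let ?a = "qdim p" and ?b = "qdim q" and ?s = "orth R p q"
 have s: "sform R ?s" using assms by simp
 have *: "(\<lambda>i. v (i + ?a)) \<in> vec R" "(\<lambda>i. w (i + ?a)) \<in> vec R" using assms by auto
 have "bilin R ?s v w = (\<Oplus>i\<in>{..<?a + ?b}. v i \<otimes> (\<Oplus>j\<in>{..<?a + ?b}. gram ?s i j \<otimes> w j))"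
  using bilin_alt[OF s assms(3,4)] by simp
 also have "\<dots> = (\<Oplus>i\<in>{..<?a}. v i \<otimes> (\<Oplus>j\<in>{..<?a + ?b}. gram ?s i j \<otimes> w j)) \<oplus>
   (\<Oplus>i\<in>{..<?b}. v (i + ?a) \<otimes> (\<Oplus>j\<in>{..<?a + ?b}. gram ?s (i + ?a) j \<otimes> w j))"
  using s assms by (intro finsum_lessThan_add) (auto intro!: finsum_closed m_closed)
 also have "(\<Oplus>i\<in>{..<?a}. v i \<otimes> (\<Oplus>j\<in>{..<?a + ?b}. gram ?s i j \<otimes> w j)) = bilin R p v w"
  unfolding bilin_alt[OF assms(1,3,4)]
 proof (rule finsum_cong'[OF refl])
  fix i assume i: "i \<in> {..<?a}"
  have "(\<Oplus>j\<in>{..<?a + ?b}. gram ?s i j \<otimes> w j) = (\<Oplus>j\<in>{..<?a}. gram ?s i j \<otimes> w j)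
    \<oplus> (\<Oplus>j\<in>{..<?b}. gram ?s i (j + ?a) \<otimes> w (j + ?a))"
   using i s assms by (intro finsum_lessThan_add) (auto intro!: m_closed)
  also have "(\<Oplus>j\<in>{..<?b}. gram ?s i (j + ?a) \<otimes> w (j + ?a)) = \<zero>"
   using i assms by (intro finsum_all_zero) (auto simp: orth_sum_def)
  also have "(\<Oplus>j\<in>{..<?a}. gram ?s i j \<otimes> w j) = (\<Oplus>j\<in>{..<?a}. gram p i j \<otimes> w j)"
   using i assms by (intro finsum_cong') (auto simp: orth_sum_def)
  finally show "v i \<otimes> (\<Oplus>j\<in>{..<?a + ?b}. gram ?s i j \<otimes> w j) = v i \<otimes> (\<Oplus>j\<in>{..<?a}. gram p i j \<otimes> w j)"
   using i assms by (simp add: finsum_closed Pi_def)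
 qed (use assms in "auto intro!: finsum_closed m_closed")
 also have "(\<Oplus>i\<in>{..<?b}. v (i + ?a) \<otimes> (\<Oplus>j\<in>{..<?a + ?b}. gram ?s (i + ?a) j \<otimes> w j)) =
   bilin R q (\<lambda>i. v (i + ?a)) (\<lambda>i. w (i + ?a))"
  unfolding bilin_alt[OF assms(2) *]
 proof (rule finsum_cong'[OF refl])
  fix i assume i: "i \<in> {..<?b}"
  have "(\<Oplus>j\<in>{..<?a + ?b}. gram ?s (i + ?a) j \<otimes> w j) = (\<Oplus>j\<in>{..<?a}. gram ?s (i + ?a) j \<otimes> w j)
    \<oplus> (\<Oplus>j\<in>{..<?b}. gram ?s (i + ?a) (j + ?a) \<otimes> w (j + ?a))"
   using i s assms by (intro finsum_lessThan_add) (auto intro!: m_closed)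
  also have "(\<Oplus>j\<in>{..<?a}. gram ?s (i + ?a) j \<otimes> w j) = \<zero>"
   using i assms by (intro finsum_all_zero) (auto simp: orth_sum_def)
  also have "(\<Oplus>j\<in>{..<?b}. gram ?s (i + ?a) (j + ?a) \<otimes> w (j + ?a)) = (\<Oplus>j\<in>{..<?b}. gram q i j \<otimes> w (j + ?a))"
   using i assms by (intro finsum_cong') (auto simp: orth_sum_def)
  finally show "v (i + ?a) \<otimes> (\<Oplus>j\<in>{..<?a + ?b}. gram ?s (i + ?a) j \<otimes> w j) = v (i + ?a) \<otimes> (\<Oplus>j\<in>{..<?b}. gram q i j \<otimes> w (j + ?a))"
   using i assms by (simp add: finsum_closed Pi_def)
 qed (use assms in "auto intro!: finsum_closed m_closed")
 finally show ?thesis .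
qed

end

lemma bilin_extend:
 assumes "cring K" "cring L" "h \<in> ring_hom K L" "sform K q" "v \<in> vec K" "w \<in> vec K"
 shows "bilin L (ext h q) (\<lambda>i. h (v i)) (\<lambda>i. h (w i)) = h (bilin K q v w)"
proof -
 interpret K: cring K by fact
 interpret L: cring L by fact
 interpret h: ring_hom_cring K L h
  using assms(1-3) by (simp add: ring_hom_cring_def ring_hom_cring_axioms_def)
 show ?thesis unfolding bilin_def using assms
  by (simp add: extend_form_def Pi_def K.finsum_closed comp_def)
    (intro L.finsum_cong'; auto intro!: L.finsum_closed L.finsum_cong')
qed

section \<open>Calculus of embeddings\<close>

definition vjoin :: "nat \<Rightarrow> (nat \<Rightarrow> 'a) \<Rightarrow> (nat \<Rightarrow> 'a) \<Rightarrow> nat \<Rightarrow> 'a"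
 where "vjoin a v w = (\<lambda>k. if k < a then v k else w (k - a))"

lemma vjoin_vec [simp]: "v \<in> vec K \<Longrightarrow> w \<in> vec K \<Longrightarrow> vjoin a v w \<in> vec K"
 by (auto simp: vjoin_def)

lemma vjoin_add [simp]: "vjoin a v w (i + a) = w i"
 by (simp add: vjoin_def)

lemma shift_vec [simp]: "v \<in> vec K \<Longrightarrow> (\<lambda>i. v (i + a)) \<in> vec K"
 "v \<in> vec K \<Longrightarrow> (\<lambda>i. v (Suc i)) \<in> vec K"
 by auto

context cring
begin

lemma zero_vec [simp]: "(\<lambda>_. \<zero>) \<in> vec R"
 by auto

lemma bilin_vjoin_left [simp]:
 assumes "sform R p" "v \<in> vec R" "v' \<in> vec R"
 shows "bilin R p (vjoin (qdim p) v w) (vjoin (qdim p) v' w') = bilin R p v v'"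
 using assms by (intro bilin_cong) (auto simp: vjoin_def)

lemma bilin_vjoin:
 assumes "sform R p" "sform R r" "v \<in> vec R" "w \<in> vec R" "v' \<in> vec R" "w' \<in> vec R"
 shows "bilin R (orth R p r) (vjoin (qdim p) v w) (vjoin (qdim p) v' w') = bilin R p v v' \<oplus> bilin R r w w'"
 using assms by (simp add: bilin_orth)

lemma emb_id:
 assumes "sform R p" "\<And>v w. v \<in> vec R \<Longrightarrow> w \<in> vec R \<Longrightarrow> bilin R q v w = bilin R p v w"
 shows "emb R p q"
 by (rule embI[of p "\<lambda>v. v"]) (use assms in auto)

lemma emb_orth:
 assumes "emb R p p'" "emb R r r'" "sform R p'" "sform R r'"
 shows "emb R (orth R p r) (orth R p' r')"
proof -
 have sp: "sform R p" and sr: "sform R r" using assms emb_sform by blast+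
 obtain f where f: "linmap R (qdim p) f"
  "\<And>v w. v \<in> vec R \<Longrightarrow> w \<in> vec R \<Longrightarrow> bilin R p' (f v) (f w) = bilin R p v w"
  using emb_linmap[OF assms(1,3)] by metis
 obtain g where g: "linmap R (qdim r) g"
  "\<And>v w. v \<in> vec R \<Longrightarrow> w \<in> vec R \<Longrightarrow> bilin R r' (g v) (g w) = bilin R r v w"
  using emb_linmap[OF assms(2,4)] by metis
 show ?thesis
  by (rule embI[of _ "\<lambda>v. vjoin (qdim p') (f v) (g (\<lambda>i. v (i + qdim p)))"])
   (use sp sr f g assms linmapD(1)[OF f(1)] linmapD(1)[OF g(1)] in
    \<open>auto simp: bilin_orth\<close>)
qed

lemma emb_left:
 assumes "sform R p" "sform R r" shows "emb R p (orth R p r)"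
proof -
 show ?thesis
  by (rule embI[of _ "\<lambda>v. vjoin (qdim p) v (\<lambda>_. \<zero>)"])
   (use assms in "auto simp: bilin_orth bilin_zero_left")
qed

lemma emb_right:
 assumes "sform R p" "sform R r" shows "emb R r (orth R p r)"
proof -
 show ?thesis
  by (rule embI[of _ "\<lambda>v. vjoin (qdim p) (\<lambda>_. \<zero>) v"])
   (use assms in "auto simp: bilin_orth bilin_zero_left")
qed

lemma emb_scale:
 assumes "emb R p q" "sform R q" "a \<in> carrier R"
 shows "emb R (scl R a p) (scl R a q)"
proof -
 have sp: "sform R p" using assms emb_sform by blast
 obtain f where f: "linmap R (qdim p) f"
  "\<And>v w. v \<in> vec R \<Longrightarrow> w \<in> vec R \<Longrightarrow> bilin R q (f v) (f w) = bilin R p v w"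
  using emb_linmap[OF assms(1,2)] by metis
 show ?thesis
  by (rule embI[of _ f]) (use sp f assms linmapD(1)[OF f(1)] in "auto simp: bilin_scale")
qed

lemma emb_orth_comm:
 assumes "sform R p" "sform R r" shows "emb R (orth R p r) (orth R r p)"
 by (rule embI[of _ "\<lambda>v. vjoin (qdim r) (\<lambda>i. v (i + qdim p)) v"])
  (use assms in "auto simp: bilin_orth a_comm")

lemma bilin_orth_assoc:
 assumes "sform R p" "sform R q" "sform R r" "v \<in> vec R" "w \<in> vec R"
 shows "bilin R (orth R (orth R p q) r) v w = bilin R (orth R p (orth R q r)) v w"
 using assms by (simp add: bilin_orth a_assoc add.assoc add.commute[of "qdim p"])

lemma emb_orth_assoc:
 assumes "sform R p" "sform R q" "sform R r"
 shows "emb R (orth R (orth R p q) r) (orth R p (orth R q r))"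
  "emb R (orth R p (orth R q r)) (orth R (orth R p q) r)"
 by (rule emb_id; use assms in "simp add: bilin_orth_assoc")+

lemma emb_scale_orth:
 assumes "sform R p" "sform R r" "a \<in> carrier R"
 shows "emb R (scl R a (orth R p r)) (orth R (scl R a p) (scl R a r))"
  "emb R (orth R (scl R a p) (scl R a r)) (scl R a (orth R p r))"
 by (rule emb_id; use assms in "simp add: bilin_orth bilin_scale r_distr")+

lemma emb_scale_scale:
 assumes "sform R p" "a \<in> carrier R" "b \<in> carrier R"
 shows "emb R (scl R a (scl R b p)) (scl R (a \<otimes> b) p)"
  "emb R (scl R (a \<otimes> b) p) (scl R a (scl R b p))"
 by (rule emb_id; use assms in "simp add: bilin_scale m_assoc")+

lemma emb_scale_one:
 assumes "sform R p" shows "emb R (scl R \<one> p) p" "emb R p (scl R \<one> p)"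
 by (rule emb_id; use assms in "simp add: bilin_scale")+

text \<open>Multiplication by \<open>c\<close> absorbs the square factor; \<open>c\<close> may be
  zero because embeddings need not be injective.\<close>

lemma emb_scale_square:
 assumes "sform R p" "a \<in> carrier R" "c \<in> carrier R"
 shows "emb R (scl R (c \<otimes> c \<otimes> a) p) (scl R a p)"
 by (rule embI[of _ "smul R c"])
  (use assms in "auto simp: bilin_scale bilin_smul_left bilin_smul_right m_ac")

section \<open>Diagonal forms\<close>

lemma sform_diag [simp]: "set as \<subseteq> carrier R \<Longrightarrow> sform R (diag_form R as)"
 by (auto simp: sform_def diag_form_def subset_iff)

lemma bilin_diag:
 assumes "set as \<subseteq> carrier R" "v \<in> vec R" "w \<in> vec R"
 shows "bilin R (diag_form R as) v w = (\<Oplus>i\<in>{..<length as}. v i \<otimes> as ! i \<otimes> w i)"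
 unfolding bilin_def
proof (intro finsum_cong')
 have c: "as ! i \<in> carrier R" if "i < length as" for i using that assms(1) by auto
 fix i assume i: "i \<in> {..<length as}"
 have "(\<Oplus>j\<in>{..<qdim (diag_form R as)}. v i \<otimes> gram (diag_form R as) i j \<otimes> w j)
  = v i \<otimes> gram (diag_form R as) i i \<otimes> w i"
  using assms i c by (intro finsum_delta) (auto simp: diag_form_def)
 thus "(\<Oplus>j\<in>{..<qdim (diag_form R as)}. v i \<otimes> gram (diag_form R as) i j \<otimes> w j) = v i \<otimes> as ! i \<otimes> w i"
  by (simp add: diag_form_def)
qed (use assms in "auto simp: subset_iff")

lemma bilin_diag_Nil: "bilin R (diag_form R []) v w = \<zero>"
 by (simp add: bilin_def)

lemma bilin_diag_Cons:
 assumes "a \<in> carrier R" "set as \<subseteq> carrier R" "v \<in> vec R" "w \<in> vec R"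
 shows "bilin R (diag_form R (a # as)) v w = v 0 \<otimes> a \<otimes> w 0 \<oplus>
  bilin R (diag_form R as) (\<lambda>i. v (Suc i)) (\<lambda>i. w (Suc i))"
proof -
 have c: "as ! i \<in> carrier R" if "i < length as" for i using that assms(2) by auto
 have c': "(a # as) ! i \<in> carrier R" if "i < 1 + length as" for i
  using that assms(1,2) by (cases i) auto
 have "bilin R (diag_form R (a # as)) v w = (\<Oplus>i\<in>{..<1 + length as}. v i \<otimes> (a # as) ! i \<otimes> w i)"
  using assms by (subst bilin_diag) auto
 also have "\<dots> = (\<Oplus>i\<in>{..<1}. v i \<otimes> (a # as) ! i \<otimes> w i) \<oplus> (\<Oplus>i\<in>{..<length as}. v (i + 1) \<otimes> (a # as) ! (i + 1) \<otimes> w (i + 1))"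
  using assms c' by (intro finsum_lessThan_add) auto
 also have "(\<Oplus>i\<in>{..<1}. v i \<otimes> (a # as) ! i \<otimes> w i) = v 0 \<otimes> a \<otimes> w 0"
  using assms by (simp add: lessThan_Suc Pi_def)
 finally show ?thesis using assms by (simp add: bilin_diag)
qed

lemma emb_diag_Cons:
 assumes "a \<in> carrier R" "set as \<subseteq> carrier R"
 shows "emb R (diag_form R (a # as)) (orth R (diag_form R [a]) (diag_form R as))"
  "emb R (orth R (diag_form R [a]) (diag_form R as)) (diag_form R (a # as))"
 by (rule emb_id; use assms in "simp add: bilin_orth bilin_diag_Cons bilin_diag_Nil")+

section \<open>Isometry, regularity and anisotropy in terms of total vectors\<close>

lemma bilin_isometry:
 assumes "inverse_matrices R d S T" "i < d" "k < d"
 shows "(\<Oplus>j\<in>{..<d}. S k j \<otimes> T j i) = (if k = i then \<one> else \<zero>)"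
  "(\<Oplus>j\<in>{..<d}. T k j \<otimes> S j i) = (if k = i then \<one> else \<zero>)"
 using assms unfolding inverse_matrices_def by auto

lemma isometric_emb:
 assumes "isometric R p q" shows "emb R p q"
proof -
 from assms obtain S T where "qdim p = qdim q" "inverse_matrices R (qdim q) S T"
  "\<forall>i<qdim p. \<forall>j<qdim p. gram p i j = bilin R q (\<lambda>k. T k i) (\<lambda>k. T k j)"
  unfolding isometric_def by blast
 thus ?thesis unfolding emb_def inverse_matrices_def
  by (intro exI[of _ "\<lambda>j k. T k j"]) auto
qed

text \<open>In matrices: from \<open>G\<^sub>p = T\<^sup>t G\<^sub>q T\<close> and
  \<open>T S = 1\<close> follows \<open>S\<^sup>t G\<^sub>p S = G\<^sub>q\<close>. The primed
  matrices are transposed and padded by zero, so that their rows are vectors.\<close>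

lemma isometric_sym:
 assumes "isometric R p q" "sform R q" shows "isometric R q p"
proof -
 from assms(1) obtain S T where d: "qdim p = qdim q" and inv: "inverse_matrices R (qdim q) S T"
  and g: "\<And>i j. i < qdim p \<Longrightarrow> j < qdim p \<Longrightarrow> gram p i j = bilin R q (\<lambda>k. T k i) (\<lambda>k. T k j)"
  unfolding isometric_def by blast
 let ?d = "qdim q"
 have ST: "S i j \<in> carrier R" "T i j \<in> carrier R" if "i < ?d" "j < ?d" for i j
  using inv that unfolding inverse_matrices_def by blast+
 define S' where "S' = (\<lambda>j k. if j < ?d \<and> k < ?d then S k j else \<zero>)"
 define T' where "T' = (\<lambda>j k. if j < ?d \<and> k < ?d then T k j else \<zero>)"
 have v: "S' j \<in> vec R" "T' j \<in> vec R" for j using ST by (auto simp: S'_def T'_def)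
 have g': "gram p i j = bilin R q (T' i) (T' j)" if "i < ?d" "j < ?d" for i j
  using that g[of i j] d bilin_cong[OF assms(2) v(2) v(2), of "\<lambda>k. T k i" i "\<lambda>k. T k j" j]
  by (simp add: T'_def)
 have sp: "sform R p" unfolding sform_def using g' d v assms(2) bilin_sym[OF assms(2)] by auto
 have gq: "gram q i j = bilin R p (\<lambda>k. S k i) (\<lambda>k. S k j)" if ij: "i < ?d" "j < ?d" for i j
 proof -
  have e: "lcomb R {..<?d} (S' i) T' k = uvec R i k" if "i < ?d" "k < ?d" for i k
  proof -
   have "lcomb R {..<?d} (S' i) T' k = (\<Oplus>j\<in>{..<?d}. T k j \<otimes> S j i)"
    unfolding lcomb_def using that ST
    by (intro finsum_cong') (auto simp: S'_def T'_def m_comm)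
   thus ?thesis using bilin_isometry(2)[OF inv that] by (simp add: uvec_def)
  qed
  have "bilin R p (\<lambda>k. S k i) (\<lambda>k. S k j) = bilin R p (S' i) (S' j)"
   by (rule bilin_cong[OF sp v(1) v(1)]) (use ij d in "auto simp: S'_def")
  also have "\<dots> = (\<Oplus>a\<in>{..<?d}. S' i a \<otimes> (\<Oplus>b\<in>{..<?d}. gram p a b \<otimes> S' j b))"
   using bilin_alt[OF sp v(1) v(1)] d by simp
  also have "\<dots> = (\<Oplus>a\<in>{..<?d}. S' i a \<otimes> (\<Oplus>b\<in>{..<?d}. S' j b \<otimes> bilin R q (T' a) (T' b)))"
  proof (rule finsum_cong'[OF refl])
   fix a assume a: "a \<in> {..<?d}"
   have "(\<Oplus>b\<in>{..<?d}. gram p a b \<otimes> S' j b) = (\<Oplus>b\<in>{..<?d}. S' j b \<otimes> bilin R q (T' a) (T' b))"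
    using a v g' assms(2) by (intro finsum_cong') (auto simp: m_comm)
   thus "S' i a \<otimes> (\<Oplus>b\<in>{..<?d}. gram p a b \<otimes> S' j b) = S' i a \<otimes> (\<Oplus>b\<in>{..<?d}. S' j b \<otimes> bilin R q (T' a) (T' b))"
    by simp
  qed (use v assms(2) in "auto intro!: finsum_closed m_closed")
  also have "\<dots> = (\<Oplus>a\<in>{..<?d}. S' i a \<otimes> bilin R q (T' a) (lcomb R {..<?d} (S' j) T'))"
   using v assms(2) by (simp add: bilin_lcomb_right)
  also have "\<dots> = bilin R q (lcomb R {..<?d} (S' i) T') (lcomb R {..<?d} (S' j) T')"
   using v assms(2) by (simp add: bilin_lcomb_left)
  also have "\<dots> = bilin R q (uvec R i) (uvec R j)"
   using v assms(2) e ij by (intro bilin_cong) auto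
  also have "\<dots> = gram q i j" using assms(2) ij by (rule bilin_uvec)
  finally show ?thesis by simp
 qed
 show ?thesis unfolding isometric_def
 proof (intro conjI exI)
  show "qdim q = qdim p" using d by simp
  show "inverse_matrices R (qdim p) T S" using inv d unfolding inverse_matrices_def by auto
  show "\<forall>i<qdim q. \<forall>j<qdim q. gram q i j = bilin R p (\<lambda>k. S k i) (\<lambda>k. S k j)"
   using gq by blast
 qed
qed

text \<open>The definition quantifies over functions constrained only on the index range; values
  beyond it do not influence the form, so total vectors may take their place.\<close>

lemma regular_iff:
 "regular R q \<longleftrightarrow> sform R q \<and>
  (\<forall>v\<in>vec R. (\<forall>w\<in>vec R. bilin R q v w = \<zero>) \<longrightarrow> (\<forall>i<qdim q. v i = \<zero>))"
 (is "?A \<longleftrightarrow> ?B")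
proof
 assume ?A
 hence s: "sform R q" by (rule regular_sform)
 have "\<forall>i<qdim q. v i = \<zero>" if "v \<in> vec R" "\<forall>w\<in>vec R. bilin R q v w = \<zero>" for v
 proof -
  have "bilin R q v w = \<zero>" if w: "w \<in> {..<qdim q} \<rightarrow> carrier R" for w
  proof -
   let ?w = "\<lambda>i. if i < qdim q then w i else \<zero>"
   have "?w \<in> vec R" using w by (intro vecI) (auto simp: Pi_def)
   moreover from this have "bilin R q v w = bilin R q v ?w"
    using s \<open>v \<in> vec R\<close> by (intro bilin_cong) auto
   ultimately show ?thesis using that \<open>\<forall>w\<in>vec R. bilin R q v w = \<zero>\<close> by simp
  qed
  moreover have "v \<in> {..<qdim q} \<rightarrow> carrier R" using that by auto
  ultimately show ?thesis using \<open>?A\<close> unfolding quadratic_form_def by blast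
 qed
 thus ?B using s by blast
next
 assume B: ?B
 have "\<forall>i<qdim q. v i = \<zero>" if v: "v \<in> {..<qdim q} \<rightarrow> carrier R"
  "\<forall>w\<in>{..<qdim q} \<rightarrow> carrier R. bilin R q v w = \<zero>" for v
 proof -
  let ?v = "\<lambda>i. if i < qdim q then v i else \<zero>"
  have v': "?v \<in> vec R" using v by (intro vecI) (auto simp: Pi_def)
  have "bilin R q ?v w = \<zero>" if w: "w \<in> vec R" for w
  proof -
   have "bilin R q v w = bilin R q ?v w"
    using B v' w by (intro bilin_cong) auto
   thus ?thesis using v w by (auto simp: Pi_def)
  qed
  hence "\<forall>i<qdim q. ?v i = \<zero>" using B v' by blast
  thus ?thesis by auto
 qed
 thus ?A using B unfolding quadratic_form_def sform_def by blast
qed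

lemma regularD:
 assumes "regular R q" "v \<in> vec R" "\<And>w. w \<in> vec R \<Longrightarrow> bilin R q v w = \<zero>" "i < qdim q"
 shows "v i = \<zero>"
 using assms regular_iff[of q] by blast

lemma aniso_iff:
 assumes s: "sform R q"
 shows "aniso R q \<longleftrightarrow> (\<forall>v\<in>vec R. bilin R q v v = \<zero> \<longrightarrow> (\<forall>i<qdim q. v i = \<zero>))"
 (is "?A \<longleftrightarrow> ?B")
proof
 assume B: ?B
 show ?A unfolding anisotropic_def
 proof (intro ballI impI)
  fix v assume v: "v \<in> {..<qdim q} \<rightarrow> carrier R" and z: "bilin R q v v = \<zero>"
  let ?v = "\<lambda>i. if i < qdim q then v i else \<zero>"
  have v': "?v \<in> vec R" using v by (intro vecI) (auto simp: Pi_def)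
  have "bilin R q v v = bilin R q ?v ?v" using s v' by (intro bilin_cong) auto
  hence "bilin R q ?v ?v = \<zero>" using z by simp
  hence "\<forall>i<qdim q. ?v i = \<zero>" using B v' by blast
  thus "\<forall>i<qdim q. v i = \<zero>" by auto
 qed
next
 assume ?A
 moreover have "v \<in> {..<qdim q} \<rightarrow> carrier R" if "v \<in> vec R" for v using that by auto
 ultimately show ?B unfolding anisotropic_def by blast
qed

lemma aniso_regular:
 assumes "sform R q" "aniso R q" shows "regular R q"
 using assms unfolding regular_iff aniso_iff[OF assms(1)] by blast

text \<open>An isotropic vector of \<open>p\<close> is sent to a null vector of \<open>q\<close>,
  hence to zero on all coordinates of \<open>q\<close>; so it lies in the radical of
  \<open>p\<close>.\<close>

lemma aniso_emb:
 assumes "emb R p q" "sform R q" "aniso R q" "regular R p"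
 shows "aniso R p"
proof -
 have sp: "sform R p" by (rule emb_sform[OF assms(1,2)])
 obtain f where f: "linmap R (qdim p) f"
  "\<And>v w. v \<in> vec R \<Longrightarrow> w \<in> vec R \<Longrightarrow> bilin R q (f v) (f w) = bilin R p v w"
  using emb_linmap[OF assms(1,2)] by metis
 show ?thesis unfolding aniso_iff[OF sp]
 proof (intro ballI impI allI)
  fix v i assume v: "v \<in> vec R" and z: "bilin R p v v = \<zero>" and i: "i < qdim p"
  have fv: "f v \<in> vec R" by (rule linmapD(1)[OF f(1) v])
  have "bilin R q (f v) (f v) = \<zero>" using f(2)[OF v v] z by simp
  hence "\<forall>i<qdim q. f v i = \<zero>" using assms(3) fv unfolding aniso_iff[OF assms(2)] by blast
  hence "bilin R p v w = \<zero>" if "w \<in> vec R" for w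
   using f(2)[OF v that] bilin_zero_left[OF assms(2) linmapD(1)[OF f(1) that]] by simp
  thus "v i = \<zero>" using regularD[OF assms(4) v _ i] by blast
 qed
qed

lemma regular_orth:
 assumes "regular R p" "regular R r"
 shows "regular R (orth R p r)"
proof -
 have s: "sform R p" "sform R r" using assms by (auto simp: regular_sform)
 show ?thesis unfolding regular_iff
 proof (intro conjI ballI impI allI)
  fix v i assume v: "v \<in> vec R" and b: "\<forall>w\<in>vec R. bilin R (orth R p r) v w = \<zero>"
   and i: "i < qdim (orth R p r)"
  have v': "(\<lambda>i. v (i + qdim p)) \<in> vec R" using v by simp
  have vj: "v = vjoin (qdim p) v (\<lambda>i. v (i + qdim p))" by (auto simp: vjoin_def)
  have *: "bilin R p v w \<oplus> bilin R r (\<lambda>i. v (i + qdim p)) w' = \<zero>" if "w \<in> vec R" "w' \<in> vec R" for w w'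
   using b[rule_format, of "vjoin (qdim p) w w'"] that bilin_vjoin[OF s v v' that] vj by simp
  have 1: "bilin R p v w = \<zero>" if "w \<in> vec R" for w
   using *[OF that zero_vec] s v v' that by (simp add: bilin_zero_right)
  have 2: "bilin R r (\<lambda>i. v (i + qdim p)) w = \<zero>" if "w \<in> vec R" for w
   using *[OF zero_vec that] s v v' that by (simp add: bilin_zero_right)
  show "v i = \<zero>"
  proof (cases "i < qdim p")
   case True thus ?thesis using regularD[OF assms(1) v 1] by blast
  next
   case False thus ?thesis using regularD[OF assms(2) v' 2, of "i - qdim p"] i by simp
  qed
 qed (use s in simp)
qed

end

lemma emb_extend:
 assumes "cring K" "cring L" "h \<in> ring_hom K L" "sform K q" "emb K p q"
 shows "emb L (ext h p) (ext h q)"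
proof -
 interpret K: cring K by fact
 interpret L: cring L by fact
 have h: "h x \<in> carrier L" if "x \<in> carrier K" for x using that assms(3) by (simp add: ring_hom_closed)
 have sp: "sform K p" by (rule K.emb_sform[OF assms(5,4)])
 obtain f where f: "linmap K (qdim p) f"
  "\<And>v w. v \<in> vec K \<Longrightarrow> w \<in> vec K \<Longrightarrow> bilin K q (f v) (f w) = bilin K p v w"
  using K.emb_linmap[OF assms(5,4)] by metis
 let ?T = "\<lambda>j. f (uvec K j)"
 have T: "?T j \<in> vec K" for j by (rule K.linmapD(1)[OF f(1)]) simp
 show ?thesis unfolding emb_def
 proof (intro exI[of _ "\<lambda>j k. h (?T j k)"] conjI allI impI)
  fix i j assume "i < qdim (ext h p)" "j < qdim (ext h p)"
  thus "gram (ext h p) i j = bilin L (ext h q) (\<lambda>k. h (?T i k)) (\<lambda>k. h (?T j k))"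
   using bilin_extend[OF assms(1-4) T T] f(2)[of "uvec K i" "uvec K j"] K.bilin_uvec[OF sp]
   by (simp add: extend_form_def)
 qed (use T h in auto)
qed

lemma sform_ext:
 assumes "h \<in> ring_hom K L" "sform K q" shows "sform L (ext h q)"
 using assms by (auto simp: sform_def extend_form_def ring_hom_closed)

section \<open>Linear algebra over a field\<close>

context field
begin

lemma inv_closed_field [simp]: "a \<in> carrier R \<Longrightarrow> a \<noteq> \<zero> \<Longrightarrow> inv a \<in> carrier R"
 using field_Units by auto

lemma inv_r_field [simp]: "a \<in> carrier R \<Longrightarrow> a \<noteq> \<zero> \<Longrightarrow> a \<otimes> inv a = \<one>"
 using field_Units by auto

lemma inv_l_field [simp]: "a \<in> carrier R \<Longrightarrow> a \<noteq> \<zero> \<Longrightarrow> inv a \<otimes> a = \<one>"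
 using field_Units by auto

lemma inv_nonzero [simp]: "a \<in> carrier R \<Longrightarrow> a \<noteq> \<zero> \<Longrightarrow> inv a \<noteq> \<zero>"
 by (metis inv_r_field one_not_zero r_null)

lemma neg_inv_cancel:
 assumes "a \<in> carrier R" "a \<noteq> \<zero>" "b \<in> carrier R"
 shows "\<ominus> (inv a) \<otimes> (\<ominus> (a \<otimes> b)) = b"
proof -
 have "\<ominus> (inv a) \<otimes> (\<ominus> (a \<otimes> b)) = (inv a \<otimes> a) \<otimes> b"
  using assms(1,3) inv_closed_field[OF assms(1,2)]
  by (simp add: l_minus r_minus m_assoc del: inv_l_field)
 thus ?thesis using assms by simp
qed

text \<open>One step of Gaussian elimination with pivot \<open>j0\<close>: a combination of the
  reduced vectors is a combination of the original ones in which only the coefficient at the pivot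
  changes.\<close>

lemma lcomb_pivot:
 assumes "finite J" "j0 \<in> J" "c \<in> vec R" "m \<in> vec R" "\<And>j. w j \<in> vec R"
 shows "lcomb R (J - {j0}) c (\<lambda>j. vadd R (w j) (smul R (\<ominus> m j) (w j0))) =
  lcomb R J (c(j0 := \<ominus> (\<Oplus>j\<in>J - {j0}. c j \<otimes> m j))) w"
proof
 fix k
 let ?J = "J - {j0}"
 define s where "s = (\<Oplus>j\<in>?J. c j \<otimes> m j)"
 have s: "s \<in> carrier R" using assms by (auto simp: s_def intro!: finsum_closed)
 have e: "c j \<otimes> (x \<oplus> \<ominus> m j \<otimes> y) = c j \<otimes> x \<oplus> c j \<otimes> m j \<otimes> (\<ominus> y)"
  if "x \<in> carrier R" "y \<in> carrier R" for j x y
  using that assms by (simp add: r_distr l_minus r_minus m_assoc)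
 have "lcomb R ?J c (\<lambda>j. vadd R (w j) (smul R (\<ominus> m j) (w j0))) k =
  (\<Oplus>j\<in>?J. c j \<otimes> w j k \<oplus> c j \<otimes> m j \<otimes> (\<ominus> w j0 k))"
  unfolding lcomb_def vadd_def smul_def using assms
  by (intro finsum_cong') (auto simp: e)
 also have "\<dots> = (\<Oplus>j\<in>?J. c j \<otimes> w j k) \<oplus> (\<Oplus>j\<in>?J. c j \<otimes> m j \<otimes> (\<ominus> w j0 k))"
  using assms by (intro finsum_addf) auto
 also have "(\<Oplus>j\<in>?J. c j \<otimes> m j \<otimes> (\<ominus> w j0 k)) = s \<otimes> (\<ominus> w j0 k)"
  unfolding s_def using assms by (subst finsum_ldistr) auto
 also have "(\<Oplus>j\<in>?J. c j \<otimes> w j k) \<oplus> s \<otimes> (\<ominus> w j0 k) = \<ominus> s \<otimes> w j0 k \<oplus> (\<Oplus>j\<in>?J. c j \<otimes> w j k)"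
  using assms s by (simp add: r_minus l_minus a_comm finsum_closed Pi_def)
 also have "\<dots> = lcomb R (insert j0 ?J) (c(j0 := \<ominus> s)) w k"
 proof -
  have "(\<Oplus>j\<in>?J. c j \<otimes> w j k) = (\<Oplus>j\<in>?J. (c(j0 := \<ominus> s)) j \<otimes> w j k)"
   using assms by (intro finsum_cong') auto
  thus ?thesis unfolding lcomb_def using assms s
   by (subst finsum_insert) auto
 qed
 finally show "lcomb R ?J c (\<lambda>j. vadd R (w j) (smul R (\<ominus> m j) (w j0))) k =
  lcomb R J (c(j0 := \<ominus> (\<Oplus>j\<in>?J. c j \<otimes> m j))) w k"
  using assms by (simp add: s_def insert_absorb)
qed

text \<open>Induction on the number of coordinates that must vanish: either the last one vanishes on
  the whole family, or one vector is used to clear it from the others.\<close>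

lemma linear_dependent:
 fixes w :: "'j \<Rightarrow> nat \<Rightarrow> 'a"
 assumes "finite J" "card J > d" "\<And>j. w j \<in> vec R"
 shows "\<exists>c\<in>vec R. (\<exists>j\<in>J. c j \<noteq> \<zero>) \<and> (\<forall>k<d. lcomb R J c w k = \<zero>)"
 using assms
proof (induction d arbitrary: J w)
 case 0
 then obtain j where "j \<in> J" by fastforce
 thus ?case by (intro bexI[of _ "\<lambda>_. \<one>"]) auto
next
 case (Suc d)
 show ?case
 proof (cases "\<forall>j\<in>J. w j d = \<zero>")
  case True
  have "card J > d" using Suc.prems by simp
  from Suc.IH[of J w, OF Suc.prems(1) this Suc.prems(3)] obtain c where
   c: "c \<in> vec R" "\<exists>j\<in>J. c j \<noteq> \<zero>" "\<forall>k<d. lcomb R J c w k = \<zero>"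
   by blast
  have "lcomb R J c w d = \<zero>" unfolding lcomb_def
   by (intro finsum_all_zero) (use True c in auto)
  thus ?thesis using c by (auto simp: less_Suc_eq)
 next
  case False
  then obtain j0 where j0: "j0 \<in> J" "w j0 d \<noteq> \<zero>" by blast
  let ?J = "J - {j0}"
  define m where "m = (\<lambda>j. w j d \<otimes> inv (w j0 d))"
  define w' where "w' = (\<lambda>j. vadd R (w j) (smul R (\<ominus> m j) (w j0)))"
  have m: "m \<in> vec R" using Suc.prems(3) j0 by (auto simp: m_def)
  have w': "w' j \<in> vec R" for j using Suc.prems(3) m by (simp add: w'_def)
  have "finite ?J" "card ?J > d" using Suc.prems(1,2) j0 by auto
  from Suc.IH[of ?J w', OF this w'] obtain c where
   c: "c \<in> vec R" "\<exists>j\<in>?J. c j \<noteq> \<zero>" "\<forall>k<d. lcomb R ?J c w' k = \<zero>"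
   by blast
  have "w' j d = \<zero>" for j
   using Suc.prems(3) j0 by (simp add: w'_def vadd_def smul_def m_def l_minus m_assoc r_neg)
  hence "lcomb R ?J c w' d = \<zero>" unfolding lcomb_def
   by (intro finsum_all_zero) (use c in auto)
  hence z: "lcomb R ?J c w' k = \<zero>" if "k < Suc d" for k
   using c(3) that by (auto simp: less_Suc_eq)
  let ?c = "c(j0 := \<ominus> (\<Oplus>j\<in>?J. c j \<otimes> m j))"
  have "(\<Oplus>j\<in>?J. c j \<otimes> m j) \<in> carrier R" using c m by (intro finsum_closed) auto
  hence "?c \<in> vec R" using c by auto
  moreover have "\<exists>j\<in>J. ?c j \<noteq> \<zero>" using c(2) by auto
  moreover have "\<forall>k<Suc d. lcomb R J ?c w k = \<zero>"
   using z unfolding w'_def lcomb_pivot[of J j0 c m w, OF Suc.prems(1) j0(1) c(1) m Suc.prems(3)] by simp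
  ultimately show ?thesis by (intro bexI[of _ ?c] conjI)
 qed
qed

text \<open>Here injectivity comes for free: a linear relation among the images of the basis vectors
  would produce a nonzero radical vector of \<open>p\<close>.\<close>

lemma regular_emb_dim_le:
 assumes "regular R p" "emb R p q" "sform R q"
 shows "qdim p \<le> qdim q"
proof (rule ccontr)
 assume "\<not> qdim p \<le> qdim q"
 obtain f where f: "linmap R (qdim p) f"
  "\<And>v w. v \<in> vec R \<Longrightarrow> w \<in> vec R \<Longrightarrow> bilin R q (f v) (f w) = bilin R p v w"
  using emb_linmap[OF assms(2,3)] by metis
 have v: "f (uvec R j) \<in> vec R" for j by (rule linmapD(1)[OF f(1)]) simp
 from \<open>\<not> qdim p \<le> qdim q\<close> have "card {..<qdim p} > qdim q" by simp
 from linear_dependent[OF _ this, of "\<lambda>j. f (uvec R j)"] v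
 obtain c j where c: "c \<in> vec R" "j < qdim p" "c j \<noteq> \<zero>"
  "\<forall>k<qdim q. lcomb R {..<qdim p} c (\<lambda>j. f (uvec R j)) k = \<zero>" by auto
 let ?u = "lcomb R {..<qdim p} c (uvec R)"
 have u: "?u \<in> vec R" using c by simp
 have fu: "f ?u = lcomb R {..<qdim p} c (\<lambda>j. f (uvec R j))"
  by (rule linmap_lcomb[OF f(1)]) (use c in auto)
 have "bilin R p ?u w = \<zero>" if "w \<in> vec R" for w
 proof -
  have "bilin R p ?u w = bilin R q (f ?u) (f w)" using f(2)[OF u that] by simp
  also have "\<dots> = \<zero>"
   by (rule bilin_zero_left[OF assms(3) linmapD(1)[OF f(1) that]]) (use fu c(4) in auto)
  finally show ?thesis .
 qed
 hence "?u j = \<zero>" using regularD[OF assms(1) u] c by blast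
 thus False using c lcomb_uvec[OF c(1,2)] by simp
qed

text \<open>The rows of the Gram matrix together with \<open>a\<close> are one vector too many,
  hence dependent. The relation must involve \<open>a\<close>, as otherwise its coefficients would
  form a nonzero radical vector.\<close>

lemma riesz:
 assumes "regular R p" and a: "a \<in> vec R"
 shows "\<exists>w\<in>vec R. \<forall>j<qdim p. bilin R p w (uvec R j) = a j"
proof -
 have s: "sform R p" using assms by (rule_tac regular_sform)
 let ?d = "qdim p"
 define W where "W = (\<lambda>i k. if i < ?d then bilin R p (uvec R i) (uvec R k) else a k)"
 define W' where "W' = (\<lambda>i k. if k < ?d then W i k else \<zero>)"
 have W': "W' i \<in> vec R" for i using a s by (auto simp: W'_def W_def)
 have "card {..<Suc ?d} > ?d" by simp
 from linear_dependent[OF _ this, of W'] W' obtain c where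
  c: "c \<in> vec R" "\<exists>j<Suc ?d. c j \<noteq> \<zero>" "\<forall>k<?d. lcomb R {..<Suc ?d} c W' k = \<zero>" by auto
 let ?u = "lcomb R {..<?d} c (uvec R)"
 have u: "?u \<in> vec R" using c by simp
 have B: "bilin R p ?u (uvec R k) \<oplus> c ?d \<otimes> a k = \<zero>" if k: "k < ?d" for k
 proof -
  have "\<zero> = lcomb R {..<Suc ?d} c W' k" using c k by simp
  also have "\<dots> = c ?d \<otimes> a k \<oplus> (\<Oplus>j\<in>{..<?d}. c j \<otimes> W' j k)"
   unfolding lcomb_def using c W' k a by (simp add: lessThan_Suc Pi_def) (simp add: W'_def W_def)
  also have "(\<Oplus>j\<in>{..<?d}. c j \<otimes> W' j k) = (\<Oplus>j\<in>{..<?d}. c j \<otimes> bilin R p (uvec R j) (uvec R k))"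
   using c k s by (intro finsum_cong') (auto simp: W'_def W_def)
  also have "\<dots> = bilin R p ?u (uvec R k)" using c s by (simp add: bilin_lcomb_left)
  finally show ?thesis using c a u s by (simp add: a_comm)
 qed
 show ?thesis
 proof (cases "c ?d = \<zero>")
  case True
  have z: "bilin R p ?u (uvec R k) = \<zero>" if "k < ?d" for k
   using B[OF that] True a u s by simp
  have "bilin R p ?u w = \<zero>" if w: "w \<in> vec R" for w
  proof -
   have "bilin R p ?u w = bilin R p w ?u" using bilin_sym[OF s u w] .
   also have "\<dots> = (\<Oplus>j\<in>{..<?d}. w j \<otimes> bilin R p (uvec R j) ?u)" by (rule bilin_expand[OF s w u])
   also have "\<dots> = \<zero>" by (intro finsum_all_zero) (use z w u s bilin_sym[OF s u] in auto)
   finally show ?thesis .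
  qed
  hence "?u j = \<zero>" if "j < ?d" for j using regularD[OF assms(1) u _ that] by blast
  hence "c j = \<zero>" if "j < Suc ?d" for j using True lcomb_uvec[OF c(1)] that by (metis less_SucE)
  thus ?thesis using c(2) by auto
 next
  case False
  let ?e = "\<ominus> (inv (c ?d))"
  have e: "?e \<in> carrier R" using False c by simp
  show ?thesis
  proof (intro bexI[of _ "smul R ?e ?u"] allI impI)
   fix j assume j: "j < ?d"
   have "bilin R p ?u (uvec R j) = \<ominus> (c ?d \<otimes> a j)"
    using B[OF j] c a u s by (intro minus_equality[symmetric]) auto
   hence "bilin R p (smul R ?e ?u) (uvec R j) = ?e \<otimes> (\<ominus> (c ?d \<otimes> a j))"
    using e u s by (simp add: bilin_smul_left)
   thus "bilin R p (smul R ?e ?u) (uvec R j) = a j"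
    using neg_inv_cancel[of "c ?d" "a j"] False c a by simp
  qed (use e u in simp)
 qed
qed

text \<open>The map is injective because \<open>p\<close> is regular, and equal dimensions make it
  surjective: each basis vector depends on the images of the basis, with a nonzero coefficient,
  which yields the columns of the inverse.\<close>

lemma isometric_of_emb:
 assumes "regular R p" "emb R p q" "sform R q" "qdim p = qdim q"
 shows "isometric R p q"
proof -
 let ?d = "qdim q"
 have sp: "sform R p" using assms regular_sform by blast
 obtain f where f: "linmap R (qdim p) f"
  "\<And>v w. v \<in> vec R \<Longrightarrow> w \<in> vec R \<Longrightarrow> bilin R q (f v) (f w) = bilin R p v w"
  using emb_linmap[OF assms(2,3)] by metis
 have fv: "f v \<in> vec R" if "v \<in> vec R" for v using linmapD(1)[OF f(1) that] .
 have inj: "v j = \<zero>" if v: "v \<in> vec R" and z: "\<And>k. k < ?d \<Longrightarrow> f v k = \<zero>" and j: "j < ?d" for v j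
 proof -
  have "bilin R p v w = \<zero>" if "w \<in> vec R" for w
   using f(2)[OF v that] bilin_zero_left[OF assms(3) fv[OF that] z] by simp
  thus ?thesis using regularD[OF assms(1) v] j assms(4) by simp
 qed
 have "\<exists>s\<in>vec R. \<forall>k<?d. f s k = uvec R j k" if j: "j < ?d" for j
 proof -
  define W where "W = (\<lambda>i. if i < ?d then f (uvec R i) else uvec R j)"
  have W: "W i \<in> vec R" for i using fv by (simp add: W_def)
  have "card {..<Suc ?d} > ?d" by simp
  from linear_dependent[OF _ this, of W] W obtain c where
   c: "c \<in> vec R" "\<exists>j<Suc ?d. c j \<noteq> \<zero>" "\<forall>k<?d. lcomb R {..<Suc ?d} c W k = \<zero>" by auto
  let ?u = "lcomb R {..<?d} c (uvec R)"
  have u: "?u \<in> vec R" using c by simp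
  have fu: "f ?u = lcomb R {..<?d} c (\<lambda>i. f (uvec R i))"
   by (rule linmap_lcomb[OF f(1)]) (use c in auto)
  have B: "f ?u k \<oplus> c ?d \<otimes> uvec R j k = \<zero>" if k: "k < ?d" for k
  proof -
   have "\<zero> = lcomb R {..<Suc ?d} c W k" using c k by simp
   also have "\<dots> = c ?d \<otimes> uvec R j k \<oplus> (\<Oplus>i\<in>{..<?d}. c i \<otimes> W i k)"
    unfolding lcomb_def using c W by (simp add: lessThan_Suc Pi_def) (simp add: W_def)
   also have "(\<Oplus>i\<in>{..<?d}. c i \<otimes> W i k) = f ?u k"
    unfolding fu unfolding lcomb_def using c W fv by (intro finsum_cong') (auto simp: W_def)
   finally show ?thesis using c fv[OF u] by (simp add: a_comm)
  qed
  show ?thesis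
  proof (cases "c ?d = \<zero>")
   case True
   hence "f ?u k = \<zero>" if "k < ?d" for k using B[OF that] c fv[OF u] by simp
   hence "?u i = \<zero>" if "i < ?d" for i using inj[OF u _ that] by blast
   hence "c i = \<zero>" if "i < Suc ?d" for i using True lcomb_uvec[OF c(1)] that by (metis less_SucE)
   thus ?thesis using c(2) by auto
  next
   case False
   let ?e = "\<ominus> (inv (c ?d))"
   have e: "?e \<in> carrier R" using False c by simp
   show ?thesis
   proof (intro bexI[of _ "smul R ?e ?u"] allI impI)
    fix k assume k: "k < ?d"
    have "f ?u k = \<ominus> (c ?d \<otimes> uvec R j k)"
     using B[OF k] c fv[OF u] by (intro minus_equality[symmetric]) auto
    hence "f (smul R ?e ?u) k = ?e \<otimes> (\<ominus> (c ?d \<otimes> uvec R j k))"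
     using linmapD(3)[OF f(1) e u] by (simp add: smul_def)
    thus "f (smul R ?e ?u) k = uvec R j k"
     using neg_inv_cancel[of "c ?d" "uvec R j k"] False c by simp
   qed (use e u in simp)
  qed
 qed
 then obtain S where S: "\<And>j. j < ?d \<Longrightarrow> S j \<in> vec R"
  "\<And>j k. j < ?d \<Longrightarrow> k < ?d \<Longrightarrow> f (S j) k = uvec R j k" by metis
 have T: "f (uvec R j) \<in> vec R" for j by (rule fv) simp
 have fexp: "f v k = (\<Oplus>j\<in>{..<?d}. v j \<otimes> f (uvec R j) k)" if v: "v \<in> vec R" for v k
 proof -
  have "f v = f (lcomb R {..<?d} v (uvec R))"
   by (rule linmapD(4)[OF f(1)]) (use v assms(4) in "auto simp: lcomb_uvec")
  also have "\<dots> = lcomb R {..<?d} v (\<lambda>j. f (uvec R j))"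
   by (rule linmap_lcomb[OF f(1)]) (use v in auto)
  finally show ?thesis by (simp add: lcomb_def)
 qed
 \<comment> \<open>A right inverse of an injective map is a left inverse: \<open>f\<close> kills the
   difference of the two sides.\<close>
 have Sf: "lcomb R {..<?d} (f (uvec R j)) S' i = uvec R j i"
  if S': "S' = (\<lambda>j. if j < ?d then S j else (\<lambda>_. \<zero>))" and ij: "i < ?d" "j < ?d" for S' i j
 proof -
  have S'v: "S' j \<in> vec R" for j using S S' by auto
  let ?v = "lcomb R {..<?d} (f (uvec R j)) S'"
  have v: "?v \<in> vec R" using S'v T by simp
  have fv': "f ?v k = f (uvec R j) k" if k: "k < ?d" for k
  proof -
   have "f ?v = lcomb R {..<?d} (f (uvec R j)) (\<lambda>j. f (S' j))"
    by (rule linmap_lcomb[OF f(1)]) (use S'v T in auto)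
   hence "f ?v k = (\<Oplus>i\<in>{..<?d}. f (uvec R j) i \<otimes> f (S' i) k)" by (simp add: lcomb_def)
   also have "\<dots> = f (uvec R j) k \<otimes> f (S' k) k"
    using k T fv[OF S'v] S by (intro finsum_delta) (auto simp: S' uvec_def)
   finally show ?thesis using k S S' T by (simp add: uvec_def)
  qed
  let ?u = "vadd R ?v (smul R (\<ominus> \<one>) (uvec R j))"
  have u: "?u \<in> vec R" using v by simp
  have "f ?u = vadd R (f ?v) (smul R (\<ominus> \<one>) (f (uvec R j)))"
   using v by (simp add: linmapD(2,3)[OF f(1)])
  hence "f ?u k = \<zero>" if "k < ?d" for k
   using fv'[OF that] T by (simp add: vadd_def smul_def l_minus r_neg)
  hence "?u i = \<zero>" using inj[OF u _ ij(1)] by blast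
  hence "?v i \<oplus> \<ominus> uvec R j i = \<zero>" by (simp add: vadd_def smul_def l_minus)
  thus ?thesis using v by (metis minus_eq r_right_minus_eq uvec_vec vec_closed)
 qed
 show ?thesis unfolding isometric_def
 proof (rule conjI[OF assms(4)], rule exI[of _ "\<lambda>k j. S j k"],
   rule exI[of _ "\<lambda>k j. f (uvec R j) k"], intro conjI allI impI)
  show "gram p i j = bilin R q (f (uvec R i)) (f (uvec R j))" if "i < qdim p" "j < qdim p" for i j
   using that sp f(2) by (simp add: bilin_uvec)
  show "inverse_matrices R ?d (\<lambda>k j. S j k) (\<lambda>k j. f (uvec R j) k)"
   unfolding inverse_matrices_def
  proof (intro allI impI conjI)
   fix i j assume ij: "i < ?d" "j < ?d"
   show "S j i \<in> carrier R" "f (uvec R j) i \<in> carrier R" using S ij T by auto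
   have "(\<Oplus>k\<in>{..<?d}. f (uvec R k) i \<otimes> S j k) = f (S j) i"
    unfolding fexp[OF S(1)[OF ij(2)]] using S ij T by (intro finsum_cong') (auto simp: m_comm)
   thus "(\<Oplus>k\<in>{..<?d}. f (uvec R k) i \<otimes> S j k) = (if i = j then \<one> else \<zero>)"
    using S(2)[OF ij(2,1)] by (simp add: uvec_def)
   have "(\<Oplus>k\<in>{..<?d}. S k i \<otimes> f (uvec R j) k) = uvec R j i"
    unfolding Sf[OF refl ij, symmetric] lcomb_def using S ij T
    by (intro finsum_cong') (auto simp: m_comm)
   thus "(\<Oplus>k\<in>{..<?d}. S k i \<otimes> f (uvec R j) k) = (if i = j then \<one> else \<zero>)"
    by (simp add: uvec_def)
  qed
 qed
qed

end

section \<open>Witt decomposition\<close>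

lemma shift_vec2 [simp]: "v \<in> vec K \<Longrightarrow> (\<lambda>i. v (Suc (Suc i))) \<in> vec K"
 by auto

locale field2 = field +
 assumes two_nonzero: "\<one> \<oplus> \<one> \<noteq> \<zero>"
begin

definition half :: 'a where "half = inv (\<one> \<oplus> \<one>)"

lemma half_closed [simp]: "half \<in> carrier R"
 by (simp add: half_def two_nonzero)

lemma half_add: "half \<oplus> half = \<one>"
proof -
 have "(\<one> \<oplus> \<one>) \<otimes> half = \<one>" by (simp add: half_def two_nonzero)
 thus ?thesis by (simp add: l_distr)
qed

lemma double_zero: "x \<in> carrier R \<Longrightarrow> x \<oplus> x = \<zero> \<Longrightarrow> x = \<zero>"
proof -
 assume x: "x \<in> carrier R" "x \<oplus> x = \<zero>"
 hence "(\<one> \<oplus> \<one>) \<otimes> x = \<zero>" by (simp only: l_distr one_closed l_one)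
 thus "x = \<zero>" using integral[of "\<one> \<oplus> \<one>" x] two_nonzero x(1) by auto
qed

end

context cring
begin

lemma emb_add_vector:
 assumes "sform R q" "sform R p" "linmap R (qdim p) f"
  "\<And>v w. v \<in> vec R \<Longrightarrow> w \<in> vec R \<Longrightarrow> bilin R q (f v) (f w) = bilin R p v w"
  "y \<in> vec R" "\<And>v. v \<in> vec R \<Longrightarrow> bilin R q (f v) y = \<zero>" "bilin R q y y = c"
 shows "emb R (orth R p (diag_form R [c])) q"
proof (rule embI)
 have c: "c \<in> carrier R" using assms by auto
 thus "sform R (orth R p (diag_form R [c]))" using assms(2) by simp
 have fv: "f v \<in> vec R" if "v \<in> vec R" for v using linmapD(1)[OF assms(3) that] .
 let ?g = "\<lambda>v. vadd R (f v) (smul R (v (qdim p)) y)"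
 show "?g v \<in> vec R" if "v \<in> vec R" for v using that fv assms(5) by simp
 fix v w :: "nat \<Rightarrow> 'a" assume v: "v \<in> vec R" and w: "w \<in> vec R"
 have fy: "bilin R q y (f v) = \<zero>" if "v \<in> vec R" for v
  using assms(6)[OF that] bilin_sym[OF assms(1) assms(5) fv[OF that]] by simp
 have "bilin R q (?g v) (?g w) = bilin R p v w \<oplus> v (qdim p) \<otimes> (w (qdim p) \<otimes> c)"
  using v w fv assms fy c
  by (simp add: bilin_add_left bilin_add_right bilin_smul_left bilin_smul_right m_lcomm)
 also have "\<dots> = bilin R (orth R p (diag_form R [c])) v w"
  using v w assms c by (simp add: bilin_orth bilin_diag_Cons bilin_diag_Nil m_ac)
 finally show "bilin R q (?g v) (?g w) = bilin R (orth R p (diag_form R [c])) v w" .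
qed

lemma emb_diag2:
 assumes "sform R q" "x \<in> vec R" "y \<in> vec R" "bilin R q x x = a" "bilin R q y y = b" "bilin R q x y = \<zero>"
 shows "emb R (diag_form R [a, b]) q"
proof (rule embI)
 have ab: "a \<in> carrier R" "b \<in> carrier R" using assms by auto
 thus "sform R (diag_form R [a, b])" by simp
 let ?g = "\<lambda>v. vadd R (smul R (v 0) x) (smul R (v (Suc 0)) y)"
 show "?g v \<in> vec R" if "v \<in> vec R" for v using that assms by simp
 fix v w :: "nat \<Rightarrow> 'a" assume v: "v \<in> vec R" and w: "w \<in> vec R"
 have yx: "bilin R q y x = \<zero>" using assms bilin_sym by metis
 show "bilin R q (?g v) (?g w) = bilin R (diag_form R [a, b]) v w"
  using v w ab assms yx
  by (simp add: bilin_add_left bilin_add_right bilin_smul_left bilin_smul_right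
    bilin_diag_Cons bilin_diag_Nil m_comm m_assoc)
qed

section \<open>Hyperbolic forms\<close>

lemma sform_hyp [simp]: "sform R (hyp R i)"
 unfolding hyperbolic_form_def by (rule sform_diag) (auto split: if_splits)

lemma qdim_hyp [simp]: "qdim (hyp R i) = 2 * i"
 unfolding hyperbolic_form_def by (induction i) auto

lemma hyp_entries: "set (concat (replicate i [\<one>, \<ominus> \<one>])) \<subseteq> carrier R"
 by (auto split: if_splits)

lemma hyp_1: "hyp R 1 = diag_form R [\<one>, \<ominus> \<one>]"
 by (simp add: hyperbolic_form_def)

lemma bilin_hyp_Suc:
 assumes "v \<in> vec R" "w \<in> vec R"
 shows "bilin R (hyp R (Suc i)) v w =
  bilin R (orth R (hyp R 1) (hyp R i)) v w"
proof -
 define L where "L = concat (replicate i [\<one>, \<ominus> \<one>])"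
 have L: "set L \<subseteq> carrier R" unfolding L_def by (rule hyp_entries)
 have "hyp R (Suc i) = diag_form R (\<one> # \<ominus> \<one> # L)" "hyp R i = diag_form R L"
  by (simp_all add: hyperbolic_form_def L_def)
 thus ?thesis unfolding hyp_1 using assms L
  by (simp add: bilin_orth bilin_diag_Cons bilin_diag_Nil a_assoc)
qed

lemma emb_hyp_Suc:
 "emb R (hyp R (Suc i)) (orth R (hyp R 1) (hyp R i))"
 "emb R (orth R (hyp R 1) (hyp R i)) (hyp R (Suc i))"
 by (rule emb_id; simp add: bilin_hyp_Suc del: One_nat_def)+

lemma hyp_0: "hyp R 0 = diag_form R []"
 by (simp add: hyperbolic_form_def)

lemma emb_Nil: "emb R (diag_form R []) q"
 unfolding emb_def by simp

lemma emb_hyp_add: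
 "emb R (hyp R (i + j)) (orth R (hyp R i) (hyp R j))"
 "emb R (orth R (hyp R i) (hyp R j)) (hyp R (i + j))"
proof (induction i)
 case 0
 show "emb R (hyp R (0 + j)) (orth R (hyp R 0) (hyp R j))"
  by (simp add: emb_right)
 show "emb R (orth R (hyp R 0) (hyp R j)) (hyp R (0 + j))"
  by (rule emb_id) (simp_all add: bilin_orth hyp_0 bilin_diag_Nil)
next
 case (Suc i)
 let ?h = "hyp R"
 let ?o = "orth R"
 have "emb R (?h (Suc (i + j))) (?o (?h 1) (?h (i + j)))" by (rule emb_hyp_Suc)
 moreover have "emb R (?o (?h 1) (?h (i + j))) (?o (?h 1) (?o (?h i) (?h j)))"
  by (rule emb_orth) (simp_all add: emb_refl Suc)
 moreover have "emb R (?o (?h 1) (?o (?h i) (?h j))) (?o (?o (?h 1) (?h i)) (?h j))"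
  by (rule emb_orth_assoc) simp_all
 moreover have "emb R (?o (?o (?h 1) (?h i)) (?h j)) (?o (?h (Suc i)) (?h j))"
  by (rule emb_orth) (simp_all add: emb_refl emb_hyp_Suc del: One_nat_def)
 ultimately show "emb R (?h (Suc i + j)) (?o (?h (Suc i)) (?h j))"
  by (metis add_Suc emb_trans sform_hyp sform_orth)
 have "emb R (?o (?h (Suc i)) (?h j)) (?o (?o (?h 1) (?h i)) (?h j))"
  by (rule emb_orth) (simp_all add: emb_refl emb_hyp_Suc del: One_nat_def)
 moreover have "emb R (?o (?o (?h 1) (?h i)) (?h j)) (?o (?h 1) (?o (?h i) (?h j)))"
  by (rule emb_orth_assoc) simp_all
 moreover have "emb R (?o (?h 1) (?o (?h i) (?h j))) (?o (?h 1) (?h (i + j)))"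
  by (rule emb_orth) (simp_all add: emb_refl Suc)
 moreover have "emb R (?o (?h 1) (?h (i + j))) (?h (Suc (i + j)))" by (rule emb_hyp_Suc)
 ultimately show "emb R (?o (?h (Suc i)) (?h j)) (?h (Suc i + j))"
  by (metis add_Suc emb_trans sform_hyp sform_orth)
qed

lemma emb_hyp_mono: "i \<le> j \<Longrightarrow> emb R (hyp R i) (hyp R j)"
 using emb_trans[OF emb_left emb_hyp_add(2)[of i "j - i"]] by simp

end

context field
begin

lemma regular_diag:
 assumes "set as \<subseteq> carrier R - {\<zero>}" shows "regular R (diag_form R as)"
proof -
 have s: "set as \<subseteq> carrier R" using assms by auto
 show ?thesis unfolding regular_iff
 proof (intro conjI ballI impI allI)
  fix v i assume v: "v \<in> vec R" and b: "\<forall>w\<in>vec R. bilin R (diag_form R as) v w = \<zero>"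
   and i: "i < qdim (diag_form R as)"
  have a: "as ! j \<in> carrier R" "as ! j \<noteq> \<zero>" if "j < length as" for j
   using that assms nth_mem by blast+
  have "\<zero> = bilin R (diag_form R as) v (uvec R i)" using b by simp
  also have "\<dots> = (\<Oplus>j\<in>{..<length as}. v j \<otimes> as ! j \<otimes> uvec R i j)"
   using s v by (simp add: bilin_diag)
  also have "\<dots> = v i \<otimes> as ! i \<otimes> uvec R i i"
   by (rule finsum_delta) (use i a v in "auto simp: uvec_def")
  finally have "v i \<otimes> as ! i = \<zero>" using i a v by (simp add: uvec_def)
  thus "v i = \<zero>" using integral[of "v i" "as ! i"] i a v by auto
 qed (use s in simp)
qed

lemma regular_scale:
 assumes "regular R q" "a \<in> carrier R" "a \<noteq> \<zero>"
 shows "regular R (scl R a q)"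
proof -
 have s: "sform R q" using assms regular_sform by blast
 show ?thesis unfolding regular_iff
 proof (intro conjI ballI impI allI)
  fix v i assume v: "v \<in> vec R" and b: "\<forall>w\<in>vec R. bilin R (scl R a q) v w = \<zero>"
   and i: "i < qdim (scl R a q)"
  have "bilin R q v w = \<zero>" if w: "w \<in> vec R" for w
   using b[rule_format, OF w] s assms v w by (simp add: bilin_scale integral_iff)
  thus "v i = \<zero>" using regularD[OF assms(1) v _] i by simp
 qed (use s assms in simp)
qed

lemma regular_hyp: "regular R (hyp R i)"
 unfolding hyperbolic_form_def
 by (rule regular_diag) (auto split: if_splits)

end

context field2
begin

text \<open>If every vector orthogonal to the image of \<open>f\<close> were isotropic, polarisation
  would make this complement totally isotropic. As it spans the whole space together with the image,
  it would lie in the radical of \<open>q\<close> and vanish; then \<open>f\<close> would be onto,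
  against the dimensions.\<close>

lemma emb_extend_vector:
 assumes P: "regular R p" and Q: "regular R q" and e: "emb R p q" and d: "qdim p < qdim q"
 shows "\<exists>c\<in>carrier R - {\<zero>}. emb R (orth R p (diag_form R [c])) q"
proof -
 have sp: "sform R p" and sq: "sform R q" using P Q regular_sform by blast+
 obtain f where f: "linmap R (qdim p) f"
  "\<And>v w. v \<in> vec R \<Longrightarrow> w \<in> vec R \<Longrightarrow> bilin R q (f v) (f w) = bilin R p v w"
  using emb_linmap[OF e sq] by metis
 have fv: "f v \<in> vec R" if "v \<in> vec R" for v using linmapD(1)[OF f(1) that] .
 let ?W = "{y \<in> vec R. \<forall>v\<in>vec R. bilin R q (f v) y = \<zero>}"
 have "\<exists>y\<in>?W. bilin R q y y \<noteq> \<zero>"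
 proof (rule ccontr)
  assume "\<not> (\<exists>y\<in>?W. bilin R q y y \<noteq> \<zero>)"
  hence iso: "bilin R q y y = \<zero>" if "y \<in> ?W" for y using that by blast
  have orth: "bilin R q y y' = \<zero>" if y: "y \<in> ?W" "y' \<in> ?W" for y y'
  proof -
   have v: "y \<in> vec R" "y' \<in> vec R" using y by auto
   have "vadd R y y' \<in> ?W" using y sq fv by (auto simp: bilin_add_right)
   from iso[OF this] have "bilin R q y y' \<oplus> bilin R q y' y = \<zero>"
    using v sq iso[OF y(1)] iso[OF y(2)] by (simp add: bilin_add_left bilin_add_right a_comm)
   hence "bilin R q y y' \<oplus> bilin R q y y' = \<zero>" using bilin_sym[OF sq v] by simp
   with v sq show ?thesis by (rule_tac double_zero) simp_all
  qed
  \<comment> \<open>Orthogonal projection to the image: by \<open>riesz\<close> the functional that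
    \<open>z\<close> induces on the image is represented by some \<open>w\<close>.\<close>
  have decomp: "\<exists>w\<in>vec R. vadd R z (smul R (\<ominus> \<one>) (f w)) \<in> ?W" if z: "z \<in> vec R" for z
  proof -
   have "(\<lambda>j. bilin R q z (f (uvec R j))) \<in> vec R" using z sq fv by auto
   from riesz[OF P this] obtain w where w: "w \<in> vec R"
    "\<And>j. j < qdim p \<Longrightarrow> bilin R p w (uvec R j) = bilin R q z (f (uvec R j))" by blast
   have *: "bilin R p w v = bilin R q z (f v)" if v: "v \<in> vec R" for v
   proof -
    have "bilin R p w v = bilin R p v w" using bilin_sym[OF sp w(1) v] .
    also have "\<dots> = (\<Oplus>j\<in>{..<qdim p}. v j \<otimes> bilin R p (uvec R j) w)" by (rule bilin_expand[OF sp v w(1)])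
    also have "\<dots> = (\<Oplus>j\<in>{..<qdim p}. v j \<otimes> bilin R q z (f (uvec R j)))"
     by (rule finsum_cong') (use w v sp sq z fv bilin_sym[OF sp w(1)] in auto)
    also have "\<dots> = bilin R q z (lcomb R {..<qdim p} v (\<lambda>j. f (uvec R j)))"
     using v sq z fv by (simp add: bilin_lcomb_right)
    also have "lcomb R {..<qdim p} v (\<lambda>j. f (uvec R j)) = f (lcomb R {..<qdim p} v (uvec R))"
     by (rule linmap_lcomb[OF f(1), symmetric]) (use v in auto)
    also have "\<dots> = f v" by (rule linmapD(4)[OF f(1)]) (use v in "auto simp: lcomb_uvec")
    finally show ?thesis .
   qed
   have "vadd R z (smul R (\<ominus> \<one>) (f w)) \<in> ?W"
   proof (intro CollectI conjI ballI)
    show "vadd R z (smul R (\<ominus> \<one>) (f w)) \<in> vec R" using z fv w by simp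
    fix v :: "nat \<Rightarrow> 'a" assume v: "v \<in> vec R"
    have "bilin R q (f v) (vadd R z (smul R (\<ominus> \<one>) (f w))) = bilin R q (f v) z \<oplus> \<ominus> \<one> \<otimes> bilin R p v w"
     using v z w fv sq f(2) by (simp add: bilin_add_right bilin_smul_right)
    also have "bilin R q (f v) z = bilin R p v w"
     using *[OF v] bilin_sym[OF sq fv[OF v] z] bilin_sym[OF sp v w(1)] by simp
    finally show "bilin R q (f v) (vadd R z (smul R (\<ominus> \<one>) (f w))) = \<zero>"
     using v w sp by (simp add: l_minus r_neg)
   qed
   thus ?thesis using w(1) by blast
  qed
  have zero: "y i = \<zero>" if y: "y \<in> ?W" and i: "i < qdim q" for y i
  proof (rule regularD[OF Q _ _ i])
   show yv: "y \<in> vec R" using y by simp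
   fix z :: "nat \<Rightarrow> 'a" assume z: "z \<in> vec R"
   obtain w where w: "w \<in> vec R" "vadd R z (smul R (\<ominus> \<one>) (f w)) \<in> ?W" using decomp[OF z] by blast
   have "\<zero> = bilin R q y (vadd R z (smul R (\<ominus> \<one>) (f w)))" using orth[OF y w(2)] by simp
   also have "\<dots> = bilin R q y z \<oplus> \<ominus> \<one> \<otimes> bilin R q y (f w)"
    using yv z w fv sq by (simp add: bilin_add_right bilin_smul_right)
   also have "bilin R q y (f w) = \<zero>" using y w(1) bilin_sym[OF sq yv fv[OF w(1)]] by simp
   finally show "bilin R q y z = \<zero>" using yv z sq by simp
  qed
  \<comment> \<open>The complement being zero, \<open>f\<close> reaches every basis vector of
    \<open>q\<close>. The preimages are too many to be independent, and applying \<open>f\<close> to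
    a relation among them gives the contradiction.\<close>
  have "\<exists>w\<in>vec R. \<forall>i<qdim q. f w i = uvec R k i" for k
  proof -
   obtain w where w: "w \<in> vec R" "vadd R (uvec R k) (smul R (\<ominus> \<one>) (f w)) \<in> ?W"
    using decomp[of "uvec R k"] by auto
   have "f w i = uvec R k i" if i: "i < qdim q" for i
   proof -
    have "uvec R k i \<oplus> \<ominus> (f w i) = \<zero>"
     using zero[OF w(2) i] fv[OF w(1)] by (simp add: vadd_def smul_def l_minus)
    thus ?thesis using fv[OF w(1)] by (metis minus_eq r_right_minus_eq uvec_vec vec_closed)
   qed
   thus ?thesis using w(1) by blast
  qed
  then obtain w where w: "\<And>k. w k \<in> vec R" "\<And>k i. i < qdim q \<Longrightarrow> f (w k) i = uvec R k i" by metis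
  have "card {..<qdim q} > qdim p" using d by simp
  from linear_dependent[OF _ this, of w] w(1) obtain c j where c: "c \<in> vec R" "j < qdim q" "c j \<noteq> \<zero>"
   "\<forall>k<qdim p. lcomb R {..<qdim q} c w k = \<zero>" by auto
  have "f (lcomb R {..<qdim q} c w) = f (\<lambda>_. \<zero>)"
   by (rule linmapD(4)[OF f(1)]) (use c w in auto)
  hence "lcomb R {..<qdim q} c (\<lambda>j. f (w j)) = (\<lambda>_. \<zero>)"
   using linmap_lcomb[OF f(1) _ c(1) w(1), of "{..<qdim q}"] linmap_zero[OF f(1)] by simp
  hence "\<zero> = lcomb R {..<qdim q} c (\<lambda>j. f (w j)) j" by simp
  also have "\<dots> = lcomb R {..<qdim q} c (uvec R) j"
   unfolding lcomb_def using c w by (intro finsum_cong') auto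
  also have "\<dots> = c j" by (rule lcomb_uvec[OF c(1,2)])
  finally show False using c(3) by simp
 qed
 then obtain y where y: "y \<in> vec R" "\<And>v. v \<in> vec R \<Longrightarrow> bilin R q (f v) y = \<zero>" "bilin R q y y \<noteq> \<zero>" by blast
 have "emb R (orth R p (diag_form R [bilin R q y y])) q"
  by (rule emb_add_vector[OF sq sp f y(1,2) refl])
 thus ?thesis using y sq by (intro bexI[of _ "bilin R q y y"]) auto
qed

text \<open>Splitting off one vector of nonzero value at a time diagonalises the complement on the
  way.\<close>

lemma orthogonal_complement:
 assumes "regular R p" "regular R q" "emb R p q"
 shows "\<exists>cs. set cs \<subseteq> carrier R - {\<zero>} \<and> emb R (orth R p (diag_form R cs)) q \<and>
  qdim p + length cs = qdim q"
 using assms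
proof (induction "qdim q - qdim p" arbitrary: p rule: less_induct)
 case less
 have sp: "sform R p" and sq: "sform R q" using less regular_sform by blast+
 have le: "qdim p \<le> qdim q" using regular_emb_dim_le[OF less(2,4) sq] .
 show ?case
 proof (cases "qdim p = qdim q")
  case True
  have "emb R (orth R p (diag_form R [])) p"
   by (rule emb_id) (use sp in "simp_all add: bilin_orth bilin_diag_Nil")
  thus ?thesis using emb_trans[OF _ less(4) sq] True by (intro exI[of _ "[]"]) auto
 next
  case False
  hence lt: "qdim p < qdim q" using le by simp
  from emb_extend_vector[OF less(2,3,4) lt] obtain c where c: "c \<in> carrier R" "c \<noteq> \<zero>"
   "emb R (orth R p (diag_form R [c])) q" by blast
  let ?p = "orth R p (diag_form R [c])"
  have p': "regular R ?p" using c less(2) by (intro regular_orth regular_diag) auto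
  have "qdim q - qdim ?p < qdim q - qdim p" using lt by simp
  from less(1)[OF this p' less(3) c(3)] obtain cs where cs: "set cs \<subseteq> carrier R - {\<zero>}"
   "emb R (orth R ?p (diag_form R cs)) q" "qdim ?p + length cs = qdim q" by blast
  have s: "sform R (diag_form R [c])" "sform R (diag_form R cs)" "sform R (diag_form R (c # cs))"
   using c cs by (auto intro!: sform_diag)
  have "emb R (orth R p (diag_form R (c # cs))) (orth R p (orth R (diag_form R [c]) (diag_form R cs)))"
   by (rule emb_orth) (use sp s c cs in "auto intro!: emb_refl emb_diag_Cons")
  moreover have "emb R (orth R p (orth R (diag_form R [c]) (diag_form R cs))) (orth R ?p (diag_form R cs))"
   by (rule emb_orth_assoc) (use sp s in auto)
  ultimately have "emb R (orth R p (diag_form R (c # cs))) q"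
   using cs(2) emb_trans sq emb_sform by metis
  thus ?thesis using c cs by (intro exI[of _ "c # cs"]) auto
 qed
qed

text \<open>This leads back from embeddings to the subforms in the definition of Pfister
  neighbours.\<close>

lemma subform_of_emb:
 assumes "regular R p" "regular R q" "emb R p q"
 shows "subform R p q"
proof -
 have sq: "sform R q" using assms regular_sform by blast
 from orthogonal_complement[OF assms] obtain cs where cs: "set cs \<subseteq> carrier R - {\<zero>}"
  "emb R (orth R p (diag_form R cs)) q" "qdim p + length cs = qdim q" by blast
 have r: "regular R (diag_form R cs)" using cs(1) by (rule regular_diag)
 have "isometric R (orth R p (diag_form R cs)) q"
  by (rule isometric_of_emb[OF regular_orth[OF assms(1) r] cs(2) sq]) (use cs in simp)
 thus ?thesis unfolding subform_def using r isometric_sym[OF _ sq] by blast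
qed

lemma isotropic_hyp:
 assumes Q: "regular R q" and "\<not> aniso R q"
 shows "emb R (hyp R 1) q"
proof -
 have s: "sform R q" using Q regular_sform by blast
 from assms(2) obtain z i where z: "z \<in> vec R" "bilin R q z z = \<zero>" "i < qdim q" "z i \<noteq> \<zero>"
  unfolding aniso_iff[OF s] by blast
 then obtain w where w: "w \<in> vec R" "bilin R q z w \<noteq> \<zero>" using regularD[OF Q z(1)] by blast
 define y where "y = smul R (inv (bilin R q z w)) w"
 have y: "y \<in> vec R" using w s z by (simp add: y_def)
 have zy: "bilin R q z y = \<one>" using w s z by (simp add: y_def bilin_smul_right)
 have yz: "bilin R q y z = \<one>" using zy bilin_sym[OF s z(1) y] by simp
 \<comment> \<open>Correcting \<open>y\<close> by a multiple of \<open>z\<close> gives a pair of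
   isotropic vectors \<open>z\<close>, \<open>f\<close> with pairing 1; then \<open>z + f/2\<close>
   and \<open>z - f/2\<close> are orthogonal with values 1 and -1.\<close>
 define a where "a = \<ominus> (half \<otimes> bilin R q y y)"
 have a: "a \<in> carrier R" using s y by (simp add: a_def)
 define f where "f = vadd R y (smul R a z)"
 have f: "f \<in> vec R" using y z a by (simp add: f_def)
 have zf: "bilin R q z f = \<one>" using s y z a zy by (simp add: f_def bilin_add_right bilin_smul_right)
 hence fz: "bilin R q f z = \<one>" using bilin_sym[OF s z(1) f] by simp
 have ff: "bilin R q f f = \<zero>"
 proof -
  have "bilin R q f f = bilin R q y y \<oplus> (a \<oplus> a)"
   using s y z a zy yz by (simp add: f_def bilin_add_left bilin_add_right bilin_smul_left bilin_smul_right a_assoc)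
  also have "a \<oplus> a = \<ominus> ((half \<oplus> half) \<otimes> bilin R q y y)"
   using s y by (simp add: a_def l_distr minus_add)
  finally show ?thesis using s y by (simp add: half_add r_neg)
 qed
 let ?u = "vadd R z (smul R half f)" and ?v = "vadd R z (smul R (\<ominus> half) f)"
 have "emb R (diag_form R [\<one>, \<ominus> \<one>]) q"
 proof (rule emb_diag2[OF s, of ?u ?v])
  show "bilin R q ?u ?u = \<one>"
   using s z f zf fz ff by (simp add: bilin_add_left bilin_add_right bilin_smul_left bilin_smul_right half_add)
  show "bilin R q ?v ?v = \<ominus> \<one>"
   using s z f zf fz ff half_add
   by (simp add: bilin_add_left bilin_add_right bilin_smul_left bilin_smul_right minus_add[symmetric])
  show "bilin R q ?u ?v = \<zero>"
   using s z f zf fz ff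
   by (simp add: bilin_add_left bilin_add_right bilin_smul_left bilin_smul_right l_neg r_neg)
 qed (use z f in auto)
 thus ?thesis unfolding hyp_1 .
qed

text \<open>Take the largest number of hyperbolic planes that embed. An isotropic complement would
  contain one more.\<close>

lemma witt_decomposition:
 assumes Q: "regular R q"
 shows "\<exists>i p. regular R p \<and> aniso R p \<and> isometric R q (orth R p (hyp R i))"
proof -
 have s: "sform R q" using Q regular_sform by blast
 let ?h = "hyp R"
 let ?S = "{i. emb R (?h i) q}"
 have "?S \<subseteq> {..qdim q}" using regular_emb_dim_le[OF regular_hyp _ s] by fastforce
 hence fin: "finite ?S" using finite_subset by blast
 have "0 \<in> ?S" by (simp add: hyp_0 emb_Nil)
 then obtain i where i: "i \<in> ?S" "\<And>j. j \<in> ?S \<Longrightarrow> j \<le> i"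
  using Max_in[OF fin] Max_ge[OF fin] by blast
 from orthogonal_complement[OF regular_hyp Q, of i] i(1) obtain cs where
  cs: "set cs \<subseteq> carrier R - {\<zero>}" "emb R (orth R (?h i) (diag_form R cs)) q"
  "2 * i + length cs = qdim q" by auto
 let ?r = "diag_form R cs"
 have r: "regular R ?r" using cs(1) by (rule regular_diag)
 have sr: "sform R ?r" using r regular_sform by blast
 have e: "emb R (orth R ?r (?h i)) q"
  by (rule emb_trans[OF emb_orth_comm cs(2) s]) (use sr in auto)
 have "aniso R ?r"
 proof (rule ccontr)
  assume "\<not> aniso R ?r"
  from isotropic_hyp[OF r this] have "emb R (?h 1) ?r" .
  hence "emb R (orth R (?h 1) (?h i)) (orth R ?r (?h i))"
   by (rule emb_orth) (use sr in "auto intro: emb_refl")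
  hence "emb R (?h (Suc i)) q"
   using emb_hyp_Suc(1)[of i] e s emb_trans emb_sform by metis
  thus False using i(2)[of "Suc i"] by simp
 qed
 moreover have "isometric R (orth R ?r (?h i)) q"
  by (rule isometric_of_emb[OF regular_orth[OF r regular_hyp] e s]) (use cs in simp)
 hence "isometric R q (orth R ?r (?h i))" using isometric_sym s by blast
 ultimately show ?thesis using r by blast
qed

end

section \<open>Uniqueness of the Witt index by counting totally isotropic vectors\<close>

lemma shift_vec3 [simp]: "v \<in> vec K \<Longrightarrow> (\<lambda>i. v (Suc (i + a))) \<in> vec K"
 by auto

text \<open>\<open>witt_bound R q i\<close>: totally isotropic subspaces of \<open>q\<close> have dimension at most \<open>i\<close>.\<close>

definition witt_bound :: "('a, 'b) ring_scheme \<Rightarrow> 'a qform \<Rightarrow> nat \<Rightarrow> bool"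
 where "witt_bound K q i \<longleftrightarrow> (\<forall>J (w :: nat \<Rightarrow> nat \<Rightarrow> 'a). finite J \<longrightarrow> (\<forall>j. w j \<in> vec K) \<longrightarrow>
  (\<forall>j\<in>J. \<forall>k\<in>J. bilin K q (w j) (w k) = \<zero>\<^bsub>K\<^esub>) \<longrightarrow>
  (\<forall>c\<in>vec K. (\<forall>k<qdim q. lcomb K J c w k = \<zero>\<^bsub>K\<^esub>) \<longrightarrow> (\<forall>j\<in>J. c j = \<zero>\<^bsub>K\<^esub>)) \<longrightarrow>
  card J \<le> i)"

lemma witt_boundD:
 fixes w :: "nat \<Rightarrow> nat \<Rightarrow> 'a"
 assumes "witt_bound K q i" "finite J" "\<And>j. w j \<in> vec K"
  "\<And>j k. j \<in> J \<Longrightarrow> k \<in> J \<Longrightarrow> bilin K q (w j) (w k) = \<zero>\<^bsub>K\<^esub>"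
  "\<And>c j. c \<in> vec K \<Longrightarrow> (\<And>k. k < qdim q \<Longrightarrow> lcomb K J c w k = \<zero>\<^bsub>K\<^esub>) \<Longrightarrow> j \<in> J \<Longrightarrow> c j = \<zero>\<^bsub>K\<^esub>"
 shows "card J \<le> i"
proof -
 have 1: "\<forall>j. w j \<in> vec K" using assms(3) by (intro allI)
 have 2: "\<forall>j\<in>J. \<forall>k\<in>J. bilin K q (w j) (w k) = \<zero>\<^bsub>K\<^esub>" using assms(4) by (intro ballI)
 have 3: "\<forall>c\<in>vec K. (\<forall>k<qdim q. lcomb K J c w k = \<zero>\<^bsub>K\<^esub>) \<longrightarrow> (\<forall>j\<in>J. c j = \<zero>\<^bsub>K\<^esub>)"
 proof (intro ballI impI)
  fix c j assume "c \<in> vec K" "\<forall>k<qdim q. lcomb K J c w k = \<zero>\<^bsub>K\<^esub>" "j \<in> J"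
  thus "c j = \<zero>\<^bsub>K\<^esub>" using assms(5)[of c j] by simp
 qed
 show ?thesis
  using assms(1)[unfolded witt_bound_def, THEN spec[of _ J], THEN spec[of _ w],
    THEN mp, OF assms(2), THEN mp, OF 1, THEN mp, OF 2, THEN mp, OF 3] .
qed

context field
begin

lemma witt_bound_aniso:
 assumes s: "sform R p" and a: "aniso R p"
 shows "witt_bound R p 0"
 unfolding witt_bound_def
proof (intro allI impI)
 fix J and w :: "nat \<Rightarrow> nat \<Rightarrow> 'a"
 assume J: "finite J" "\<forall>j. w j \<in> vec R" "\<forall>j\<in>J. \<forall>k\<in>J. bilin R p (w j) (w k) = \<zero>"
  "\<forall>c\<in>vec R. (\<forall>k<qdim p. lcomb R J c w k = \<zero>) \<longrightarrow> (\<forall>j\<in>J. c j = \<zero>)"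
 have "J = {}"
 proof (rule ccontr)
  assume "J \<noteq> {}"
  then obtain j where j: "j \<in> J" by blast
  have wz: "w j k = \<zero>" if "j \<in> J" "k < qdim p" for j k
   using a J that unfolding aniso_iff[OF s] by blast
  have "\<forall>k<qdim p. lcomb R J (\<lambda>_. \<one>) w k = \<zero>"
   unfolding lcomb_def by (intro allI impI finsum_all_zero) (use wz in auto)
  moreover have "(\<lambda>_. \<one>) \<in> vec R" by auto
  ultimately have "\<one> = \<zero>" using J(4) j by blast
  thus False by simp
 qed
 thus "card J \<le> 0" by simp
qed

text \<open>Regularity of \<open>p\<close> makes the embedding injective, so independent families of
  isotropic vectors stay independent.\<close>

lemma witt_bound_emb:
 assumes W: "witt_bound R q i" and P: "regular R p" and e: "emb R p q" and s: "sform R q"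
 shows "witt_bound R p i"
proof -
 have sp: "sform R p" using P regular_sform by blast
 obtain f where f: "linmap R (qdim p) f"
  "\<And>v w. v \<in> vec R \<Longrightarrow> w \<in> vec R \<Longrightarrow> bilin R q (f v) (f w) = bilin R p v w"
  using emb_linmap[OF e s] by metis
 have fv: "f v \<in> vec R" if "v \<in> vec R" for v using linmapD(1)[OF f(1) that] .
 show ?thesis unfolding witt_bound_def
 proof (intro allI impI)
  fix J and w :: "nat \<Rightarrow> nat \<Rightarrow> 'a"
  assume J: "finite J" "\<forall>j. w j \<in> vec R" "\<forall>j\<in>J. \<forall>k\<in>J. bilin R p (w j) (w k) = \<zero>"
   "\<forall>c\<in>vec R. (\<forall>k<qdim p. lcomb R J c w k = \<zero>) \<longrightarrow> (\<forall>j\<in>J. c j = \<zero>)"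
  show "card J \<le> i"
  proof (rule witt_boundD[OF W J(1), of "\<lambda>j. f (w j)"])
   show "f (w j) \<in> vec R" for j using J fv by blast
   show "bilin R q (f (w j)) (f (w k)) = \<zero>" if "j \<in> J" "k \<in> J" for j k
    using J f(2) that by simp
   fix c j assume c: "c \<in> vec R" "\<And>k. k < qdim q \<Longrightarrow> lcomb R J c (\<lambda>j. f (w j)) k = \<zero>" and j: "j \<in> J"
   let ?u = "lcomb R J c w"
   have u: "?u \<in> vec R" using c J by simp
   have "f ?u = lcomb R J c (\<lambda>j. f (w j))" by (rule linmap_lcomb[OF f(1) J(1)]) (use c J in auto)
   hence "bilin R p ?u v = \<zero>" if "v \<in> vec R" for v
    using f(2)[OF u that] bilin_zero_left[OF s fv[OF that], of "f ?u"] c(2) by simp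
   hence "\<forall>k<qdim p. ?u k = \<zero>" using regularD[OF P u] by blast
   thus "c j = \<zero>" using J(4) c(1) j by blast
  qed
 qed
qed

lemma bilin_hyp_plane:
 assumes "sform R q" "v \<in> vec R" "w \<in> vec R"
 shows "bilin R (orth R q (hyp R 1)) v w = bilin R q v w \<oplus>
  (v (qdim q) \<otimes> w (qdim q) \<oplus> \<ominus> (v (Suc (qdim q)) \<otimes> w (Suc (qdim q))))"
 unfolding hyp_1 using assms
 by (simp add: bilin_orth bilin_diag_Cons bilin_diag_Nil l_minus r_minus)

text \<open>Two things can cost a dimension: passing to the kernel of the functional
  \<open>b\<close> below, where the form is that of \<open>q\<close>, and then projecting to
  \<open>q\<close>, which kills the line of (0, 1, 1). They cannot both happen, since a vector on
  which \<open>b\<close> is nonzero is not orthogonal to that line.\<close>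

lemma witt_bound_hyp_plane:
 assumes W: "witt_bound R q i" and s: "sform R q"
 shows "witt_bound R (orth R q (hyp R 1)) (Suc i)"
 unfolding witt_bound_def
proof (intro allI impI)
 let ?Q = "orth R q (hyp R 1)" and ?D = "qdim q"
 fix J and w :: "nat \<Rightarrow> nat \<Rightarrow> 'a"
 assume J: "finite J" and w': "\<forall>j. w j \<in> vec R"
  and iso': "\<forall>j\<in>J. \<forall>k\<in>J. bilin R ?Q (w j) (w k) = \<zero>"
  and ind': "\<forall>c\<in>vec R. (\<forall>k<qdim ?Q. lcomb R J c w k = \<zero>) \<longrightarrow> (\<forall>j\<in>J. c j = \<zero>)"
 have w: "w j \<in> vec R" for j using w' by blast
 have iso: "bilin R ?Q (w j) (w k) = \<zero>" if "j \<in> J" "k \<in> J" for j k using iso' that by blast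
 have ind: "c j = \<zero>" if "c \<in> vec R" "\<And>k. k < Suc (Suc ?D) \<Longrightarrow> lcomb R J c w k = \<zero>" "j \<in> J" for c j
  using ind' that by simp
 have sQ: "sform R ?Q" using s by simp
 \<comment> \<open>\<open>b v\<close> is the pairing of \<open>v\<close> with the isotropic vector
   (0, 1, 1); where it vanishes, the plane contributes nothing to the form.\<close>
 define b where "b = (\<lambda>v :: nat \<Rightarrow> 'a. v ?D \<oplus> \<ominus> v (Suc ?D))"
 have bc: "b v \<in> carrier R" if "v \<in> vec R" for v using that by (simp add: b_def)
 have b0: "v (Suc ?D) = v ?D" if "b v = \<zero>" "v \<in> vec R" for v
  using that unfolding b_def by (metis minus_eq r_right_minus_eq vec_closed)
 have Qq: "bilin R q v u = bilin R ?Q v u" if "b v = \<zero>" "b u = \<zero>" "v \<in> vec R" "u \<in> vec R" for v u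
  using that s b0[of v] b0[of u] by (simp add: bilin_hyp_plane r_neg del: One_nat_def)
 have blc: "b (lcomb R I c y) = \<zero>" if "finite I" "c \<in> vec R" "\<And>j. y j \<in> vec R" "\<And>j. j \<in> I \<Longrightarrow> b (y j) = \<zero>"
  for I c and y :: "nat \<Rightarrow> nat \<Rightarrow> 'a"
 proof -
  have "y j (Suc ?D) = y j ?D" if "j \<in> I" for j using b0 \<open>j \<in> I\<close> that(1) \<open>\<And>j. y j \<in> vec R\<close>
    \<open>\<And>j. j \<in> I \<Longrightarrow> b (y j) = \<zero>\<close> by blast
  hence "lcomb R I c y (Suc ?D) = lcomb R I c y ?D"
   unfolding lcomb_def by (intro finsum_cong') (use that in auto)
  thus ?thesis using that by (simp add: b_def r_neg)
 qed
 show "card J \<le> Suc i"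
 proof (cases "\<exists>j0\<in>J. b (w j0) \<noteq> \<zero>")
  case True
  then obtain j0 where j0: "j0 \<in> J" "b (w j0) \<noteq> \<zero>" by blast
  let ?J = "J - {j0}"
  define m where "m = (\<lambda>j. b (w j) \<otimes> inv (b (w j0)))"
  have m: "m \<in> vec R" using bc w j0 by (auto simp: m_def)
  define y where "y = (\<lambda>j. vadd R (w j) (smul R (\<ominus> m j) (w j0)))"
  have y: "y j \<in> vec R" for j using w m by (simp add: y_def)
  have by0: "b (y j) = \<zero>" for j
  proof -
   { fix x1 x2 x3 x4 n assume x: "x1 \<in> carrier R" "x2 \<in> carrier R" "x3 \<in> carrier R" "x4 \<in> carrier R" "n \<in> carrier R"
    have "(x1 \<oplus> \<ominus> n \<otimes> x3) \<oplus> \<ominus> (x2 \<oplus> \<ominus> n \<otimes> x4) = (x1 \<oplus> \<ominus> x2) \<ominus> n \<otimes> (x3 \<oplus> \<ominus> x4)"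
     using x by algebra }
   from this[of "w j ?D" "w j (Suc ?D)" "w j0 ?D" "w j0 (Suc ?D)" "m j"]
   have "b (y j) = b (w j) \<ominus> m j \<otimes> b (w j0)"
    using w m by (simp add: b_def y_def vadd_def smul_def)
   also have "m j \<otimes> b (w j0) = b (w j)" using j0 bc w by (simp add: m_def m_assoc)
   finally show ?thesis using bc w by (simp add: minus_eq r_neg)
  qed
  have yQ: "bilin R ?Q (y j) (w k) = \<zero>" if "j \<in> J" "k \<in> J" for j k
   using that j0 w m iso sQ by (simp add: y_def bilin_add_left bilin_smul_left)
  have "card ?J \<le> i"
  proof (rule witt_boundD[OF W, of ?J y])
   show "finite ?J" using J by simp
   show "y j \<in> vec R" for j by (rule y)
   fix j k assume jk: "j \<in> ?J" "k \<in> ?J"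
   have "bilin R q (y j) (y k) = bilin R ?Q (y j) (y k)" by (rule Qq[OF by0 by0 y y])
   also have "\<dots> = bilin R ?Q (y j) (w k) \<oplus> \<ominus> m k \<otimes> bilin R ?Q (y j) (w j0)"
    unfolding y_def[of] using y w m sQ by (simp add: y_def[symmetric] bilin_add_right bilin_smul_right)
   finally show "bilin R q (y j) (y k) = \<zero>" using jk j0 yQ m by simp
  next
   fix c j assume c: "c \<in> vec R" "\<And>k. k < ?D \<Longrightarrow> lcomb R ?J c y k = \<zero>" and j: "j \<in> ?J"
   let ?u = "lcomb R ?J c y"
   have u: "?u \<in> vec R" using c y by simp
   have bu: "b ?u = \<zero>" by (rule blc) (use J c y by0 in auto)
   \<comment> \<open>A combination with vanishing \<open>q\<close>-part is a multiple of (0, 1, 1),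
     and its pairing with \<open>w j0\<close> is that multiple times \<open>b (w j0)\<close>; so it
     is zero.\<close>
   have "\<zero> = bilin R ?Q ?u (w j0)"
   proof -
    have "bilin R ?Q ?u (w j0) = (\<Oplus>j\<in>?J. c j \<otimes> bilin R ?Q (y j) (w j0))"
     using J c y w sQ by (intro bilin_lcomb_left) auto
    also have "\<dots> = \<zero>" by (intro finsum_all_zero) (use yQ j0 c in auto)
    finally show ?thesis by simp
   qed
   also have "\<dots> = ?u ?D \<otimes> w j0 ?D \<oplus> \<ominus> (?u ?D \<otimes> w j0 (Suc ?D))"
    using bilin_hyp_plane[OF s u w[of j0]] bilin_zero_left[OF s w[of j0] c(2)] b0[OF bu u] u w by (simp del: One_nat_def)
   also have "\<dots> = ?u ?D \<otimes> b (w j0)" using u w by (simp add: b_def r_distr r_minus)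
   finally have "?u ?D = \<zero>" using integral[of "?u ?D" "b (w j0)"] u bc w j0 by auto
   hence "?u k = \<zero>" if "k < Suc (Suc ?D)" for k using that c(2) b0[OF bu u] by (metis less_SucE)
   moreover have "?u = lcomb R J (c(j0 := \<ominus> (\<Oplus>j\<in>?J. c j \<otimes> m j))) w"
    unfolding y_def by (rule lcomb_pivot) (use J j0 c m w in auto)
   ultimately have z: "lcomb R J (c(j0 := \<ominus> (\<Oplus>j\<in>?J. c j \<otimes> m j))) w k = \<zero>" if "k < Suc (Suc ?D)" for k
    using that by metis
   have "(\<Oplus>j\<in>?J. c j \<otimes> m j) \<in> carrier R" using c m by (intro finsum_closed) auto
   hence "c(j0 := \<ominus> (\<Oplus>j\<in>?J. c j \<otimes> m j)) \<in> vec R" using c by (intro vecI) auto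
   from ind[OF this z, of j] show "c j = \<zero>" using j by auto
  qed
  thus ?thesis using J j0 by simp
 next
  case False
  hence b: "b (w j) = \<zero>" if "j \<in> J" for j using that by blast
  have qiso: "bilin R q (w j) (w k) = \<zero>" if "j \<in> J" "k \<in> J" for j k
   using Qq[OF b b w w] iso that by simp
  show ?thesis
  proof (cases "\<forall>c\<in>vec R. (\<forall>k<?D. lcomb R J c w k = \<zero>) \<longrightarrow> (\<forall>j\<in>J. c j = \<zero>)")
   case True
   hence "card J \<le> i"
    by (intro witt_boundD[OF W J, of w]) (use w qiso in auto)
   thus ?thesis by simp
  next
   case False
   then obtain c j1 where c: "c \<in> vec R" "\<forall>k<?D. lcomb R J c w k = \<zero>" "j1 \<in> J" "c j1 \<noteq> \<zero>" by blast
   let ?u = "lcomb R J c w"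
   have u: "?u \<in> vec R" using c w by simp
   have bu: "b ?u = \<zero>" by (rule blc) (use J c w b in auto)
   have uD: "?u ?D \<noteq> \<zero>"
   proof
    assume "?u ?D = \<zero>"
    hence "?u k = \<zero>" if "k < Suc (Suc ?D)" for k using that c(2) b0[OF bu u] by (metis less_SucE)
    thus False using ind[OF c(1) _ c(3)] c(4) by blast
   qed
   let ?J = "J - {j1}"
   have "card ?J \<le> i"
   proof (rule witt_boundD[OF W, of ?J w])
    show "finite ?J" using J by simp
    show "w j \<in> vec R" for j by (rule w)
    show "bilin R q (w j) (w k) = \<zero>" if "j \<in> ?J" "k \<in> ?J" for j k using that qiso by simp
    fix c' j assume c': "c' \<in> vec R" "\<And>k. k < ?D \<Longrightarrow> lcomb R ?J c' w k = \<zero>" and j: "j \<in> ?J"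
    let ?u' = "lcomb R ?J c' w"
    have u': "?u' \<in> vec R" using c' w by simp
    have bu': "b ?u' = \<zero>" by (rule blc) (use J c' w b in auto)
    \<comment> \<open>Any relation between the \<open>q\<close>-parts without \<open>j1\<close>
      becomes a relation between the full vectors after subtracting \<open>t\<close> times the
      relation \<open>c\<close>. Independence then applies, and its coefficient at \<open>j1\<close>
      shows that \<open>t\<close> is zero.\<close>
    define t where "t = ?u' ?D \<otimes> inv (?u ?D)"
    have t: "t \<in> carrier R" using u' u uD by (simp add: t_def)
    have tu: "t \<otimes> ?u ?D = ?u' ?D" using u' u uD by (simp add: t_def m_assoc)
    let ?e = "\<lambda>j. (if j = j1 then \<zero> else c' j) \<oplus> \<ominus> (t \<otimes> c j)"
    have e: "?e \<in> vec R" using c c' t by (intro vecI) auto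
    have lc: "lcomb R J ?e w k = ?u' k \<oplus> \<ominus> (t \<otimes> ?u k)" for k
    proof -
     have "lcomb R J ?e w k = (\<Oplus>j\<in>J. (if j = j1 then \<zero> else c' j) \<otimes> w j k \<oplus> \<ominus> t \<otimes> (c j \<otimes> w j k))"
      unfolding lcomb_def using c c' t w
      by (intro finsum_cong') (auto simp: l_distr l_minus m_assoc)
     also have "\<dots> = (\<Oplus>j\<in>J. (if j = j1 then \<zero> else c' j) \<otimes> w j k) \<oplus> (\<Oplus>j\<in>J. \<ominus> t \<otimes> (c j \<otimes> w j k))"
      using c c' t w by (intro finsum_addf) auto
     also have "(\<Oplus>j\<in>J. \<ominus> t \<otimes> (c j \<otimes> w j k)) = \<ominus> t \<otimes> ?u k"
      unfolding lcomb_def using J c t w by (subst finsum_rdistr) auto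
     also have "(\<Oplus>j\<in>J. (if j = j1 then \<zero> else c' j) \<otimes> w j k) = (\<Oplus>j\<in>?J. (if j = j1 then \<zero> else c' j) \<otimes> w j k)"
      by (rule finsum_mono_neutral) (use J c c' w in auto)
     also have "\<dots> = ?u' k" unfolding lcomb_def
      by (rule finsum_cong') (use c' w in auto)
     finally show ?thesis using t u by (simp add: l_minus)
    qed
    have z: "lcomb R J ?e w k = \<zero>" if k: "k < Suc (Suc ?D)" for k
    proof -
     consider "k < ?D" | "k = ?D" | "k = Suc ?D" using k by linarith
     thus ?thesis
     proof cases
      case 1 thus ?thesis using c' c t by (simp add: lc)
     next
      case 2 thus ?thesis using tu u' by (simp add: lc r_neg)
     next
      case 3 thus ?thesis using tu u' b0[OF bu u] b0[OF bu' u'] by (simp add: lc r_neg)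
     qed
    qed
    have e0: "?e k = \<zero>" if "k \<in> J" for k by (rule ind[OF e z that])
    have "\<ominus> (t \<otimes> c j1) = \<zero>" using e0[OF c(3)] t c by simp
    hence "t \<otimes> c j1 = \<zero>" using t c by (metis add.inv_eq_1_iff m_closed vec_closed)
    hence "t = \<zero>" using integral[of t "c j1"] t c by auto
    thus "c' j = \<zero>" using e0[of j] j c c' by simp
   qed
   thus ?thesis using J c by simp
  qed
 qed
qed

lemma witt_bound_hyp:
 assumes "sform R p" "aniso R p"
 shows "witt_bound R (orth R p (hyp R i)) i"
proof (induction i)
 case 0
 have p: "regular R p" by (rule aniso_regular[OF assms])
 have "emb R (orth R p (hyp R 0)) p"
  by (rule emb_id) (use assms in "simp_all add: bilin_orth hyp_0 bilin_diag_Nil")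
 thus ?case
  using witt_bound_emb[OF witt_bound_aniso[OF assms] regular_orth[OF p regular_hyp] _ assms(1)] by blast
next
 case (Suc i)
 let ?h = "hyp R" and ?o = "orth R"
 have p: "regular R p" by (rule aniso_regular[OF assms])
 have 1: "emb R (?o p (?h (Suc i))) (?o p (?h (i + 1)))" using assms by (simp add: emb_refl)
 have 2: "emb R (?o p (?h (i + 1))) (?o p (?o (?h i) (?h 1)))"
  by (rule emb_orth[OF emb_refl emb_hyp_add(1)]) (use assms in auto)
 have 3: "emb R (?o p (?o (?h i) (?h 1))) (?o (?o p (?h i)) (?h 1))"
  by (rule emb_orth_assoc) (use assms in auto)
 have s: "sform R (?o (?o p (?h i)) (?h 1))" "sform R (?o p (?o (?h i) (?h 1)))" using assms by auto
 have "emb R (?o p (?h (Suc i))) (?o (?o p (?h i)) (?h 1))"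
  using emb_trans[OF 2 3 s(1)] 1 by simp
 moreover have "witt_bound R (?o (?o p (?h i)) (?h 1)) (Suc i)"
  by (rule witt_bound_hyp_plane[OF Suc]) (use assms in simp)
 ultimately show ?case
  using witt_bound_emb[OF _ regular_orth[OF p regular_hyp] _ s(1)] by blast
qed

lemma hyp_entry:
 "i < 2 * m \<Longrightarrow> concat (replicate m [\<one>, \<ominus> \<one>]) ! i = (if even i then \<one> else \<ominus> \<one>)"
proof (induction m arbitrary: i)
 case (Suc m)
 consider "i = 0" | "i = Suc 0" | j where "i = Suc (Suc j)" by (metis not0_implies_Suc)
 thus ?case using Suc by cases auto
qed simp

lemma gram_hyp:
 assumes "i < 2 * m"
 shows "gram (hyp R m) i j = (if i = j then if even i then \<one> else \<ominus> \<one> else \<zero>)"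
proof (cases "i = j")
 case True
 thus ?thesis using hyp_entry[OF assms] by (simp only: hyperbolic_form_def diag_form_def qform.sel simp_thms if_True)
qed (simp add: hyperbolic_form_def diag_form_def)

text \<open>The sums of the two basis vectors of each plane span a totally isotropic space of
  dimension \<open>m\<close>, so the bound is sharp.\<close>

lemma witt_bound_hyp_le:
 assumes "witt_bound R (hyp R m) i"
 shows "m \<le> i"
proof -
 let ?h = "hyp R m"
 define w where "w = (\<lambda>j. if j < m then vadd R (uvec R (2 * j)) (uvec R (Suc (2 * j))) else (\<lambda>_. \<zero>))"
 have w: "w j \<in> vec R" for j by (simp add: w_def)
 have odd: "2 * a \<noteq> Suc (2 * b)" "Suc (2 * b) \<noteq> 2 * a" for a b :: nat by presburger+
 have "card {..<m} \<le> i"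
 proof (rule witt_boundD[OF assms _ w])
  fix j k assume jk: "j \<in> {..<m}" "k \<in> {..<m}"
  hence "bilin R ?h (w j) (w k) =
   (gram ?h (2 * j) (2 * k) \<oplus> gram ?h (2 * j) (Suc (2 * k))) \<oplus>
   (gram ?h (Suc (2 * j)) (2 * k) \<oplus> gram ?h (Suc (2 * j)) (Suc (2 * k)))"
   by (simp add: w_def bilin_add_left bilin_add_right bilin_uvec a_ac)
  thus "bilin R ?h (w j) (w k) = \<zero>"
   using jk odd by (auto simp: gram_hyp r_neg)
 next
  fix c j assume c: "c \<in> vec R" "\<And>k. k < qdim ?h \<Longrightarrow> lcomb R {..<m} c w k = \<zero>" and j: "j \<in> {..<m}"
  have "lcomb R {..<m} c w (2 * j) = c j \<otimes> w j (2 * j)"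
   unfolding lcomb_def
   by (rule finsum_delta) (use j c w odd in "auto simp: w_def vadd_def uvec_def")
  also have "\<dots> = c j" using j c odd by (auto simp: w_def vadd_def uvec_def)
  finally show "c j = \<zero>" using c(2)[of "2 * j"] j by simp
 qed simp
 thus ?thesis by simp
qed

text \<open>The bound on totally isotropic vectors shows that all decompositions have the same
  number of planes, which makes the description in \<open>witt_index\<close> well defined.\<close>

lemma witt_index_le:
 assumes "sform R p" "aniso R p" "emb R (hyp R m) (orth R p (hyp R i))"
 shows "m \<le> i"
 by (rule witt_bound_hyp_le, rule witt_bound_emb[OF witt_bound_hyp[OF assms(1,2)] regular_hyp assms(3)])
  (use assms in simp)

end

context field2
begin

lemma witt_indexE:
 assumes Q: "regular R q"
 obtains p where "regular R p" "aniso R p"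
  "isometric R q (orth R p (hyp R (witt_index R q)))"
proof -
 have s: "sform R q" using Q regular_sform by blast
 let ?P = "\<lambda>i. \<exists>p. regular R p \<and> aniso R p \<and> isometric R q (orth R p (hyp R i))"
 have le: "i \<le> j" if "?P i" "?P j" for i j
 proof -
  from that obtain p r where p: "regular R p" "isometric R q (orth R p (hyp R i))"
   and r: "regular R r" "aniso R r" "isometric R q (orth R r (hyp R j))" by blast
  have sf: "sform R p" "sform R r" using p r regular_sform by blast+
  have 1: "emb R (hyp R i) (orth R p (hyp R i))"
   by (rule emb_right) (use sf in auto)
  have 2: "emb R (orth R p (hyp R i)) q"
   by (rule isometric_emb[OF isometric_sym[OF p(2)]]) (use sf in simp)
  have 3: "emb R q (orth R r (hyp R j))" by (rule isometric_emb[OF r(3)])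
  have "emb R (hyp R i) (orth R r (hyp R j))"
   by (rule emb_trans[OF emb_trans[OF 1 2 s] 3]) (use sf in simp)
  thus ?thesis using witt_index_le[OF sf(2) r(2)] by blast
 qed
 from witt_decomposition[OF Q] obtain i where i: "?P i" by blast
 have "?P (THE i. ?P i)"
  by (rule theI[of ?P i]) (use i le in "auto intro!: le_antisym")
 hence "?P (witt_index R q)" unfolding witt_index_def .
 thus ?thesis using that by blast
qed

text \<open>In this form Witt indices can be compared across base change and transfer.\<close>

lemma witt_index_iff:
 assumes Q: "regular R q"
 shows "m \<le> witt_index R q \<longleftrightarrow> emb R (hyp R m) q"
proof -
 have s: "sform R q" using Q regular_sform by blast
 let ?i = "witt_index R q"
 obtain p where p: "regular R p" "aniso R p" "isometric R q (orth R p (hyp R ?i))"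
  using witt_indexE[OF Q] by blast
 have sp: "sform R p" using p regular_sform by blast
 have so: "sform R (orth R p (hyp R ?i))" using sp by simp
 show ?thesis
 proof
  assume "m \<le> ?i"
  hence 1: "emb R (hyp R m) (hyp R ?i)" by (rule emb_hyp_mono)
  have 2: "emb R (hyp R ?i) (orth R p (hyp R ?i))"
   by (rule emb_right) (use sp in auto)
  have 3: "emb R (orth R p (hyp R ?i)) q"
   by (rule isometric_emb[OF isometric_sym[OF p(3) so]])
  show "emb R (hyp R m) q"
   by (rule emb_trans[OF emb_trans[OF 1 2 so] 3 s])
 next
  assume "emb R (hyp R m) q"
  from emb_trans[OF this isometric_emb[OF p(3)] so] show "m \<le> ?i"
   by (rule witt_index_le[OF sp p(2)])
 qed
qed

end

section \<open>Laurent series\<close>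

text \<open>The order of \<open>f\<close> is at least \<open>N\<close>. Only lower bounds occur, so
  the zero series needs no infinite order.\<close>

abbreviation van :: "('a, 'b) ring_scheme \<Rightarrow> int \<Rightarrow> (int \<Rightarrow> 'a) \<Rightarrow> bool"
 where "van K N f \<equiv> (\<forall>k<N. f k = \<zero>\<^bsub>K\<^esub>)"

definition single :: "('a, 'b) ring_scheme \<Rightarrow> 'a \<Rightarrow> int \<Rightarrow> int \<Rightarrow> 'a"
 where "single K a n = (\<lambda>k. if k = n then a else \<zero>\<^bsub>K\<^esub>)"

lemma laurent_const_single: "laurent_const K a = single K a 0"
 by (simp add: laurent_const_def single_def fun_eq_iff)

lemma laurent_var_single: "laurent_var K = single K \<one>\<^bsub>K\<^esub> 1"
 by (simp add: laurent_var_def single_def fun_eq_iff)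

context cring
begin

abbreviation L where "L \<equiv> laurent_ring R"

lemma laurent_carrier: "f \<in> carrier L \<longleftrightarrow> (\<forall>k. f k \<in> carrier R) \<and> (\<exists>N. van R N f)"
 unfolding laurent_ring_def by simp

lemma laurentI: "(\<And>k. f k \<in> carrier R) \<Longrightarrow> van R N f \<Longrightarrow> f \<in> carrier L"
 using laurent_carrier by blast

lemma laurent_closed [simp]: "f \<in> carrier L \<Longrightarrow> f k \<in> carrier R"
 by (simp add: laurent_carrier)

lemma laurent_add: "(f \<oplus>\<^bsub>L\<^esub> g) k = f k \<oplus> g k"
 unfolding laurent_ring_def by simp

lemma laurent_zero: "\<zero>\<^bsub>L\<^esub> k = \<zero>"
 unfolding laurent_ring_def by simp

lemma laurent_one: "\<one>\<^bsub>L\<^esub> = single R \<one> 0"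
 unfolding laurent_ring_def by (simp add: single_def)

lemma laurent_one_apply: "\<one>\<^bsub>L\<^esub> k = (if k = 0 then \<one> else \<zero>)"
 by (simp add: laurent_one single_def)

text \<open>The product is defined by summing over the pairs of nonzero coefficients; enlarging the
  range to any finite superset lets different products be compared over common intervals.\<close>

lemma laurent_mult_sum:
 assumes f: "\<And>k. f k \<in> carrier R" and g: "\<And>k. g k \<in> carrier R" and A: "finite A"
  and "\<And>i. i \<notin> A \<Longrightarrow> f i = \<zero> \<or> g (k - i) = \<zero>"
 shows "(f \<otimes>\<^bsub>L\<^esub> g) k = (\<Oplus>i\<in>A. f i \<otimes> g (k - i))"
proof -
 have "(\<Oplus>i\<in>A. f i \<otimes> g (k - i)) = (\<Oplus>i\<in>{i. f i \<noteq> \<zero> \<and> g (k - i) \<noteq> \<zero>}. f i \<otimes> g (k - i))"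
  by (rule finsum_mono_neutral) (use assms in auto)
 thus ?thesis unfolding laurent_ring_def by simp
qed

lemma laurent_mult:
 assumes "\<And>k. f k \<in> carrier R" "\<And>k. g k \<in> carrier R" "van R M f" "van R N g" "A \<le> M" "k - N \<le> B"
 shows "(f \<otimes>\<^bsub>L\<^esub> g) k = (\<Oplus>i\<in>{A..B}. f i \<otimes> g (k - i))"
 by (rule laurent_mult_sum) (use assms in "auto simp: not_le")

lemma van_mult:
 assumes "\<And>k. f k \<in> carrier R" "\<And>k. g k \<in> carrier R" "van R M f" "van R N g"
 shows "van R (M + N) (f \<otimes>\<^bsub>L\<^esub> g)"
proof (intro allI impI)
 fix k assume "k < M + N"
 thus "(f \<otimes>\<^bsub>L\<^esub> g) k = \<zero>"
  using laurent_mult[OF assms order.refl order.refl, of k] by simp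
qed

lemma lead_mult:
 assumes "\<And>k. f k \<in> carrier R" "\<And>k. g k \<in> carrier R" "van R M f" "van R N g"
 shows "(f \<otimes>\<^bsub>L\<^esub> g) (M + N) = f M \<otimes> g N"
 using laurent_mult[OF assms order.refl order.refl, of "M + N"] assms(1,2) by simp

lemma laurent_mult_closed:
 assumes "f \<in> carrier L" "g \<in> carrier L" shows "f \<otimes>\<^bsub>L\<^esub> g \<in> carrier L"
proof -
 obtain M N where MN: "van R M f" "van R N g" using assms by (auto simp: laurent_carrier)
 have "(f \<otimes>\<^bsub>L\<^esub> g) k \<in> carrier R" for k
  unfolding laurent_mult[OF laurent_closed[OF assms(1)] laurent_closed[OF assms(2)] MN order.refl order.refl]
  using assms by (intro finsum_closed) auto
 thus ?thesis using van_mult[OF _ _ MN] assms unfolding laurent_carrier by fast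
qed

lemma laurent_mult_comm:
 assumes "f \<in> carrier L" "g \<in> carrier L" shows "f \<otimes>\<^bsub>L\<^esub> g = g \<otimes>\<^bsub>L\<^esub> f"
proof
 fix k
 obtain M N where MN: "van R M f" "van R N g" using assms by (auto simp: laurent_carrier)
 have c: "\<And>k. f k \<in> carrier R" "\<And>k. g k \<in> carrier R" using assms by auto
 have im: "(\<lambda>i. k - i) ` {N..k - M} = {M..k - N}"
  by (auto intro!: image_eqI[of _ _ "k - _"])
 have "(f \<otimes>\<^bsub>L\<^esub> g) k = (\<Oplus>i\<in>(\<lambda>i. k - i) ` {N..k - M}. f i \<otimes> g (k - i))"
  unfolding laurent_mult[OF c MN order.refl order.refl] im ..
 also have "\<dots> = (\<Oplus>i\<in>{N..k - M}. f (k - i) \<otimes> g (k - (k - i)))"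
  by (rule finsum_reindex) (use c in "auto simp: inj_on_def")
 also have "\<dots> = (g \<otimes>\<^bsub>L\<^esub> f) k"
  unfolding laurent_mult[OF c(2,1) MN(2,1) order.refl order.refl] using c
  by (intro finsum_cong') (auto simp: m_comm)
 finally show "(f \<otimes>\<^bsub>L\<^esub> g) k = (g \<otimes>\<^bsub>L\<^esub> f) k" .
qed

lemma laurent_mult_assoc:
 assumes "f \<in> carrier L" "g \<in> carrier L" "h \<in> carrier L"
 shows "(f \<otimes>\<^bsub>L\<^esub> g) \<otimes>\<^bsub>L\<^esub> h = f \<otimes>\<^bsub>L\<^esub> (g \<otimes>\<^bsub>L\<^esub> h)"
proof
 fix k
 obtain M N P where V: "van R M f" "van R N g" "van R P h" using assms by (auto simp: laurent_carrier)
 have c: "\<And>k. f k \<in> carrier R" "\<And>k. g k \<in> carrier R" "\<And>k. h k \<in> carrier R" using assms by auto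
 have fg: "\<And>k. (f \<otimes>\<^bsub>L\<^esub> g) k \<in> carrier R" and gh: "\<And>k. (g \<otimes>\<^bsub>L\<^esub> h) k \<in> carrier R"
  using laurent_mult_closed assms by auto
 let ?S = "{M + N..k - P}" and ?I = "{M..k - (N + P)}"
 have "((f \<otimes>\<^bsub>L\<^esub> g) \<otimes>\<^bsub>L\<^esub> h) k = (\<Oplus>s\<in>?S. (f \<otimes>\<^bsub>L\<^esub> g) s \<otimes> h (k - s))"
  by (rule laurent_mult[OF fg c(3) van_mult[OF c(1,2) V(1,2)] V(3) order.refl order.refl])
 also have "\<dots> = (\<Oplus>s\<in>?S. \<Oplus>i\<in>?I. f i \<otimes> (g (s - i) \<otimes> h (k - s)))"
 proof (rule finsum_cong'[OF refl])
  fix s assume s: "s \<in> ?S"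
  have "(f \<otimes>\<^bsub>L\<^esub> g) s = (\<Oplus>i\<in>?I. f i \<otimes> g (s - i))"
   by (rule laurent_mult[OF c(1,2) V(1,2)]) (use s in auto)
  thus "(f \<otimes>\<^bsub>L\<^esub> g) s \<otimes> h (k - s) = (\<Oplus>i\<in>?I. f i \<otimes> (g (s - i) \<otimes> h (k - s)))"
   using c by (simp add: finsum_ldistr Pi_def m_assoc)
 qed (use c in "auto intro!: finsum_closed")
 also have "\<dots> = (\<Oplus>i\<in>?I. \<Oplus>s\<in>?S. f i \<otimes> (g (s - i) \<otimes> h (k - s)))"
  by (rule finsum_swap) (use c in auto)
 also have "\<dots> = (\<Oplus>i\<in>?I. f i \<otimes> (g \<otimes>\<^bsub>L\<^esub> h) (k - i))"
 proof (rule finsum_cong'[OF refl])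
  fix i assume i: "i \<in> ?I"
  have "(g \<otimes>\<^bsub>L\<^esub> h) (k - i) = (\<Oplus>j\<in>{M + N - i..k - P - i}. g j \<otimes> h (k - i - j))"
   by (rule laurent_mult[OF c(2,3) V(2,3)]) (use i in auto)
  also have "{M + N - i..k - P - i} = (\<lambda>s. s - i) ` ?S"
   by (auto intro!: image_eqI[of _ _ "_ + i"])
  also have "(\<Oplus>j\<in>(\<lambda>s. s - i) ` ?S. g j \<otimes> h (k - i - j)) = (\<Oplus>s\<in>?S. g (s - i) \<otimes> h (k - i - (s - i)))"
   by (rule finsum_reindex) (use c in "auto simp: inj_on_def")
  finally show "(\<Oplus>s\<in>?S. f i \<otimes> (g (s - i) \<otimes> h (k - s))) = f i \<otimes> (g \<otimes>\<^bsub>L\<^esub> h) (k - i)"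
   using c by (simp add: finsum_rdistr Pi_def)
 qed (use c gh in "auto intro!: finsum_closed")
 also have "\<dots> = (f \<otimes>\<^bsub>L\<^esub> (g \<otimes>\<^bsub>L\<^esub> h)) k"
  by (rule laurent_mult[OF c(1) gh V(1) van_mult[OF c(2,3) V(2,3)] order.refl order.refl, symmetric])
 finally show "((f \<otimes>\<^bsub>L\<^esub> g) \<otimes>\<^bsub>L\<^esub> h) k = (f \<otimes>\<^bsub>L\<^esub> (g \<otimes>\<^bsub>L\<^esub> h)) k" .
qed

lemma single_closed [simp]: "a \<in> carrier R \<Longrightarrow> single R a n \<in> carrier L"
 unfolding laurent_carrier single_def by (auto intro!: exI[of _ n])

lemma single_mult:
 assumes "a \<in> carrier R" "f \<in> carrier L"
 shows "(single R a n \<otimes>\<^bsub>L\<^esub> f) k = a \<otimes> f (k - n)"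
proof -
 have "(single R a n \<otimes>\<^bsub>L\<^esub> f) k = (\<Oplus>i\<in>{n}. single R a n i \<otimes> f (k - i))"
  by (rule laurent_mult_sum) (use assms in "auto simp: single_def")
 thus ?thesis using assms by (simp add: single_def)
qed

lemma laurent_add_closed:
 assumes "f \<in> carrier L" "g \<in> carrier L" shows "f \<oplus>\<^bsub>L\<^esub> g \<in> carrier L"
proof -
 obtain M N where MN: "van R M f" "van R N g" using assms by (auto simp: laurent_carrier)
 hence "van R (min M N) (f \<oplus>\<^bsub>L\<^esub> g)" by (auto simp: laurent_add)
 thus ?thesis using assms by (intro laurentI[of _ "min M N"]) (auto simp: laurent_add)
qed

lemma laurent_cring: "cring L"
proof (rule cringI)
 show "abelian_group L"
 proof (rule abelian_groupI)
  fix f assume f: "f \<in> carrier L"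
  then obtain N where "van R N f" by (auto simp: laurent_carrier)
  hence "(\<lambda>k. \<ominus> f k) \<in> carrier L" using f by (intro laurentI[of _ N]) auto
  moreover have "(\<lambda>k. \<ominus> f k) \<oplus>\<^bsub>L\<^esub> f = \<zero>\<^bsub>L\<^esub>" using f by (auto simp: fun_eq_iff l_neg laurent_zero laurent_add)
  ultimately show "\<exists>g\<in>carrier L. g \<oplus>\<^bsub>L\<^esub> f = \<zero>\<^bsub>L\<^esub>" by blast
 next
  show "\<zero>\<^bsub>L\<^esub> \<in> carrier L" by (rule laurentI[of _ 0]) (auto simp: laurent_zero)
 qed (auto simp: laurent_add_closed fun_eq_iff a_ac laurent_zero laurent_add)
 show "comm_monoid L"
 proof (rule comm_monoidI)
  fix f assume f: "f \<in> carrier L"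
  show "\<one>\<^bsub>L\<^esub> \<otimes>\<^bsub>L\<^esub> f = f"
   using f by (simp add: laurent_one fun_eq_iff single_mult)
 next
  fix f g h assume a: "f \<in> carrier L" "g \<in> carrier L" "h \<in> carrier L"
  show "f \<otimes>\<^bsub>L\<^esub> g \<in> carrier L" by (rule laurent_mult_closed[OF a(1,2)])
  show "f \<otimes>\<^bsub>L\<^esub> g \<otimes>\<^bsub>L\<^esub> h = f \<otimes>\<^bsub>L\<^esub> (g \<otimes>\<^bsub>L\<^esub> h)" by (rule laurent_mult_assoc[OF a])
  show "f \<otimes>\<^bsub>L\<^esub> g = g \<otimes>\<^bsub>L\<^esub> f" by (rule laurent_mult_comm[OF a(1,2)])
 qed (simp add: laurent_one)
 fix f g h assume a: "f \<in> carrier L" "g \<in> carrier L" "h \<in> carrier L"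
 show "(f \<oplus>\<^bsub>L\<^esub> g) \<otimes>\<^bsub>L\<^esub> h = f \<otimes>\<^bsub>L\<^esub> h \<oplus>\<^bsub>L\<^esub> g \<otimes>\<^bsub>L\<^esub> h"
 proof
  fix k
  obtain M N P where V: "van R M f" "van R N g" "van R P h" using a by (auto simp: laurent_carrier)
  have c: "\<And>k. f k \<in> carrier R" "\<And>k. g k \<in> carrier R" "\<And>k. h k \<in> carrier R"
   "\<And>k. (f \<oplus>\<^bsub>L\<^esub> g) k \<in> carrier R" using a by (auto simp: laurent_add)
  have V4: "van R (min M N) (f \<oplus>\<^bsub>L\<^esub> g)" using V by (auto simp: laurent_add)
  let ?A = "{min M N..k - P}"
  have "((f \<oplus>\<^bsub>L\<^esub> g) \<otimes>\<^bsub>L\<^esub> h) k = (\<Oplus>i\<in>?A. (f \<oplus>\<^bsub>L\<^esub> g) i \<otimes> h (k - i))"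
   by (rule laurent_mult[OF c(4,3) V4 V(3)]) auto
  also have "\<dots> = (\<Oplus>i\<in>?A. f i \<otimes> h (k - i) \<oplus> g i \<otimes> h (k - i))"
   using c by (intro finsum_cong') (auto simp: l_distr laurent_add)
  also have "\<dots> = (\<Oplus>i\<in>?A. f i \<otimes> h (k - i)) \<oplus> (\<Oplus>i\<in>?A. g i \<otimes> h (k - i))"
   using c by (intro finsum_addf) auto
  also have "(\<Oplus>i\<in>?A. f i \<otimes> h (k - i)) = (f \<otimes>\<^bsub>L\<^esub> h) k"
   by (rule laurent_mult[OF c(1,3) V(1,3), symmetric]) auto
  also have "(\<Oplus>i\<in>?A. g i \<otimes> h (k - i)) = (g \<otimes>\<^bsub>L\<^esub> h) k"
   by (rule laurent_mult[OF c(2,3) V(2,3), symmetric]) auto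
  also have "(f \<otimes>\<^bsub>L\<^esub> h) k \<oplus> (g \<otimes>\<^bsub>L\<^esub> h) k = (f \<otimes>\<^bsub>L\<^esub> h \<oplus>\<^bsub>L\<^esub> g \<otimes>\<^bsub>L\<^esub> h) k"
   by (rule laurent_add[symmetric])
  finally show "((f \<oplus>\<^bsub>L\<^esub> g) \<otimes>\<^bsub>L\<^esub> h) k = (f \<otimes>\<^bsub>L\<^esub> h \<oplus>\<^bsub>L\<^esub> g \<otimes>\<^bsub>L\<^esub> h) k" .
 qed
qed

lemma laurent_neg: "f \<in> carrier L \<Longrightarrow> (\<ominus>\<^bsub>L\<^esub> f) k = \<ominus> f k"
proof -
 interpret L: cring L by (rule laurent_cring)
 assume f: "f \<in> carrier L"
 have "(\<ominus>\<^bsub>L\<^esub> f) k \<oplus> f k = (\<ominus>\<^bsub>L\<^esub> f \<oplus>\<^bsub>L\<^esub> f) k" by (simp add: laurent_add)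
 also have "\<dots> = \<zero>" using f by (simp add: L.l_neg laurent_zero)
 finally show ?thesis using f by (intro minus_equality[symmetric]) auto
qed

lemma laurent_minus: "f \<in> carrier L \<Longrightarrow> g \<in> carrier L \<Longrightarrow> (f \<ominus>\<^bsub>L\<^esub> g) k = f k \<ominus> g k"
 by (simp add: a_minus_def[of L] minus_eq laurent_add laurent_neg)

lemma lc_hom: "laurent_const R \<in> ring_hom R L"
proof (rule ring_hom_memI)
 fix a b assume a: "a \<in> carrier R" "b \<in> carrier R"
 show "laurent_const R (a \<otimes> b) = laurent_const R a \<otimes>\<^bsub>L\<^esub> laurent_const R b"
  using a by (simp add: laurent_const_single fun_eq_iff single_mult) (simp add: single_def)
 show "laurent_const R (a \<oplus> b) = laurent_const R a \<oplus>\<^bsub>L\<^esub> laurent_const R b"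
  using a by (auto simp: laurent_const_single fun_eq_iff single_def laurent_add)
qed (auto simp: laurent_const_single laurent_one)

lemma laurent_const_mult:
 "a \<in> carrier R \<Longrightarrow> f \<in> carrier L \<Longrightarrow> (laurent_const R a \<otimes>\<^bsub>L\<^esub> f) k = a \<otimes> f k"
 by (simp add: laurent_const_single single_mult)

lemma laurent_var_mult:
 "f \<in> carrier L \<Longrightarrow> (laurent_var R \<otimes>\<^bsub>L\<^esub> f) k = f (k - 1)"
 by (simp add: laurent_var_single single_mult)

lemma laurent_finsum:
 assumes "finite A" "\<And>a. a \<in> A \<Longrightarrow> f a \<in> carrier L"
 shows "(\<Oplus>\<^bsub>L\<^esub>a\<in>A. f a) k = (\<Oplus>a\<in>A. f a k)"
proof -
 interpret L: cring L by (rule laurent_cring)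
 show ?thesis using assms by (induction A rule: finite_induct) (auto simp: Pi_def laurent_zero laurent_add)
qed

text \<open>The Gram entries are constants, so orders add, and the lowest coefficient of the value
  is the value at the lowest coefficients.\<close>

lemma laurent_bilin:
 assumes s: "sform R p" and y: "y \<in> vec L" "y' \<in> vec L"
  and V: "\<And>i. i < qdim p \<Longrightarrow> van R M (y i)" "\<And>i. i < qdim p \<Longrightarrow> van R N (y' i)"
 shows "van R (M + N) (bilin L (ext (laurent_const R) p) y y')"
  and "bilin L (ext (laurent_const R) p) y y' (M + N) = bilin R p (\<lambda>i. y i M) (\<lambda>i. y' i N)"
proof -
 interpret L: cring L by (rule laurent_cring)
 let ?c = "laurent_const R"
 have cl: "?c a \<in> carrier L" if "a \<in> carrier R" for a using that by (simp add: laurent_const_single)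
 have sc: "sform L (ext ?c p)" by (rule sform_ext[OF lc_hom s])
 have yc: "y i \<in> carrier L" "y' i \<in> carrier L" for i using y by auto
 let ?t = "\<lambda>i j. y i \<otimes>\<^bsub>L\<^esub> ?c (gram p i j) \<otimes>\<^bsub>L\<^esub> y' j"
 have tc: "?t i j \<in> carrier L" if "i < qdim p" "j < qdim p" for i j using that yc cl s by simp
 have b: "bilin L (ext ?c p) y y' k = (\<Oplus>i\<in>{..<qdim p}. \<Oplus>j\<in>{..<qdim p}. ?t i j k)" for k
 proof -
  have "bilin L (ext ?c p) y y' k = (\<Oplus>i\<in>{..<qdim p}. (\<Oplus>\<^bsub>L\<^esub>j\<in>{..<qdim p}. ?t i j) k)"
   unfolding bilin_def using tc
   by (subst laurent_finsum) (auto simp: extend_form_def intro!: L.finsum_closed)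
  also have "\<dots> = (\<Oplus>i\<in>{..<qdim p}. \<Oplus>j\<in>{..<qdim p}. ?t i j k)"
  proof (rule finsum_cong'[OF refl])
   fix i assume i: "i \<in> {..<qdim p}"
   show "(\<Oplus>\<^bsub>L\<^esub>j\<in>{..<qdim p}. ?t i j) k = (\<Oplus>j\<in>{..<qdim p}. ?t i j k)"
    by (rule laurent_finsum) (use tc i in auto)
  qed (use tc in "auto intro!: finsum_closed")
  finally show ?thesis .
 qed
 have t: "van R (M + N) (?t i j)" "?t i j (M + N) = y i M \<otimes> gram p i j \<otimes> y' j N"
  if ij: "i < qdim p" "j < qdim p" for i j
 proof -
  have g: "gram p i j \<in> carrier R" using s ij by simp
  have yg: "(y i \<otimes>\<^bsub>L\<^esub> ?c (gram p i j)) k = y i k \<otimes> gram p i j" for k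
   using laurent_const_mult[OF g yc(1)] L.m_comm[OF yc(1) cl[OF g]] g yc by (simp add: m_comm)
  have v: "van R M (y i \<otimes>\<^bsub>L\<^esub> ?c (gram p i j))" using V(1)[OF ij(1)] yg g by simp
  have c: "\<And>k. (y i \<otimes>\<^bsub>L\<^esub> ?c (gram p i j)) k \<in> carrier R" "\<And>k. y' j k \<in> carrier R"
   using yc g yg by auto
  show "van R (M + N) (?t i j)" by (rule van_mult[OF c v V(2)[OF ij(2)]])
  show "?t i j (M + N) = y i M \<otimes> gram p i j \<otimes> y' j N"
   unfolding lead_mult[OF c v V(2)[OF ij(2)]] yg ..
 qed
 show "van R (M + N) (bilin L (ext ?c p) y y')"
  unfolding b by (intro allI impI finsum_all_zero) (use t in auto)
 show "bilin L (ext ?c p) y y' (M + N) = bilin R p (\<lambda>i. y i M) (\<lambda>i. y' i N)"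
  unfolding b unfolding bilin_def using t s yc by (intro finsum_cong') (auto intro!: finsum_closed finsum_cong')
qed

end

section \<open>Hensel's lemma for quadratic equations, and inverses\<close>

lemma (in cring) newton_identity:
 assumes "c \<in> carrier R" "u \<in> carrier R" "a \<in> carrier R" "g \<in> carrier R" "d \<in> carrier R"
 shows "c \<ominus> (u \<otimes> (g \<oplus> d) \<oplus> a \<otimes> (g \<oplus> d) \<otimes> (g \<oplus> d)) =
  (c \<ominus> (u \<otimes> g \<oplus> a \<otimes> g \<otimes> g)) \<ominus> (u \<oplus> a \<otimes> (g \<oplus> (g \<oplus> d))) \<otimes> d"
 using assms by algebra

context field
begin

text \<open>One equation serves for inverses (\<open>a\<close> zero), for square roots
  (\<open>u = 2\<close>, \<open>a = 1\<close>) and for moving a zero of a quadratic form. Newton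
  steps correct one coefficient at a time: by \<open>newton_identity\<close> a correction
  \<open>d\<close> changes the residual by \<open>d\<close> times a series with constant term
  \<open>u 0\<close>.\<close>

lemma laurent_hensel:
 assumes u: "u \<in> carrier L" "van R 0 u" "u 0 \<noteq> \<zero>" and a: "a \<in> carrier L" "van R 0 a"
  and c: "c \<in> carrier L" "van R 1 c"
 shows "\<exists>g\<in>carrier L. van R 1 g \<and> u \<otimes>\<^bsub>L\<^esub> g \<oplus>\<^bsub>L\<^esub> a \<otimes>\<^bsub>L\<^esub> g \<otimes>\<^bsub>L\<^esub> g = c"
proof -
 interpret L: cring L by (rule laurent_cring)
 define r where "r = (\<lambda>g. c \<ominus>\<^bsub>L\<^esub> (u \<otimes>\<^bsub>L\<^esub> g \<oplus>\<^bsub>L\<^esub> a \<otimes>\<^bsub>L\<^esub> g \<otimes>\<^bsub>L\<^esub> g))"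
 have rc: "r g \<in> carrier L" if "g \<in> carrier L" for g using that u a c by (simp add: r_def)
 \<comment> \<open>The monomial that clears coefficient \<open>n + 1\<close> of the
   residual.\<close>
 define d where "d = (\<lambda>g (n::nat). single R (inv (u 0) \<otimes> r g (int n + 1)) (int n + 1))"
 have dc: "d g n \<in> carrier L" if "g \<in> carrier L" for g n using rc[OF that] u by (simp add: d_def)
 have step: "r (g \<oplus>\<^bsub>L\<^esub> e) = r g \<ominus>\<^bsub>L\<^esub> (u \<oplus>\<^bsub>L\<^esub> a \<otimes>\<^bsub>L\<^esub> (g \<oplus>\<^bsub>L\<^esub> (g \<oplus>\<^bsub>L\<^esub> e))) \<otimes>\<^bsub>L\<^esub> e"
  if "g \<in> carrier L" "e \<in> carrier L" for g e
  unfolding r_def by (rule L.newton_identity) (use that u a c in auto)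
 have w: "van R 0 (u \<oplus>\<^bsub>L\<^esub> a \<otimes>\<^bsub>L\<^esub> (g \<oplus>\<^bsub>L\<^esub> (g \<oplus>\<^bsub>L\<^esub> e)))"
  "(u \<oplus>\<^bsub>L\<^esub> a \<otimes>\<^bsub>L\<^esub> (g \<oplus>\<^bsub>L\<^esub> (g \<oplus>\<^bsub>L\<^esub> e))) 0 = u 0"
  if "g \<in> carrier L" "e \<in> carrier L" "van R 1 g" "van R 1 e" for g e
 proof -
  have "van R (0 + 1) (a \<otimes>\<^bsub>L\<^esub> (g \<oplus>\<^bsub>L\<^esub> (g \<oplus>\<^bsub>L\<^esub> e)))"
   by (rule van_mult) (use that a in "auto simp: laurent_add")
  thus "van R 0 (u \<oplus>\<^bsub>L\<^esub> a \<otimes>\<^bsub>L\<^esub> (g \<oplus>\<^bsub>L\<^esub> (g \<oplus>\<^bsub>L\<^esub> e)))"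
   "(u \<oplus>\<^bsub>L\<^esub> a \<otimes>\<^bsub>L\<^esub> (g \<oplus>\<^bsub>L\<^esub> (g \<oplus>\<^bsub>L\<^esub> e))) 0 = u 0" using u by (auto simp: laurent_add)
 qed
 define G where "G = rec_nat \<zero>\<^bsub>L\<^esub> (\<lambda>n g. g \<oplus>\<^bsub>L\<^esub> d g n)"
 have G0: "G 0 = \<zero>\<^bsub>L\<^esub>" and GS: "G (Suc n) = G n \<oplus>\<^bsub>L\<^esub> d (G n) n" for n by (simp_all add: G_def)
 have inv: "G n \<in> carrier L \<and> van R 1 (G n) \<and> van R (int n + 1) (r (G n))" for n
 proof (induction n)
  case 0
  have "r \<zero>\<^bsub>L\<^esub> = c" using u a c by (simp add: r_def L.minus_eq)
  moreover have "van R 1 \<zero>\<^bsub>L\<^esub>" by (intro allI impI laurent_zero)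
  ultimately show ?case unfolding G0 using c by simp
 next
  case (Suc n)
  let ?g = "G n" and ?d = "d (G n) n"
  define w1 where "w1 = u \<oplus>\<^bsub>L\<^esub> a \<otimes>\<^bsub>L\<^esub> (?g \<oplus>\<^bsub>L\<^esub> (?g \<oplus>\<^bsub>L\<^esub> ?d))"
  let ?w = w1
  have g: "?g \<in> carrier L" "van R 1 ?g" "van R (int n + 1) (r ?g)" using Suc by auto
  have dv: "van R (int n + 1) ?d" by (simp add: d_def single_def)
  hence dv1: "van R 1 ?d" by simp
  have wc: "?w \<in> carrier L" unfolding w1_def using u a g dc by simp
  note w' = w[OF g(1) dc[OF g(1)] g(2) dv1, folded w1_def]
  have cc: "\<And>k. ?w k \<in> carrier R" "\<And>k. ?d k \<in> carrier R" using wc dc[OF g(1)] laurent_closed by blast+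
  have v1: "van R (int n + 1) (?w \<otimes>\<^bsub>L\<^esub> ?d)" using van_mult[OF cc w'(1) dv] by simp
  have "(?w \<otimes>\<^bsub>L\<^esub> ?d) (int n + 1) = ?w 0 \<otimes> ?d (int n + 1)" using lead_mult[OF cc w'(1) dv] by simp
  also have "\<dots> = u 0 \<otimes> (inv (u 0) \<otimes> r ?g (int n + 1))" using w'(2) by (simp add: d_def single_def)
  also have "\<dots> = r ?g (int n + 1)" using u rc[OF g(1)] by (simp add: m_assoc[symmetric])
  finally have v2: "(?w \<otimes>\<^bsub>L\<^esub> ?d) (int n + 1) = r ?g (int n + 1)" .
  have "r (G (Suc n)) = r ?g \<ominus>\<^bsub>L\<^esub> ?w \<otimes>\<^bsub>L\<^esub> ?d" unfolding GS w1_def by (rule step[OF g(1) dc[OF g(1)]])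
  hence "r (G (Suc n)) k = \<zero>" if "k < int n + 2" for k
   using v1 v2 g(3) that rc[OF g(1)] wc dc[OF g(1)]
   by (cases "k = int n + 1") (auto simp: minus_eq r_neg laurent_minus)
  moreover have "van R 1 (G (Suc n))" using g dv1 by (simp add: GS laurent_add)
  ultimately show ?case using g dc by (simp add: GS)
 qed
 have Gs: "G (Suc n) k = G n k" if "k \<le> int n" for n k
  using that inv[of n] by (simp add: GS d_def single_def laurent_add)
 have Gm: "G (n + m) k = G n k" if "k \<le> int n" for n m k
  using that by (induction m) (auto simp: Gs)
 \<comment> \<open>Coefficient \<open>k\<close> no longer changes after stage \<open>nat k\<close>,
   so the limit is read off along the diagonal.\<close>
 define g where "g = (\<lambda>k. G (nat k) k)"
 have gG: "g k = G n k" if "k \<le> int n" for k n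
 proof -
  have "G (nat k + (n - nat k)) k = G (nat k) k" by (rule Gm) simp
  thus ?thesis using that by (simp add: g_def)
 qed
 have g1: "van R 1 g" using inv by (simp add: g_def)
 have gc: "g \<in> carrier L" by (rule laurentI[OF _ g1]) (use inv in "auto simp: g_def")
 have "r g k = \<zero>" for k
 proof -
  define n where "n = nat k"
  have k: "k < int n + 1" by (simp add: n_def)
  \<comment> \<open>The limit differs from stage \<open>n\<close> only beyond coefficient
    \<open>n\<close>; up to there its residual agrees with that of stage \<open>n\<close>, which
    vanishes.\<close>
  define e where "e = g \<ominus>\<^bsub>L\<^esub> G n"
  let ?e = e
  have Gc: "G n \<in> carrier L" "van R 1 (G n)" "van R (int n + 1) (r (G n))" using inv[of n] by auto
  have ec: "?e \<in> carrier L" unfolding e_def using gc Gc by simp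
  have ev: "van R (int n + 1) ?e" unfolding e_def using gG[of _ n] gc Gc by (simp add: minus_eq r_neg laurent_minus)
  hence ev1: "van R 1 ?e" by simp
  define w1 where "w1 = u \<oplus>\<^bsub>L\<^esub> a \<otimes>\<^bsub>L\<^esub> (G n \<oplus>\<^bsub>L\<^esub> (G n \<oplus>\<^bsub>L\<^esub> ?e))"
  let ?w = w1
  have wc: "?w \<in> carrier L" unfolding w1_def using u a Gc ec by simp
  have cc: "\<And>k. ?w k \<in> carrier R" "\<And>k. ?e k \<in> carrier R" using wc ec laurent_closed by blast+
  have v: "van R (int n + 1) (?w \<otimes>\<^bsub>L\<^esub> ?e)" using van_mult[OF cc w(1)[OF Gc(1) ec Gc(2) ev1, folded w1_def] ev] by simp
  have "g = G n \<oplus>\<^bsub>L\<^esub> ?e"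
   unfolding e_def using gc Gc by (simp add: L.minus_eq L.a_ac(1)[symmetric] L.a_comm[of "G n"]) (simp add: L.a_assoc L.l_neg L.r_neg)
  hence "r g = r (G n) \<ominus>\<^bsub>L\<^esub> ?w \<otimes>\<^bsub>L\<^esub> ?e" unfolding w1_def using step[OF Gc(1) ec] by simp
  thus "r g k = \<zero>" using v Gc k rc[OF Gc(1)] wc ec by (simp add: minus_eq laurent_minus)
 qed
 hence "r g = \<zero>\<^bsub>L\<^esub>" by (simp add: fun_eq_iff laurent_zero)
 hence "c = u \<otimes>\<^bsub>L\<^esub> g \<oplus>\<^bsub>L\<^esub> a \<otimes>\<^bsub>L\<^esub> g \<otimes>\<^bsub>L\<^esub> g"
  unfolding r_def using L.r_right_minus_eq u a c gc by simp
 thus ?thesis using gc g1 by auto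
qed

lemma laurent_lead:
 assumes "f \<in> carrier L" "f \<noteq> \<zero>\<^bsub>L\<^esub>"
 obtains N where "van R N f" "f N \<noteq> \<zero>"
proof -
 obtain M where M: "van R M f" using assms by (auto simp: laurent_carrier)
 obtain k where k: "f k \<noteq> \<zero>" using assms by (auto simp: fun_eq_iff laurent_zero)
 define n where "n = (LEAST n. f (M + int n) \<noteq> \<zero>)"
 have "M \<le> k" using M k by force
 hence "f (M + int (nat (k - M))) \<noteq> \<zero>" using k by simp
 hence n: "f (M + int n) \<noteq> \<zero>" unfolding n_def by (rule LeastI)
 have "f j = \<zero>" if "j < M + int n" for j
 proof (cases "j < M")
  case False
  hence "nat (j - M) < n" using that by linarith
  hence "\<not> f (M + int (nat (j - M))) \<noteq> \<zero>" unfolding n_def by (rule not_less_Least)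
  thus ?thesis using False by simp
 qed (use M in auto)
 thus thesis using that n by blast
qed

text \<open>After a shift to order zero, the inverse is the inverse of the constant term plus a
  correction of positive order, found by Hensel's lemma with vanishing quadratic term.\<close>

lemma laurent_field: "field L"
proof -
 interpret L: cring L by (rule laurent_cring)
 show ?thesis
 proof (rule L.cring_fieldI2)
  have "\<zero>\<^bsub>L\<^esub> 0 \<noteq> \<one>\<^bsub>L\<^esub> 0" by (simp add: laurent_one_apply laurent_zero)
  thus "\<zero>\<^bsub>L\<^esub> \<noteq> \<one>\<^bsub>L\<^esub>" by metis
  fix f assume f: "f \<in> carrier L" "f \<noteq> \<zero>\<^bsub>L\<^esub>"
  then obtain N where N: "van R N f" "f N \<noteq> \<zero>" using laurent_lead by metis
  define u where "u = single R \<one> (- N) \<otimes>\<^bsub>L\<^esub> f"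
  have uk: "u k = f (k + N)" for k using f by (simp add: u_def single_mult)
  have u: "u \<in> carrier L" "van R 0 u" "u 0 \<noteq> \<zero>" using f N by (auto simp: u_def[symmetric] uk) (simp add: u_def)
  define s where "s = single R (inv (u 0)) 0"
  have s: "s \<in> carrier L" using u by (simp add: s_def)
  let ?c = "\<one>\<^bsub>L\<^esub> \<ominus>\<^bsub>L\<^esub> u \<otimes>\<^bsub>L\<^esub> s"
  have "van R (0 + 0) (u \<otimes>\<^bsub>L\<^esub> s)" "(u \<otimes>\<^bsub>L\<^esub> s) (0 + 0) = u 0 \<otimes> s 0"
   by (rule van_mult lead_mult; use u s in "auto simp: s_def single_def")+
  hence "van R 0 (u \<otimes>\<^bsub>L\<^esub> s)" "(u \<otimes>\<^bsub>L\<^esub> s) 0 = \<one>" using u by (auto simp: s_def single_def)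
  hence cv: "?c k = \<zero>" if "k < 1" for k
   using that u s by (cases "k = 0") (auto simp: minus_eq r_neg laurent_one_apply laurent_minus)
  have "\<exists>g\<in>carrier L. van R 1 g \<and> u \<otimes>\<^bsub>L\<^esub> g \<oplus>\<^bsub>L\<^esub> \<zero>\<^bsub>L\<^esub> \<otimes>\<^bsub>L\<^esub> g \<otimes>\<^bsub>L\<^esub> g = ?c"
   by (rule laurent_hensel) (use u s cv in "auto simp: laurent_zero")
  then obtain g where g: "g \<in> carrier L" "u \<otimes>\<^bsub>L\<^esub> g = ?c" using u by auto
  have "u \<otimes>\<^bsub>L\<^esub> (s \<oplus>\<^bsub>L\<^esub> g) = \<one>\<^bsub>L\<^esub>"
   using u s g by (simp add: L.r_distr L.minus_eq L.a_ac(1)[symmetric] L.a_comm[of "u \<otimes>\<^bsub>L\<^esub> s"])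
    (simp add: L.a_assoc L.r_neg)
  hence "f \<otimes>\<^bsub>L\<^esub> (single R \<one> (- N) \<otimes>\<^bsub>L\<^esub> (s \<oplus>\<^bsub>L\<^esub> g)) = \<one>\<^bsub>L\<^esub>"
   using f s g by (simp add: u_def L.m_assoc L.m_lcomm)
  moreover have "single R \<one> (- N) \<otimes>\<^bsub>L\<^esub> (s \<oplus>\<^bsub>L\<^esub> g) \<in> carrier L" using s g by simp
  ultimately show "\<exists>b\<in>carrier L. f \<otimes>\<^bsub>L\<^esub> b = \<one>\<^bsub>L\<^esub>" by blast
 qed
qed

end

section \<open>Springer's theorem for \<open>p \<perp> x r\<close>\<close>

lemma qdim_forms [simp]: "qdim (orth K p q) = qdim p + qdim q"
 "qdim (scl K a p) = qdim p" "qdim (diag_form K as) = length as"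
 "qdim (tensor_form K p q) = qdim p * qdim q"
 by (auto simp: orth_sum_def scale_form_def diag_form_def tensor_form_def)

context cring
begin

abbreviation lc :: "'a \<Rightarrow> int \<Rightarrow> 'a" where "lc \<equiv> laurent_const R"
abbreviation LX :: "int \<Rightarrow> 'a" where "LX \<equiv> laurent_var R"

text \<open>With equal arguments this is the form \<open>\<phi>\<close>; unequal arguments occur as
  the two residue forms of multiples of Pfister forms.\<close>

definition laurent_sum :: "'a qform \<Rightarrow> 'a qform \<Rightarrow> (int \<Rightarrow> 'a) qform"
 where "laurent_sum p r = orth L (ext lc p) (scl L LX (ext lc r))"

lemma lc_closed [simp]: "a \<in> carrier R \<Longrightarrow> lc a \<in> carrier L"
 by (simp add: laurent_const_single)

lemma LX_closed [simp]: "LX \<in> carrier L"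
 by (simp add: laurent_var_single)

lemma sform_ext_lc [simp]: "sform R p \<Longrightarrow> sform L (ext lc p)"
 by (rule sform_ext[OF lc_hom])

lemma qdim_laurent_sum [simp]: "qdim (laurent_sum p r) = qdim p + qdim r"
 by (simp add: laurent_sum_def)

lemma sform_laurent_sum [simp]: "sform R p \<Longrightarrow> sform R r \<Longrightarrow> sform L (laurent_sum p r)"
 unfolding laurent_sum_def
 by (intro cring.sform_orth[OF laurent_cring] cring.sform_scale[OF laurent_cring]) auto

lemma bilin_laurent_sum:
 assumes "sform R p" "sform R r" "v \<in> vec L" "w \<in> vec L"
 shows "bilin L (laurent_sum p r) v w = bilin L (ext lc p) v w \<oplus>\<^bsub>L\<^esub>
  LX \<otimes>\<^bsub>L\<^esub> bilin L (ext lc r) (\<lambda>i. v (i + qdim p)) (\<lambda>i. w (i + qdim p))"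
proof -
 interpret L: cring L by (rule laurent_cring)
 show ?thesis unfolding laurent_sum_def using assms
  by (simp add: L.bilin_orth L.bilin_scale)
qed

text \<open>The summands contribute to different parities: lowest terms of order \<open>M\<close>
  enter coefficient \<open>2 M\<close> through \<open>p\<close> alone, and once the coordinates of
  \<open>p\<close> start later, they enter coefficient \<open>2 M + 1\<close> through
  \<open>r\<close> alone.\<close>

lemma laurent_sum_coeff:
 assumes s: "sform R p" "sform R r" and v: "v \<in> vec L" "w \<in> vec L"
  and V: "\<And>i. i < qdim p + qdim r \<Longrightarrow> van R M (v i)" "\<And>i. i < qdim p + qdim r \<Longrightarrow> van R M (w i)"
 shows "bilin L (laurent_sum p r) v w (2 * M) = bilin R p (\<lambda>i. v i M) (\<lambda>i. w i M)"
  and "(\<And>i. i < qdim p \<Longrightarrow> van R (M + 1) (v i)) \<Longrightarrow> (\<And>i. i < qdim p \<Longrightarrow> van R (M + 1) (w i)) \<Longrightarrow>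
   bilin L (laurent_sum p r) v w (2 * M + 1) =
    bilin R r (\<lambda>i. v (i + qdim p) M) (\<lambda>i. w (i + qdim p) M)"
proof -
 interpret L: cring L by (rule laurent_cring)
 let ?v = "\<lambda>i. v (i + qdim p)" and ?w = "\<lambda>i. w (i + qdim p)"
 define b0 where "b0 = bilin L (ext lc p) v w"
 define b1 where "b1 = bilin L (ext lc r) ?v ?w"
 have v': "?v \<in> vec L" "?w \<in> vec L" using v by auto
 have b: "b0 \<in> carrier L" "b1 \<in> carrier L" using s v v' by (auto simp: b0_def b1_def)
 have B: "bilin L (laurent_sum p r) v w k = b0 k \<oplus> b1 (k - 1)" for k
  unfolding bilin_laurent_sum[OF s v] laurent_add laurent_var_mult[OF b(2)[unfolded b1_def]]
  by (simp add: b0_def b1_def)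
 have 0: "van R (M + M) b0" "b0 (M + M) = bilin R p (\<lambda>i. v i M) (\<lambda>i. w i M)"
  unfolding b0_def by (rule laurent_bilin[OF s(1) v]; use V in simp)+
 have 1: "van R (M + M) b1" "b1 (M + M) = bilin R r (\<lambda>i. ?v i M) (\<lambda>i. ?w i M)"
  unfolding b1_def by (rule laurent_bilin[OF s(2) v']; use V in simp)+
 have vv: "(\<lambda>i. v i M) \<in> vec R" "(\<lambda>i. w i M) \<in> vec R" "(\<lambda>i. ?v i M) \<in> vec R" "(\<lambda>i. ?w i M) \<in> vec R"
  using v by (auto intro!: vecI)
 show "bilin L (laurent_sum p r) v w (2 * M) = bilin R p (\<lambda>i. v i M) (\<lambda>i. w i M)"
 proof -
  have "b1 (2 * M - 1) = \<zero>" using 1(1) by simp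
  moreover have "b0 (2 * M) = bilin R p (\<lambda>i. v i M) (\<lambda>i. w i M)" using 0(2) by (simp only: mult_2)
  ultimately show ?thesis unfolding B using s vv by simp
 qed
 assume W: "\<And>i. i < qdim p \<Longrightarrow> van R (M + 1) (v i)" "\<And>i. i < qdim p \<Longrightarrow> van R (M + 1) (w i)"
 have 2: "van R ((M + 1) + (M + 1)) b0"
  unfolding b0_def by (rule laurent_bilin[OF s(1) v]; use W in simp)
 show "bilin L (laurent_sum p r) v w (2 * M + 1) = bilin R r (\<lambda>i. ?v i M) (\<lambda>i. ?w i M)"
 proof -
  have "b0 (2 * M + 1) = \<zero>" using 2 by simp
  moreover have "b1 (2 * M) = bilin R r (\<lambda>i. ?v i M) (\<lambda>i. ?w i M)" using 1(2) by (simp only: mult_2)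
  ultimately show ?thesis unfolding B using s vv by simp
 qed
qed

lemma van_lower_bound:
 fixes d :: nat
 assumes "v \<in> vec L" shows "\<exists>A. \<forall>i<d. van R A (v i)"
proof (induction d)
 case (Suc d)
 then obtain A where A: "\<forall>i<d. van R A (v i)" by blast
 have "v d \<in> carrier L" using assms by simp
 then obtain B where B: "van R B (v d)" by (auto simp: laurent_carrier)
 have "\<forall>i<Suc d. van R (min A B) (v i)" using A B by (auto simp: less_Suc_eq)
 thus ?case by blast
qed simp

lemma van_Suc: "van R M f \<Longrightarrow> f M = \<zero> \<Longrightarrow> van R (M + 1) f"
 by (metis zle_add1_eq_le order_le_less)

text \<open>Anisotropic residue forms keep lowest terms from cancelling, so the order of the value
  controls the order of every coordinate. The second part uses one further coefficient to push the
  coordinates of \<open>p\<close> a step higher.\<close>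

lemma springer_val:
 assumes s: "sform R p" "sform R r" and a: "aniso R p" "aniso R r" and v: "v \<in> vec L"
  and T: "van R (2 * N) (bilin L (laurent_sum p r) v v)"
 shows "\<And>i. i < qdim p + qdim r \<Longrightarrow> van R N (v i)"
  and "bilin L (laurent_sum p r) v v (2 * N) = \<zero> \<Longrightarrow> (\<And>i. i < qdim p \<Longrightarrow> van R (N + 1) (v i))"
proof -
 let ?d = "qdim p + qdim r"
 have vc: "v i k \<in> carrier R" for i k using v by simp
 have st: "van R (M + 1) (v i)" if V: "\<And>i. i < ?d \<Longrightarrow> van R M (v i)"
  and z: "bilin L (laurent_sum p r) v v (2 * M) = \<zero>" and i: "i < qdim p" for M i
 proof -
  have "bilin R p (\<lambda>i. v i M) (\<lambda>i. v i M) = \<zero>"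
   using laurent_sum_coeff(1)[OF s v v V V] z by simp
  moreover have "(\<lambda>i. v i M) \<in> vec R" using vc by (intro vecI)
  ultimately have "v i M = \<zero>" using a(1) i unfolding aniso_iff[OF s(1)] by blast
  thus ?thesis using V[of i] i by (intro van_Suc) auto
 qed
 have st2: "van R (M + 1) (v i)" if V: "\<And>i. i < ?d \<Longrightarrow> van R M (v i)"
  and z: "bilin L (laurent_sum p r) v v (2 * M) = \<zero>" "bilin L (laurent_sum p r) v v (2 * M + 1) = \<zero>"
  and i: "i < ?d" for M i
 proof (cases "i < qdim p")
  case True thus ?thesis using st[OF V z(1)] by blast
 next
  case False
  have "bilin R r (\<lambda>i. v (i + qdim p) M) (\<lambda>i. v (i + qdim p) M) = \<zero>"
   using laurent_sum_coeff(2)[OF s v v V V st[OF V z(1)] st[OF V z(1)]] z by simp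
  moreover have "(\<lambda>i. v (i + qdim p) M) \<in> vec R" using vc by (intro vecI)
  ultimately have "\<forall>i<qdim r. v (i + qdim p) M = \<zero>" using a(2) unfolding aniso_iff[OF s(2)] by blast
  from this[rule_format, of "i - qdim p"] have "v i M = \<zero>" using False i by simp
  thus ?thesis using V[of i] i by (intro van_Suc) auto
 qed
 obtain A where A: "\<forall>i<?d. van R A (v i)" using van_lower_bound[OF v] by blast
 \<comment> \<open>A common lower bound \<open>A\<close> of the orders is raised in unit steps; a
   step from \<open>M\<close> uses the vanishing of the coefficients \<open>2 M\<close> and
   \<open>2 M + 1\<close>, available as long as \<open>M < N\<close>.\<close>
 have ind: "A + int n \<le> N \<Longrightarrow> (\<forall>i<?d. van R (A + int n) (v i))" for n
 proof (induction n)
  case (Suc n)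
  hence V: "\<And>i. i < ?d \<Longrightarrow> van R (A + int n) (v i)" by simp
  have "van R ((A + int n) + 1) (v i)" if "i < ?d" for i
   by (rule st2[OF V _ _ that]) (use T Suc.prems in auto)
  thus ?case by (simp add: algebra_simps)
 qed (use A in simp)
 show 1: "van R N (v i)" if "i < ?d" for i
 proof (cases "A \<le> N")
  case True
  thus ?thesis using ind[of "nat (N - A)"] that by simp
 next
  case False
  thus ?thesis using A that by auto
 qed
 show "van R (N + 1) (v i)" if "bilin L (laurent_sum p r) v v (2 * N) = \<zero>" "i < qdim p" for i
  by (rule st[OF 1 that])
qed

lemma springer_aniso:
 assumes s: "sform R p" "sform R r" and a: "aniso R p" "aniso R r"
 shows "aniso L (laurent_sum p r)"
proof -
 interpret L: cring L by (rule laurent_cring)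
 show ?thesis unfolding L.aniso_iff[OF sform_laurent_sum[OF s]]
 proof (intro ballI impI allI)
  fix v i assume v: "v \<in> vec L" and z: "bilin L (laurent_sum p r) v v = \<zero>\<^bsub>L\<^esub>"
   and i: "i < qdim (laurent_sum p r)"
  have "van R N (v i)" for N
   by (rule springer_val(1)[OF s a v]) (use z i in "auto simp: laurent_zero")
  hence "v i k = \<zero>" for k using zless_add1_eq[of k k] by blast
  thus "v i = \<zero>\<^bsub>L\<^esub>" by (simp add: fun_eq_iff laurent_zero)
 qed
qed

text \<open>Images of the first copy of \<open>q\<close> have integral coordinates, and the constant
  terms of the \<open>p\<close>-coordinates carry the values. Images of the second copy have values
  divisible by \<open>x\<close>; this forces their \<open>p\<close>-coordinates to positive order,
  and the constant terms of the \<open>r\<close>-coordinates carry the values.\<close>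

lemma laurent_residue:
 assumes s: "sform R p" "sform R r" and a: "aniso R p" "aniso R r" and q: "sform R q"
  and e: "emb L (laurent_sum q q) (laurent_sum p r)"
 shows "emb R q p" "emb R q r"
proof -
 interpret L: cring L by (rule laurent_cring)
 let ?Q = "laurent_sum q q" and ?P = "laurent_sum p r" and ?d = "qdim q"
 have sQ: "sform L ?Q" and sP: "sform L ?P" using s q by auto
 obtain f where f: "linmap L (qdim ?Q) f"
  "\<And>v w. v \<in> vec L \<Longrightarrow> w \<in> vec L \<Longrightarrow> bilin L ?P (f v) (f w) = bilin L ?Q v w"
  using L.emb_linmap[OF e sP] by metis
 define Y where "Y = (\<lambda>i. f (uvec L i))"
 have Y: "Y i \<in> vec L" for i unfolding Y_def by (rule L.linmapD(1)[OF f(1)]) simp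
 have B: "bilin L ?P (Y i) (Y j) = gram ?Q i j" if "i < qdim ?Q" "j < qdim ?Q" for i j
  unfolding Y_def using f(2) L.bilin_uvec[OF sQ that] by simp
 have g0: "gram ?Q i j k = (if k = 0 then gram q i j else \<zero>)" if "i < ?d" "j < ?d" for i j k
  using that by (simp add: laurent_sum_def orth_sum_def extend_form_def laurent_const_def)
 have g1: "gram ?Q (i + ?d) (j + ?d) k = (if k = 1 then gram q i j else \<zero>)" if "i < ?d" "j < ?d" for i j k
 proof -
  have gc: "gram q i j \<in> carrier R" using q that by simp
  have "gram ?Q (i + ?d) (j + ?d) = LX \<otimes>\<^bsub>L\<^esub> lc (gram q i j)"
   using that by (simp add: laurent_sum_def orth_sum_def extend_form_def scale_form_def)
  thus ?thesis using laurent_var_mult[OF lc_closed[OF gc], of k] by (simp add: laurent_const_def)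
 qed
 have V0: "van R 0 (Y i k)" if "i < ?d" "k < qdim p + qdim r" for i k
  by (rule springer_val(1)[OF s a Y _ that(2)]) (use that in "simp add: B g0")
 have V1: "van R 0 (Y (i + ?d) k)" if "i < ?d" "k < qdim p + qdim r" for i k
  by (rule springer_val(1)[OF s a Y _ that(2)]) (use that in "simp add: B g1")
 have V2: "van R (0 + 1) (Y (i + ?d) k)" if "i < ?d" "k < qdim p" for i k
  by (rule springer_val(2)[OF s a Y _ _ that(2)]) (use that in "simp_all add: B g1")
 show "emb R q p" unfolding emb_def
 proof (intro exI[of _ "\<lambda>i k. Y i k 0"] conjI allI impI)
  show "Y i k 0 \<in> carrier R" for i k using Y by simp
  fix i j assume ij: "i < ?d" "j < ?d"
  have "gram q i j = bilin L ?P (Y i) (Y j) (2 * 0)" using ij by (simp add: B g0)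
  also have "\<dots> = bilin R p (\<lambda>k. Y i k 0) (\<lambda>k. Y j k 0)"
   by (rule laurent_sum_coeff(1)[OF s Y Y V0[OF ij(1)] V0[OF ij(2)]])
  finally show "gram q i j = bilin R p (\<lambda>k. Y i k 0) (\<lambda>k. Y j k 0)" .
 qed
 show "emb R q r" unfolding emb_def
 proof (intro exI[of _ "\<lambda>i k. Y (i + ?d) (k + qdim p) 0"] conjI allI impI)
  show "Y (i + ?d) (k + qdim p) 0 \<in> carrier R" for i k using Y by simp
  fix i j assume ij: "i < ?d" "j < ?d"
  have "gram q i j = bilin L ?P (Y (i + ?d)) (Y (j + ?d)) (2 * 0 + 1)" using ij by (simp add: B g1)
  also have "\<dots> = bilin R r (\<lambda>k. Y (i + ?d) (k + qdim p) 0) (\<lambda>k. Y (j + ?d) (k + qdim p) 0)"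
   by (rule laurent_sum_coeff(2)[OF s Y Y V1[OF ij(1)] V1[OF ij(2)] V2[OF ij(1)] V2[OF ij(2)]])
  finally show "gram q i j = bilin R r (\<lambda>k. Y (i + ?d) (k + qdim p) 0) (\<lambda>k. Y (j + ?d) (k + qdim p) 0)" .
 qed
qed

lemma laurent_aniso:
 assumes s: "sform R p" and a: "aniso R p"
 shows "aniso L (ext lc p)"
proof -
 interpret L: cring L by (rule laurent_cring)
 \<comment> \<open>The empty form as second residue turns the extension of \<open>p\<close> into a
   Laurent sum.\<close>
 let ?n = "diag_form R []"
 have n: "sform R ?n" "aniso R ?n" by (auto simp: aniso_iff)
 have e: "bilin L (laurent_sum p ?n) v w = bilin L (ext lc p) v w" if "v \<in> vec L" "w \<in> vec L" for v w
  using that s n(1) by (simp add: bilin_laurent_sum bilin_def[of L "ext lc (diag_form R [])"])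
 show ?thesis using springer_aniso[OF s n(1) a n(2)] n(1) s e
  by (simp add: L.aniso_iff)
qed

end

section \<open>Square roots and square classes of Laurent series\<close>

context field2
begin

text \<open>The root is sought as \<open>1 + g\<close>, that is
  \<open>2 g + g\<^sup>2 = f - 1\<close>; the linear coefficient 2 is a unit.\<close>

lemma laurent_sqrt:
 assumes f: "f \<in> carrier L" "van R 0 f" "f 0 = \<one>"
 shows "\<exists>g\<in>carrier L. g \<otimes>\<^bsub>L\<^esub> g = f"
proof -
 interpret L: cring L by (rule laurent_cring)
 have "\<exists>g\<in>carrier L. van R 1 g \<and> (\<one>\<^bsub>L\<^esub> \<oplus>\<^bsub>L\<^esub> \<one>\<^bsub>L\<^esub>) \<otimes>\<^bsub>L\<^esub> g \<oplus>\<^bsub>L\<^esub> \<one>\<^bsub>L\<^esub> \<otimes>\<^bsub>L\<^esub> g \<otimes>\<^bsub>L\<^esub> g = f \<ominus>\<^bsub>L\<^esub> \<one>\<^bsub>L\<^esub>"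
 proof (rule laurent_hensel)
  show "van R 1 (f \<ominus>\<^bsub>L\<^esub> \<one>\<^bsub>L\<^esub>)"
  proof (intro allI impI)
   fix k :: int assume "k < 1"
   thus "(f \<ominus>\<^bsub>L\<^esub> \<one>\<^bsub>L\<^esub>) k = \<zero>"
    using f by (cases "k = 0") (auto simp: laurent_minus laurent_one_apply minus_eq r_neg)
  qed
 qed (use f two_nonzero in "auto simp: laurent_add laurent_one_apply")
 then obtain g where g: "g \<in> carrier L"
  "(\<one>\<^bsub>L\<^esub> \<oplus>\<^bsub>L\<^esub> \<one>\<^bsub>L\<^esub>) \<otimes>\<^bsub>L\<^esub> g \<oplus>\<^bsub>L\<^esub> \<one>\<^bsub>L\<^esub> \<otimes>\<^bsub>L\<^esub> g \<otimes>\<^bsub>L\<^esub> g = f \<ominus>\<^bsub>L\<^esub> \<one>\<^bsub>L\<^esub>" by blast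
 have "(\<one>\<^bsub>L\<^esub> \<oplus>\<^bsub>L\<^esub> g) \<otimes>\<^bsub>L\<^esub> (\<one>\<^bsub>L\<^esub> \<oplus>\<^bsub>L\<^esub> g) =
  \<one>\<^bsub>L\<^esub> \<oplus>\<^bsub>L\<^esub> ((\<one>\<^bsub>L\<^esub> \<oplus>\<^bsub>L\<^esub> \<one>\<^bsub>L\<^esub>) \<otimes>\<^bsub>L\<^esub> g \<oplus>\<^bsub>L\<^esub> \<one>\<^bsub>L\<^esub> \<otimes>\<^bsub>L\<^esub> g \<otimes>\<^bsub>L\<^esub> g)"
  using g(1) by algebra
 also have "\<dots> = f"
  unfolding g(2) using f(1) by algebra
 finally show ?thesis using g(1) by (intro bexI[of _ "\<one>\<^bsub>L\<^esub> \<oplus>\<^bsub>L\<^esub> g"]) auto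
qed

text \<open>A nonzero series is \<open>a x\<^sup>N\<close> times a series with constant term 1,
  which is a square; the parity of \<open>N\<close> decides between the alternatives.\<close>

lemma laurent_square_class:
 assumes f: "f \<in> carrier L" "f \<noteq> \<zero>\<^bsub>L\<^esub>"
 obtains a s where "a \<in> carrier R - {\<zero>}" "s \<in> carrier L"
  "f = s \<otimes>\<^bsub>L\<^esub> s \<otimes>\<^bsub>L\<^esub> lc a \<or> f = s \<otimes>\<^bsub>L\<^esub> s \<otimes>\<^bsub>L\<^esub> (lc a \<otimes>\<^bsub>L\<^esub> LX)"
proof -
 interpret L: cring L by (rule laurent_cring)
 obtain N where N: "van R N f" "f N \<noteq> \<zero>" using laurent_lead[OF f] by metis
 let ?a = "f N"
 have a: "?a \<in> carrier R" using f by simp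
 define u where "u = single R (inv ?a) (- N) \<otimes>\<^bsub>L\<^esub> f"
 have uk: "u k = inv ?a \<otimes> f (k + N)" for k using f a N by (simp add: u_def single_mult)
 have uc: "u \<in> carrier L" using f a N by (simp add: u_def)
 obtain g where g: "g \<in> carrier L" "g \<otimes>\<^bsub>L\<^esub> g = u"
  using laurent_sqrt[OF uc] uk N a by auto
 have ss: "single R x m \<otimes>\<^bsub>L\<^esub> single R y n = single R (x \<otimes> y) (m + n)"
  if "x \<in> carrier R" "y \<in> carrier R" for x y m n
 proof
  fix k show "(single R x m \<otimes>\<^bsub>L\<^esub> single R y n) k = single R (x \<otimes> y) (m + n) k"
   unfolding single_mult[OF that(1) single_closed[OF that(2)]] using that by (auto simp: single_def)
 qed
 have fu: "f = single R ?a N \<otimes>\<^bsub>L\<^esub> u"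
 proof
  fix k show "f k = (single R ?a N \<otimes>\<^bsub>L\<^esub> u) k"
   unfolding single_mult[OF a uc] uk using a N f by (simp add: m_assoc[symmetric])
 qed
 \<comment> \<open>Division rounds down also for negative \<open>N\<close>, so \<open>N\<close> is
   \<open>2 m\<close> or \<open>2 m + 1\<close>.\<close>
 define m where "m = N div 2"
 let ?s = "single R \<one> m \<otimes>\<^bsub>L\<^esub> g"
 have s: "?s \<in> carrier L" using g by simp
 have sq: "?s \<otimes>\<^bsub>L\<^esub> ?s = single R \<one> (m + m) \<otimes>\<^bsub>L\<^esub> u"
 proof -
  have "?s \<otimes>\<^bsub>L\<^esub> ?s = (single R \<one> m \<otimes>\<^bsub>L\<^esub> single R \<one> m) \<otimes>\<^bsub>L\<^esub> (g \<otimes>\<^bsub>L\<^esub> g)"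
   using g(1) by (simp add: L.m_ac)
  thus ?thesis unfolding g(2) using ss by simp
 qed
 show thesis
 proof (cases "even N")
  case True
  hence mm: "m + m = N" by (simp add: m_def)
  have "?s \<otimes>\<^bsub>L\<^esub> ?s \<otimes>\<^bsub>L\<^esub> lc ?a = (single R \<one> N \<otimes>\<^bsub>L\<^esub> lc ?a) \<otimes>\<^bsub>L\<^esub> u"
   unfolding sq mm using uc a by (simp add: L.m_ac)
  also have "\<dots> = f" using fu ss[of \<one> ?a N 0] a by (simp add: laurent_const_single)
  finally show thesis using that[of ?a ?s] a N s by auto
 next
  case False
  hence mm: "N = m + m + 1" unfolding m_def by presburger
  have "?s \<otimes>\<^bsub>L\<^esub> ?s \<otimes>\<^bsub>L\<^esub> (lc ?a \<otimes>\<^bsub>L\<^esub> LX) = (single R \<one> (m + m) \<otimes>\<^bsub>L\<^esub> (lc ?a \<otimes>\<^bsub>L\<^esub> LX)) \<otimes>\<^bsub>L\<^esub> u"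
   unfolding sq using uc a by (simp add: L.m_ac)
  also have "single R \<one> (m + m) \<otimes>\<^bsub>L\<^esub> (lc ?a \<otimes>\<^bsub>L\<^esub> LX) = single R ?a N"
   using ss[of ?a \<one> 0 1] ss[of \<one> ?a "m + m" 1] a mm
   by (simp add: laurent_const_single laurent_var_single)
  also have "single R ?a N \<otimes>\<^bsub>L\<^esub> u = f" by (rule fu[symmetric])
  finally show thesis using that[of ?a ?s] a N s by auto
 qed
qed

end

text \<open>Used to map \<open>K((x))\<close> into the Laurent series over a function field of
  \<open>K\<close>.\<close>

lemma laurent_map_hom:
 assumes "field K" "field M" "h \<in> ring_hom K M"
 shows "(\<lambda>f k. h (f k)) \<in> ring_hom (laurent_ring K) (laurent_ring M)"
proof -
 interpret K: field K by fact
 interpret M: field M by fact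
 interpret h: ring_hom_cring K M h
  by (rule ring_hom_cringI2[OF K.cring_axioms M.cring_axioms assms(3)])
 have inj: "h x = \<zero>\<^bsub>M\<^esub> \<longleftrightarrow> x = \<zero>\<^bsub>K\<^esub>" if x: "x \<in> carrier K" for x
 proof
  assume z: "h x = \<zero>\<^bsub>M\<^esub>"
  show "x = \<zero>\<^bsub>K\<^esub>"
  proof (rule ccontr)
   assume "x \<noteq> \<zero>\<^bsub>K\<^esub>"
   hence "h (x \<otimes>\<^bsub>K\<^esub> inv\<^bsub>K\<^esub> x) = \<one>\<^bsub>M\<^esub>" using x by simp
   moreover have "h (x \<otimes>\<^bsub>K\<^esub> inv\<^bsub>K\<^esub> x) = h x \<otimes>\<^bsub>M\<^esub> h (inv\<^bsub>K\<^esub> x)" using x \<open>x \<noteq> \<zero>\<^bsub>K\<^esub>\<close> by (intro h.hom_mult) auto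
   ultimately show False using z x \<open>x \<noteq> \<zero>\<^bsub>K\<^esub>\<close> by simp
  qed
 qed simp
 show ?thesis
 proof (rule ring_hom_memI)
  fix f g assume f: "f \<in> carrier (laurent_ring K)"
  hence fc: "\<And>k. f k \<in> carrier K" by (simp add: K.laurent_carrier)
  obtain N where N: "van K N f" using f by (auto simp: K.laurent_carrier)
  show "(\<lambda>k. h (f k)) \<in> carrier (laurent_ring M)"
   by (rule M.laurentI[of _ N]) (use fc N in auto)
  assume g: "g \<in> carrier (laurent_ring K)"
  hence gc: "\<And>k. g k \<in> carrier K" by (simp add: K.laurent_carrier)
  obtain N' where N': "van K N' g" using g by (auto simp: K.laurent_carrier)
  show "(\<lambda>k. h ((f \<otimes>\<^bsub>laurent_ring K\<^esub> g) k)) = (\<lambda>k. h (f k)) \<otimes>\<^bsub>laurent_ring M\<^esub> (\<lambda>k. h (g k))"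
  proof
   fix k
   have "(f \<otimes>\<^bsub>laurent_ring K\<^esub> g) k = (\<Oplus>\<^bsub>K\<^esub>i\<in>{N..k - N'}. f i \<otimes>\<^bsub>K\<^esub> g (k - i))"
    by (rule K.laurent_mult[OF fc gc N N']) auto
   hence "h ((f \<otimes>\<^bsub>laurent_ring K\<^esub> g) k) = (\<Oplus>\<^bsub>M\<^esub>i\<in>{N..k - N'}. h (f i) \<otimes>\<^bsub>M\<^esub> h (g (k - i)))"
    using fc gc by (simp add: Pi_def comp_def)
   also have "\<dots> = ((\<lambda>k. h (f k)) \<otimes>\<^bsub>laurent_ring M\<^esub> (\<lambda>k. h (g k))) k"
    by (rule M.laurent_mult[symmetric]) (use fc gc N N' in auto)
   finally show "h ((f \<otimes>\<^bsub>laurent_ring K\<^esub> g) k) = ((\<lambda>k. h (f k)) \<otimes>\<^bsub>laurent_ring M\<^esub> (\<lambda>k. h (g k))) k" .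
  qed
  show "(\<lambda>k. h ((f \<oplus>\<^bsub>laurent_ring K\<^esub> g) k)) = (\<lambda>k. h (f k)) \<oplus>\<^bsub>laurent_ring M\<^esub> (\<lambda>k. h (g k))"
   by (rule ext) (simp only: K.laurent_add M.laurent_add h.hom_add[OF fc gc])
 next
  show "(\<lambda>k. h (\<one>\<^bsub>laurent_ring K\<^esub> k)) = \<one>\<^bsub>laurent_ring M\<^esub>"
   by (rule ext) (simp add: K.laurent_one_apply M.laurent_one_apply)
 qed
qed

section \<open>Scalar extension\<close>

lemma field_hom_zero_iff:
 assumes "field K" "field M" "h \<in> ring_hom K M" "x \<in> carrier K"
 shows "h x = \<zero>\<^bsub>M\<^esub> \<longleftrightarrow> x = \<zero>\<^bsub>K\<^esub>"
proof -
 interpret K: field K by fact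
 interpret M: field M by fact
 interpret h: ring_hom_cring K M h
  by (rule ring_hom_cringI2[OF K.cring_axioms M.cring_axioms assms(3)])
 show ?thesis
 proof
  assume z: "h x = \<zero>\<^bsub>M\<^esub>"
  show "x = \<zero>\<^bsub>K\<^esub>"
  proof (rule ccontr)
   assume n: "x \<noteq> \<zero>\<^bsub>K\<^esub>"
   have "\<one>\<^bsub>M\<^esub> = h (x \<otimes>\<^bsub>K\<^esub> inv\<^bsub>K\<^esub> x)" using assms(4) n by simp
   also have "\<dots> = h x \<otimes>\<^bsub>M\<^esub> h (inv\<^bsub>K\<^esub> x)" using assms(4) n by (intro h.hom_mult) auto
   finally show False using z assms(4) n by simp
  qed
 qed simp
qed

lemma field2_hom:
 assumes "field2 K" "field M" "h \<in> ring_hom K M"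
 shows "field2 M"
proof -
 interpret K: field2 K by fact
 interpret M: field M by fact
 interpret h: ring_hom_cring K M h
  by (rule ring_hom_cringI2[OF K.cring_axioms M.cring_axioms assms(3)])
 have "\<one>\<^bsub>K\<^esub> \<oplus>\<^bsub>K\<^esub> \<one>\<^bsub>K\<^esub> \<in> carrier K" by simp
 from field_hom_zero_iff[OF K.field_axioms assms(2,3) this] K.two_nonzero
 have "h (\<one>\<^bsub>K\<^esub> \<oplus>\<^bsub>K\<^esub> \<one>\<^bsub>K\<^esub>) \<noteq> \<zero>\<^bsub>M\<^esub>" by blast
 thus ?thesis by unfold_locales simp
qed

lemma extend_extend: "ext k (ext h q) = ext (\<lambda>a. k (h a)) q"
 by (simp add: extend_form_def)

lemma ring_hom_comp:
 assumes "h \<in> ring_hom K L" "k \<in> ring_hom L M" shows "(\<lambda>a. k (h a)) \<in> ring_hom K M"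
 using ring_hom_trans[OF assms] by (simp add: comp_def)

lemma emb_extend_orth:
 assumes "field K" "field M" "h \<in> ring_hom K M" "sform K p" "sform K r"
 shows "emb M (ext h (orth K p r)) (orth M (ext h p) (ext h r))"
  "emb M (orth M (ext h p) (ext h r)) (ext h (orth K p r))"
proof -
 interpret K: field K by fact
 interpret M: field M by fact
 have s: "sform M (ext h p)" "sform M (ext h r)" "sform M (ext h (orth K p r))"
  using assms by (auto intro!: sform_ext)
 have z: "h \<zero>\<^bsub>K\<^esub> = \<zero>\<^bsub>M\<^esub>" using field_hom_zero_iff[OF assms(1-3)] by simp
 have g: "gram (ext h (orth K p r)) i j = gram (orth M (ext h p) (ext h r)) i j" for i j
  using z by (simp add: extend_form_def orth_sum_def)
 show "emb M (ext h (orth K p r)) (orth M (ext h p) (ext h r))"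
  "emb M (orth M (ext h p) (ext h r)) (ext h (orth K p r))"
  by (rule M.emb_form_eq; (simp add: g s)?)+
qed

lemma emb_extend_scale:
 assumes "field K" "field M" "h \<in> ring_hom K M" "sform K p" "a \<in> carrier K"
 shows "emb M (ext h (scl K a p)) (scl M (h a) (ext h p))"
  "emb M (scl M (h a) (ext h p)) (ext h (scl K a p))"
proof -
 interpret K: field K by fact
 interpret M: field M by fact
 have ha: "h a \<in> carrier M" using assms by (simp add: ring_hom_closed)
 have s: "sform M (ext h p)" "sform M (ext h (scl K a p))"
  "sform M (scl M (h a) (ext h p))"
  using assms ha by (auto intro!: sform_ext M.sform_scale)
 have g: "h (a \<otimes>\<^bsub>K\<^esub> gram p i j) = h a \<otimes>\<^bsub>M\<^esub> h (gram p i j)" if "i < qdim p" "j < qdim p" for i j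
  using that assms by (intro ring_hom_mult[OF assms(3)]) auto
 hence g': "gram (ext h (scl K a p)) i j = gram (scl M (h a) (ext h p)) i j"
  if "i < qdim p" "j < qdim p" for i j using that by (simp add: extend_form_def scale_form_def)
 show "emb M (ext h (scl K a p)) (scl M (h a) (ext h p))"
  "emb M (scl M (h a) (ext h p)) (ext h (scl K a p))"
  by (rule M.emb_form_eq; (simp add: g' s)?)+
qed

lemma emb_extend_hyp:
 assumes "field K" "field M" "h \<in> ring_hom K M"
 shows "emb M (hyp M i) (ext h (hyp K i))"
  "emb M (ext h (hyp K i)) (hyp M i)"
proof -
 interpret K: field K by fact
 interpret M: field M by fact
 interpret h: ring_hom_cring K M h
  by (rule ring_hom_cringI2[OF K.cring_axioms M.cring_axioms assms(3)])
 have s: "sform M (ext h (hyp K i))" by (rule sform_ext[OF assms(3)]) simp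
 have g: "gram (ext h (hyp K i)) a b = gram (hyp M i) a b" if "a < 2 * i" for a b
  using that by (simp add: K.gram_hyp M.gram_hyp extend_form_def)
 show "emb M (hyp M i) (ext h (hyp K i))"
  "emb M (ext h (hyp K i)) (hyp M i)"
  by (rule M.emb_form_eq; (simp add: g s)?)+
qed

lemma aniso_descend:
 assumes "field K" "field M" "h \<in> ring_hom K M" "sform K q" "aniso M (ext h q)"
 shows "aniso K q"
proof -
 interpret K: field K by fact
 interpret M: field M by fact
 have z: "h x = \<zero>\<^bsub>M\<^esub> \<longleftrightarrow> x = \<zero>\<^bsub>K\<^esub>" if "x \<in> carrier K" for x
  using field_hom_zero_iff[OF assms(1-3) that] .
 have s: "sform M (ext h q)" by (rule sform_ext[OF assms(3,4)])
 show ?thesis unfolding K.aniso_iff[OF assms(4)]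
 proof (intro ballI impI allI)
  fix v i assume v: "v \<in> vec K" and b: "bilin K q v v = \<zero>\<^bsub>K\<^esub>" and i: "i < qdim q"
  have "bilin M (ext h q) (\<lambda>i. h (v i)) (\<lambda>i. h (v i)) = \<zero>\<^bsub>M\<^esub>"
   unfolding bilin_extend[OF K.cring_axioms M.cring_axioms assms(3,4) v v] b using z[of "\<zero>\<^bsub>K\<^esub>"] by simp
  moreover have "(\<lambda>i. h (v i)) \<in> vec M" using v assms(3) by (auto intro!: vecI simp: ring_hom_closed)
  ultimately have "\<forall>i<qdim (ext h q). h (v i) = \<zero>\<^bsub>M\<^esub>"
   using assms(5) unfolding M.aniso_iff[OF s] by blast
  hence "h (v i) = \<zero>\<^bsub>M\<^esub>" using i by simp
  thus "v i = \<zero>\<^bsub>K\<^esub>" using z v by simp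
 qed
qed

text \<open>Vectors over \<open>K\<close> dual to the basis exist by \<open>riesz\<close> and remain
  dual over \<open>M\<close>; pairing with them reads off the coordinates of a radical
  vector.\<close>

lemma regular_extend:
 assumes "field K" "field M" "h \<in> ring_hom K M" "regular K q"
 shows "regular M (ext h q)"
proof -
 interpret K: field K by fact
 interpret M: field M by fact
 interpret h: ring_hom_cring K M h
  by (rule ring_hom_cringI2[OF K.cring_axioms M.cring_axioms assms(3)])
 have sq: "sform K q" using assms(4) by (rule regular_sform)
 have s: "sform M (ext h q)" by (rule sform_ext[OF assms(3) sq])
 show ?thesis unfolding M.regular_iff
 proof (intro conjI ballI impI allI)
  fix v i assume v: "v \<in> vec M" and b: "\<forall>w\<in>vec M. bilin M (ext h q) v w = \<zero>\<^bsub>M\<^esub>"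
   and i: "i < qdim (ext h q)"
  obtain w where w: "w \<in> vec K" "\<And>j. j < qdim q \<Longrightarrow> bilin K q w (uvec K j) = uvec K i j"
   using K.riesz[OF assms(4) K.uvec_vec[of i]] by blast
  let ?w = "\<lambda>i. h (w i)"
  have hw: "?w \<in> vec M" using w by (auto intro!: vecI)
  have u: "(\<lambda>k. h (uvec K j k)) = uvec M j" for j by (auto simp: uvec_def)
  have wj: "bilin M (ext h q) (uvec M j) ?w = (if j = i then \<one>\<^bsub>M\<^esub> else \<zero>\<^bsub>M\<^esub>)" if "j < qdim q" for j
  proof -
   have "bilin M (ext h q) (uvec M j) ?w = bilin M (ext h q) ?w (uvec M j)"
    by (rule M.bilin_sym[OF s]) (use hw in auto)
   also have "\<dots> = h (uvec K i j)"
    using bilin_extend[OF K.cring_axioms M.cring_axioms assms(3) sq w(1) K.uvec_vec[of j]] w(2)[OF that]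
    unfolding u by simp
   finally show ?thesis by (simp add: uvec_def)
  qed
  have "\<zero>\<^bsub>M\<^esub> = bilin M (ext h q) v ?w" using b hw by simp
  also have "\<dots> = (\<Oplus>\<^bsub>M\<^esub>j\<in>{..<qdim q}. v j \<otimes>\<^bsub>M\<^esub> bilin M (ext h q) (uvec M j) ?w)"
   using M.bilin_expand[OF s v hw] by simp
  also have "\<dots> = v i \<otimes>\<^bsub>M\<^esub> bilin M (ext h q) (uvec M i) ?w"
   by (rule M.finsum_delta) (use i wj v in auto)
  finally show "v i = \<zero>\<^bsub>M\<^esub>" using wj i v by simp
 qed (rule s)
qed

section \<open>Quadratic extensions and transfer\<close>

text \<open>\<open>K[\<lambda>]\<close> with \<open>\<lambda>\<^sup>2 = x - t \<lambda>\<close>; the pair \<open>(a, b)\<close> stands for \<open>a + b \<lambda>\<close>.\<close>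

definition quad_ext :: "('a, 'b) ring_scheme \<Rightarrow> 'a \<Rightarrow> 'a \<Rightarrow> ('a \<times> 'a) ring"
 where "quad_ext K t x = \<lparr>
  carrier = carrier K \<times> carrier K,
  monoid.mult = (\<lambda>(a, b) (c, e). (a \<otimes>\<^bsub>K\<^esub> c \<oplus>\<^bsub>K\<^esub> x \<otimes>\<^bsub>K\<^esub> (b \<otimes>\<^bsub>K\<^esub> e),
   a \<otimes>\<^bsub>K\<^esub> e \<oplus>\<^bsub>K\<^esub> b \<otimes>\<^bsub>K\<^esub> c \<ominus>\<^bsub>K\<^esub> t \<otimes>\<^bsub>K\<^esub> (b \<otimes>\<^bsub>K\<^esub> e))),
  one = (\<one>\<^bsub>K\<^esub>, \<zero>\<^bsub>K\<^esub>),
  zero = (\<zero>\<^bsub>K\<^esub>, \<zero>\<^bsub>K\<^esub>),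
  add = (\<lambda>(a, b) (c, e). (a \<oplus>\<^bsub>K\<^esub> c, b \<oplus>\<^bsub>K\<^esub> e))\<rparr>"

lemma quad_ext_simps [simp]:
 "carrier (quad_ext K t x) = carrier K \<times> carrier K"
 "(a, b) \<otimes>\<^bsub>quad_ext K t x\<^esub> (c, e) = (a \<otimes>\<^bsub>K\<^esub> c \<oplus>\<^bsub>K\<^esub> x \<otimes>\<^bsub>K\<^esub> (b \<otimes>\<^bsub>K\<^esub> e),
   a \<otimes>\<^bsub>K\<^esub> e \<oplus>\<^bsub>K\<^esub> b \<otimes>\<^bsub>K\<^esub> c \<ominus>\<^bsub>K\<^esub> t \<otimes>\<^bsub>K\<^esub> (b \<otimes>\<^bsub>K\<^esub> e))"
 "(a, b) \<oplus>\<^bsub>quad_ext K t x\<^esub> (c, e) = (a \<oplus>\<^bsub>K\<^esub> c, b \<oplus>\<^bsub>K\<^esub> e)"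
 "\<one>\<^bsub>quad_ext K t x\<^esub> = (\<one>\<^bsub>K\<^esub>, \<zero>\<^bsub>K\<^esub>)" "\<zero>\<^bsub>quad_ext K t x\<^esub> = (\<zero>\<^bsub>K\<^esub>, \<zero>\<^bsub>K\<^esub>)"
 by (simp_all add: quad_ext_def)

lemmas (in cring) ring_expand = l_distr r_distr minus_eq l_minus r_minus minus_add m_ac a_ac

lemma (in cring) quad_ext_assoc:
 assumes [simp]: "a \<in> carrier R" "b \<in> carrier R" "c \<in> carrier R" "e \<in> carrier R" "f \<in> carrier R" "g \<in> carrier R"
  "x \<in> carrier R" "t \<in> carrier R"
 shows "(a \<otimes> c \<oplus> x \<otimes> (b \<otimes> e)) \<otimes> f \<oplus> x \<otimes> ((a \<otimes> e \<oplus> b \<otimes> c \<ominus> t \<otimes> (b \<otimes> e)) \<otimes> g) =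
  a \<otimes> (c \<otimes> f \<oplus> x \<otimes> (e \<otimes> g)) \<oplus> x \<otimes> (b \<otimes> (c \<otimes> g \<oplus> e \<otimes> f \<ominus> t \<otimes> (e \<otimes> g)))"
  "(a \<otimes> c \<oplus> x \<otimes> (b \<otimes> e)) \<otimes> g \<oplus> (a \<otimes> e \<oplus> b \<otimes> c \<ominus> t \<otimes> (b \<otimes> e)) \<otimes> f
   \<ominus> t \<otimes> ((a \<otimes> e \<oplus> b \<otimes> c \<ominus> t \<otimes> (b \<otimes> e)) \<otimes> g) =
  a \<otimes> (c \<otimes> g \<oplus> e \<otimes> f \<ominus> t \<otimes> (e \<otimes> g)) \<oplus> b \<otimes> (c \<otimes> f \<oplus> x \<otimes> (e \<otimes> g))
   \<ominus> t \<otimes> (b \<otimes> (c \<otimes> g \<oplus> e \<otimes> f \<ominus> t \<otimes> (e \<otimes> g)))"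
 by (simp_all add: ring_expand)

lemma (in cring) quad_ext_distr:
 assumes [simp]: "a \<in> carrier R" "b \<in> carrier R" "c \<in> carrier R" "e \<in> carrier R" "f \<in> carrier R" "g \<in> carrier R"
  "x \<in> carrier R" "t \<in> carrier R"
 shows "(a \<oplus> c) \<otimes> f \<oplus> x \<otimes> ((b \<oplus> e) \<otimes> g) = (a \<otimes> f \<oplus> x \<otimes> (b \<otimes> g)) \<oplus> (c \<otimes> f \<oplus> x \<otimes> (e \<otimes> g))"
  "(a \<oplus> c) \<otimes> g \<oplus> (b \<oplus> e) \<otimes> f \<ominus> t \<otimes> ((b \<oplus> e) \<otimes> g) =
   (a \<otimes> g \<oplus> b \<otimes> f \<ominus> t \<otimes> (b \<otimes> g)) \<oplus> (c \<otimes> g \<oplus> e \<otimes> f \<ominus> t \<otimes> (e \<otimes> g))"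
 by (simp_all add: ring_expand)

lemma (in cring) quad_ext_cring:
 assumes "x \<in> carrier R" "t \<in> carrier R"
 shows "cring (quad_ext R t x)"
proof (rule cringI)
 show "abelian_group (quad_ext R t x)"
 proof (rule abelian_groupI)
  fix y assume y: "y \<in> carrier (quad_ext R t x)"
  thus "\<exists>z\<in>carrier (quad_ext R t x). z \<oplus>\<^bsub>quad_ext R t x\<^esub> y = \<zero>\<^bsub>quad_ext R t x\<^esub>"
   by (intro bexI[of _ "(\<ominus> fst y, \<ominus> snd y)"]) (auto simp: l_neg)
 qed (auto simp: a_ac)
 show "comm_monoid (quad_ext R t x)"
  by (rule comm_monoidI)
   (use assms quad_ext_assoc in "auto simp: m_comm a_comm minus_eq")
 fix y z w assume "y \<in> carrier (quad_ext R t x)" "z \<in> carrier (quad_ext R t x)" "w \<in> carrier (quad_ext R t x)"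
 thus "(y \<oplus>\<^bsub>quad_ext R t x\<^esub> z) \<otimes>\<^bsub>quad_ext R t x\<^esub> w =
  y \<otimes>\<^bsub>quad_ext R t x\<^esub> w \<oplus>\<^bsub>quad_ext R t x\<^esub> z \<otimes>\<^bsub>quad_ext R t x\<^esub> w"
  using assms by (cases y; cases z; cases w) (simp add: quad_ext_distr)
qed

lemma (in cring) quad_ext_hom:
 assumes "x \<in> carrier R" "t \<in> carrier R"
 shows "(\<lambda>a. (a, \<zero>)) \<in> ring_hom R (quad_ext R t x)"
 by (rule ring_hom_memI) (use assms in "auto simp: minus_eq")

text \<open>The conjugate of \<open>a + b \<lambda>\<close> is
  \<open>(a - t b) - b \<lambda>\<close> and the norm is
  \<open>a\<^sup>2 - t a b - x b\<^sup>2\<close>; in the application \<open>n\<close> is the inverse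
  of the norm.\<close>

lemma (in cring) quad_ext_norm:
 assumes [simp]: "a \<in> carrier R" "b \<in> carrier R" "x \<in> carrier R" "t \<in> carrier R" "n \<in> carrier R"
 shows "a \<otimes> (n \<otimes> (a \<ominus> t \<otimes> b)) \<oplus> x \<otimes> (b \<otimes> (n \<otimes> (\<ominus> b))) = n \<otimes> (a \<otimes> a \<ominus> t \<otimes> (a \<otimes> b) \<ominus> x \<otimes> (b \<otimes> b))"
  "a \<otimes> (n \<otimes> (\<ominus> b)) \<oplus> b \<otimes> (n \<otimes> (a \<ominus> t \<otimes> b)) \<ominus> t \<otimes> (b \<otimes> (n \<otimes> (\<ominus> b))) = \<zero>"
proof -
 show "a \<otimes> (n \<otimes> (a \<ominus> t \<otimes> b)) \<oplus> x \<otimes> (b \<otimes> (n \<otimes> (\<ominus> b))) = n \<otimes> (a \<otimes> a \<ominus> t \<otimes> (a \<otimes> b) \<ominus> x \<otimes> (b \<otimes> b))"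
  by (simp add: ring_expand)
 let ?u = "a \<otimes> n \<otimes> b" and ?v = "b \<otimes> n \<otimes> t \<otimes> b"
 have "a \<otimes> (n \<otimes> (\<ominus> b)) \<oplus> b \<otimes> (n \<otimes> (a \<ominus> t \<otimes> b)) \<ominus> t \<otimes> (b \<otimes> (n \<otimes> (\<ominus> b))) = (?u \<oplus> \<ominus> ?u) \<oplus> (?v \<oplus> \<ominus> ?v)"
  by (simp add: ring_expand)
 thus "a \<otimes> (n \<otimes> (\<ominus> b)) \<oplus> b \<otimes> (n \<otimes> (a \<ominus> t \<otimes> b)) \<ominus> t \<otimes> (b \<otimes> (n \<otimes> (\<ominus> b))) = \<zero>" by (simp add: r_neg)
qed

text \<open>A vanishing norm with invertible \<open>b\<close> would exhibit the root
  \<open>- a / b\<close> of \<open>r\<^sup>2 + t r - x\<close>.\<close>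

lemma (in cring) quad_ext_root:
 assumes [simp]: "a \<in> carrier R" "b \<in> carrier R" "x \<in> carrier R" "t \<in> carrier R" "n \<in> carrier R" and n: "n \<otimes> b = \<one>"
 shows "(\<ominus> (a \<otimes> n)) \<otimes> (\<ominus> (a \<otimes> n)) \<oplus> t \<otimes> (\<ominus> (a \<otimes> n)) \<ominus> x =
  (n \<otimes> n) \<otimes> (a \<otimes> a \<ominus> t \<otimes> (a \<otimes> b) \<ominus> x \<otimes> (b \<otimes> b))"
proof -
 have "(n \<otimes> n) \<otimes> (a \<otimes> a \<ominus> t \<otimes> (a \<otimes> b) \<ominus> x \<otimes> (b \<otimes> b)) =
  (\<ominus> (a \<otimes> n)) \<otimes> (\<ominus> (a \<otimes> n)) \<oplus> t \<otimes> (\<ominus> (a \<otimes> n)) \<otimes> (n \<otimes> b) \<ominus> x \<otimes> ((n \<otimes> b) \<otimes> (n \<otimes> b))"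
  by (simp add: ring_expand)
 thus ?thesis by (simp add: n)
qed

lemma (in field) quad_ext_field:
 assumes x: "x \<in> carrier R" "t \<in> carrier R"
  and irr: "\<And>r. r \<in> carrier R \<Longrightarrow> r \<otimes> r \<oplus> t \<otimes> r \<ominus> x \<noteq> \<zero>"
 shows "field (quad_ext R t x)"
proof -
 interpret Q: cring "quad_ext R t x" by (rule quad_ext_cring[OF x])
 show ?thesis
 proof (rule Q.cring_fieldI2)
  show "\<zero>\<^bsub>quad_ext R t x\<^esub> \<noteq> \<one>\<^bsub>quad_ext R t x\<^esub>" by simp
  fix y assume y: "y \<in> carrier (quad_ext R t x)" "y \<noteq> \<zero>\<^bsub>quad_ext R t x\<^esub>"
  obtain a b where ab: "y = (a, b)" "a \<in> carrier R" "b \<in> carrier R" "a \<noteq> \<zero> \<or> b \<noteq> \<zero>" using y by (cases y) auto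
  let ?N = "a \<otimes> a \<ominus> t \<otimes> (a \<otimes> b) \<ominus> x \<otimes> (b \<otimes> b)"
  have N: "?N \<in> carrier R" using ab x by simp
  have "?N \<noteq> \<zero>"
  proof (cases "b = \<zero>")
   case True
   thus ?thesis using ab x integral[of a a] by (auto simp: minus_eq)
  next
   case False
   have ib: "inv b \<in> carrier R" "inv b \<otimes> b = \<one>" using False ab by auto
   have "(inv b \<otimes> inv b) \<otimes> ?N \<noteq> \<zero>"
    using irr[of "\<ominus> (a \<otimes> inv b)"] quad_ext_root[OF ab(2,3) x ib] ab ib by simp
   thus ?thesis using ib by auto
  qed
  hence iN: "inv ?N \<in> carrier R" "inv ?N \<otimes> ?N = \<one>" using N by auto
  show "\<exists>b\<in>carrier (quad_ext R t x). y \<otimes>\<^bsub>quad_ext R t x\<^esub> b = \<one>\<^bsub>quad_ext R t x\<^esub>"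
   by (rule bexI[of _ "(inv ?N \<otimes> (a \<ominus> t \<otimes> b), inv ?N \<otimes> (\<ominus> b))"])
    (use ab x iN quad_ext_norm[OF ab(2,3) x iN(1)] in auto)
 qed
qed

lemma (in cring) bilin_quad_ext:
 assumes x: "x \<in> carrier R" "t \<in> carrier R" and s: "sform R q"
  and v: "a \<in> vec R" "b \<in> vec R" "c \<in> vec R" "e \<in> vec R"
 shows "bilin (quad_ext R t x) (ext (\<lambda>a. (a, \<zero>)) q) (\<lambda>i. (a i, b i)) (\<lambda>i. (c i, e i)) =
  (bilin R q a c \<oplus> x \<otimes> bilin R q b e, bilin R q a e \<oplus> bilin R q b c \<ominus> t \<otimes> bilin R q b e)"
proof -
 let ?Q = "quad_ext R t x" and ?i = "\<lambda>a. (a, \<zero>)"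
 interpret Q: cring ?Q by (rule quad_ext_cring[OF x])
 have h: "?i \<in> ring_hom R ?Q" by (rule quad_ext_hom[OF x])
 have sQ: "sform ?Q (ext ?i q)" by (rule sform_ext[OF h s])
 let ?l = "(\<zero>, \<one>)"
 have pair: "(\<lambda>i. (a i, b i)) = vadd ?Q (\<lambda>i. ?i (a i)) (smul ?Q ?l (\<lambda>i. ?i (b i)))"
  if "a \<in> vec R" "b \<in> vec R" for a b :: "nat \<Rightarrow> 'a"
  using that x by (auto simp: vadd_def smul_def minus_eq)
 have iv: "(\<lambda>i. ?i (a i)) \<in> vec ?Q" if "a \<in> vec R" for a :: "nat \<Rightarrow> 'a"
  using that by (intro vecI) simp
 have l: "?l \<in> carrier ?Q" by simp
 have B: "bilin ?Q (ext ?i q) (\<lambda>i. ?i (a i)) (\<lambda>i. ?i (b i)) = ?i (bilin R q a b)"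
  if "a \<in> vec R" "b \<in> vec R" for a b
  by (rule bilin_extend[OF cring_axioms Q.cring_axioms h s that])
 have ring1: "A \<oplus> (x \<otimes> \<zero> \<oplus> x \<otimes> D) = A \<oplus> x \<otimes> D" if "A \<in> carrier R" "D \<in> carrier R" for A D
  using that x by simp
 show ?thesis
  unfolding pair[OF v(1,2)] pair[OF v(3,4)]
  using v iv l sQ B s x
  by (simp add: Q.bilin_add_left Q.bilin_add_right Q.bilin_smul_left Q.bilin_smul_right del: quad_ext_simps(1))
   (simp add: minus_eq a_ac)
qed

text \<open>This is the transfer along the linear functional with \<open>1 \<mapsto> 1\<close> and
  \<open>\<lambda> \<mapsto> 0\<close>: composed with it, the form over the extension becomes
  \<open>q \<perp> x q\<close>, because \<open>t\<close> enters only the second component of a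
  product. Vectors over the extension are pairs of vectors over the base.\<close>

lemma (in cring) emb_transfer:
 assumes x: "x \<in> carrier R" "t \<in> carrier R" and s: "sform R p" "sform R q"
  and e: "emb (quad_ext R t x) (ext (\<lambda>a. (a, \<zero>)) p) (ext (\<lambda>a. (a, \<zero>)) q)"
 shows "emb R (orth R p (scl R x p)) (orth R q (scl R x q))"
proof -
 let ?Q = "quad_ext R t x" and ?i = "\<lambda>a. (a, \<zero>)"
 interpret Q: cring ?Q by (rule quad_ext_cring[OF x])
 have h: "?i \<in> ring_hom R ?Q" by (rule quad_ext_hom[OF x])
 have sQ: "sform ?Q (ext ?i q)" by (rule sform_ext[OF h s(2)])
 obtain f where f: "linmap ?Q (qdim (ext ?i p)) f"
  "\<And>v w. v \<in> vec ?Q \<Longrightarrow> w \<in> vec ?Q \<Longrightarrow> bilin ?Q (ext ?i q) (f v) (f w) = bilin ?Q (ext ?i p) v w"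
  using Q.emb_linmap[OF e sQ] by metis
 define W where "W = (\<lambda>v :: nat \<Rightarrow> 'a. f (\<lambda>i. (v i, v (i + qdim p))))"
 have pv: "(\<lambda>i. (v i, v (i + qdim p))) \<in> vec ?Q" if "v \<in> vec R" for v
  using that by (intro vecI) simp
 have Wv: "W v \<in> vec ?Q" if "v \<in> vec R" for v unfolding W_def by (rule Q.linmapD(1)[OF f(1) pv[OF that]])
 have Wc: "(\<lambda>i. fst (W v i)) \<in> vec R" "(\<lambda>i. snd (W v i)) \<in> vec R" if "v \<in> vec R" for v
  using vec_closed[OF Wv[OF that]] by (auto intro!: vecI simp: mem_Times_iff)
 show ?thesis
 proof (rule embI)
  show "sform R (orth R p (scl R x p))" using s x by simp
  let ?g = "\<lambda>v. vjoin (qdim q) (\<lambda>i. fst (W v i)) (\<lambda>i. snd (W v i))"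
  show "?g v \<in> vec R" if "v \<in> vec R" for v using Wc[OF that] by simp
  fix v w :: "nat \<Rightarrow> 'a" assume v: "v \<in> vec R" and w: "w \<in> vec R"
  have "bilin R (orth R q (scl R x q)) (?g v) (?g w) =
   bilin R q (\<lambda>i. fst (W v i)) (\<lambda>i. fst (W w i)) \<oplus> x \<otimes> bilin R q (\<lambda>i. snd (W v i)) (\<lambda>i. snd (W w i))"
   using Wc[OF v] Wc[OF w] s x by (simp add: bilin_vjoin bilin_scale)
  also have "\<dots> = fst (bilin ?Q (ext ?i q) (W v) (W w))"
   using bilin_quad_ext[OF x s(2) Wc(1)[OF v] Wc(2)[OF v] Wc(1)[OF w] Wc(2)[OF w]] by simp
  also have "\<dots> = fst (bilin ?Q (ext ?i p) (\<lambda>i. (v i, v (i + qdim p))) (\<lambda>i. (w i, w (i + qdim p))))"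
   unfolding W_def using f(2)[OF pv[OF v] pv[OF w]] by simp
  also have "\<dots> = bilin R p v w \<oplus> x \<otimes> bilin R p (\<lambda>i. v (i + qdim p)) (\<lambda>i. w (i + qdim p))"
   using bilin_quad_ext[OF x s(1) v _ w, of "\<lambda>i. v (i + qdim p)" "\<lambda>i. w (i + qdim p)"] v w by simp
  also have "\<dots> = bilin R (orth R p (scl R x p)) v w"
   using v w s x by (simp add: bilin_orth bilin_scale)
  finally show "bilin R (orth R q (scl R x q)) (?g v) (?g w) =
   bilin R (orth R p (scl R x p)) v w" .
 qed
qed

section \<open>Rings embedded in a field\<close>

text \<open>This spares checking associativity for convolution products and fractions.\<close>

lemma cring_by_embedding:
 fixes A :: "'a ring" and S (structure)
 assumes "cring S" and inj: "inj_on \<phi> (carrier A)"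
  and cl: "\<And>x. x \<in> carrier A \<Longrightarrow> \<phi> x \<in> carrier S"
  and m: "\<And>x y. x \<in> carrier A \<Longrightarrow> y \<in> carrier A \<Longrightarrow> x \<otimes>\<^bsub>A\<^esub> y \<in> carrier A \<and> \<phi> (x \<otimes>\<^bsub>A\<^esub> y) = \<phi> x \<otimes> \<phi> y"
  and a: "\<And>x y. x \<in> carrier A \<Longrightarrow> y \<in> carrier A \<Longrightarrow> x \<oplus>\<^bsub>A\<^esub> y \<in> carrier A \<and> \<phi> (x \<oplus>\<^bsub>A\<^esub> y) = \<phi> x \<oplus> \<phi> y"
  and o: "\<one>\<^bsub>A\<^esub> \<in> carrier A" "\<phi> \<one>\<^bsub>A\<^esub> = \<one>" and z: "\<zero>\<^bsub>A\<^esub> \<in> carrier A" "\<phi> \<zero>\<^bsub>A\<^esub> = \<zero>"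
  and n: "\<And>x. x \<in> carrier A \<Longrightarrow> \<exists>y\<in>carrier A. \<phi> y = \<ominus> \<phi> x"
 shows "cring A"
proof -
 interpret S: cring S by fact
 have eq: "x = y" if "x \<in> carrier A" "y \<in> carrier A" "\<phi> x = \<phi> y" for x y
  using inj that by (auto dest: inj_onD)
 note s = m[THEN conjunct1] m[THEN conjunct2] a[THEN conjunct1] a[THEN conjunct2] o z cl
 show ?thesis
 proof (rule cringI)
  show "abelian_group A"
  proof (rule abelian_groupI)
   fix x assume x: "x \<in> carrier A"
   then obtain y where y: "y \<in> carrier A" "\<phi> y = \<ominus> \<phi> x" using n by blast
   hence "y \<oplus>\<^bsub>A\<^esub> x = \<zero>\<^bsub>A\<^esub>" using x s by (intro eq) (auto simp: S.l_neg)
   thus "\<exists>y\<in>carrier A. y \<oplus>\<^bsub>A\<^esub> x = \<zero>\<^bsub>A\<^esub>" using y by blast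
  qed ((simp add: s; fail) | (rule eq; simp add: s S.a_ac))+
  show "comm_monoid A"
   by (rule comm_monoidI) ((simp add: s; fail) | (rule eq; simp add: s S.m_ac))+
 qed (rule eq; simp add: s S.l_distr)
qed

section \<open>Evaluation of polynomials\<close>

text \<open>Letters of \<open>m\<close> outside \<open>{..<d}\<close> are ignored, which is why
  multiplicativity of evaluation restricts the set of variables.\<close>

definition mon :: "('m, 'c) ring_scheme \<Rightarrow> nat \<Rightarrow> (nat \<Rightarrow> 'm) \<Rightarrow> nat multiset \<Rightarrow> 'm"
 where "mon M d s m = (\<Otimes>\<^bsub>M\<^esub>i\<in>{..<d}. s i [^]\<^bsub>M\<^esub> count m i)"

definition pev :: "('a, 'b) ring_scheme \<Rightarrow> ('m, 'c) ring_scheme \<Rightarrow> ('a \<Rightarrow> 'm) \<Rightarrow> nat \<Rightarrow> (nat \<Rightarrow> 'm) \<Rightarrow>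
  (nat multiset \<Rightarrow> 'a) \<Rightarrow> 'm"
 where "pev K M k d s f = (\<Oplus>\<^bsub>M\<^esub>m\<in>{m. f m \<noteq> \<zero>\<^bsub>K\<^esub>}. k (f m) \<otimes>\<^bsub>M\<^esub> mon M d s m)"

lemma finite_submultisets: "finite {a. a \<subseteq># m}"
proof (induction m)
 case (add x m)
 have "{a. a \<subseteq># add_mset x m} \<subseteq> {a. a \<subseteq># m} \<union> add_mset x ` {a. a \<subseteq># m}"
 proof
  fix a assume a: "a \<in> {a. a \<subseteq># add_mset x m}"
  show "a \<in> {a. a \<subseteq># m} \<union> add_mset x ` {a. a \<subseteq># m}"
  proof (cases "x \<in># a")
   case True
   then obtain b where b: "a = add_mset x b" by (metis insert_DiffM)
   thus ?thesis using a by auto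
  next
   case False
   hence "a \<subseteq># m" using a by (metis diff_single_trivial mem_Collect_eq subset_eq_diff_conv add_mset_add_single)
   thus ?thesis by simp
  qed
 qed
 thus ?case using add finite_subset by blast
qed simp

context cring
begin

definition pmul :: "('i multiset \<Rightarrow> 'a) \<Rightarrow> ('i multiset \<Rightarrow> 'a) \<Rightarrow> 'i multiset \<Rightarrow> 'a"
 where "pmul f g = (\<lambda>m. \<Oplus>a\<in>{a. a \<subseteq># m}. f a \<otimes> g (m - a))"

abbreviation pset :: "'i set \<Rightarrow> ('i multiset \<Rightarrow> 'a) set"
 where "pset I \<equiv> indexed_pset I (carrier R)"

lemma mpoly_simps:
 "carrier (mpoly_ring R I) = pset I" "\<one>\<^bsub>mpoly_ring R I\<^esub> = indexed_const \<one>"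
 "\<zero>\<^bsub>mpoly_ring R I\<^esub> = indexed_const \<zero>"
 "f \<oplus>\<^bsub>mpoly_ring R I\<^esub> g = indexed_padd f g" "f \<otimes>\<^bsub>mpoly_ring R I\<^esub> g = pmul f g"
 by (simp_all add: mpoly_ring_def pmul_def)

lemma pset_closed: "f \<in> pset I \<Longrightarrow> f m \<in> carrier R"
 using indexed_pset_in_carrier[of "carrier R" f I] by (auto simp: carrier_coeff_def)

lemma pset_support: "f \<in> pset I \<Longrightarrow> finite {m. f m \<noteq> \<zero>} \<and> (\<forall>m. f m \<noteq> \<zero> \<longrightarrow> set_mset m \<subseteq> I)"
proof (induction rule: indexed_pset.induct)
 case (indexed_const k)
 have "{m. indexed_const k m \<noteq> \<zero>} \<subseteq> {{#}}" by (auto simp: indexed_const_def split: if_splits)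
 thus ?case by (auto simp: indexed_const_def intro: finite_subset)
next
 case (indexed_padd f g)
 have "{m. indexed_padd f g m \<noteq> \<zero>} \<subseteq> {m. f m \<noteq> \<zero>} \<union> {m. g m \<noteq> \<zero>}"
  by (auto simp: indexed_padd_def)
 moreover from this have "set_mset m \<subseteq> I" if "indexed_padd f g m \<noteq> \<zero>" for m
  using that indexed_padd.IH by blast
 ultimately show ?case using indexed_padd.IH finite_subset by blast
next
 case (indexed_pmult f i)
 have 1: "{m. indexed_pmult f i m \<noteq> \<zero>} \<subseteq> add_mset i ` {m. f m \<noteq> \<zero>}"
 proof
  fix m assume "m \<in> {m. indexed_pmult f i m \<noteq> \<zero>}"
  hence m: "i \<in># m" "f (m - {#i#}) \<noteq> \<zero>" by (auto simp: indexed_pmult_def split: if_splits)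
  thus "m \<in> add_mset i ` {m. f m \<noteq> \<zero>}"
   by (intro image_eqI[of _ _ "m - {#i#}"]) auto
 qed
 moreover have "set_mset m \<subseteq> I" if m: "indexed_pmult f i m \<noteq> \<zero>" for m
 proof -
  obtain m' where "m = add_mset i m'" "f m' \<noteq> \<zero>" using 1 m by blast
  thus ?thesis using indexed_pmult by auto
 qed
 ultimately show ?case using indexed_pmult.IH finite_subset[OF 1] by blast
qed

lemma pset_mono: "f \<in> pset I \<Longrightarrow> I \<subseteq> J \<Longrightarrow> f \<in> pset J"
 by (induction rule: indexed_pset.induct) (auto intro: indexed_pset.intros)

lemma pset_smult:
 assumes "a \<in> carrier R" "f \<in> pset I" shows "(\<lambda>m. a \<otimes> f m) \<in> pset I"
 using assms(2)
proof (induction rule: indexed_pset.induct)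
 case (indexed_const k)
 have e: "(\<lambda>m. a \<otimes> indexed_const k m) = indexed_const (a \<otimes> k)"
  using assms by (auto simp: indexed_const_def)
 show ?case unfolding e using indexed_const assms by (intro indexed_pset.indexed_const) simp
next
 case (indexed_padd f g)
 have e: "(\<lambda>m. a \<otimes> indexed_padd f g m) = indexed_padd (\<lambda>m. a \<otimes> f m) (\<lambda>m. a \<otimes> g m)"
  using assms pset_closed[OF indexed_padd.hyps(1)] pset_closed[OF indexed_padd.hyps(2)]
  by (auto simp: indexed_padd_def r_distr)
 show ?case unfolding e using indexed_padd.IH by (rule indexed_pset.indexed_padd)
next
 case (indexed_pmult f i)
 have e: "(\<lambda>m. a \<otimes> indexed_pmult f i m) = indexed_pmult (\<lambda>m. a \<otimes> f m) i"
  using assms by (auto simp: indexed_pmult_def)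
 show ?case unfolding e using indexed_pmult by (intro indexed_pset.indexed_pmult) auto
qed

text \<open>Together with \<open>pmul_padd\<close> and \<open>pmul_pmult\<close> this computes
  products by recursion on the generation of the left factor; closure and multiplicativity of
  evaluation then follow by induction.\<close>

lemma pmul_const:
 fixes g :: "'i multiset \<Rightarrow> 'a"
 assumes "a \<in> carrier R" "\<And>m. g m \<in> carrier R"
 shows "pmul (indexed_const a) g = (\<lambda>m. a \<otimes> g m)"
proof
 fix m
 have "pmul (indexed_const a) g m = indexed_const a ({#} :: 'i multiset) \<otimes> g (m - {#})"
  unfolding pmul_def
  by (rule finsum_delta[of "{a. a \<subseteq># m}" "{#}" "\<lambda>b. indexed_const a b \<otimes> g (m - b)"]) (use assms finite_submultisets in "auto simp: indexed_const_def")
 thus "pmul (indexed_const a) g m = a \<otimes> g m" by (simp add: indexed_const_def)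
qed

lemma pmul_padd:
 assumes "\<And>m. f m \<in> carrier R" "\<And>m. f' m \<in> carrier R" "\<And>m. g m \<in> carrier R"
 shows "pmul (indexed_padd f f') g = indexed_padd (pmul f g) (pmul f' g)"
proof
 fix m
 have "pmul (indexed_padd f f') g m = (\<Oplus>a\<in>{a. a \<subseteq># m}. f a \<otimes> g (m - a) \<oplus> f' a \<otimes> g (m - a))"
  unfolding pmul_def indexed_padd_def using assms by (intro finsum_cong') (auto simp: l_distr)
 also have "\<dots> = indexed_padd (pmul f g) (pmul f' g) m"
  unfolding pmul_def indexed_padd_def using assms by (intro finsum_addf) auto
 finally show "pmul (indexed_padd f f') g m = indexed_padd (pmul f g) (pmul f' g) m" .
qed

lemma pmul_pmult:
 assumes "\<And>m. f m \<in> carrier R" "\<And>m. g m \<in> carrier R"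
 shows "pmul (indexed_pmult f i) g = indexed_pmult (pmul f g) i"
proof
 fix m
 show "pmul (indexed_pmult f i) g m = indexed_pmult (pmul f g) i m"
 proof (cases "i \<in># m")
  case True
  then obtain m' where m: "m = add_mset i m'" by (metis insert_DiffM)
  have 1: "add_mset i ` {a. a \<subseteq># m'} \<subseteq> {a. a \<subseteq># m}" using m by auto
  have "pmul (indexed_pmult f i) g m = (\<Oplus>a\<in>add_mset i ` {a. a \<subseteq># m'}. indexed_pmult f i a \<otimes> g (m - a))"
   unfolding pmul_def
  proof (rule finsum_mono_neutral[OF finite_submultisets 1])
   fix a assume a: "a \<in> {a. a \<subseteq># m} - add_mset i ` {a. a \<subseteq># m'}"
   have "i \<notin># a"
   proof
    assume "i \<in># a"
    then obtain b where "a = add_mset i b" by (metis insert_DiffM)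
    thus False using a m by auto
   qed
   thus "indexed_pmult f i a \<otimes> g (m - a) = \<zero>" using assms by (simp add: indexed_pmult_def)
  qed (use assms in "auto simp: indexed_pmult_def")
  also have "\<dots> = (\<Oplus>a\<in>{a. a \<subseteq># m'}. indexed_pmult f i (add_mset i a) \<otimes> g (m - add_mset i a))"
   by (rule finsum_reindex) (use assms in "auto simp: indexed_pmult_def inj_on_def")
  also have "\<dots> = pmul f g m'"
   unfolding pmul_def using assms m by (intro finsum_cong') (auto simp: indexed_pmult_def)
  finally show ?thesis using m by (simp add: indexed_pmult_def)
 next
  case False
  have "pmul (indexed_pmult f i) g m = \<zero>"
   unfolding pmul_def
  proof (rule finsum_all_zero)
   fix a assume "a \<in> {a. a \<subseteq># m}"
   hence "i \<notin># a" using False by (auto dest: mset_subset_eqD)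
   thus "indexed_pmult f i a \<otimes> g (m - a) = \<zero>" using assms by (simp add: indexed_pmult_def)
  qed
  thus ?thesis using False by (simp add: indexed_pmult_def)
 qed
qed

lemma pmul_closed:
 assumes "f \<in> pset I" "g \<in> pset I" shows "pmul f g \<in> pset I"
 using assms(1)
proof (induction rule: indexed_pset.induct)
 case (indexed_const k)
 thus ?case using pset_smult[OF _ assms(2)] pmul_const[of k g] pset_closed[OF assms(2)] by simp
next
 case (indexed_padd f f')
 thus ?case using pmul_padd[of f f' g] pset_closed assms(2) by (metis indexed_pset.indexed_padd)
next
 case (indexed_pmult f i)
 thus ?case using pmul_pmult[of f g i] pset_closed assms(2) by (metis indexed_pset.indexed_pmult)
qed

lemma pneg_closed:
 assumes "f \<in> pset I" shows "(\<lambda>m. \<ominus> f m) \<in> pset I"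
proof -
 have "(\<lambda>m. \<ominus> f m) = (\<lambda>m. \<ominus> \<one> \<otimes> f m)" using pset_closed[OF assms] by (simp add: l_minus)
 thus ?thesis using pset_smult[OF _ assms, of "\<ominus> \<one>"] by simp
qed

end

locale poly_eval = ring_hom_cring K M k
 for K :: "('a, 'b) ring_scheme" (structure) and M :: "('m, 'c) ring_scheme" (structure) and k +
 fixes d :: nat and s :: "nat \<Rightarrow> 'm"
 assumes s: "s \<in> vec M"
begin

abbreviation ev where "ev \<equiv> pev K M k d s"

lemma mon_closed [simp]: "mon M d s m \<in> carrier M"
 unfolding mon_def using s by (intro S.finprod_closed) auto

lemma mon_empty: "mon M d s {#} = \<one>\<^bsub>M\<^esub>"
 unfolding mon_def by (rule S.finprod_one_eqI) simp

lemma mon_add: "mon M d s (m + m') = mon M d s m \<otimes>\<^bsub>M\<^esub> mon M d s m'"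
 unfolding mon_def using s
 by (subst S.finprod_multf[symmetric]) (auto simp: S.nat_pow_mult intro!: S.finprod_cong')

lemma mon_single:
 assumes "i < d" shows "mon M d s {#i#} = s i"
proof -
 have "mon M d s {#i#} = (\<Otimes>\<^bsub>M\<^esub>j\<in>{..<d}. if i = j then s j else \<one>\<^bsub>M\<^esub>)"
  unfolding mon_def using s by (intro S.finprod_cong') auto
 thus ?thesis using S.finprod_singleton[of i "{..<d}" s] assms s by auto
qed

lemma mon_add_mset: "i < d \<Longrightarrow> mon M d s (add_mset i m) = s i \<otimes>\<^bsub>M\<^esub> mon M d s m"
 using mon_add[of "{#i#}" m] mon_single by simp

lemma ev_sum:
 assumes "finite A" "{m. f m \<noteq> \<zero>} \<subseteq> A" "\<And>m. f m \<in> carrier K"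
 shows "ev f = (\<Oplus>\<^bsub>M\<^esub>m\<in>A. k (f m) \<otimes>\<^bsub>M\<^esub> mon M d s m)"
 unfolding pev_def by (rule S.finsum_mono_neutral[symmetric]) (use assms in auto)

lemma ev_closed [simp]:
 assumes "\<And>m. f m \<in> carrier K" shows "ev f \<in> carrier M"
 unfolding pev_def using assms by (intro S.finsum_closed) auto

lemma ev_const: "a \<in> carrier K \<Longrightarrow> ev (R.indexed_const a) = k a"
 by (subst ev_sum[of "{{#}}"]) (auto simp: R.indexed_const_def mon_empty)

lemma ev_padd:
 assumes "f \<in> R.pset I" "g \<in> R.pset I"
 shows "ev (R.indexed_padd f g) = ev f \<oplus>\<^bsub>M\<^esub> ev g"
proof -
 let ?A = "{m. f m \<noteq> \<zero>} \<union> {m. g m \<noteq> \<zero>}"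
 have A: "finite ?A" using assms R.pset_support by blast
 have c: "f m \<in> carrier K" "g m \<in> carrier K" for m using assms R.pset_closed by auto
 have "ev (R.indexed_padd f g) = (\<Oplus>\<^bsub>M\<^esub>m\<in>?A. k (R.indexed_padd f g m) \<otimes>\<^bsub>M\<^esub> mon M d s m)"
  by (rule ev_sum[OF A]) (use c in "auto simp: R.indexed_padd_def")
 also have "\<dots> = (\<Oplus>\<^bsub>M\<^esub>m\<in>?A. k (f m) \<otimes>\<^bsub>M\<^esub> mon M d s m \<oplus>\<^bsub>M\<^esub> k (g m) \<otimes>\<^bsub>M\<^esub> mon M d s m)"
  using c by (intro S.finsum_cong') (auto simp: R.indexed_padd_def S.l_distr)
 also have "\<dots> = (\<Oplus>\<^bsub>M\<^esub>m\<in>?A. k (f m) \<otimes>\<^bsub>M\<^esub> mon M d s m) \<oplus>\<^bsub>M\<^esub> (\<Oplus>\<^bsub>M\<^esub>m\<in>?A. k (g m) \<otimes>\<^bsub>M\<^esub> mon M d s m)"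
  using c by (intro S.finsum_addf) auto
 also have "\<dots> = ev f \<oplus>\<^bsub>M\<^esub> ev g" using ev_sum[OF A, of f] ev_sum[OF A, of g] c by auto
 finally show ?thesis .
qed

lemma ev_pmult:
 assumes "f \<in> R.pset I" "i < d"
 shows "ev (R.indexed_pmult f i) = s i \<otimes>\<^bsub>M\<^esub> ev f"
proof -
 let ?A = "{m. f m \<noteq> \<zero>}"
 have A: "finite ?A" using assms R.pset_support by blast
 have c: "f m \<in> carrier K" for m using assms R.pset_closed by auto
 have sub: "{m. R.indexed_pmult f i m \<noteq> \<zero>} \<subseteq> add_mset i ` ?A"
 proof
  fix m assume "m \<in> {m. R.indexed_pmult f i m \<noteq> \<zero>}"
  hence m: "i \<in># m" "f (m - {#i#}) \<noteq> \<zero>" by (auto simp: R.indexed_pmult_def split: if_splits)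
  thus "m \<in> add_mset i ` ?A" by (intro image_eqI[of _ _ "m - {#i#}"]) auto
 qed
 have c': "R.indexed_pmult f i m \<in> carrier K" for m using c by (simp add: R.indexed_pmult_def)
 have "ev (R.indexed_pmult f i) =
   (\<Oplus>\<^bsub>M\<^esub>m\<in>add_mset i ` ?A. k (R.indexed_pmult f i m) \<otimes>\<^bsub>M\<^esub> mon M d s m)"
  by (rule ev_sum[OF _ sub c']) (use A in auto)
 also have "\<dots> = (\<Oplus>\<^bsub>M\<^esub>m\<in>?A. k (R.indexed_pmult f i (add_mset i m)) \<otimes>\<^bsub>M\<^esub> mon M d s (add_mset i m))"
  by (rule S.finsum_reindex) (use c' in "auto simp: inj_on_def")
 also have "\<dots> = (\<Oplus>\<^bsub>M\<^esub>m\<in>?A. s i \<otimes>\<^bsub>M\<^esub> (k (f m) \<otimes>\<^bsub>M\<^esub> mon M d s m))"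
  using c s assms(2) by (intro S.finsum_cong') (auto simp: R.indexed_pmult_def mon_add_mset S.m_lcomm)
 also have "\<dots> = s i \<otimes>\<^bsub>M\<^esub> ev f" unfolding pev_def using A c s by (subst S.finsum_rdistr) auto
 finally show ?thesis .
qed

lemma ev_smult:
 assumes "f \<in> R.pset I" "a \<in> carrier K"
 shows "ev (\<lambda>m. a \<otimes> f m) = k a \<otimes>\<^bsub>M\<^esub> ev f"
proof -
 let ?A = "{m. f m \<noteq> \<zero>}"
 have A: "finite ?A" using assms R.pset_support by blast
 have c: "f m \<in> carrier K" for m using assms R.pset_closed by auto
 have "ev (\<lambda>m. a \<otimes> f m) = (\<Oplus>\<^bsub>M\<^esub>m\<in>?A. k (a \<otimes> f m) \<otimes>\<^bsub>M\<^esub> mon M d s m)"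
  by (rule ev_sum[OF A]) (use c assms in auto)
 also have "\<dots> = (\<Oplus>\<^bsub>M\<^esub>m\<in>?A. k a \<otimes>\<^bsub>M\<^esub> (k (f m) \<otimes>\<^bsub>M\<^esub> mon M d s m))"
  using c assms by (intro S.finsum_cong') (auto simp: S.m_assoc)
 also have "\<dots> = k a \<otimes>\<^bsub>M\<^esub> ev f" unfolding pev_def using A c assms by (subst S.finsum_rdistr) auto
 finally show ?thesis .
qed

lemma ev_mult:
 assumes "f \<in> R.pset I" "g \<in> R.pset I" "I \<subseteq> {..<d}"
 shows "ev (R.pmul f g) = ev f \<otimes>\<^bsub>M\<^esub> ev g"
 using assms(1)
proof (induction rule: R.indexed_pset.induct)
 case (indexed_const a)
 thus ?case
  using R.pmul_const[of a g] ev_smult[OF assms(2)] R.pset_closed[OF assms(2)] by (simp add: ev_const)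
next
 case (indexed_padd f f')
 have c: "\<And>m. f m \<in> carrier K" "\<And>m. f' m \<in> carrier K" "\<And>m. g m \<in> carrier K"
  using indexed_padd.hyps assms(2) R.pset_closed by auto
 show ?case unfolding R.pmul_padd[OF c]
  using indexed_padd.IH indexed_padd.hyps assms(2) c ev_padd[OF R.pmul_closed[OF indexed_padd.hyps(1) assms(2)] R.pmul_closed[OF indexed_padd.hyps(2) assms(2)]]
  by (simp add: ev_padd[of _ I] S.l_distr)
next
 case (indexed_pmult f i)
 have c: "\<And>m. f m \<in> carrier K" "\<And>m. g m \<in> carrier K"
  using indexed_pmult.hyps assms(2) R.pset_closed by auto
 have i: "i < d" using indexed_pmult.hyps assms(3) by auto
 show ?case unfolding R.pmul_pmult[OF c]
  using indexed_pmult i assms(2) c s ev_pmult[OF R.pmul_closed[OF indexed_pmult.hyps(1) assms(2)] i]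
  by (simp add: ev_pmult[of _ I] S.m_assoc)
qed

lemma ev_hom:
 assumes "I \<subseteq> {..<d}"
 shows "ev \<in> ring_hom (mpoly_ring K I) M"
 by (rule ring_hom_memI)
  (use assms ev_closed[OF R.pset_closed] in "auto simp: R.mpoly_simps ev_mult ev_padd ev_const")

text \<open>Algebraic independence over \<open>K\<close> of the coordinates in \<open>I\<close>.
  Relations are finite sums over arbitrary sets of monomials rather than polynomials, so that
  monomials can be regrouped freely.\<close>

definition indep :: "nat set \<Rightarrow> bool"
 where "indep I \<longleftrightarrow> (\<forall>A c. finite A \<longrightarrow> (\<forall>m\<in>A. set_mset m \<subseteq> I) \<longrightarrow> (\<forall>m. c m \<in> carrier K) \<longrightarrow>
  (\<Oplus>\<^bsub>M\<^esub>m\<in>A. k (c m) \<otimes>\<^bsub>M\<^esub> mon M d s m) = \<zero>\<^bsub>M\<^esub> \<longrightarrow> (\<forall>m\<in>A. c m = \<zero>))"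

lemma indepD:
 assumes "indep I" "finite A" "\<And>m. m \<in> A \<Longrightarrow> set_mset m \<subseteq> I" "\<And>m. c m \<in> carrier K"
  "(\<Oplus>\<^bsub>M\<^esub>m\<in>A. k (c m) \<otimes>\<^bsub>M\<^esub> mon M d s m) = \<zero>\<^bsub>M\<^esub>" "m \<in> A"
 shows "c m = \<zero>"
 using assms(1)[unfolded indep_def, rule_format, of A c m] assms(2-) by blast

lemma ev_eq_zero:
 assumes "indep I" "f \<in> R.pset I" "ev f = \<zero>\<^bsub>M\<^esub>"
 shows "f = R.indexed_const \<zero>"
proof
 fix m
 have "f m = \<zero>"
 proof (rule ccontr)
  assume m: "f m \<noteq> \<zero>"
  have "f m = \<zero>"
   by (rule indepD[OF assms(1), of "{m. f m \<noteq> \<zero>}"])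
    (use assms R.pset_support[OF assms(2)] R.pset_closed m in "auto simp: pev_def")
  thus False using m by simp
 qed
 thus "f m = R.indexed_const \<zero> m" by (simp add: R.indexed_const_def)
qed

lemma ev_neg:
 assumes "f \<in> R.pset I" shows "ev (\<lambda>m. \<ominus> f m) = \<ominus>\<^bsub>M\<^esub> ev f"
proof -
 have "(\<lambda>m. \<ominus> f m) = (\<lambda>m. \<ominus> \<one> \<otimes> f m)" using R.pset_closed[OF assms] by (simp add: R.l_minus)
 hence "ev (\<lambda>m. \<ominus> f m) = k (\<ominus> \<one>) \<otimes>\<^bsub>M\<^esub> ev f" using ev_smult[OF assms, of "\<ominus> \<one>"] by simp
 thus ?thesis using ev_closed[OF R.pset_closed[OF assms]] by (simp add: S.l_minus)
qed

lemma ev_inj: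
 assumes "indep I" shows "inj_on ev (R.pset I)"
proof (rule inj_onI)
 fix f g assume fg: "f \<in> R.pset I" "g \<in> R.pset I" "ev f = ev g"
 have c: "\<And>m. f m \<in> carrier K" "\<And>m. g m \<in> carrier K" using fg R.pset_closed by auto
 have n: "(\<lambda>m. \<ominus> g m) \<in> R.pset I" by (rule R.pneg_closed[OF fg(2)])
 have "ev (R.indexed_padd f (\<lambda>m. \<ominus> g m)) = \<zero>\<^bsub>M\<^esub>"
  using ev_padd[OF fg(1) n] ev_neg[OF fg(2)] fg(3) c by (simp add: S.r_neg)
 from ev_eq_zero[OF assms R.indexed_pset.indexed_padd[OF fg(1) n] this]
 have "f m \<oplus> \<ominus> g m = \<zero>" for m
  by (metis R.indexed_padd_def R.indexed_zero_def)
 thus "f = g" using c by (metis R.minus_eq R.r_right_minus_eq ext)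
qed

text \<open>Evaluation at an independent point is injective, so the polynomial ring is a copy of a
  subring of \<open>M\<close>.\<close>

lemma mpoly_cring:
 assumes "indep I" "I \<subseteq> {..<d}" shows "cring (mpoly_ring K I)"
proof (rule cring_by_embedding[OF S.cring_axioms, of ev])
 show "inj_on ev (carrier (mpoly_ring K I))" using ev_inj[OF assms(1)] by (simp add: R.mpoly_simps)
 fix f assume f: "f \<in> carrier (mpoly_ring K I)"
 thus "ev f \<in> carrier M" using ev_closed[OF R.pset_closed] by (auto simp: R.mpoly_simps)
 show "\<exists>g\<in>carrier (mpoly_ring K I). ev g = \<ominus>\<^bsub>M\<^esub> ev f"
  using f R.pneg_closed[of f I] ev_neg[of f I] by (intro bexI[of _ "\<lambda>m. \<ominus> f m"]) (simp_all add: R.mpoly_simps)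
qed (use assms in "auto simp: R.mpoly_simps ev_mult ev_padd ev_const R.pmul_closed intro: R.indexed_pset.intros")

end

section \<open>Quotient fields\<close>

text \<open>As \<rho> is injective, a fraction class is determined by its value
  \<open>\<rho> a / \<rho> b\<close> in \<open>M\<close>. Calculating with values in place of
  representatives gives the field axioms and, at the same time, the extension \<sigma> of
  \<rho>.\<close>

lemma quotient_field_hom:
 fixes A :: "'a ring" and M (structure)
 assumes "cring A" "field M" and r: "\<rho> \<in> ring_hom A M" and inj: "inj_on \<rho> (carrier A)"
 shows "field (quotient_field A) \<and> (\<lambda>a. fraction_class A a \<one>\<^bsub>A\<^esub>) \<in> ring_hom A (quotient_field A) \<and>
  (\<exists>\<sigma>. \<sigma> \<in> ring_hom (quotient_field A) M \<and> (\<forall>a\<in>carrier A. \<sigma> (fraction_class A a \<one>\<^bsub>A\<^esub>) = \<rho> a))"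
proof -
 interpret A: cring A by fact
 interpret M: field M by fact
 interpret r: ring_hom_cring A M \<rho>
  by (rule ring_hom_cringI2[OF A.cring_axioms M.cring_axioms r])
 let ?Q = "quotient_field A"
 have nz: "\<rho> a \<noteq> \<zero>" if "a \<in> carrier A" "a \<noteq> \<zero>\<^bsub>A\<^esub>" for a
  using that inj r.hom_zero by (metis A.zero_closed inj_onD)
 have mi: "z \<otimes> y \<otimes> inv y = z" "z \<otimes> inv y \<otimes> y = z"
  if "z \<in> carrier M" "y \<in> carrier M" "y \<noteq> \<zero>" for z y
  using that by (simp_all add: M.m_assoc)
 \<comment> \<open>The class of all fractions with value \<open>z\<close>.\<close>
 define Cl where "Cl = (\<lambda>z. {(c, e). c \<in> carrier A \<and> e \<in> carrier A - {\<zero>\<^bsub>A\<^esub>} \<and> \<rho> c = z \<otimes> \<rho> e})"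
 have fc: "fraction_class A a b = Cl (\<rho> a \<otimes> inv \<rho> b)"
  if ab: "a \<in> carrier A" "b \<in> carrier A" "b \<noteq> \<zero>\<^bsub>A\<^esub>" for a b
 proof -
  have "a \<otimes>\<^bsub>A\<^esub> e = c \<otimes>\<^bsub>A\<^esub> b \<longleftrightarrow> \<rho> c = \<rho> a \<otimes> inv \<rho> b \<otimes> \<rho> e"
   if ce: "c \<in> carrier A" "e \<in> carrier A" for c e
  proof -
   have i: "inv \<rho> b \<in> carrier M" "\<rho> b \<otimes> inv \<rho> b = \<one>" using nz[OF ab(2,3)] ab by auto
   have "a \<otimes>\<^bsub>A\<^esub> e = c \<otimes>\<^bsub>A\<^esub> b \<longleftrightarrow> \<rho> a \<otimes> \<rho> e = \<rho> c \<otimes> \<rho> b"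
    using inj ab ce by (metis A.m_closed inj_onD r.hom_mult)
   also have "\<dots> \<longleftrightarrow> \<rho> c = \<rho> a \<otimes> inv \<rho> b \<otimes> \<rho> e"
   proof
    assume h: "\<rho> a \<otimes> \<rho> e = \<rho> c \<otimes> \<rho> b"
    have "\<rho> a \<otimes> inv \<rho> b \<otimes> \<rho> e = (\<rho> a \<otimes> \<rho> e) \<otimes> inv \<rho> b" using ab ce i by (simp add: M.m_ac)
    also have "\<dots> = \<rho> c" unfolding h using ab ce i by (simp add: M.m_assoc)
    finally show "\<rho> c = \<rho> a \<otimes> inv \<rho> b \<otimes> \<rho> e" by simp
   next
    assume h: "\<rho> c = \<rho> a \<otimes> inv \<rho> b \<otimes> \<rho> e"
    have "\<rho> c \<otimes> \<rho> b = (\<rho> a \<otimes> \<rho> e) \<otimes> (\<rho> b \<otimes> inv \<rho> b)" unfolding h using ab ce i(1) by (simp add: M.m_ac)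
    thus "\<rho> a \<otimes> \<rho> e = \<rho> c \<otimes> \<rho> b" using i ab ce by simp
   qed
   finally show ?thesis .
  qed
  thus ?thesis by (auto simp: fraction_class_def Cl_def)
 qed
 define Z where "Z = {\<rho> a \<otimes> inv \<rho> b | a b. a \<in> carrier A \<and> b \<in> carrier A - {\<zero>\<^bsub>A\<^esub>}}"
 have Zc: "z \<in> carrier M" if "z \<in> Z" for z using that nz by (auto simp: Z_def)
 have car: "carrier ?Q = Cl ` Z"
  unfolding quotient_field_def Z_def using fc by (auto simp: image_iff) (metis Diff_iff empty_iff insert_iff)+
 have val: "z = \<rho> c \<otimes> inv \<rho> e" if "(c, e) \<in> Cl z" "z \<in> carrier M" for z c e
 proof -
  have "e \<in> carrier A" "\<rho> e \<noteq> \<zero>" "\<rho> c = z \<otimes> \<rho> e" using that(1) nz[of e] by (auto simp: Cl_def)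
  thus ?thesis using mi(1)[of z "\<rho> e"] that(2) by simp
 qed
 have ne: "\<exists>c e. (c, e) \<in> Cl z" if z: "z \<in> Z" for z
 proof -
  obtain a b where ab: "a \<in> carrier A" "b \<in> carrier A" "b \<noteq> \<zero>\<^bsub>A\<^esub>" "z = \<rho> a \<otimes> inv \<rho> b"
   using z unfolding Z_def by blast
  hence "(a, b) \<in> Cl z" using nz[of b] mi(2)[of "\<rho> a" "\<rho> b"] by (auto simp: Cl_def)
  thus ?thesis by blast
 qed
 define \<sigma> where "\<sigma> = (\<lambda>U. THE z. z \<in> Z \<and> U = Cl z)"
 have inC: "z = w" if "z \<in> Z" "w \<in> Z" "Cl z = Cl w" for z w
  using ne[OF that(1)] val that Zc by metis
 have \<sigma>: "\<sigma> (Cl z) = z" if "z \<in> Z" for z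
  unfolding \<sigma>_def by (rule the_equality) (use that inC in auto)
 \<comment> \<open>Sum and product of classes are unions over all representatives. All of these give
   the same class, and classes are nonempty, so the union is that class.\<close>
 have Un: "(\<Union>(a, b)\<in>Cl z. \<Union>(c, e)\<in>Cl w. F a b c e) = Cl u"
  if zw: "z \<in> Z" "w \<in> Z" and F: "\<And>a b c e. (a, b) \<in> Cl z \<Longrightarrow> (c, e) \<in> Cl w \<Longrightarrow> F a b c e = Cl u"
  for z w u and F :: "'a \<Rightarrow> 'a \<Rightarrow> 'a \<Rightarrow> 'a \<Rightarrow> ('a \<times> 'a) set"
 proof -
  obtain a b where ab: "(a, b) \<in> Cl z" using ne[OF zw(1)] by blast
  obtain c e where ce: "(c, e) \<in> Cl w" using ne[OF zw(2)] by blast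
  show ?thesis
  proof (intro equalityI subsetI)
   fix x assume "x \<in> Cl u"
   hence "x \<in> F a b c e" using F[OF ab ce] by simp
   thus "x \<in> (\<Union>(a, b)\<in>Cl z. \<Union>(c, e)\<in>Cl w. F a b c e)" using ab ce by blast
  qed (use F in blast)
 qed
 have ClD: "a \<in> carrier A" "b \<in> carrier A" "b \<noteq> \<zero>\<^bsub>A\<^esub>" "\<rho> b \<in> carrier M" "\<rho> b \<noteq> \<zero>" "\<rho> a = z \<otimes> \<rho> b"
  if "(a, b) \<in> Cl z" for a b z using that nz by (auto simp: Cl_def)
 have prod_nz: "b \<otimes>\<^bsub>A\<^esub> e \<noteq> \<zero>\<^bsub>A\<^esub>" if "b \<in> carrier A" "e \<in> carrier A" "\<rho> b \<noteq> \<zero>" "\<rho> e \<noteq> \<zero>" for b e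
  using that M.integral[of "\<rho> b" "\<rho> e"] r.hom_mult[of b e] by fastforce
 have Zin: "z \<in> Z" if "a \<in> carrier A" "b \<in> carrier A" "\<rho> b \<noteq> \<zero>" "\<rho> a = z \<otimes> \<rho> b" "z \<in> carrier M" for a b z
 proof -
  have "\<rho> a \<otimes> inv \<rho> b = z" using that mi(1)[of z "\<rho> b"] by simp
  moreover have "b \<noteq> \<zero>\<^bsub>A\<^esub>" using that by auto
  ultimately show ?thesis using that unfolding Z_def by blast
 qed
 have fcz: "fraction_class A a b = Cl z" if "a \<in> carrier A" "b \<in> carrier A" "\<rho> b \<noteq> \<zero>" "\<rho> a = z \<otimes> \<rho> b" "z \<in> carrier M" for a b z
 proof -
  have "\<rho> a \<otimes> inv \<rho> b = z" using that mi(1)[of z "\<rho> b"] by simp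
  moreover have "b \<noteq> \<zero>\<^bsub>A\<^esub>" using that by auto
  ultimately show ?thesis using fc that by metis
 qed
 have mult: "Cl z \<otimes>\<^bsub>?Q\<^esub> Cl w = Cl (z \<otimes> w) \<and> z \<otimes> w \<in> Z" if zw: "z \<in> Z" "w \<in> Z" for z w
 proof -
  have c: "z \<in> carrier M" "w \<in> carrier M" using zw Zc by auto
  have *: "\<rho> (a \<otimes>\<^bsub>A\<^esub> c) = z \<otimes> w \<otimes> \<rho> (b \<otimes>\<^bsub>A\<^esub> e) \<and> \<rho> (b \<otimes>\<^bsub>A\<^esub> e) \<noteq> \<zero>"
   if "(a, b) \<in> Cl z" "(c, e) \<in> Cl w" for a b c e
  proof -
   note D = ClD[OF that(1)] ClD[OF that(2)]
   have "\<rho> (a \<otimes>\<^bsub>A\<^esub> c) = z \<otimes> w \<otimes> \<rho> (b \<otimes>\<^bsub>A\<^esub> e)" using D c by (simp add: M.m_ac)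
   moreover have "\<rho> (b \<otimes>\<^bsub>A\<^esub> e) \<noteq> \<zero>"
    by (rule nz[OF A.m_closed[OF D(2) D(8)] prod_nz[OF D(2) D(8) D(5) D(11)]])
   ultimately show ?thesis by blast
  qed
  have "Cl z \<otimes>\<^bsub>?Q\<^esub> Cl w = (\<Union>(a, b)\<in>Cl z. \<Union>(c, e)\<in>Cl w. fraction_class A (a \<otimes>\<^bsub>A\<^esub> c) (b \<otimes>\<^bsub>A\<^esub> e))"
   by (simp add: quotient_field_def)
  also have "\<dots> = Cl (z \<otimes> w)"
   by (rule Un[OF zw]) (rule fcz, use * c ClD in "auto simp del: r.hom_mult")
  finally have 1: "Cl z \<otimes>\<^bsub>?Q\<^esub> Cl w = Cl (z \<otimes> w)" .
  obtain a b c' e where "(a, b) \<in> Cl z" "(c', e) \<in> Cl w" using ne zw by blast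
  hence "z \<otimes> w \<in> Z" using * c ClD by (intro Zin[of "a \<otimes>\<^bsub>A\<^esub> c'" "b \<otimes>\<^bsub>A\<^esub> e"]) (auto simp del: r.hom_mult)
  thus ?thesis using 1 by blast
 qed
 have add: "Cl z \<oplus>\<^bsub>?Q\<^esub> Cl w = Cl (z \<oplus> w) \<and> z \<oplus> w \<in> Z" if zw: "z \<in> Z" "w \<in> Z" for z w
 proof -
  have c: "z \<in> carrier M" "w \<in> carrier M" using zw Zc by auto
  have *: "\<rho> (a \<otimes>\<^bsub>A\<^esub> e \<oplus>\<^bsub>A\<^esub> c \<otimes>\<^bsub>A\<^esub> b) = (z \<oplus> w) \<otimes> \<rho> (b \<otimes>\<^bsub>A\<^esub> e) \<and> \<rho> (b \<otimes>\<^bsub>A\<^esub> e) \<noteq> \<zero>"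
   if "(a, b) \<in> Cl z" "(c, e) \<in> Cl w" for a b c e
  proof -
   note D = ClD[OF that(1)] ClD[OF that(2)]
   have "\<rho> (a \<otimes>\<^bsub>A\<^esub> e \<oplus>\<^bsub>A\<^esub> c \<otimes>\<^bsub>A\<^esub> b) = (z \<oplus> w) \<otimes> \<rho> (b \<otimes>\<^bsub>A\<^esub> e)"
    using D c by (simp add: M.m_ac M.l_distr M.r_distr)
   moreover have "\<rho> (b \<otimes>\<^bsub>A\<^esub> e) \<noteq> \<zero>"
    by (rule nz[OF A.m_closed[OF D(2) D(8)] prod_nz[OF D(2) D(8) D(5) D(11)]])
   ultimately show ?thesis by blast
  qed
  have "Cl z \<oplus>\<^bsub>?Q\<^esub> Cl w = (\<Union>(a, b)\<in>Cl z. \<Union>(c, e)\<in>Cl w. fraction_class A (a \<otimes>\<^bsub>A\<^esub> e \<oplus>\<^bsub>A\<^esub> c \<otimes>\<^bsub>A\<^esub> b) (b \<otimes>\<^bsub>A\<^esub> e))"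
   by (simp add: quotient_field_def)
  also have "\<dots> = Cl (z \<oplus> w)"
   by (rule Un[OF zw]) (rule fcz, use * c ClD in "auto simp del: r.hom_mult r.hom_add")
  finally have 1: "Cl z \<oplus>\<^bsub>?Q\<^esub> Cl w = Cl (z \<oplus> w)" .
  obtain a b c' e where "(a, b) \<in> Cl z" "(c', e) \<in> Cl w" using ne zw by blast
  hence "z \<oplus> w \<in> Z" using * c ClD
   by (intro Zin[of "a \<otimes>\<^bsub>A\<^esub> e \<oplus>\<^bsub>A\<^esub> c' \<otimes>\<^bsub>A\<^esub> b" "b \<otimes>\<^bsub>A\<^esub> e"]) (auto simp del: r.hom_mult r.hom_add)
  thus ?thesis using 1 by blast
 qed
 have one1: "\<one>\<^bsub>A\<^esub> \<in> carrier A" "\<rho> \<one>\<^bsub>A\<^esub> \<noteq> \<zero>" by auto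
 have emb: "fraction_class A a \<one>\<^bsub>A\<^esub> = Cl (\<rho> a) \<and> \<rho> a \<in> Z" if "a \<in> carrier A" for a
  using fcz[of a "\<one>\<^bsub>A\<^esub>" "\<rho> a"] Zin[of a "\<one>\<^bsub>A\<^esub>" "\<rho> a"] that by simp
 have oneQ: "\<one>\<^bsub>?Q\<^esub> = Cl \<one>" "\<one> \<in> Z" using emb[of "\<one>\<^bsub>A\<^esub>"] by (auto simp: quotient_field_def)
 have zeroQ: "\<zero>\<^bsub>?Q\<^esub> = Cl \<zero>" "\<zero> \<in> Z" using emb[of "\<zero>\<^bsub>A\<^esub>"] by (auto simp: quotient_field_def)
 have neg: "\<ominus> z \<in> Z" if z: "z \<in> Z" for z
 proof -
  obtain a b where "(a, b) \<in> Cl z" using ne z by blast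
  thus ?thesis using ClD[of a b z] Zc[OF z]
   by (intro Zin[of "\<ominus>\<^bsub>A\<^esub> a" b]) (auto simp: M.l_minus)
 qed
 have s\<sigma>: "\<sigma> (Cl z \<otimes>\<^bsub>?Q\<^esub> Cl w) = z \<otimes> w" "\<sigma> (Cl z \<oplus>\<^bsub>?Q\<^esub> Cl w) = z \<oplus> w" if "z \<in> Z" "w \<in> Z" for z w
  using mult[OF that] add[OF that] \<sigma> by auto
 have "cring ?Q"
 proof (rule cring_by_embedding[OF M.cring_axioms, of \<sigma>])
  show "inj_on \<sigma> (carrier ?Q)" unfolding car by (auto simp: inj_on_def \<sigma>)
 qed (use mult add oneQ zeroQ neg \<sigma> Zc in "auto simp: car s\<sigma>")
 then interpret Q: cring ?Q .
 have "field ?Q"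
 proof (rule Q.cring_fieldI2)
  show "\<zero>\<^bsub>?Q\<^esub> \<noteq> \<one>\<^bsub>?Q\<^esub>" using inC[OF zeroQ(2) oneQ(2)] zeroQ oneQ by auto
  fix U assume U: "U \<in> carrier ?Q" "U \<noteq> \<zero>\<^bsub>?Q\<^esub>"
  then obtain z where z: "z \<in> Z" "U = Cl z" by (auto simp: car)
  hence z0: "z \<noteq> \<zero>" using U zeroQ by auto
  obtain a b where ab: "(a, b) \<in> Cl z" using ne z by blast
  note D = ClD[OF ab]
  have "\<rho> a \<noteq> \<zero>" using D z0 Zc[OF z(1)] M.integral[of z "\<rho> b"] by auto
  hence "inv z \<in> Z" using D z0 Zc[OF z(1)]
   by (intro Zin[of b a]) (auto simp: M.m_assoc[symmetric])
  thus "\<exists>V\<in>carrier ?Q. U \<otimes>\<^bsub>?Q\<^esub> V = \<one>\<^bsub>?Q\<^esub>"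
   using mult[OF z(1)] z z0 Zc[OF z(1)] oneQ by (intro bexI[of _ "Cl (inv z)"]) (auto simp: car)
 qed
 moreover have "(\<lambda>a. fraction_class A a \<one>\<^bsub>A\<^esub>) \<in> ring_hom A ?Q"
  by (rule ring_hom_memI) (use emb mult add oneQ in "auto simp: car")
 moreover have "\<sigma> \<in> ring_hom ?Q M"
  by (rule ring_hom_memI) (use \<sigma> s\<sigma> Zc oneQ in "auto simp: car")
 moreover have "\<forall>a\<in>carrier A. \<sigma> (fraction_class A a \<one>\<^bsub>A\<^esub>) = \<rho> a" using emb \<sigma> by auto
 ultimately show ?thesis by blast
qed

section \<open>Iterated Laurent series\<close>

lemma image_ring_hom: "inj f \<Longrightarrow> f \<in> ring_hom A (image_ring f A)"
 using inj_imp_image_ring_iso[of f A] by (simp add: ring_iso_def inj_on_subset[of f UNIV])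

lemma image_ring_inv_hom: "inj f \<Longrightarrow> Hilbert_Choice.inv f \<in> ring_hom (image_ring f A) A"
 using inj_imp_image_ring_inv_iso[of f A] by (simp add: ring_iso_def)

lemma inj_tower: "inj tower.Const" "inj Series"
 by (auto simp: inj_def)

lemma tower_field:
 assumes "field K" shows "field (iterated_laurent K n)"
proof (induction n)
 case 0
 thus ?case using field.inj_imp_image_ring_is_field[OF assms, of tower.Const] by (simp add: inj_on_def)
next
 case (Suc n)
 have "field (laurent_ring (iterated_laurent K n))" by (rule field.laurent_field[OF Suc])
 thus ?case
  using field.inj_imp_image_ring_is_field[of "laurent_ring (iterated_laurent K n)" Series] by (simp add: inj_on_def)
qed

lemma tower_step_hom:
 assumes "field K"
 shows "(\<lambda>f. Series f) \<in> ring_hom (laurent_ring (iterated_laurent K n)) (iterated_laurent K (Suc n))"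
 using image_ring_hom[OF inj_tower(2)] by simp

lemma tower_const_hom:
 assumes "field K" shows "iterated_laurent_const K n \<in> ring_hom K (iterated_laurent K n)"
proof (induction n)
 case 0
 have "iterated_laurent_const K 0 = tower.Const" by (simp add: fun_eq_iff)
 thus ?case using image_ring_hom[OF inj_tower(1)] by simp
next
 case (Suc n)
 interpret T: field "iterated_laurent K n" by (rule tower_field[OF assms])
 have "(\<lambda>a. Series (laurent_const (iterated_laurent K n) (iterated_laurent_const K n a)))
   \<in> ring_hom K (iterated_laurent K (Suc n))"
  by (rule ring_hom_comp[OF ring_hom_comp[OF Suc T.lc_hom] tower_step_hom[OF assms]])
 thus ?case by simp
qed

lemma aniso_image:
 assumes "field A" "inj f" "sform A p" "aniso A p"
 shows "aniso (image_ring f A) (ext f p)"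
proof (rule aniso_descend[OF _ assms(1) image_ring_inv_hom[OF assms(2)]])
 show "field (image_ring f A)"
  using field.inj_imp_image_ring_is_field[OF assms(1) inj_on_subset[OF assms(2) subset_UNIV]] .
 show "sform (image_ring f A) (ext f p)" by (rule sform_ext[OF image_ring_hom[OF assms(2)] assms(3)])
 have "ext (Hilbert_Choice.inv f) (ext f p) = p"
  using assms(2) by (cases p) (simp add: extend_form_def)
 thus "aniso A (ext (Hilbert_Choice.inv f) (ext f p))" using assms(4) by simp
qed

text \<open>The Laurent tower stands in for a purely transcendental extension: Springer's theorem
  with empty second residue is applied once for each variable.\<close>

lemma tower_aniso:
 assumes "field K" "sform K p" "aniso K p"
 shows "aniso (iterated_laurent K n) (ext (iterated_laurent_const K n) p)"
proof (induction n)
 case 0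
 have "iterated_laurent_const K 0 = tower.Const" by (simp add: fun_eq_iff)
 thus ?case using aniso_image[OF assms(1) inj_tower(1) assms(2,3)] by simp
next
 case (Suc n)
 interpret T: field "iterated_laurent K n" by (rule tower_field[OF assms(1)])
 let ?p = "ext (iterated_laurent_const K n) p"
 have s: "sform (iterated_laurent K n) ?p" by (rule sform_ext[OF tower_const_hom[OF assms(1)] assms(2)])
 have "aniso (image_ring Series (laurent_ring (iterated_laurent K n)))
   (ext Series (ext (laurent_const (iterated_laurent K n)) ?p))"
  by (rule aniso_image[OF T.laurent_field inj_tower(2) T.sform_ext_lc[OF s] T.laurent_aniso[OF s Suc]])
 thus ?case by (simp add: extend_extend)
qed

section \<open>Algebraic independence\<close>

lemma poly_evalI:
 assumes "cring K" "cring M" "k \<in> ring_hom K M" "s \<in> vec M" shows "poly_eval K M k s"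
 using assms by (simp add: poly_eval_def poly_eval_axioms_def ring_hom_cring_def ring_hom_cring_axioms_def)

lemma indep_empty:
 assumes "field K" "field M" "k \<in> ring_hom K M" "s \<in> vec M"
 shows "poly_eval.indep K M k d s {}"
proof -
 interpret K: field K by fact
 interpret M: field M by fact
 interpret P: poly_eval K M k d s by (rule poly_evalI[OF K.cring_axioms M.cring_axioms assms(3,4)])
 show ?thesis unfolding P.indep_def
 proof (intro allI impI ballI)
  fix A c m assume A: "finite A" "\<forall>m\<in>A. set_mset m \<subseteq> {}" "\<forall>m. c m \<in> carrier K"
   "(\<Oplus>\<^bsub>M\<^esub>m\<in>A. k (c m) \<otimes>\<^bsub>M\<^esub> mon M d s m) = \<zero>\<^bsub>M\<^esub>" "m \<in> A"
  hence "A = {{#}}" by auto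
  hence "k (c {#}) = \<zero>\<^bsub>M\<^esub>" using A by (simp add: P.mon_empty)
  thus "c m = \<zero>\<^bsub>K\<^esub>" using field_hom_zero_iff[OF assms(1-3)] A \<open>A = {{#}}\<close> by simp
 qed
qed

lemma mon_hom:
 assumes "cring M" "cring N" "j \<in> ring_hom M N" "s \<in> vec M"
 shows "mon N d (\<lambda>i. j (s i)) m = j (mon M d s m)"
proof -
 interpret M: cring M by fact
 interpret N: cring N by fact
 interpret j: ring_hom_cring M N j
  using assms by (simp add: ring_hom_cring_def ring_hom_cring_axioms_def)
 have pow: "j (x [^]\<^bsub>M\<^esub> n) = j x [^]\<^bsub>N\<^esub> n" if "x \<in> carrier M" for x and n :: nat
  using that by (induction n) auto
 show ?thesis unfolding mon_def using assms(4)
  by (subst j.hom_finprod) (auto simp: pow intro!: N.finprod_cong')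
qed

lemma indep_hom:
 assumes "field K" "field M" "field N" "k \<in> ring_hom K M" "s \<in> vec M" "j \<in> ring_hom M N"
  and ind: "poly_eval.indep K M k d s I"
 shows "poly_eval.indep K N (\<lambda>a. j (k a)) d (\<lambda>i. j (s i)) I"
proof -
 interpret K: field K by fact
 interpret M: field M by fact
 interpret N: field N by fact
 interpret P: poly_eval K M k d s by (rule poly_evalI[OF K.cring_axioms M.cring_axioms assms(4,5)])
 have js: "(\<lambda>i. j (s i)) \<in> vec N" using assms(5,6) by (auto intro!: vecI simp: ring_hom_closed)
 interpret Q: poly_eval K N "\<lambda>a. j (k a)" d "\<lambda>i. j (s i)"
  by (rule poly_evalI[OF K.cring_axioms N.cring_axioms ring_hom_comp[OF assms(4,6)] js])
 interpret j: ring_hom_cring M N j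
  by (rule ring_hom_cringI2[OF M.cring_axioms N.cring_axioms assms(6)])
 show ?thesis unfolding Q.indep_def
 proof (intro allI impI ballI)
  fix A c m assume A: "finite A" "\<forall>m\<in>A. set_mset m \<subseteq> I" "\<forall>m. c m \<in> carrier K"
   "(\<Oplus>\<^bsub>N\<^esub>m\<in>A. j (k (c m)) \<otimes>\<^bsub>N\<^esub> mon N d (\<lambda>i. j (s i)) m) = \<zero>\<^bsub>N\<^esub>" "m \<in> A"
  have t: "k (c m) \<otimes>\<^bsub>M\<^esub> mon M d s m \<in> carrier M" for m using A(3) by simp
  have "j (\<Oplus>\<^bsub>M\<^esub>m\<in>A. k (c m) \<otimes>\<^bsub>M\<^esub> mon M d s m) = (\<Oplus>\<^bsub>N\<^esub>m\<in>A. j (k (c m)) \<otimes>\<^bsub>N\<^esub> mon N d (\<lambda>i. j (s i)) m)"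
   using t A(3) by (subst j.hom_finsum)
    (auto simp: mon_hom[OF M.cring_axioms N.cring_axioms assms(6,5)] intro!: N.finsum_cong')
  hence "j (\<Oplus>\<^bsub>M\<^esub>m\<in>A. k (c m) \<otimes>\<^bsub>M\<^esub> mon M d s m) = \<zero>\<^bsub>N\<^esub>" using A(4) by (rule trans)
  moreover have "(\<Oplus>\<^bsub>M\<^esub>m\<in>A. k (c m) \<otimes>\<^bsub>M\<^esub> mon M d s m) \<in> carrier M" using t by (intro M.finsum_closed) auto
  ultimately have "(\<Oplus>\<^bsub>M\<^esub>m\<in>A. k (c m) \<otimes>\<^bsub>M\<^esub> mon M d s m) = \<zero>\<^bsub>M\<^esub>"
   using field_hom_zero_iff[OF assms(2,3,6)] by blast
  thus "c m = \<zero>\<^bsub>K\<^esub>" using P.indepD[OF ind, of A c m] A by blast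
 qed
qed

text \<open>The power is a monic polynomial of degree \<open>e\<close> in the variable; its top
  coefficient will separate monomials by their exponent.\<close>

lemma (in field) linear_pow_coeff:
 assumes a: "a \<in> carrier R"
 shows "((lc a \<oplus>\<^bsub>L\<^esub> LX) [^]\<^bsub>L\<^esub> (e :: nat)) (int e) = \<one> \<and>
  (\<forall>j > int e. ((lc a \<oplus>\<^bsub>L\<^esub> LX) [^]\<^bsub>L\<^esub> e) j = \<zero>)"
proof -
 interpret L: cring L by (rule laurent_cring)
 let ?T = "lc a \<oplus>\<^bsub>L\<^esub> LX"
 have T: "?T \<in> carrier L" using a by simp
 have TC: "?T [^]\<^bsub>L\<^esub> e \<in> carrier L" for e :: nat using T by simp
 have st: "(?T [^]\<^bsub>L\<^esub> Suc e) j = a \<otimes> (?T [^]\<^bsub>L\<^esub> e) j \<oplus> (?T [^]\<^bsub>L\<^esub> e) (j - 1)" for e :: nat and j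
 proof -
  have "?T [^]\<^bsub>L\<^esub> Suc e = lc a \<otimes>\<^bsub>L\<^esub> (?T [^]\<^bsub>L\<^esub> e) \<oplus>\<^bsub>L\<^esub> LX \<otimes>\<^bsub>L\<^esub> (?T [^]\<^bsub>L\<^esub> e)"
   using a TC[of e] by (simp add: L.r_distr L.l_distr L.m_comm)
  thus ?thesis using laurent_const_mult[OF a TC] laurent_var_mult[OF TC] by (simp only: laurent_add)
 qed
 show ?thesis
 proof (induction e)
  case 0
  show ?case by (simp add: laurent_one_apply)
 next
  case (Suc e)
  have "(?T [^]\<^bsub>L\<^esub> Suc e) (int (Suc e)) = \<one>" unfolding st using Suc a by simp
  moreover have "(?T [^]\<^bsub>L\<^esub> Suc e) j = \<zero>" if "j > int (Suc e)" for j
   unfolding st using Suc a that by simp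
  ultimately show ?case by blast
 qed
qed

text \<open>Sort the monomials of a relation by their exponent in \<open>i0\<close>. As powers of
  \<open>a + x\<close> are monic in the new variable \<open>x\<close>, the coefficient at the
  highest exponent is a relation among the old coordinates. Coordinates outside
  \<open>insert i0 I\<close> are unconstrained, which leaves coordinate 0 of a zero of the form free
  to depend on the others.\<close>

lemma indep_step:
 assumes "field K" "field M" "k \<in> ring_hom K M" "s \<in> vec M" and ind: "poly_eval.indep K M k d s I"
  and I: "I \<subseteq> {..<d}" "i0 < d" "i0 \<notin> I" and a: "a \<in> carrier M"
  and s': "s' \<in> vec (laurent_ring M)" "\<And>i. i \<in> I \<Longrightarrow> s' i = laurent_const M (s i)"
   "s' i0 = laurent_const M a \<oplus>\<^bsub>laurent_ring M\<^esub> laurent_var M"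
 shows "poly_eval.indep K (laurent_ring M) (\<lambda>a. laurent_const M (k a)) d s' (insert i0 I)"
proof -
 interpret K: field K by fact
 interpret M: field M by fact
 interpret L: field "laurent_ring M" by (rule M.laurent_field)
 interpret P: poly_eval K M k d s by (rule poly_evalI[OF K.cring_axioms M.cring_axioms assms(3,4)])
 interpret Q: poly_eval K "laurent_ring M" "\<lambda>a. laurent_const M (k a)" d s'
  by (rule poly_evalI[OF K.cring_axioms L.cring_axioms ring_hom_comp[OF assms(3) M.lc_hom] s'(1)])
 let ?L = "laurent_ring M" and ?c = "laurent_const M"
 define r where "r = (\<lambda>m :: nat multiset. filter_mset (\<lambda>i. i \<noteq> i0) m)"
 have sc: "\<And>i. s' i \<in> carrier ?L" "\<And>i. s i \<in> carrier M" using s'(1) assms(4) by auto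
 have mon: "mon ?L d s' m = ?c (mon M d s (r m)) \<otimes>\<^bsub>?L\<^esub> (?c a \<oplus>\<^bsub>?L\<^esub> laurent_var M) [^]\<^bsub>?L\<^esub> count m i0"
  if m: "set_mset m \<subseteq> insert i0 I" for m
 proof -
  have d: "{..<d} = insert i0 ({..<d} - {i0})" using I by auto
  have "mon ?L d s' m = s' i0 [^]\<^bsub>?L\<^esub> count m i0 \<otimes>\<^bsub>?L\<^esub> (\<Otimes>\<^bsub>?L\<^esub>i\<in>{..<d} - {i0}. s' i [^]\<^bsub>?L\<^esub> count m i)"
   unfolding mon_def using sc by (subst d, subst L.finprod_insert) auto
  also have "(\<Otimes>\<^bsub>?L\<^esub>i\<in>{..<d} - {i0}. s' i [^]\<^bsub>?L\<^esub> count m i) =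
    (\<Otimes>\<^bsub>?L\<^esub>i\<in>{..<d} - {i0}. ?c (s i) [^]\<^bsub>?L\<^esub> count (r m) i)"
  proof (rule L.finprod_cong'[OF refl])
   fix i assume i: "i \<in> {..<d} - {i0}"
   show "s' i [^]\<^bsub>?L\<^esub> count m i = ?c (s i) [^]\<^bsub>?L\<^esub> count (r m) i"
   proof (cases "i \<in># m")
    case True
    hence "i \<in> I" using m i by auto
    thus ?thesis using s'(2) i by (simp add: r_def)
   next
    case False
    hence "count m i = 0" by (simp add: not_in_iff)
    thus ?thesis using i by (simp add: r_def)
   qed
  qed (use sc in auto)
  also have "\<dots> = mon ?L d (\<lambda>i. ?c (s i)) (r m)"
  proof -
   have "mon ?L d (\<lambda>i. ?c (s i)) (r m) = ?c (s i0) [^]\<^bsub>?L\<^esub> count (r m) i0 \<otimes>\<^bsub>?L\<^esub>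
     (\<Otimes>\<^bsub>?L\<^esub>i\<in>{..<d} - {i0}. ?c (s i) [^]\<^bsub>?L\<^esub> count (r m) i)"
    unfolding mon_def using sc by (subst d, subst L.finprod_insert) auto
   moreover have "(\<Otimes>\<^bsub>?L\<^esub>i\<in>{..<d} - {i0}. ?c (s i) [^]\<^bsub>?L\<^esub> count (r m) i) \<in> carrier ?L"
    using sc by (intro L.finprod_closed) auto
   ultimately show ?thesis using sc by (simp add: r_def)
  qed
  also have "\<dots> = ?c (mon M d s (r m))"
   by (rule mon_hom[OF M.cring_axioms L.cring_axioms M.lc_hom assms(4)])
  finally show ?thesis using a s'(3) by (simp add: L.m_comm)
 qed
 show ?thesis unfolding Q.indep_def
 proof (intro allI impI ballI)
  fix A c m0 assume A: "finite A" "\<forall>m\<in>A. set_mset m \<subseteq> insert i0 I" "\<forall>m. c m \<in> carrier K"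
   "(\<Oplus>\<^bsub>?L\<^esub>m\<in>A. ?c (k (c m)) \<otimes>\<^bsub>?L\<^esub> mon ?L d s' m) = \<zero>\<^bsub>?L\<^esub>" "m0 \<in> A"
  show "c m0 = \<zero>\<^bsub>K\<^esub>"
  proof (rule ccontr)
   assume c0: "c m0 \<noteq> \<zero>\<^bsub>K\<^esub>"
   define A1 where "A1 = {m \<in> A. c m \<noteq> \<zero>\<^bsub>K\<^esub>}"
   have A1: "finite A1" "m0 \<in> A1" using A c0 by (auto simp: A1_def)
   \<comment> \<open>The highest exponent of \<open>i0\<close> among monomials with nonzero
     coefficient: monomials of smaller exponent do not reach the power \<open>n\<close> of the
     variable.\<close>
   define n where "n = Max ((\<lambda>m. count m i0) ` A1)"
   have nge: "count m i0 \<le> n" if "m \<in> A1" for m unfolding n_def using A1 that by (intro Max_ge) auto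
   have "n \<in> (\<lambda>m. count m i0) ` A1" unfolding n_def using A1 by (intro Max_in) auto
   then obtain m1 where m1: "m1 \<in> A1" "count m1 i0 = n" by auto
   define A2 where "A2 = {m \<in> A1. count m i0 = n}"
   have tc: "?c (k (c m)) \<otimes>\<^bsub>?L\<^esub> mon ?L d s' m \<in> carrier ?L" for m using A(3) by simp
   have coeff: "(?c (k (c m)) \<otimes>\<^bsub>?L\<^esub> mon ?L d s' m) (int n) =
     (if count m i0 = n then k (c m) \<otimes>\<^bsub>M\<^esub> mon M d s (r m) else \<zero>\<^bsub>M\<^esub>)" if m: "m \<in> A1" for m
   proof -
    let ?b = "k (c m) \<otimes>\<^bsub>M\<^esub> mon M d s (r m)"
    let ?T = "?c a \<oplus>\<^bsub>?L\<^esub> laurent_var M"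
    have b: "?b \<in> carrier M" using A(3) by simp
    have "?c (k (c m)) \<otimes>\<^bsub>?L\<^esub> mon ?L d s' m = ?c ?b \<otimes>\<^bsub>?L\<^esub> ?T [^]\<^bsub>?L\<^esub> count m i0"
     using mon[of m] m A a ring_hom_mult[OF M.lc_hom, of "k (c m)" "mon M d s (r m)"]
     by (simp add: A1_def L.m_assoc)
    moreover have "(?c ?b \<otimes>\<^bsub>?L\<^esub> ?T [^]\<^bsub>?L\<^esub> count m i0) (int n) = ?b \<otimes>\<^bsub>M\<^esub> (?T [^]\<^bsub>?L\<^esub> count m i0) (int n)"
     by (rule M.laurent_const_mult[OF b]) (use a in simp)
    moreover have "(?T [^]\<^bsub>?L\<^esub> count m i0) (int n) = (if count m i0 = n then \<one>\<^bsub>M\<^esub> else \<zero>\<^bsub>M\<^esub>)"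
     using M.linear_pow_coeff[OF a, of "count m i0"] nge[OF m] by auto
    ultimately show ?thesis using b by simp
   qed
   have "\<zero>\<^bsub>M\<^esub> = (\<Oplus>\<^bsub>?L\<^esub>m\<in>A. ?c (k (c m)) \<otimes>\<^bsub>?L\<^esub> mon ?L d s' m) (int n)"
    using A(4) by (simp add: M.laurent_zero)
   also have "(\<Oplus>\<^bsub>?L\<^esub>m\<in>A. ?c (k (c m)) \<otimes>\<^bsub>?L\<^esub> mon ?L d s' m) = (\<Oplus>\<^bsub>?L\<^esub>m\<in>A1. ?c (k (c m)) \<otimes>\<^bsub>?L\<^esub> mon ?L d s' m)"
   proof (rule L.finsum_mono_neutral)
    fix m assume "m \<in> A - A1"
    hence "c m = \<zero>\<^bsub>K\<^esub>" by (simp add: A1_def)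
    moreover have "?c \<zero>\<^bsub>M\<^esub> = \<zero>\<^bsub>?L\<^esub>" by (rule ext) (simp add: laurent_const_def M.laurent_zero)
    ultimately show "?c (k (c m)) \<otimes>\<^bsub>?L\<^esub> mon ?L d s' m = \<zero>\<^bsub>?L\<^esub>" by simp
   qed (use A tc in "auto simp: A1_def")
   also have "\<dots> (int n) = (\<Oplus>\<^bsub>M\<^esub>m\<in>A1. (?c (k (c m)) \<otimes>\<^bsub>?L\<^esub> mon ?L d s' m) (int n))"
    by (rule M.laurent_finsum[OF A1(1) tc])
   also have "\<dots> = (\<Oplus>\<^bsub>M\<^esub>m\<in>A1. if count m i0 = n then k (c m) \<otimes>\<^bsub>M\<^esub> mon M d s (r m) else \<zero>\<^bsub>M\<^esub>)"
    using coeff A(3) by (intro M.finsum_cong') auto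
   also have "\<dots> = (\<Oplus>\<^bsub>M\<^esub>m\<in>A2. if count m i0 = n then k (c m) \<otimes>\<^bsub>M\<^esub> mon M d s (r m) else \<zero>\<^bsub>M\<^esub>)"
    by (rule M.finsum_mono_neutral) (use A1 A(3) in "auto simp: A2_def")
   also have "\<dots> = (\<Oplus>\<^bsub>M\<^esub>m\<in>A2. k (c m) \<otimes>\<^bsub>M\<^esub> mon M d s (r m))"
    using A(3) by (intro M.finsum_cong') (auto simp: A2_def)
   finally have z: "(\<Oplus>\<^bsub>M\<^esub>m\<in>A2. k (c m) \<otimes>\<^bsub>M\<^esub> mon M d s (r m)) = \<zero>\<^bsub>M\<^esub>" by simp
   \<comment> \<open>All members of \<open>A2\<close> contain \<open>i0\<close> exactly
     \<open>n\<close> times, so deleting it loses nothing, and the relation can be indexed by the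
     stripped monomials.\<close>
   have rb: "m = r m + replicate_mset n i0" if "m \<in> A2" for m
    using that by (intro multiset_eqI) (auto simp: A2_def r_def)
   have inj: "inj_on r A2" using rb by (metis inj_onI)
   define e where "e = (\<lambda>m. c (m + replicate_mset n i0))"
   have "(\<Oplus>\<^bsub>M\<^esub>m\<in>r ` A2. k (e m) \<otimes>\<^bsub>M\<^esub> mon M d s m) = (\<Oplus>\<^bsub>M\<^esub>m\<in>A2. k (e (r m)) \<otimes>\<^bsub>M\<^esub> mon M d s (r m))"
    by (rule M.finsum_reindex[OF _ inj]) (use A(3) in "auto simp: e_def")
   also have "\<dots> = \<zero>\<^bsub>M\<^esub>"
   proof -
    have "e (r m) = c m" if "m \<in> A2" for m using rb[OF that] by (simp add: e_def)
    hence "(\<Oplus>\<^bsub>M\<^esub>m\<in>A2. k (e (r m)) \<otimes>\<^bsub>M\<^esub> mon M d s (r m)) = (\<Oplus>\<^bsub>M\<^esub>m\<in>A2. k (c m) \<otimes>\<^bsub>M\<^esub> mon M d s (r m))"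
     using A(3) by (intro M.finsum_cong') auto
    thus ?thesis using z by simp
   qed
   finally have z2: "(\<Oplus>\<^bsub>M\<^esub>m\<in>r ` A2. k (e m) \<otimes>\<^bsub>M\<^esub> mon M d s m) = \<zero>\<^bsub>M\<^esub>" .
   have m12: "m1 \<in> A2" using m1 by (simp add: A2_def)
   have "e (r m1) = \<zero>\<^bsub>K\<^esub>"
   proof (rule P.indepD[OF ind _ _ _ z2])
    show "finite (r ` A2)" using A1 by (simp add: A2_def)
    show "set_mset m \<subseteq> I" if "m \<in> r ` A2" for m
    proof -
     obtain m' where m': "m' \<in> A" "m = r m'" using \<open>m \<in> r ` A2\<close> by (auto simp: A2_def A1_def)
     hence "set_mset m' \<subseteq> insert i0 I" using A(2) by blast
     thus ?thesis unfolding m'(2) r_def by auto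
    qed
    show "e m \<in> carrier K" for m using A(3) by (simp add: e_def)
    show "r m1 \<in> r ` A2" using m12 by blast
   qed
   moreover have "e (r m1) = c m1" using rb[OF m12] by (simp add: e_def)
   ultimately show False using m1 by (simp add: A1_def)
  qed
 qed
qed

text \<open>The variables of the tower are themselves independent; each stage adjoins one of them by
  \<open>indep_step\<close> with \<open>a\<close> zero.\<close>

lemma generic_tower_point:
 assumes "field K" "n \<le> d"
 shows "\<exists>y\<in>vec (iterated_laurent K n).
  poly_eval.indep K (iterated_laurent K n) (iterated_laurent_const K n) d y {..<n}"
 using assms(2)
proof (induction n)
 case 0
 interpret T: field "iterated_laurent K 0" by (rule tower_field[OF assms(1)])
 have "poly_eval.indep K (iterated_laurent K 0) (iterated_laurent_const K 0) d (\<lambda>_. \<zero>\<^bsub>iterated_laurent K 0\<^esub>) {}"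
  by (rule indep_empty[OF assms(1) T.field_axioms tower_const_hom[OF assms(1)] T.zero_vec])
 thus ?case using T.zero_vec by (metis lessThan_0)
next
 case (Suc n)
 let ?T = "iterated_laurent K n" and ?k = "iterated_laurent_const K n"
 let ?L = "laurent_ring ?T"
 interpret T: field ?T by (rule tower_field[OF assms(1)])
 interpret L: field ?L by (rule T.laurent_field)
 have T': "field (iterated_laurent K (Suc n))" by (rule tower_field[OF assms(1)])
 obtain y where y: "y \<in> vec ?T" "poly_eval.indep K ?T ?k d y {..<n}" using Suc by auto
 define y' where "y' = (\<lambda>i. if i = n then laurent_const ?T \<zero>\<^bsub>?T\<^esub> \<oplus>\<^bsub>?L\<^esub> laurent_var ?T else laurent_const ?T (y i))"
 have y': "y' \<in> vec ?L" using y by (intro vecI) (simp add: y'_def)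
 have "poly_eval.indep K ?L (\<lambda>a. laurent_const ?T (?k a)) d y' (insert n {..<n})"
  by (rule indep_step[OF assms(1) T.field_axioms tower_const_hom[OF assms(1)] y _ _ _ T.zero_closed y'])
   (use Suc.prems in "auto simp: y'_def")
 hence "poly_eval.indep K (iterated_laurent K (Suc n)) (\<lambda>a. Series (laurent_const ?T (?k a))) d (\<lambda>i. Series (y' i)) (insert n {..<n})"
  by (rule indep_hom[OF assms(1) L.field_axioms T' ring_hom_comp[OF tower_const_hom[OF assms(1)] T.lc_hom]
    y' tower_step_hom[OF assms(1)]])
 moreover have "(\<lambda>a. Series (laurent_const ?T (?k a))) = iterated_laurent_const K (Suc n)" by (simp add: fun_eq_iff)
 moreover have "(\<lambda>i. Series (y' i)) \<in> vec (iterated_laurent K (Suc n))"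
  using ring_hom_closed[OF tower_step_hom[OF assms(1)]] y' by (intro vecI) (metis vec_closed)
 ultimately show ?case by (metis lessThan_Suc)
qed

section \<open>Function fields of quadratic forms\<close>

context cring
begin

lemma bilin_gram_cong:
 assumes "sform R q" "qdim p = qdim q" "\<And>i j. i < qdim q \<Longrightarrow> j < qdim q \<Longrightarrow> gram p i j = gram q i j"
  "v \<in> vec R" "w \<in> vec R"
 shows "bilin R p v w = bilin R q v w"
 unfolding bilin_def assms(2) using assms by (intro finsum_cong') (auto intro!: finsum_closed)

lemma indexed_const_pset: "a \<in> carrier R \<Longrightarrow> indexed_const a \<in> pset I"
 by (rule indexed_pset.indexed_const)

lemma indexed_const_hom: "indexed_const \<in> ring_hom R (mpoly_ring R I)"
proof (rule ring_hom_memI)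
 fix a b assume a: "a \<in> carrier R" "b \<in> carrier R"
 show "indexed_const (a \<otimes> b) = indexed_const a \<otimes>\<^bsub>mpoly_ring R I\<^esub> indexed_const b"
  unfolding mpoly_simps using a by (subst pmul_const) (auto simp: indexed_const_def)
qed (auto simp: mpoly_simps indexed_const_pset indexed_padd_const)

lemma indexed_var_pset: "i \<in> I \<Longrightarrow> indexed_var i \<in> pset I"
 unfolding indexed_var_def by (intro indexed_pset.indexed_pmult indexed_const_pset) auto

lemma pmul_var:
 assumes "f \<in> pset I" shows "pmul (indexed_var i) f = indexed_pmult f i"
proof -
 have c: "\<And>m. f m \<in> carrier R" using pset_closed[OF assms] .
 have "pmul (indexed_var i) f = indexed_pmult (pmul (indexed_const \<one>) f) i"
  unfolding indexed_var_def using c by (intro pmul_pmult) (auto simp: indexed_const_def)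
 also have "pmul (indexed_const \<one>) f = f" using pmul_const[OF one_closed c] c by simp
 finally show ?thesis .
qed

text \<open>Multiplying a remainder \<open>A + x B\<close> by \<open>x\<close> creates
  \<open>x x B\<close>; the relation \<open>c x x = G - x (l1 + l2) - r\<close> with invertible
  \<open>c\<close> removes the square.\<close>

lemma division_step:
 assumes [simp]: "A \<in> carrier R" "B \<in> carrier R" "x \<in> carrier R" "y \<in> carrier R" "g \<in> carrier R" "c \<in> carrier R"
  "l1 \<in> carrier R" "l2 \<in> carrier R" "r \<in> carrier R" and gc: "g \<otimes> c = \<one>"
  and G: "G = (c \<otimes> x \<otimes> x \<oplus> x \<otimes> l1) \<oplus> (x \<otimes> l2 \<oplus> r)"
 shows "x \<otimes> (A \<oplus> x \<otimes> B \<oplus> y \<otimes> G) =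
  \<ominus> (g \<otimes> r \<otimes> B) \<oplus> x \<otimes> (A \<oplus> \<ominus> (g \<otimes> (l1 \<oplus> l2) \<otimes> B)) \<oplus> (x \<otimes> y \<oplus> g \<otimes> B) \<otimes> G"
proof -
 let ?u = "g \<otimes> r \<otimes> B" and ?v = "x \<otimes> g \<otimes> l1 \<otimes> B" and ?w = "x \<otimes> g \<otimes> l2 \<otimes> B"
 have "\<ominus> ?u \<oplus> x \<otimes> (A \<oplus> \<ominus> (g \<otimes> (l1 \<oplus> l2) \<otimes> B)) \<oplus> (x \<otimes> y \<oplus> g \<otimes> B) \<otimes> G =
  x \<otimes> (A \<oplus> (g \<otimes> c) \<otimes> (x \<otimes> B) \<oplus> y \<otimes> G) \<oplus> ((?u \<oplus> \<ominus> ?u) \<oplus> (?v \<oplus> \<ominus> ?v) \<oplus> (?w \<oplus> \<ominus> ?w))"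
  unfolding G by (simp add: ring_expand)
 thus ?thesis by (simp add: gc r_neg G)
qed

lemma division_add:
 assumes [simp]: "A \<in> carrier R" "B \<in> carrier R" "x \<in> carrier R" "y \<in> carrier R" "G \<in> carrier R"
  "A' \<in> carrier R" "B' \<in> carrier R" "y' \<in> carrier R"
 shows "(A \<oplus> x \<otimes> B \<oplus> y \<otimes> G) \<oplus> (A' \<oplus> x \<otimes> B' \<oplus> y' \<otimes> G) =
  (A \<oplus> A') \<oplus> x \<otimes> (B \<oplus> B') \<oplus> (y \<oplus> y') \<otimes> G"
 by (simp add: ring_expand)

lemma division_mult:
 assumes [simp]: "A \<in> carrier R" "B \<in> carrier R" "x \<in> carrier R" "y \<in> carrier R" "G \<in> carrier R" "z \<in> carrier R"
 shows "z \<otimes> (A \<oplus> x \<otimes> B \<oplus> y \<otimes> G) = z \<otimes> A \<oplus> x \<otimes> (z \<otimes> B) \<oplus> (z \<otimes> y) \<otimes> G"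
 by (simp add: ring_expand)

end

text \<open>The homomorphism is arbitrary because the lemma is applied both to evaluation at a point
  and to the passage to the function field.\<close>

lemma hom_form_poly:
 fixes K :: "('a, 'b) ring_scheme"
 assumes "cring K" "cring (mpoly_ring K {..<qdim q})" "cring S" "\<eta> \<in> ring_hom (mpoly_ring K {..<qdim q}) S" "sform K q"
 shows "form_poly K q \<in> carrier (mpoly_ring K {..<qdim q})"
  and "\<eta> (form_poly K q) = bilin S (ext (\<lambda>a. \<eta> (ring.indexed_const K a)) q)
   (\<lambda>i. \<eta> (ring.indexed_var K i)) (\<lambda>i. \<eta> (ring.indexed_var K i))"
proof -
 interpret K: cring K by fact
 let ?P = "mpoly_ring K {..<qdim q}"
 interpret P: cring ?P by fact
 interpret S: cring S by fact
 interpret h: ring_hom_cring ?P S \<eta>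
  by (rule ring_hom_cringI2[OF P.cring_axioms S.cring_axioms assms(4)])
 have C: "K.indexed_const (gram q i j) \<in> carrier ?P" if "i < qdim q" "j < qdim q" for i j
  unfolding K.mpoly_simps(1) using that assms(5) by (intro K.indexed_const_pset) simp
 have X: "K.indexed_var i \<in> carrier ?P" if "i < qdim q" for i
  using that K.indexed_var_pset[of i "{..<qdim q}"] by (simp add: K.mpoly_simps(1))
 let ?t = "\<lambda>i j. K.indexed_const (gram q i j) \<otimes>\<^bsub>?P\<^esub> K.indexed_var i \<otimes>\<^bsub>?P\<^esub> K.indexed_var j"
 have G: "form_poly K q = (\<Oplus>\<^bsub>?P\<^esub>i\<in>{..<qdim q}. \<Oplus>\<^bsub>?P\<^esub>j\<in>{..<qdim q}. ?t i j)"
  by (simp add: form_poly_def Let_def)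
 have t: "?t i j \<in> carrier ?P" if "i < qdim q" "j < qdim q" for i j
  using C[OF that] X[OF that(1)] X[OF that(2)] by simp
 have inn: "(\<Oplus>\<^bsub>?P\<^esub>j\<in>{..<qdim q}. ?t i j) \<in> carrier ?P" if "i < qdim q" for i
  using t that by (intro P.finsum_closed) auto
 show "form_poly K q \<in> carrier ?P" unfolding G using inn by (intro P.finsum_closed) auto
 have "\<eta> (form_poly K q) = (\<Oplus>\<^bsub>S\<^esub>i\<in>{..<qdim q}. \<eta> (\<Oplus>\<^bsub>?P\<^esub>j\<in>{..<qdim q}. ?t i j))"
  unfolding G using inn by (subst h.hom_finsum) (auto simp: comp_def)
 also have "\<dots> = (\<Oplus>\<^bsub>S\<^esub>i\<in>{..<qdim q}. \<Oplus>\<^bsub>S\<^esub>j\<in>{..<qdim q}. \<eta> (K.indexed_var i) \<otimes>\<^bsub>S\<^esub>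
   \<eta> (K.indexed_const (gram q i j)) \<otimes>\<^bsub>S\<^esub> \<eta> (K.indexed_var j))"
 proof (rule S.finsum_cong'[OF refl])
  fix i assume i: "i \<in> {..<qdim q}"
  have "\<eta> (\<Oplus>\<^bsub>?P\<^esub>j\<in>{..<qdim q}. ?t i j) = (\<Oplus>\<^bsub>S\<^esub>j\<in>{..<qdim q}. \<eta> (?t i j))"
   using t i by (subst h.hom_finsum) (auto simp: comp_def)
  also have "\<dots> = (\<Oplus>\<^bsub>S\<^esub>j\<in>{..<qdim q}. \<eta> (K.indexed_var i) \<otimes>\<^bsub>S\<^esub>
   \<eta> (K.indexed_const (gram q i j)) \<otimes>\<^bsub>S\<^esub> \<eta> (K.indexed_var j))"
   using i C X by (intro S.finsum_cong') (auto simp: S.m_comm)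
  finally show "\<eta> (\<Oplus>\<^bsub>?P\<^esub>j\<in>{..<qdim q}. ?t i j) = (\<Oplus>\<^bsub>S\<^esub>j\<in>{..<qdim q}. \<eta> (K.indexed_var i) \<otimes>\<^bsub>S\<^esub>
   \<eta> (K.indexed_const (gram q i j)) \<otimes>\<^bsub>S\<^esub> \<eta> (K.indexed_var j))" .
 qed (use C X in "auto intro!: S.finsum_closed")
 finally show "\<eta> (form_poly K q) = bilin S (ext (\<lambda>a. \<eta> (ring.indexed_const K a)) q)
   (\<lambda>i. \<eta> (ring.indexed_var K i)) (\<lambda>i. \<eta> (ring.indexed_var K i))"
  by (simp add: bilin_def extend_form_def)
qed

lemma (in poly_eval) ev_var: "i < d \<Longrightarrow> ev (R.indexed_var i) = s i"
 unfolding R.indexed_var_def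
 using ev_pmult[OF R.indexed_const_pset[OF R.one_closed, of "{}"]] ev_const[OF R.one_closed] s by simp

text \<open>The ring axioms are pulled back along evaluation at independent elements of a Laurent
  tower of height \<open>d\<close>.\<close>

lemma mpoly_ring_cring:
 fixes d :: nat
 assumes "field K" shows "cring (mpoly_ring K {..<d})"
proof -
 interpret K: field K by fact
 let ?T = "iterated_laurent K d"
 interpret T: field ?T by (rule tower_field[OF assms])
 obtain y where y: "y \<in> vec ?T" "poly_eval.indep K ?T (iterated_laurent_const K d) d y {..<d}"
  using generic_tower_point[OF assms, of d d] by auto
 interpret Y: poly_eval K ?T "iterated_laurent_const K d" d y
  by (rule poly_evalI[OF K.cring_axioms T.cring_axioms tower_const_hom[OF assms] y(1)])
 show ?thesis by (rule Y.mpoly_cring[OF y(2)]) simp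
qed

lemma pev_form_poly:
 fixes K :: "('a, 'b) ring_scheme" and M :: "('m, 'n) ring_scheme"
 assumes "field K" "field M" "k \<in> ring_hom K M" "s \<in> vec M" "sform K q"
 shows "pev K M k (qdim q) s (form_poly K q) = bilin M (ext k q) s s"
proof -
 let ?d = "qdim q"
 interpret K: field K by fact
 interpret M: field M by fact
 interpret E: poly_eval K M k ?d s by (rule poly_evalI[OF K.cring_axioms M.cring_axioms assms(3,4)])
 have "E.ev (form_poly K q) = bilin M (ext (\<lambda>a. E.ev (K.indexed_const a)) q) (\<lambda>i. E.ev (K.indexed_var i)) (\<lambda>i. E.ev (K.indexed_var i))"
  by (rule hom_form_poly(2)[OF K.cring_axioms mpoly_ring_cring[OF assms(1)] M.cring_axioms E.ev_hom[OF subset_refl] assms(5)])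
 also have "\<dots> = bilin M (ext k q) s s"
  unfolding bilin_def using assms(4,5)
  by (intro M.finsum_cong') (auto simp: extend_form_def E.ev_const E.ev_var intro!: M.finsum_closed)
 finally show ?thesis .
qed

text \<open>The kernel of evaluation at a generic zero of \<open>q\<close> is the ideal generated by \<open>q\<close>. Division by
 \<open>q\<close> leaves \<open>A + X\<^sub>0 B\<close> with \<open>A\<close>, \<open>B\<close> free of \<open>X\<^sub>0\<close>; if this vanishes at the generic zero, then \<open>q\<close>
 represents zero at \<open>(-A, B X\<^sub>1, B X\<^sub>2, \<dots>)\<close>, and \<open>q\<close> stays anisotropic over a purely transcendental
 extension.\<close>

lemma pev_kernel:
 fixes K :: "('a, 'b) ring_scheme"
 assumes "field K" "field M" "k \<in> ring_hom K M" "s \<in> vec M" and q: "sform K q" "aniso K q" "2 \<le> qdim q"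
  and z: "bilin M (ext k q) s s = \<zero>\<^bsub>M\<^esub>"
  and ind: "poly_eval.indep K M k (qdim q) s {1..<qdim q}"
  and f: "f \<in> carrier (mpoly_ring K {..<qdim q})" "pev K M k (qdim q) s f = \<zero>\<^bsub>M\<^esub>"
 shows "f \<in> form_ideal K q"
proof -
 let ?d = "qdim q"
 let ?P = "mpoly_ring K {..<?d}"
 define J where "J = {1..<?d}"
 have J [simp]: "i \<in> J \<longleftrightarrow> 1 \<le> i \<and> i < ?d" "finite J" for i by (auto simp: J_def)
 interpret K: field K by fact
 interpret M: field M by fact
 interpret E: poly_eval K M k ?d s by (rule poly_evalI[OF K.cring_axioms M.cring_axioms assms(3,4)])
 interpret P: cring ?P by (rule mpoly_ring_cring[OF assms(1)])
 let ?C = "K.indexed_const :: 'a \<Rightarrow> nat multiset \<Rightarrow> 'a" and ?X = "K.indexed_var :: nat \<Rightarrow> nat multiset \<Rightarrow> 'a" and ?S = "K.pset J :: (nat multiset \<Rightarrow> 'a) set"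
 let ?G = "form_poly K q"
 interpret e: ring_hom_cring ?P M E.ev
  by (rule ring_hom_cringI2[OF P.cring_axioms M.cring_axioms E.ev_hom[OF subset_refl]])
 have d: "{..<?d} = insert 0 J" using q(3) by (auto simp: J_def)
 have cP: "carrier ?P = K.pset {..<?d}" by (rule K.mpoly_simps)
 have sub: "f \<in> carrier ?P" if "f \<in> ?S" for f unfolding cP by (rule K.pset_mono[OF that]) (auto simp: J(1))
 have Sadd: "f \<oplus>\<^bsub>?P\<^esub> g \<in> ?S" if "f \<in> ?S" "g \<in> ?S" for f g
  unfolding K.mpoly_simps by (rule K.indexed_pset.indexed_padd[OF that])
 have Smul: "f \<otimes>\<^bsub>?P\<^esub> g \<in> ?S" if "f \<in> ?S" "g \<in> ?S" for f g
  unfolding K.mpoly_simps by (rule K.pmul_closed[OF that])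
 have Sneg: "\<ominus>\<^bsub>?P\<^esub> f \<in> ?S" if "f \<in> ?S" for f
 proof -
  have n: "(\<lambda>m. \<ominus>\<^bsub>K\<^esub> f m) \<in> ?S" by (rule K.pneg_closed[OF that])
  have "(\<lambda>m. \<ominus>\<^bsub>K\<^esub> f m) \<oplus>\<^bsub>?P\<^esub> f = \<zero>\<^bsub>?P\<^esub>"
   using K.pset_closed[OF that] by (auto simp: K.mpoly_simps K.indexed_padd_def K.indexed_const_def K.l_neg)
  hence "\<ominus>\<^bsub>?P\<^esub> f = (\<lambda>m. \<ominus>\<^bsub>K\<^esub> f m)" using sub[OF that] sub[OF n] by (intro P.minus_equality) auto
  thus ?thesis using n by simp
 qed
 have SC: "?C a \<in> ?S" if "a \<in> carrier K" for a by (rule K.indexed_const_pset[OF that])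
 have SX: "?X i \<in> ?S" if "1 \<le> i" "i < ?d" for i using that by (intro K.indexed_var_pset) auto
 have S0: "\<zero>\<^bsub>?P\<^esub> \<in> ?S" unfolding K.mpoly_simps by (rule SC) simp
 have Ssum: "finsum ?P g A \<in> ?S" if "finite A" "\<And>i. i \<in> A \<Longrightarrow> g i \<in> ?S" for g :: "nat \<Rightarrow> _" and A
  using that
 proof (induction A rule: finite_induct)
  case empty thus ?case using S0 by simp
 next
  case (insert i A)
  have "finsum ?P g (insert i A) = g i \<oplus>\<^bsub>?P\<^esub> finsum ?P g A"
   using insert sub by (intro P.finsum_insert) auto
  thus ?case using insert Sadd by simp
 qed
 have XP: "?X i \<in> carrier ?P" if "i < ?d" for i using that K.indexed_var_pset[of i "{..<?d}"] by (simp add: cP)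
 have CP: "?C a \<in> carrier ?P" if "a \<in> carrier K" for a using sub[OF SC[OF that]] .
 have d0: "0 < ?d" "1 < ?d" using q(3) by auto
 have GP: "?G \<in> carrier ?P" by (rule hom_form_poly(1)[OF K.cring_axioms P.cring_axioms M.cring_axioms e.homh q(1)])
 define t where "t = (\<lambda>i j. ?C (gram q i j) \<otimes>\<^bsub>?P\<^esub> ?X i \<otimes>\<^bsub>?P\<^esub> ?X j)"
 have tc: "t i j \<in> carrier ?P" if "i < ?d" "j < ?d" for i j
  using that q(1) XP CP by (simp add: t_def)
 define l1 where "l1 = (\<Oplus>\<^bsub>?P\<^esub>j\<in>J. ?C (gram q 0 j) \<otimes>\<^bsub>?P\<^esub> ?X j)"
 define l2 where "l2 = (\<Oplus>\<^bsub>?P\<^esub>j\<in>J. ?C (gram q j 0) \<otimes>\<^bsub>?P\<^esub> ?X j)"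
 define r where "r = (\<Oplus>\<^bsub>?P\<^esub>i\<in>J. \<Oplus>\<^bsub>?P\<^esub>j\<in>J. t i j)"
 define x where "x = ?X 0"
 define c where "c = ?C (gram q 0 0)"
 have xP: "x \<in> carrier ?P" unfolding x_def by (rule XP[OF d0(1)])
 have cP': "c \<in> carrier ?P" unfolding c_def using CP q(1) d0 by simp
 have lS: "l1 \<in> ?S" "l2 \<in> ?S" "r \<in> ?S"
  unfolding l1_def l2_def r_def t_def using q(1) d0 by (auto intro!: Ssum Smul SC SX simp: J(1))
 have lP: "l1 \<in> carrier ?P" "l2 \<in> carrier ?P" "r \<in> carrier ?P" using lS sub by auto
 have G: "?G = (c \<otimes>\<^bsub>?P\<^esub> x \<otimes>\<^bsub>?P\<^esub> x \<oplus>\<^bsub>?P\<^esub> x \<otimes>\<^bsub>?P\<^esub> l1) \<oplus>\<^bsub>?P\<^esub> (x \<otimes>\<^bsub>?P\<^esub> l2 \<oplus>\<^bsub>?P\<^esub> r)"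
 proof -
  have inn: "(\<Oplus>\<^bsub>?P\<^esub>j\<in>{..<?d}. t i j) = t i 0 \<oplus>\<^bsub>?P\<^esub> (\<Oplus>\<^bsub>?P\<^esub>j\<in>J. t i j)" if "i < ?d" for i
  proof -
   have "finsum ?P (t i) (insert 0 J) = t i 0 \<oplus>\<^bsub>?P\<^esub> finsum ?P (t i) J"
    using tc that d0 by (intro P.finsum_insert) auto
   thus ?thesis using arg_cong[OF d, of "finsum ?P (t i)"] by argo
  qed
  have innc: "(\<Oplus>\<^bsub>?P\<^esub>j\<in>J. t i j) \<in> carrier ?P" if "i < ?d" for i
   using tc that by (intro P.finsum_closed) auto
  have "?G = (\<Oplus>\<^bsub>?P\<^esub>i\<in>{..<?d}. \<Oplus>\<^bsub>?P\<^esub>j\<in>{..<?d}. t i j)" by (simp add: form_poly_def Let_def t_def)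
  also have "\<dots> = (\<Oplus>\<^bsub>?P\<^esub>i\<in>insert 0 J. t i 0 \<oplus>\<^bsub>?P\<^esub> (\<Oplus>\<^bsub>?P\<^esub>j\<in>J. t i j))"
   using inn tc innc d0 by (intro P.finsum_cong'[OF d]) auto
  also have "\<dots> = (t 0 0 \<oplus>\<^bsub>?P\<^esub> (\<Oplus>\<^bsub>?P\<^esub>j\<in>J. t 0 j)) \<oplus>\<^bsub>?P\<^esub>
    (\<Oplus>\<^bsub>?P\<^esub>i\<in>J. t i 0 \<oplus>\<^bsub>?P\<^esub> (\<Oplus>\<^bsub>?P\<^esub>j\<in>J. t i j))"
   using tc innc d0 by (intro P.finsum_insert) auto
  also have "(\<Oplus>\<^bsub>?P\<^esub>i\<in>J. t i 0 \<oplus>\<^bsub>?P\<^esub> (\<Oplus>\<^bsub>?P\<^esub>j\<in>J. t i j)) = (\<Oplus>\<^bsub>?P\<^esub>i\<in>J. t i 0) \<oplus>\<^bsub>?P\<^esub> r"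
   unfolding r_def using tc innc d0 by (intro P.finsum_addf) auto
  also have "(\<Oplus>\<^bsub>?P\<^esub>i\<in>J. t i 0) = (\<Oplus>\<^bsub>?P\<^esub>i\<in>J. x \<otimes>\<^bsub>?P\<^esub> (?C (gram q i 0) \<otimes>\<^bsub>?P\<^esub> ?X i))"
   using q(1) XP CP d0 xP by (intro P.finsum_cong') (auto simp: t_def x_def P.m_ac)
  also have "\<dots> = x \<otimes>\<^bsub>?P\<^esub> l2"
   unfolding l2_def using q(1) XP CP d0 xP by (subst P.finsum_rdistr) auto
  also have "(\<Oplus>\<^bsub>?P\<^esub>j\<in>J. t 0 j) = (\<Oplus>\<^bsub>?P\<^esub>i\<in>J. x \<otimes>\<^bsub>?P\<^esub> (?C (gram q 0 i) \<otimes>\<^bsub>?P\<^esub> ?X i))"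
   using q(1) XP CP d0 xP by (intro P.finsum_cong') (auto simp: t_def x_def P.m_ac)
  also have "\<dots> = x \<otimes>\<^bsub>?P\<^esub> l1"
   unfolding l1_def using q(1) XP CP d0 xP by (subst P.finsum_rdistr) auto
  also have "t 0 0 = c \<otimes>\<^bsub>?P\<^esub> x \<otimes>\<^bsub>?P\<^esub> x" by (simp add: t_def c_def x_def)
  finally show ?thesis .
 qed
 have g00: "gram q 0 0 \<in> carrier K" "gram q 0 0 \<noteq> \<zero>\<^bsub>K\<^esub>"
 proof -
  show "gram q 0 0 \<in> carrier K" using q(1) d0 by simp
  show "gram q 0 0 \<noteq> \<zero>\<^bsub>K\<^esub>"
  proof
   assume "gram q 0 0 = \<zero>\<^bsub>K\<^esub>"
   hence "bilin K q (uvec K 0) (uvec K 0) = \<zero>\<^bsub>K\<^esub>" using K.bilin_uvec[OF q(1) d0(1) d0(1)] by simp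
   hence "uvec K 0 0 = \<zero>\<^bsub>K\<^esub>" using q(2) d0 unfolding K.aniso_iff[OF q(1)] by (metis K.uvec_vec)
   thus False by (simp add: uvec_def)
  qed
 qed
 define g where "g = ?C (inv\<^bsub>K\<^esub> (gram q 0 0))"
 have gS: "g \<in> ?S" unfolding g_def using g00 SC by simp
 have gc: "g \<otimes>\<^bsub>?P\<^esub> c = \<one>\<^bsub>?P\<^esub>"
  unfolding g_def c_def using ring_hom_mult[OF K.indexed_const_hom, symmetric, of _ _ "{..<?d}"] g00
  by (simp add: K.mpoly_simps(2))
 \<comment> \<open>Division with remainder by induction on the generation of polynomials. Only
   multiplication by \<open>X\<^sub>0\<close> uses \<open>division_step\<close>; the coefficient of
   \<open>X\<^sub>0\<^sup>2\<close> is invertible because the form is anisotropic.\<close>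
 have "\<exists>A\<in>?S. \<exists>B\<in>?S. \<exists>y\<in>carrier ?P. f = A \<oplus>\<^bsub>?P\<^esub> x \<otimes>\<^bsub>?P\<^esub> B \<oplus>\<^bsub>?P\<^esub> y \<otimes>\<^bsub>?P\<^esub> ?G"
  if "f \<in> K.pset {..<?d}" for f
  using that
 proof (induction rule: K.indexed_pset.induct)
  case (indexed_const a)
  thus ?case
   by (intro bexI[OF _ SC[OF indexed_const]] bexI[OF _ S0] bexI[OF _ P.zero_closed])
    (use xP GP CP in simp)
 next
  case (indexed_padd f f')
  then obtain A B y A' B' y' where *: "A \<in> ?S" "B \<in> ?S" "y \<in> carrier ?P" "A' \<in> ?S" "B' \<in> ?S" "y' \<in> carrier ?P"
   "f = A \<oplus>\<^bsub>?P\<^esub> x \<otimes>\<^bsub>?P\<^esub> B \<oplus>\<^bsub>?P\<^esub> y \<otimes>\<^bsub>?P\<^esub> ?G" "f' = A' \<oplus>\<^bsub>?P\<^esub> x \<otimes>\<^bsub>?P\<^esub> B' \<oplus>\<^bsub>?P\<^esub> y' \<otimes>\<^bsub>?P\<^esub> ?G"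
   by blast
  have "K.indexed_padd f f' = f \<oplus>\<^bsub>?P\<^esub> f'" by (simp add: K.mpoly_simps)
  also have "\<dots> = (A \<oplus>\<^bsub>?P\<^esub> A') \<oplus>\<^bsub>?P\<^esub> x \<otimes>\<^bsub>?P\<^esub> (B \<oplus>\<^bsub>?P\<^esub> B') \<oplus>\<^bsub>?P\<^esub> (y \<oplus>\<^bsub>?P\<^esub> y') \<otimes>\<^bsub>?P\<^esub> ?G"
   unfolding *(7,8) by (rule P.division_add) (use * sub xP GP in auto)
  finally show ?case using * by (intro bexI[OF _ Sadd[OF *(1,4)]] bexI[OF _ Sadd[OF *(2,5)]] bexI[OF _ P.a_closed[OF *(3,6)]])
 next
  case (indexed_pmult f i)
  then obtain A B y where *: "A \<in> ?S" "B \<in> ?S" "y \<in> carrier ?P"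
   "f = A \<oplus>\<^bsub>?P\<^esub> x \<otimes>\<^bsub>?P\<^esub> B \<oplus>\<^bsub>?P\<^esub> y \<otimes>\<^bsub>?P\<^esub> ?G" by blast
  have fi: "K.indexed_pmult f i = ?X i \<otimes>\<^bsub>?P\<^esub> f"
   using K.pmul_var[OF indexed_pmult.hyps(1)] by (simp add: K.mpoly_simps)
  have AB: "A \<in> carrier ?P" "B \<in> carrier ?P" "g \<in> carrier ?P" using * gS sub by auto
  show ?case
  proof (cases "i = 0")
   case True
   have "K.indexed_pmult f i = \<ominus>\<^bsub>?P\<^esub> (g \<otimes>\<^bsub>?P\<^esub> r \<otimes>\<^bsub>?P\<^esub> B) \<oplus>\<^bsub>?P\<^esub>
     x \<otimes>\<^bsub>?P\<^esub> (A \<oplus>\<^bsub>?P\<^esub> \<ominus>\<^bsub>?P\<^esub> (g \<otimes>\<^bsub>?P\<^esub> (l1 \<oplus>\<^bsub>?P\<^esub> l2) \<otimes>\<^bsub>?P\<^esub> B)) \<oplus>\<^bsub>?P\<^esub>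
     (x \<otimes>\<^bsub>?P\<^esub> y \<oplus>\<^bsub>?P\<^esub> g \<otimes>\<^bsub>?P\<^esub> B) \<otimes>\<^bsub>?P\<^esub> ?G"
    unfolding fi unfolding True x_def[symmetric] unfolding *(4)
    by (rule P.division_step[OF AB(1,2) xP *(3) AB(3) cP' lP gc G])
   moreover have "\<ominus>\<^bsub>?P\<^esub> (g \<otimes>\<^bsub>?P\<^esub> r \<otimes>\<^bsub>?P\<^esub> B) \<in> ?S" using gS lS * by (intro Sneg Smul)
   moreover have "A \<oplus>\<^bsub>?P\<^esub> \<ominus>\<^bsub>?P\<^esub> (g \<otimes>\<^bsub>?P\<^esub> (l1 \<oplus>\<^bsub>?P\<^esub> l2) \<otimes>\<^bsub>?P\<^esub> B) \<in> ?S"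
     using gS lS * by (intro Sneg Smul Sadd)
   moreover have "x \<otimes>\<^bsub>?P\<^esub> y \<oplus>\<^bsub>?P\<^esub> g \<otimes>\<^bsub>?P\<^esub> B \<in> carrier ?P" using AB * xP by simp
   ultimately show ?thesis by blast
  next
   case False
   hence i: "1 \<le> i" "i < ?d" using indexed_pmult.hyps by auto
   have "K.indexed_pmult f i = ?X i \<otimes>\<^bsub>?P\<^esub> A \<oplus>\<^bsub>?P\<^esub> x \<otimes>\<^bsub>?P\<^esub> (?X i \<otimes>\<^bsub>?P\<^esub> B) \<oplus>\<^bsub>?P\<^esub> (?X i \<otimes>\<^bsub>?P\<^esub> y) \<otimes>\<^bsub>?P\<^esub> ?G"
    unfolding fi unfolding *(4) by (rule P.division_mult[OF AB(1,2) xP *(3) GP XP[OF i(2)]])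
   thus ?thesis
    using Smul[OF SX[OF i] *(1)] Smul[OF SX[OF i] *(2)] P.m_closed[OF XP[OF i(2)] *(3)] by blast
  qed
 qed
 then obtain A B y where AB: "A \<in> ?S" "B \<in> ?S" "y \<in> carrier ?P"
  "f = A \<oplus>\<^bsub>?P\<^esub> x \<otimes>\<^bsub>?P\<^esub> B \<oplus>\<^bsub>?P\<^esub> y \<otimes>\<^bsub>?P\<^esub> ?G" using f(1) unfolding cP by blast
 have ABP: "A \<in> carrier ?P" "B \<in> carrier ?P" using AB sub by auto
 have sk: "sform M (ext k q)" by (rule sform_ext[OF assms(3) q(1)])
 have evX: "E.ev (?X i) = s i" if "i < ?d" for i by (rule E.ev_var[OF that])
 have evG: "E.ev ?G = \<zero>\<^bsub>M\<^esub>" using pev_form_poly[OF assms(1-4) q(1)] z by simp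
 have sM: "s i \<in> carrier M" for i using assms(4) by simp
 have eAB: "E.ev A \<in> carrier M" "E.ev B \<in> carrier M" using ABP by auto
 have "E.ev A \<oplus>\<^bsub>M\<^esub> s 0 \<otimes>\<^bsub>M\<^esub> E.ev B = \<zero>\<^bsub>M\<^esub>"
  using f(2) AB ABP xP GP evG evX[OF d0(1)] sM eAB by (simp add: x_def[symmetric])
 hence eA: "\<ominus>\<^bsub>M\<^esub> E.ev A = E.ev B \<otimes>\<^bsub>M\<^esub> s 0"
  using sM eAB by (intro M.minus_equality) (auto simp: M.m_comm M.a_comm)
 define v where "v = (\<lambda>i. if i = 0 then \<ominus>\<^bsub>?P\<^esub> A else if i < ?d then B \<otimes>\<^bsub>?P\<^esub> ?X i else \<zero>\<^bsub>?P\<^esub>)"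
 have vS: "v i \<in> ?S" for i using AB Sneg Smul SX S0 by (simp add: v_def)
 have vP: "v \<in> vec ?P" using vS sub by (intro vecI) blast
 let ?QP = "ext ?C q"
 have sQP: "sform ?P ?QP" by (rule sform_ext[OF K.indexed_const_hom q(1)])
 let ?N = "bilin ?P ?QP v v"
 have NS: "?N \<in> ?S" unfolding bilin_def using q(1) vS by (auto simp: extend_form_def intro!: Ssum Smul SC)
 \<comment> \<open>Needed for two evaluations of the same vector \<open>v\<close>: at the generic
   zero in \<open>M\<close>, and at an independent point of a Laurent tower over
   \<open>K\<close>.\<close>
 have gen: "bilin N (ext \<kappa> q) (\<lambda>i. \<eta> (v i)) (\<lambda>i. \<eta> (v i)) = \<eta> ?N"
  if N: "cring N" and \<eta>: "\<eta> \<in> ring_hom ?P N" and \<kappa>: "\<kappa> \<in> ring_hom K N" "\<And>a. a \<in> carrier K \<Longrightarrow> \<eta> (?C a) = \<kappa> a"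
  for N :: "('n, 'o) ring_scheme" and \<eta> \<kappa>
 proof -
  interpret N: cring N by fact
  have "\<eta> ?N = bilin N (ext \<eta> ?QP) (\<lambda>i. \<eta> (v i)) (\<lambda>i. \<eta> (v i))"
   by (rule bilin_extend[OF P.cring_axioms N \<eta> sQP vP vP, symmetric])
  also have "\<dots> = bilin N (ext \<kappa> q) (\<lambda>i. \<eta> (v i)) (\<lambda>i. \<eta> (v i))"
  proof (rule N.bilin_gram_cong)
   show "sform N (ext \<kappa> q)" by (rule sform_ext[OF \<kappa>(1) q(1)])
   show "(\<lambda>i. \<eta> (v i)) \<in> vec N" "(\<lambda>i. \<eta> (v i)) \<in> vec N"
    using vP \<eta> by (auto intro!: vecI simp: ring_hom_closed)
  qed (use q(1) \<kappa> in "auto simp: extend_form_def")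
  finally show ?thesis by simp
 qed
 \<comment> \<open>At the generic zero \<open>- A\<close> equals \<open>B s\<^sub>0\<close>, so
   \<open>v\<close> becomes \<open>B\<close> times that zero and the value is 0. As
   \<open>?N\<close> is free of \<open>X\<^sub>0\<close>, independence turns this into the vanishing
   of the polynomial itself.\<close>
 have "E.ev ?N = bilin M (ext k q) (\<lambda>i. E.ev (v i)) (\<lambda>i. E.ev (v i))"
  by (rule gen[OF M.cring_axioms e.homh assms(3), symmetric]) (rule E.ev_const)
 also have "\<dots> = bilin M (ext k q) (smul M (E.ev B) s) (smul M (E.ev B) s)"
 proof (rule M.bilin_cong[OF sk])
  show "smul M (E.ev B) s \<in> vec M" "smul M (E.ev B) s \<in> vec M" using eAB assms(4) by auto
  show "E.ev (v i) = smul M (E.ev B) s i" "E.ev (v i) = smul M (E.ev B) s i" if "i < qdim (ext k q)" for i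
   using that ABP XP evX eA by (auto simp: v_def smul_def)
 qed
 also have "\<dots> = \<zero>\<^bsub>M\<^esub>" using sk eAB assms(4) z by (simp add: M.bilin_smul_left M.bilin_smul_right)
 finally have "?N = ?C \<zero>\<^bsub>K\<^esub>" by (rule E.ev_eq_zero[OF ind[folded J_def] NS])
 hence N0: "?N = \<zero>\<^bsub>?P\<^esub>" by (simp add: K.mpoly_simps)
 let ?T = "iterated_laurent K ?d" and ?k = "iterated_laurent_const K ?d"
 interpret T: field ?T by (rule tower_field[OF assms(1)])
 obtain w where w: "w \<in> vec ?T" "poly_eval.indep K ?T ?k ?d w {..<?d}"
  using generic_tower_point[OF assms(1), of ?d ?d] by auto
 interpret W: poly_eval K ?T ?k ?d w
  by (rule poly_evalI[OF K.cring_axioms T.cring_axioms tower_const_hom[OF assms(1)] w(1)])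
 interpret wh: ring_hom_cring ?P ?T W.ev
  by (rule ring_hom_cringI2[OF P.cring_axioms T.cring_axioms W.ev_hom[OF subset_refl]])
 have winj: "f = \<zero>\<^bsub>?P\<^esub>" if "f \<in> carrier ?P" "W.ev f = \<zero>\<^bsub>?T\<^esub>" for f
  using W.ev_eq_zero[OF w(2)] that by (simp add: cP K.mpoly_simps(3))
 have sT: "sform ?T (ext ?k q)" by (rule sform_ext[OF tower_const_hom[OF assms(1)] q(1)])
 have "bilin ?T (ext ?k q) (\<lambda>i. W.ev (v i)) (\<lambda>i. W.ev (v i)) = W.ev ?N"
  by (rule gen[OF T.cring_axioms wh.homh tower_const_hom[OF assms(1)]]) (rule W.ev_const)
 hence "bilin ?T (ext ?k q) (\<lambda>i. W.ev (v i)) (\<lambda>i. W.ev (v i)) = \<zero>\<^bsub>?T\<^esub>" unfolding N0 by simp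
 moreover have "(\<lambda>i. W.ev (v i)) \<in> vec ?T" using vP by (intro vecI) simp
 ultimately have "\<forall>i<qdim (ext ?k q). W.ev (v i) = \<zero>\<^bsub>?T\<^esub>"
  using tower_aniso[OF assms(1) q(1,2), of ?d] unfolding T.aniso_iff[OF sT] by blast
 hence v0: "v i = \<zero>\<^bsub>?P\<^esub>" if "i < ?d" for i using winj[of "v i"] vP that by simp
 have A0: "A = \<zero>\<^bsub>?P\<^esub>" using v0[OF d0(1)] ABP by (simp add: v_def)
 \<comment> \<open>Dimension at least two enters here: a second variable exists, and
   \<open>B X\<^sub>1 = 0\<close> forces \<open>B = 0\<close>.\<close>
 have "?X 1 {#1#} = \<one>\<^bsub>K\<^esub>" by (simp add: K.indexed_var_def K.indexed_pmult_def K.indexed_const_def)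
 hence "?X 1 \<noteq> \<zero>\<^bsub>?P\<^esub>" unfolding K.mpoly_simps K.indexed_const_def
  by (metis K.one_not_zero add_mset_not_empty)
 hence "W.ev (?X 1) \<noteq> \<zero>\<^bsub>?T\<^esub>" using winj[OF XP[OF d0(2)]] by blast
 moreover have "W.ev B \<otimes>\<^bsub>?T\<^esub> W.ev (?X 1) = \<zero>\<^bsub>?T\<^esub>"
  using v0[OF d0(2)] wh.hom_mult[OF ABP(2) XP[OF d0(2)]] d0 by (simp add: v_def)
 ultimately have "W.ev B = \<zero>\<^bsub>?T\<^esub>" using T.integral[of "W.ev B" "W.ev (?X 1)"] ABP XP[OF d0(2)] by simp
 hence B0: "B = \<zero>\<^bsub>?P\<^esub>" using winj[OF ABP(2)] by blast
 have "f = y \<otimes>\<^bsub>?P\<^esub> ?G" using AB A0 B0 xP GP by simp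
 thus ?thesis unfolding form_ideal_def cgenideal_def using AB(3) by blast
qed

text \<open>By \<open>pev_kernel\<close> the ideal of the form is the kernel of evaluation at the
  generic zero \<open>s\<close>. Hence the coordinate ring embeds into the field \<open>M\<close>,
  which makes its quotient field a field and maps it to \<open>M\<close>.\<close>

lemma function_field_hom:
 fixes K :: "('a, 'b) ring_scheme" and M :: "('m, 'n) ring_scheme"
 assumes "field K" "field M" "k \<in> ring_hom K M" "s \<in> vec M" and q: "sform K q" "aniso K q" "2 \<le> qdim q"
  and z: "bilin M (ext k q) s s = \<zero>\<^bsub>M\<^esub>"
  and ind: "poly_eval.indep K M k (qdim q) s {1..<qdim q}"
 shows "field (function_field K q)" "function_field_embed K q \<in> ring_hom K (function_field K q)"
  "\<not> aniso (function_field K q) (ext (function_field_embed K q) q)"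
  "\<exists>\<sigma>. \<sigma> \<in> ring_hom (function_field K q) M \<and> (\<forall>a\<in>carrier K. \<sigma> (function_field_embed K q a) = k a)"
proof -
 let ?d = "qdim q"
 let ?P = "mpoly_ring K {..<?d}"
 interpret K: field K by fact
 interpret M: field M by fact
 interpret E: poly_eval K M k ?d s by (rule poly_evalI[OF K.cring_axioms M.cring_axioms assms(3,4)])
 interpret P: cring ?P by (rule mpoly_ring_cring[OF assms(1)])
 interpret e: ring_hom_cring ?P M E.ev
  by (rule ring_hom_cringI2[OF P.cring_axioms M.cring_axioms E.ev_hom[OF subset_refl]])
 note er = ring_hom_ringI2[OF P.ring_axioms M.ring_axioms e.homh]
 let ?C = "K.indexed_const :: 'a \<Rightarrow> nat multiset \<Rightarrow> 'a" and ?X = "K.indexed_var :: nat \<Rightarrow> nat multiset \<Rightarrow> 'a" and ?G = "form_poly K q" and ?I = "form_ideal K q"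
 let ?A = "form_coord_ring K q" and ?F = "function_field K q" and ?e = "function_field_embed K q"
 have GP: "?G \<in> carrier ?P" by (rule hom_form_poly(1)[OF K.cring_axioms P.cring_axioms M.cring_axioms e.homh q(1)])
 have CP: "?C a \<in> carrier ?P" if "a \<in> carrier K" for a using ring_hom_closed[OF K.indexed_const_hom that] .
 have XP: "?X i \<in> carrier ?P" if "i < ?d" for i
  using that K.indexed_var_pset[of i "{..<?d}"] by (simp add: K.mpoly_simps(1))
 have evX: "E.ev (?X i) = s i" if "i < ?d" for i by (rule E.ev_var[OF that])
 have evG: "E.ev ?G = \<zero>\<^bsub>M\<^esub>" using pev_form_poly[OF assms(1-4) q(1)] z by simp
 have ker: "?I = a_kernel ?P M E.ev"
 proof (intro equalityI subsetI)
  fix f assume "f \<in> ?I"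
  then obtain y where "y \<in> carrier ?P" "f = y \<otimes>\<^bsub>?P\<^esub> ?G" unfolding form_ideal_def cgenideal_def by blast
  moreover from this have "E.ev f = \<zero>\<^bsub>M\<^esub>"
   using e.hom_mult[OF _ GP] evG M.r_null[OF e.hom_closed] by metis
  ultimately show "f \<in> a_kernel ?P M E.ev" unfolding a_kernel_def' using P.m_closed[OF _ GP] by blast
 next
  fix f assume "f \<in> a_kernel ?P M E.ev"
  hence "f \<in> carrier ?P" "E.ev f = \<zero>\<^bsub>M\<^esub>" unfolding a_kernel_def' by blast+
  thus "f \<in> ?I" by (rule pev_kernel[OF assms])
 qed
 have idl: "ideal ?I ?P" unfolding form_ideal_def by (rule P.cgenideal_ideal[OF GP])
 interpret A: cring ?A unfolding form_coord_ring_def by (rule ideal.quotient_is_cring[OF idl P.cring_axioms])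
 define \<rho> where "\<rho> = (\<lambda>U. the_elem (E.ev ` U))"
 have \<rho>h: "\<rho> \<in> ring_hom ?A M"
  unfolding \<rho>_def form_coord_ring_def ker by (rule ring_hom_ring.the_elem_hom[OF er])
 have \<rho>i: "inj_on \<rho> (carrier ?A)"
  unfolding \<rho>_def form_coord_ring_def ker by (rule inj_onI) (rule ring_hom_ring.the_elem_inj[OF er])
 have \<rho>v: "\<rho> (?I +>\<^bsub>?P\<^esub> f) = E.ev f" if "f \<in> carrier ?P" for f
  unfolding \<rho>_def ker by (rule ring_hom_ring.the_elem_simp[OF er that])
 have ch: "(\<lambda>f. ?I +>\<^bsub>?P\<^esub> f) \<in> ring_hom ?P ?A"
  unfolding form_coord_ring_def by (rule ideal.rcos_ring_hom[OF idl])
 obtain \<sigma> where Q: "field ?F" "(\<lambda>a. fraction_class ?A a \<one>\<^bsub>?A\<^esub>) \<in> ring_hom ?A ?F"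
  "\<sigma> \<in> ring_hom ?F M" "\<And>a. a \<in> carrier ?A \<Longrightarrow> \<sigma> (fraction_class ?A a \<one>\<^bsub>?A\<^esub>) = \<rho> a"
  using quotient_field_hom[OF A.cring_axioms assms(2) \<rho>h \<rho>i] unfolding function_field_def by blast
 interpret F: field ?F by fact
 define \<eta> where "\<eta> = (\<lambda>f. fraction_class ?A (?I +>\<^bsub>?P\<^esub> f) \<one>\<^bsub>?A\<^esub>)"
 have \<eta>h: "\<eta> \<in> ring_hom ?P ?F" unfolding \<eta>_def by (rule ring_hom_comp[OF ch Q(2)])
 have \<sigma>\<eta>: "\<sigma> (\<eta> f) = E.ev f" if "f \<in> carrier ?P" for f
  unfolding \<eta>_def using Q(4)[OF ring_hom_closed[OF ch that]] \<rho>v[OF that] by simp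
 have e\<eta>: "?e = (\<lambda>a. \<eta> (?C a))" by (simp add: fun_eq_iff function_field_embed_def \<eta>_def)
 show "field ?F" by fact
 show eh: "?e \<in> ring_hom K ?F" unfolding e\<eta> by (rule ring_hom_comp[OF K.indexed_const_hom \<eta>h])
 show "\<exists>\<sigma>. \<sigma> \<in> ring_hom ?F M \<and> (\<forall>a\<in>carrier K. \<sigma> (?e a) = k a)"
  using Q(3) \<sigma>\<eta>[OF CP] E.ev_const by (intro exI[of _ \<sigma>]) (simp add: e\<eta>)
 show "\<not> aniso ?F (ext ?e q)"
 proof
  assume an: "aniso ?F (ext ?e q)"
  have sF: "sform ?F (ext ?e q)" by (rule sform_ext[OF eh q(1)])
  \<comment> \<open>The classes of the variables form the tautological zero; it is nonzero because
    \<open>X\<^sub>1\<close> evaluates to an independent coordinate of \<open>s\<close>.\<close>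
  let ?v = "\<lambda>i. if i < ?d then \<eta> (?X i) else \<zero>\<^bsub>?F\<^esub>"
  have v: "?v \<in> vec ?F" using ring_hom_closed[OF \<eta>h XP] by (intro vecI) simp
  have "\<sigma> (\<eta> ?G) = \<zero>\<^bsub>M\<^esub>" using \<sigma>\<eta>[OF GP] evG by simp
  hence "\<eta> ?G = \<zero>\<^bsub>?F\<^esub>" using field_hom_zero_iff[OF Q(1) assms(2) Q(3) ring_hom_closed[OF \<eta>h GP]] by simp
  moreover have "\<eta> ?G = bilin ?F (ext ?e q) (\<lambda>i. \<eta> (?X i)) (\<lambda>i. \<eta> (?X i))"
   unfolding e\<eta> by (rule hom_form_poly(2)[OF K.cring_axioms P.cring_axioms F.cring_axioms \<eta>h q(1)])
  moreover have "\<dots> = bilin ?F (ext ?e q) ?v ?v" by (rule F.bilin_cong[OF sF v v]) auto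
  ultimately have "bilin ?F (ext ?e q) ?v ?v = \<zero>\<^bsub>?F\<^esub>" by simp
  hence "\<forall>i<qdim (ext ?e q). ?v i = \<zero>\<^bsub>?F\<^esub>" using an v unfolding F.aniso_iff[OF sF] by blast
  hence "?v 1 = \<zero>\<^bsub>?F\<^esub>" using q(3) by simp
  hence "\<eta> (?X 1) = \<zero>\<^bsub>?F\<^esub>" using q(3) by simp
  hence "\<sigma> (\<eta> (?X 1)) = \<zero>\<^bsub>M\<^esub>"
   using field_hom_zero_iff[OF Q(1) assms(2) Q(3) F.zero_closed] by simp
  hence "E.ev (?X 1) = \<zero>\<^bsub>M\<^esub>" using \<sigma>\<eta>[OF XP, of 1] q(3) by simp
  moreover have "?X 1 \<in> K.pset {1..<?d}" using q(3) by (intro K.indexed_var_pset) auto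
  ultimately have "?X 1 = ?C \<zero>\<^bsub>K\<^esub>" using E.ev_eq_zero[OF ind] by blast
  moreover have "?X 1 {#1#} = \<one>\<^bsub>K\<^esub>" by (simp add: K.indexed_var_def K.indexed_pmult_def K.indexed_const_def)
  ultimately show False by (simp add: K.indexed_const_def)
 qed
qed

section \<open>Generic specialisation\<close>

text \<open>If \<open>v\<close> is orthogonal to \<open>e\<close>, choose \<open>w\<close>
  orthogonal to neither, as \<open>w0\<close> or \<open>w0 + e\<close>; then \<open>w + c v\<close>
  with \<open>c = - q(w) / (2 b(v, w))\<close> is isotropic and still pairs nontrivially with
  \<open>e\<close>. This pairing becomes the linear coefficient in Hensel's lemma.\<close>

lemma (in field2) isotropic_nonorth:
 assumes Q: "regular R q" and "\<not> aniso R q" and e: "e \<in> vec R" "bilin R q e e \<noteq> \<zero>"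
 shows "\<exists>z\<in>vec R. bilin R q z z = \<zero> \<and> bilin R q z e \<noteq> \<zero>"
proof -
 have s: "sform R q" using Q by (rule regular_sform)
 obtain v i where v: "v \<in> vec R" "bilin R q v v = \<zero>" and i: "i < qdim q" "v i \<noteq> \<zero>"
  using assms(2) unfolding aniso_iff[OF s] by blast
 show ?thesis
 proof (cases "bilin R q v e = \<zero>")
  case False thus ?thesis using v by blast
 next
  case True
  obtain w0 where w0: "w0 \<in> vec R" "bilin R q v w0 \<noteq> \<zero>" using regularD[OF Q v(1) _ i(1)] i(2) by blast
  obtain w where w: "w \<in> vec R" "bilin R q v w \<noteq> \<zero>" "bilin R q w e \<noteq> \<zero>"
  proof (cases "bilin R q w0 e = \<zero>")
   case True
   hence "bilin R q (vadd R w0 e) e \<noteq> \<zero>" "bilin R q v (vadd R w0 e) \<noteq> \<zero>"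
    using s w0 e v \<open>bilin R q v e = \<zero>\<close> by (simp_all add: bilin_add_left bilin_add_right)
   thus ?thesis using w0 e that[of "vadd R w0 e"] by simp
  qed (use w0 that in blast)
  define c where "c = \<ominus> (half \<otimes> bilin R q w w \<otimes> inv (bilin R q v w))"
  have c: "c \<in> carrier R" using s v w by (simp add: c_def)
  let ?b = "bilin R q v w" and ?n = "bilin R q w w"
  have bn [simp]: "?b \<in> carrier R" "?n \<in> carrier R" using s v w by auto
  have cb: "c \<otimes> ?b = \<ominus> (half \<otimes> ?n)"
   using w by (simp add: c_def l_minus m_assoc)
  have "bilin R q (vadd R w (smul R c v)) (vadd R w (smul R c v)) =
   (?n \<oplus> c \<otimes> ?b) \<oplus> (c \<otimes> ?b \<oplus> c \<otimes> (c \<otimes> \<zero>))"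
   using s v w c by (simp add: bilin_add_left bilin_add_right bilin_smul_left bilin_smul_right bilin_sym[of q w v])
  also have "\<dots> = ?n \<oplus> \<ominus> ((half \<oplus> half) \<otimes> ?n)"
   unfolding cb using c by (simp add: l_distr minus_add a_ac)
  also have "\<dots> = \<zero>" by (simp add: half_add r_neg)
  finally have "bilin R q (vadd R w (smul R c v)) (vadd R w (smul R c v)) = \<zero>" .
  moreover have "bilin R q (vadd R w (smul R c v)) e \<noteq> \<zero>"
   using s v w e c True by (simp add: bilin_add_left bilin_smul_left)
  ultimately show ?thesis using w v c by (intro bexI[of _ "vadd R w (smul R c v)"]) auto
 qed
qed

text \<open>Coordinate \<open>m\<close> is moved by the new variable and coordinate 0 by an unknown
  \<open>g\<close> of positive order. With \<open>e\<close> the basis vector 0, isotropy reads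
  \<open>q(w) + 2 b(w, e) g + q(e) g\<^sup>2 = 0\<close>; here \<open>q(w)\<close> has positive
  order and \<open>2 b(w, e)\<close> is a unit, so Hensel's lemma provides \<open>g\<close>.\<close>

lemma (in field2) conic_step:
 assumes s: "sform R q" and v: "v \<in> vec R" "bilin R q v v = \<zero>" "bilin R q v (uvec R 0) \<noteq> \<zero>" and m: "m \<noteq> 0"
 shows "\<exists>w\<in>vec L. bilin L (ext lc q) w w = \<zero>\<^bsub>L\<^esub> \<and>
  bilin L (ext lc q) w (uvec L 0) \<noteq> \<zero>\<^bsub>L\<^esub> \<and>
  (\<forall>i. i \<noteq> 0 \<longrightarrow> i \<noteq> m \<longrightarrow> w i = lc (v i)) \<and> w m = lc (v m) \<oplus>\<^bsub>L\<^esub> LX"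
proof -
 interpret L: field L by (rule laurent_field)
 let ?Q = "ext lc q" and ?e = "uvec L 0"
 have sQ: "sform L ?Q" using s by simp
 define w where "w = vadd L (\<lambda>i. lc (v i)) (smul L LX (uvec L m))"
 have lv: "(\<lambda>i. lc (v i)) \<in> vec L" using v(1) by (intro vecI) simp
 have w: "w \<in> vec L" using lv by (simp add: w_def)
 have X0: "LX 0 = \<zero>" "van R 0 LX" "van R 0 (\<zero>\<^bsub>L\<^esub>)" "\<zero>\<^bsub>L\<^esub> 0 = \<zero>"
  by (auto simp: laurent_var_def laurent_zero)
 have w0: "w i 0 = v i" "van R 0 (w i)" for i
  using v(1) X0 by (auto simp: w_def vadd_def smul_def uvec_def laurent_add laurent_const_def)
 have e0: "van R 0 (?e i)" "?e i 0 = uvec R 0 i" for i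
  using X0 by (auto simp: uvec_def laurent_one single_def)
 let ?a = "bilin L ?Q ?e ?e" and ?b = "bilin L ?Q w ?e" and ?n = "bilin L ?Q w w"
 have abn [simp]: "?a \<in> carrier L" "?b \<in> carrier L" "?n \<in> carrier L" using sQ w by auto
 have a: "van R 0 ?a" using laurent_bilin(1)[OF s _ _ e0(1) e0(1)] by simp
 have b: "van R 0 ?b" using laurent_bilin(1)[OF s w _ w0(2) e0(1)] by simp
 have b0: "?b 0 = bilin R q v (uvec R 0)" using laurent_bilin(2)[OF s w _ w0(2) e0(1)] by (simp add: w0 e0)
 have n: "van R 0 ?n" using laurent_bilin(1)[OF s w w w0(2) w0(2)] by simp
 have n0: "?n 0 = \<zero>" using laurent_bilin(2)[OF s w w w0(2) w0(2)] v(2) by (simp add: w0)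
 have n1: "van R 1 ?n" using n n0 by (metis int_one_le_iff_zero_less linorder_less_linear linorder_not_less)
 have bc: "?b 0 \<in> carrier R" using s v by (simp add: b0)
 have u0: "(?b \<oplus>\<^bsub>L\<^esub> ?b) 0 \<noteq> \<zero>" using double_zero[OF bc] v(3) b0 by (auto simp: laurent_add)
 have uv: "van R 0 (?b \<oplus>\<^bsub>L\<^esub> ?b)" using b by (simp add: laurent_add)
 have nn: "van R 1 (\<ominus>\<^bsub>L\<^esub> ?n)" using n1 by (simp add: laurent_neg)
 obtain g where g: "g \<in> carrier L" "van R 1 g"
  "(?b \<oplus>\<^bsub>L\<^esub> ?b) \<otimes>\<^bsub>L\<^esub> g \<oplus>\<^bsub>L\<^esub> ?a \<otimes>\<^bsub>L\<^esub> g \<otimes>\<^bsub>L\<^esub> g = \<ominus>\<^bsub>L\<^esub> ?n"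
  using laurent_hensel[OF _ uv u0 _ a _ nn] by auto
 let ?w = "vadd L w (smul L g ?e)"
 have "bilin L ?Q ?w ?w = (?n \<oplus>\<^bsub>L\<^esub> g \<otimes>\<^bsub>L\<^esub> ?b) \<oplus>\<^bsub>L\<^esub> g \<otimes>\<^bsub>L\<^esub> (?b \<oplus>\<^bsub>L\<^esub> g \<otimes>\<^bsub>L\<^esub> ?a)"
  using sQ w g(1) by (simp add: L.bilin_add_left L.bilin_add_right L.bilin_smul_left L.bilin_smul_right L.bilin_sym[of ?Q ?e w])
 also have "\<dots> = ?n \<oplus>\<^bsub>L\<^esub> ((?b \<oplus>\<^bsub>L\<^esub> ?b) \<otimes>\<^bsub>L\<^esub> g \<oplus>\<^bsub>L\<^esub> ?a \<otimes>\<^bsub>L\<^esub> g \<otimes>\<^bsub>L\<^esub> g)"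
  using g(1) by (simp add: L.l_distr L.r_distr L.m_ac L.a_ac)
 also have "\<dots> = \<zero>\<^bsub>L\<^esub>" unfolding g(3) by (simp add: L.r_neg)
 finally have 1: "bilin L ?Q ?w ?w = \<zero>\<^bsub>L\<^esub>" .
 have "bilin L ?Q ?w ?e = ?b \<oplus>\<^bsub>L\<^esub> g \<otimes>\<^bsub>L\<^esub> ?a"
  using sQ w g(1) by (simp add: L.bilin_add_left L.bilin_smul_left)
 moreover have "(g \<otimes>\<^bsub>L\<^esub> ?a) 0 = \<zero>"
 proof -
  have "van R 0 g" "g 0 = \<zero>" using g(2) by auto
  hence "(g \<otimes>\<^bsub>L\<^esub> ?a) (0 + 0) = g 0 \<otimes> ?a 0"
   using a g(1) abn(1) by (intro lead_mult) (auto simp: laurent_carrier)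
  thus ?thesis using \<open>g 0 = \<zero>\<close> abn(1) by (auto simp: laurent_carrier)
 qed
 ultimately have "bilin L ?Q ?w ?e 0 = ?b 0" using bc by (simp add: laurent_add)
 hence "bilin L ?Q ?w ?e \<noteq> \<zero>\<^bsub>L\<^esub>" using v(3) b0 X0(4) by metis
 moreover have "?w i = lc (v i)" if "i \<noteq> 0" "i \<noteq> m" for i
  using that g(1) v(1) by (simp add: vadd_def smul_def uvec_def w_def)
 moreover have "?w m = lc (v m) \<oplus>\<^bsub>L\<^esub> LX"
  using m g(1) v(1) by (simp add: vadd_def smul_def uvec_def w_def)
 ultimately show ?thesis using 1 w g(1) by (intro bexI[of _ ?w]) auto
qed

text \<open>Each stage frees one more coordinate by \<open>conic_step\<close>; nonorthogonality to
  the basis vector 0 is carried along because the next stage needs it. Independence is over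
  \<open>K\<close>, not over the field \<open>M\<close> in which the initial zero lives.\<close>

lemma generic_tower_zero:
 fixes K :: "('a, 'b) ring_scheme" and M :: "('m, 'n) ring_scheme"
 assumes "field K" "field2 M" "h \<in> ring_hom K M" "sform K q"
  and v: "v \<in> vec M" "bilin M (ext h q) v v = \<zero>\<^bsub>M\<^esub>" "bilin M (ext h q) v (uvec M 0) \<noteq> \<zero>\<^bsub>M\<^esub>"
  and n: "n < qdim q"
 shows "\<exists>w\<in>vec (iterated_laurent M n).
  bilin (iterated_laurent M n) (ext (\<lambda>a. iterated_laurent_const M n (h a)) q) w w = \<zero>\<^bsub>iterated_laurent M n\<^esub> \<and>
  bilin (iterated_laurent M n) (ext (\<lambda>a. iterated_laurent_const M n (h a)) q) w
   (uvec (iterated_laurent M n) 0) \<noteq> \<zero>\<^bsub>iterated_laurent M n\<^esub> \<and>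
  poly_eval.indep K (iterated_laurent M n) (\<lambda>a. iterated_laurent_const M n (h a)) (qdim q) w {1..n}"
 using n
proof (induction n)
 interpret M: field2 M by fact
 have sM: "sform M (ext h q)" by (rule sform_ext[OF assms(3,4)])
 note img = bilin_extend uvec_def
 have uv: "uvec N' i = (\<lambda>k. j (uvec N i k))" if "field N" "field N'" "j \<in> ring_hom N N'"
  for N :: "('p, 'r) ring_scheme" and N' :: "('s, 't) ring_scheme" and i :: nat and j
  using that field_hom_zero_iff[OF that ring.ring_simprules(2)[OF cring.axioms(1)[OF field.axioms(1)[THEN domain.axioms(1)]]]]
  by (auto simp: uvec_def fun_eq_iff ring_hom_one)
 {
  case 0
  let ?T = "iterated_laurent M 0" and ?k = "iterated_laurent_const M 0"
  interpret T: field ?T by (rule tower_field[OF M.field_axioms])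
  have k: "?k \<in> ring_hom M ?T" by (rule tower_const_hom[OF M.field_axioms])
  let ?w = "\<lambda>i. ?k (v i)"
  have w: "?w \<in> vec ?T" using v(1) by (intro vecI ring_hom_closed[OF k]) simp
  have "bilin ?T (ext ?k (ext h q)) ?w ?w = ?k (bilin M (ext h q) v v)"
   by (rule bilin_extend[OF M.cring_axioms T.cring_axioms k sM v(1) v(1)])
  moreover have "bilin ?T (ext ?k (ext h q)) ?w (uvec ?T 0) = ?k (bilin M (ext h q) v (uvec M 0))"
   unfolding uv[OF M.field_axioms T.field_axioms k]
   by (rule bilin_extend[OF M.cring_axioms T.cring_axioms k sM v(1)]) simp
  moreover have "poly_eval.indep K ?T (\<lambda>a. ?k (h a)) (qdim q) ?w {1..0}"
   using indep_empty[OF assms(1) T.field_axioms ring_hom_comp[OF assms(3) k] w] by simp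
  ultimately show ?case
   using w v field_hom_zero_iff[OF M.field_axioms T.field_axioms k] M.bilin_closed[OF sM v(1)] M.zero_closed M.uvec_vec
   unfolding extend_extend by (metis (no_types, lifting))
 next
  case (Suc n)
  let ?T = "iterated_laurent M n" and ?k = "\<lambda>a. iterated_laurent_const M n (h a)"
  let ?T' = "iterated_laurent M (Suc n)" and ?L = "laurent_ring ?T"
  have T: "field ?T" "field ?T'" by (rule tower_field[OF M.field_axioms])+
  have T2: "field2 ?T" by (rule field2_hom[OF assms(2) T(1) tower_const_hom[OF M.field_axioms]])
  interpret T: field2 ?T by (rule T2)
  interpret T': field ?T' by (rule T(2))
  interpret L: field ?L by (rule T.laurent_field)
  have k: "?k \<in> ring_hom K ?T" by (rule ring_hom_comp[OF assms(3) tower_const_hom[OF M.field_axioms]])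
  have sT: "sform ?T (ext ?k q)" by (rule sform_ext[OF k assms(4)])
  have j: "Series \<in> ring_hom ?L ?T'" using tower_step_hom[OF M.field_axioms] by simp
  obtain v where v: "v \<in> vec ?T" "bilin ?T (ext ?k q) v v = \<zero>\<^bsub>?T\<^esub>"
   "bilin ?T (ext ?k q) v (uvec ?T 0) \<noteq> \<zero>\<^bsub>?T\<^esub>"
   "poly_eval.indep K ?T ?k (qdim q) v {1..n}"
   using Suc by auto
  let ?c = "laurent_const ?T" let ?Q = "ext ?c (ext ?k q)"
  obtain w where w: "w \<in> vec ?L" "bilin ?L ?Q w w = \<zero>\<^bsub>?L\<^esub>" "bilin ?L ?Q w (uvec ?L 0) \<noteq> \<zero>\<^bsub>?L\<^esub>"
   "\<And>i. i \<noteq> 0 \<Longrightarrow> i \<noteq> Suc n \<Longrightarrow> w i = ?c (v i)" "w (Suc n) = ?c (v (Suc n)) \<oplus>\<^bsub>?L\<^esub> laurent_var ?T"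
   using T.conic_step[OF sT v(1-3), of "Suc n"] by auto
  have ind: "poly_eval.indep K ?L (\<lambda>a. ?c (?k a)) (qdim q) w (insert (Suc n) {1..n})"
   using w v(1) Suc.prems by (intro indep_step[OF assms(1) T(1) k v(1,4)]) auto
  have "poly_eval.indep K ?T' (\<lambda>a. Series (?c (?k a))) (qdim q) (\<lambda>i. Series (w i)) (insert (Suc n) {1..n})"
   by (rule indep_hom[OF assms(1) L.field_axioms T(2) ring_hom_comp[OF k T.lc_hom] w(1) j ind])
  hence 1: "poly_eval.indep K ?T' (\<lambda>a. Series (?c (?k a))) (qdim q) (\<lambda>i. Series (w i)) {1..Suc n}"
   by (simp add: atLeastAtMostSuc_conv)
  have sL: "sform ?L ?Q" using sT by simp
  have "bilin ?T' (ext Series ?Q) (\<lambda>i. Series (w i)) (\<lambda>i. Series (w i)) = Series (bilin ?L ?Q w w)"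
   by (rule bilin_extend[OF L.cring_axioms T'.cring_axioms j sL w(1) w(1)])
  moreover have "bilin ?T' (ext Series ?Q) (\<lambda>i. Series (w i)) (uvec ?T' 0) = Series (bilin ?L ?Q w (uvec ?L 0))"
   unfolding uv[OF L.field_axioms T(2) j] by (rule bilin_extend[OF L.cring_axioms T'.cring_axioms j sL w(1)]) simp
  moreover have "(\<lambda>i. Series (w i)) \<in> vec ?T'" using w(1) by (intro vecI ring_hom_closed[OF j]) simp
  moreover have "(\<lambda>a. iterated_laurent_const M (Suc n) (h a)) = (\<lambda>a. Series (?c (?k a)))" by simp
  ultimately show ?case
   using w(2,3) 1 field_hom_zero_iff[OF L.field_axioms T(2) j] L.bilin_closed[OF sL w(1)] L.zero_closed L.uvec_vec w(1)
   unfolding extend_extend by (metis (no_types, lifting))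
 }
qed

text \<open>An isotropic form over \<open>M\<close> has zeros that are generic over a purely transcendental extension, which does
 not change Witt indices; hence the Witt index over the function field is the smallest possible one.\<close>

lemma function_field_special:
 fixes K :: "('a, 'b) ring_scheme" and M :: "('m, 'n) ring_scheme"
 assumes "field K" "field2 M" "h \<in> ring_hom K M" and q: "sform K q" "aniso K q" "2 \<le> qdim q"
  and iso: "\<not> aniso M (ext h q)"
 shows "field2 (function_field K q)" "function_field_embed K q \<in> ring_hom K (function_field K q)"
  "\<not> aniso (function_field K q) (ext (function_field_embed K q) q)"
  "emb (function_field K q) (hyp (function_field K q) m) (ext (function_field_embed K q) q) \<Longrightarrow>
   emb M (hyp M m) (ext h q)"
proof -
 interpret K: field K by fact
 interpret M: field2 M by fact
 let ?F = "function_field K q" and ?e = "function_field_embed K q"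
 define n where "n = qdim q - 1"
 let ?Q = "ext h q" and ?n = n
 let ?T = "iterated_laurent M ?n" and ?\<kappa> = "iterated_laurent_const M ?n"
 let ?k = "\<lambda>a. ?\<kappa> (h a)"
 have Q: "regular M ?Q"
  by (rule regular_extend[OF assms(1) M.field_axioms assms(3) K.aniso_regular[OF q(1,2)]])
 have sQ: "sform M ?Q" by (rule sform_ext[OF assms(3) q(1)])
 have d: "0 < qdim q" using q(3) by simp
 have "gram q 0 0 \<noteq> \<zero>\<^bsub>K\<^esub>"
 proof
  assume "gram q 0 0 = \<zero>\<^bsub>K\<^esub>"
  hence "bilin K q (uvec K 0) (uvec K 0) = \<zero>\<^bsub>K\<^esub>" using K.bilin_uvec[OF q(1) d d] by simp
  hence "uvec K 0 0 = \<zero>\<^bsub>K\<^esub>" using q(2) d unfolding K.aniso_iff[OF q(1)] by (metis K.uvec_vec)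
  thus False by (simp add: uvec_def)
 qed
 hence "h (gram q 0 0) \<noteq> \<zero>\<^bsub>M\<^esub>"
  using field_hom_zero_iff[OF assms(1) M.field_axioms assms(3)] q(1) d by simp
 hence "bilin M ?Q (uvec M 0) (uvec M 0) \<noteq> \<zero>\<^bsub>M\<^esub>"
  using M.bilin_uvec[OF sQ, of 0 0] d by (simp add: extend_form_def)
 then obtain v where v: "v \<in> vec M" "bilin M ?Q v v = \<zero>\<^bsub>M\<^esub>" "bilin M ?Q v (uvec M 0) \<noteq> \<zero>\<^bsub>M\<^esub>"
  using M.isotropic_nonorth[OF Q iso M.uvec_vec] by blast
 have T: "field ?T" by (rule tower_field[OF M.field_axioms])
 have \<kappa>: "?\<kappa> \<in> ring_hom M ?T" by (rule tower_const_hom[OF M.field_axioms])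
 have k: "?k \<in> ring_hom K ?T" by (rule ring_hom_comp[OF assms(3) \<kappa>])
 obtain w where w: "w \<in> vec ?T" "bilin ?T (ext ?k q) w w = \<zero>\<^bsub>?T\<^esub>" "poly_eval.indep K ?T ?k (qdim q) w {1..?n}"
  using generic_tower_zero[OF assms(1-3) q(1) v, of ?n] d by (auto simp: n_def)
 have i: "{1..?n} = {1..<qdim q}" using d by (auto simp: n_def)
 note F = function_field_hom[OF assms(1) T k w(1) q w(2) w(3)[unfolded i]]
 have "field2 K"
 proof unfold_locales
  show "\<one>\<^bsub>K\<^esub> \<oplus>\<^bsub>K\<^esub> \<one>\<^bsub>K\<^esub> \<noteq> \<zero>\<^bsub>K\<^esub>"
  proof
   assume "\<one>\<^bsub>K\<^esub> \<oplus>\<^bsub>K\<^esub> \<one>\<^bsub>K\<^esub> = \<zero>\<^bsub>K\<^esub>"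
   hence "h (\<one>\<^bsub>K\<^esub> \<oplus>\<^bsub>K\<^esub> \<one>\<^bsub>K\<^esub>) = \<zero>\<^bsub>M\<^esub>" using field_hom_zero_iff[OF assms(1) M.field_axioms assms(3)] by simp
   thus False using M.two_nonzero ring_hom_add[OF assms(3), of "\<one>\<^bsub>K\<^esub>" "\<one>\<^bsub>K\<^esub>"] ring_hom_one[OF assms(3)] by simp
  qed
 qed
 from field2_hom[OF this F(1,2)] show F2: "field2 ?F" .
 show "?e \<in> ring_hom K ?F" "\<not> aniso ?F (ext ?e q)" by (rule F)+
 obtain \<sigma> where \<sigma>: "\<sigma> \<in> ring_hom ?F ?T" "\<And>a. a \<in> carrier K \<Longrightarrow> \<sigma> (?e a) = ?k a" using F(4) by blast
 assume e: "emb ?F (hyp ?F m) (ext ?e q)"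
 interpret F: field2 ?F by fact
 have "field2 ?T" by (rule field2_hom[OF assms(2) T \<kappa>])
 then interpret T: field2 ?T .
 have sF: "sform ?F (ext ?e q)" by (rule sform_ext[OF F(2) q(1)])
 have skQ: "sform ?T (ext ?k q)" by (rule sform_ext[OF k q(1)])
 \<comment> \<open>The anisotropic part over \<open>M\<close> stays anisotropic over the tower, so
   the \<open>m\<close> planes found there are bounded by the index \<open>i\<close> over
   \<open>M\<close>.\<close>
 obtain i p where p: "regular M p" "aniso M p" and Qp: "isometric M ?Q (orth M p (hyp M i))"
  using M.witt_decomposition[OF Q] by blast
 have sp: "sform M p" "sform ?T (ext ?\<kappa> p)" using regular_sform[OF p(1)] sform_ext[OF \<kappa>] by blast+
 have sph: "sform M (orth M p (hyp M i))" using sp by simp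
 have "emb ?T (hyp ?T m) (ext \<sigma> (hyp ?F m))"
  by (rule emb_extend_hyp[OF F(1) T \<sigma>(1)])
 moreover have "emb ?T (ext \<sigma> (hyp ?F m)) (ext \<sigma> (ext ?e q))"
  by (rule emb_extend[OF F.cring_axioms T.cring_axioms \<sigma>(1) sF e])
 moreover have "emb ?T (ext \<sigma> (ext ?e q)) (ext ?k q)"
  using q(1) \<sigma>(2) by (intro T.emb_form_eq[OF _ _ skQ]) (auto simp: extend_form_def)
 moreover have "emb ?T (ext ?k q) (ext ?\<kappa> (orth M p (hyp M i)))"
  using emb_extend[OF M.cring_axioms T.cring_axioms \<kappa> sph M.isometric_emb[OF Qp]] by (simp add: extend_extend)
 moreover have "emb ?T (ext ?\<kappa> (orth M p (hyp M i)))
   (orth ?T (ext ?\<kappa> p) (ext ?\<kappa> (hyp M i)))"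
  by (rule emb_extend_orth[OF M.field_axioms T \<kappa> sp(1)]) simp
 moreover have "emb ?T (orth ?T (ext ?\<kappa> p) (ext ?\<kappa> (hyp M i)))
   (orth ?T (ext ?\<kappa> p) (hyp ?T i))"
  using sp by (intro T.emb_orth emb_extend_hyp[OF M.field_axioms T \<kappa>] T.emb_refl) auto
 ultimately have "emb ?T (hyp ?T m) (orth ?T (ext ?\<kappa> p) (hyp ?T i))"
  using T.emb_trans sform_ext[OF \<sigma>(1)] sF skQ sform_ext[OF \<kappa> sph] sp(2) sform_ext[OF \<sigma>(1) F.sform_hyp]
   sform_ext[OF \<kappa> M.sform_hyp] T.sform_orth T.sform_hyp by (metis (no_types, lifting))
 hence "m \<le> i" by (rule T.witt_index_le[OF sp(2) tower_aniso[OF M.field_axioms sp(1) p(2)]])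
 hence "emb M (hyp M m) (hyp M i)" by (rule M.emb_hyp_mono)
 moreover have "emb M (hyp M i) (orth M p (hyp M i))" using sp by (intro M.emb_right) auto
 moreover have "emb M (orth M p (hyp M i)) ?Q"
  by (rule M.isometric_emb[OF M.isometric_sym[OF Qp sph]])
 ultimately show "emb M (hyp M m) ?Q" using M.emb_trans sph sQ by (metis (no_types, lifting))
qed

section \<open>Maximal splitting and Laurent series\<close>

lemma (in cring) emb_orth_shuffle:
 assumes [simp]: "sform R p" "sform R q" "sform R r" "sform R s"
 shows "emb R (orth R (orth R p q) (orth R r s)) (orth R (orth R p r) (orth R q s))"
proof -
 let ?o = "orth R"
 have "emb R (?o q (?o r s)) (?o r (?o s q))"
  by (rule emb_trans[OF emb_orth_comm emb_orth_assoc(1)]) simp_all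
 hence "emb R (?o q (?o r s)) (?o r (?o q s))"
  by (rule emb_trans[OF _ emb_orth[OF emb_refl emb_orth_comm]]) simp_all
 hence "emb R (?o p (?o q (?o r s))) (?o p (?o r (?o q s)))" by (rule emb_orth[OF emb_refl[OF assms(1)]]) simp_all
 hence "emb R (?o p (?o q (?o r s))) (?o (?o p r) (?o q s))"
  by (rule emb_trans[OF _ emb_orth_assoc(2)]) simp_all
 from emb_trans[OF emb_orth_assoc(1) this] show ?thesis by simp
qed

lemma (in field2) emb_scale_hyp_1:
 assumes "c \<in> carrier R"
 shows "emb R (scl R c (hyp R 1)) (hyp R 1)"
proof -
 \<comment> \<open>In the isotropic coordinates \<open>v 0 + v 1\<close> and
   \<open>v 0 - v 1\<close> the map \<open>?f\<close> multiplies the first by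
   \<open>2 b + 1 = c\<close> and fixes the second.\<close>
 define b where "b = half \<otimes> (c \<ominus> \<one>)"
 have b [simp]: "b \<in> carrier R" using assms by (simp add: b_def)
 have "b \<oplus> b = (half \<oplus> half) \<otimes> (c \<ominus> \<one>)" using assms by (simp add: b_def l_distr)
 also have "\<dots> = c \<ominus> \<one>" using assms by (simp add: half_add)
 finally have c: "c = b \<oplus> b \<oplus> \<one>" using assms by (simp add: minus_eq a_assoc l_neg)
 let ?f = "\<lambda>v k :: nat. if k = 0 then (b \<oplus> \<one>) \<otimes> v 0 \<oplus> b \<otimes> v (Suc 0) else b \<otimes> v 0 \<oplus> (b \<oplus> \<one>) \<otimes> v (Suc 0)"
 have id: "((b \<oplus> \<one>) \<otimes> x \<oplus> b \<otimes> y) \<otimes> ((b \<oplus> \<one>) \<otimes> z \<oplus> b \<otimes> t) \<oplus> \<ominus> ((b \<otimes> x \<oplus> (b \<oplus> \<one>) \<otimes> y) \<otimes> (b \<otimes> z \<oplus> (b \<oplus> \<one>) \<otimes> t))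
  = (b \<oplus> b \<oplus> \<one>) \<otimes> (x \<otimes> z \<oplus> \<ominus> (y \<otimes> t))"
  if [simp]: "x \<in> carrier R" "y \<in> carrier R" "z \<in> carrier R" "t \<in> carrier R" for x y z t
  proof -
  have "((b \<oplus> \<one>) \<otimes> x \<oplus> b \<otimes> y) \<otimes> ((b \<oplus> \<one>) \<otimes> z \<oplus> b \<otimes> t) \<oplus> \<ominus> ((b \<otimes> x \<oplus> (b \<oplus> \<one>) \<otimes> y) \<otimes> (b \<otimes> z \<oplus> (b \<oplus> \<one>) \<otimes> t)) =
   (b \<oplus> b \<oplus> \<one>) \<otimes> (x \<otimes> z \<oplus> \<ominus> (y \<otimes> t)) \<oplus>
   ((b \<otimes> b \<otimes> (x \<otimes> z) \<oplus> \<ominus> (b \<otimes> b \<otimes> (x \<otimes> z))) \<oplus> (b \<otimes> b \<otimes> (x \<otimes> t) \<oplus> \<ominus> (b \<otimes> b \<otimes> (x \<otimes> t))) \<oplus>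
    (b \<otimes> (x \<otimes> t) \<oplus> \<ominus> (b \<otimes> (x \<otimes> t))) \<oplus> (b \<otimes> b \<otimes> (y \<otimes> z) \<oplus> \<ominus> (b \<otimes> b \<otimes> (y \<otimes> z))) \<oplus>
    (b \<otimes> (y \<otimes> z) \<oplus> \<ominus> (b \<otimes> (y \<otimes> z))) \<oplus> (b \<otimes> b \<otimes> (y \<otimes> t) \<oplus> \<ominus> (b \<otimes> b \<otimes> (y \<otimes> t))))"
   by (simp add: ring_expand)
  thus ?thesis by (simp add: r_neg)
 qed
 have h: "bilin R (hyp R 1) v w = v 0 \<otimes> w 0 \<oplus> \<ominus> (v (Suc 0) \<otimes> w (Suc 0))"
  if "v \<in> vec R" "w \<in> vec R" for v w
  unfolding hyp_1 using that by (simp add: bilin_diag_Cons bilin_diag_Nil l_minus r_minus)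
 show ?thesis
 proof (rule embI)
  show "sform R (scl R c (hyp R 1))" using assms by (intro sform_scale sform_hyp)
  show fv: "?f v \<in> vec R" if "v \<in> vec R" for v using that by (intro vecI) simp
  fix v w :: "nat \<Rightarrow> 'a" assume v: "v \<in> vec R" "w \<in> vec R"
  show "bilin R (hyp R 1) (?f v) (?f w) = bilin R (scl R c (hyp R 1)) v w"
   unfolding bilin_scale[OF sform_hyp assms v] h[OF v] h[OF fv[OF v(1)] fv[OF v(2)]]
   unfolding c
   using id[of "v 0" "v (Suc 0)" "w 0" "w (Suc 0)"] v by simp
 qed
qed

lemma (in field2) emb_scale_hyp:
 assumes "c \<in> carrier R"
 shows "emb R (scl R c (hyp R i)) (hyp R i)"
proof (induction i)
 case 0 thus ?case by (simp add: hyp_0 emb_def)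
next
 case (Suc i)
 let ?h = "hyp R"
 have "emb R (scl R c (?h (Suc i))) (scl R c (orth R (?h 1) (?h i)))"
  by (rule emb_scale[OF emb_hyp_Suc(1)]) (use assms in "auto intro: sform_orth sform_hyp")
 moreover have "emb R (scl R c (orth R (?h 1) (?h i))) (orth R (scl R c (?h 1)) (scl R c (?h i)))"
  by (rule emb_scale_orth(1)[OF sform_hyp sform_hyp assms])
 moreover have "emb R (orth R (scl R c (?h 1)) (scl R c (?h i))) (orth R (?h 1) (?h i))"
  by (rule emb_orth[OF emb_scale_hyp_1[OF assms] Suc sform_hyp sform_hyp])
 ultimately show ?case using emb_hyp_Suc(2)[of i] emb_trans sform_orth sform_scale sform_hyp assms by metis
qed

lemma (in field2) emb_hyp_scale:
 assumes "c \<in> carrier R" "c \<noteq> \<zero>"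
 shows "emb R (hyp R i) (scl R c (hyp R i))"
proof -
 let ?h = "hyp R i"
 have ci: "c \<otimes> inv c = \<one>" "inv c \<in> carrier R" using assms by auto
 have "emb R ?h (scl R \<one> ?h)" by (rule emb_scale_one(2)[OF sform_hyp])
 moreover have "emb R (scl R \<one> ?h) (scl R c (scl R (inv c) ?h))"
  using emb_scale_scale(2)[OF sform_hyp assms(1) ci(2)] by (simp add: ci(1))
 moreover have "emb R (scl R c (scl R (inv c) ?h)) (scl R c ?h)"
  by (rule emb_scale[OF emb_scale_hyp[OF ci(2)] sform_hyp assms(1)])
 ultimately show ?thesis using emb_trans sform_scale sform_hyp assms(1) ci(2) one_closed by metis
qed

text \<open>Choosing \<open>t = 2 b(w, v) / q(v)\<close> kills the second component of
  \<open>q(w + \<lambda> v)\<close>, and the hypothesis on \<open>x\<close> kills the first. The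
  extension is a field because \<open>q(w + r v) = (r\<^sup>2 + t r - x) q(v)\<close>: a root
  \<open>r\<close> would give a nonzero isotropic vector over the base.\<close>

lemma (in field2) quad_ext_isotropic:
 assumes s: "sform R q" and an: "aniso R q" and v: "v \<in> vec R" "w \<in> vec R" and d: "0 < qdim q"
  and ind: "\<And>r. r \<in> carrier R \<Longrightarrow> \<exists>i<qdim q. w i \<oplus> r \<otimes> v i \<noteq> \<zero>"
  and x: "x \<in> carrier R" "bilin R q w w \<oplus> x \<otimes> bilin R q v v = \<zero>" and v0: "bilin R q v v \<noteq> \<zero>"
 shows "\<exists>t\<in>carrier R. field (quad_ext R t x) \<and> \<not> aniso (quad_ext R t x) (ext (\<lambda>a. (a, \<zero>)) q)"
proof -
 let ?a = "bilin R q v v" and ?b = "bilin R q w v" and ?n = "bilin R q w w"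
 have abn [simp]: "?a \<in> carrier R" "?b \<in> carrier R" "?n \<in> carrier R" using s v by auto
 define t where "t = (?b \<oplus> ?b) \<otimes> inv ?a"
 have t: "t \<in> carrier R" using v0 by (simp add: t_def)
 have ta: "t \<otimes> ?a = ?b \<oplus> ?b" using v0 by (simp add: t_def m_assoc)
 have n: "?n = \<ominus> (x \<otimes> ?a)" using x by (intro minus_equality[symmetric]) (auto simp: a_comm)
 have F: "field (quad_ext R t x)"
 proof (rule quad_ext_field[OF x(1) t])
  fix r assume r: "r \<in> carrier R"
  show "r \<otimes> r \<oplus> t \<otimes> r \<ominus> x \<noteq> \<zero>"
  proof
   assume z: "r \<otimes> r \<oplus> t \<otimes> r \<ominus> x = \<zero>"
   let ?u = "vadd R w (smul R r v)"
   have "bilin R q ?u ?u = (?n \<oplus> r \<otimes> ?b) \<oplus> r \<otimes> (?b \<oplus> r \<otimes> ?a)"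
    using s v r by (simp add: bilin_add_left bilin_add_right bilin_smul_left bilin_smul_right bilin_sym[of q v w])
   also have "\<dots> = ?n \<oplus> r \<otimes> ((?b \<oplus> ?b) \<oplus> r \<otimes> ?a)" using r by (simp add: r_distr a_ac)
   also have "\<dots> = (r \<otimes> r \<oplus> t \<otimes> r \<ominus> x) \<otimes> ?a"
    unfolding ta[symmetric] n using r t x(1) by (simp add: r_distr l_distr minus_eq l_minus m_ac a_ac)
   finally have "bilin R q ?u ?u = \<zero>" using z by simp
   moreover have "?u \<in> vec R" using v r by simp
   ultimately have "\<forall>i<qdim q. ?u i = \<zero>" using an unfolding aniso_iff[OF s] by blast
   thus False using ind[OF r] by (auto simp: vadd_def smul_def)
  qed
 qed
 interpret Q: field "quad_ext R t x" by (rule F)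
 let ?Q = "ext (\<lambda>a. (a, \<zero>)) q"
 have sQ: "sform (quad_ext R t x) ?Q" by (rule sform_ext[OF quad_ext_hom[OF x(1) t] s])
 have "\<not> aniso (quad_ext R t x) ?Q"
 proof
  assume an: "aniso (quad_ext R t x) ?Q"
  have "bilin (quad_ext R t x) ?Q (\<lambda>i. (w i, v i)) (\<lambda>i. (w i, v i)) = (?n \<oplus> x \<otimes> ?a, ?b \<oplus> bilin R q v w \<ominus> t \<otimes> ?a)"
   by (rule bilin_quad_ext[OF x(1) t s v(2,1,2,1)])
  also have "\<dots> = \<zero>\<^bsub>quad_ext R t x\<^esub>"
   using x(2) s v by (simp add: ta bilin_sym[of q v w] minus_eq r_neg)
  finally have z: "bilin (quad_ext R t x) ?Q (\<lambda>i. (w i, v i)) (\<lambda>i. (w i, v i)) = \<zero>\<^bsub>quad_ext R t x\<^esub>" .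
  have "(\<lambda>i. (w i, v i)) \<in> vec (quad_ext R t x)" using v by (intro vecI) simp
  hence "\<forall>i<qdim q. v i = \<zero>" using an z unfolding Q.aniso_iff[OF sQ] by fastforce
  thus False using v0 bilin_zero_left[OF s v(1), of v] by blast
 qed
 thus ?thesis using t F by blast
qed

lemma (in field2) uvec_indep:
 assumes "v i \<noteq> \<zero>" "v \<in> vec R" "j \<noteq> i" "j < d" "i < d" "r \<in> carrier R"
 shows "\<exists>k<d. uvec R j k \<oplus> r \<otimes> v k \<noteq> \<zero>"
proof (cases "r = \<zero>")
 case True thus ?thesis using assms by (intro exI[of _ j]) (simp add: uvec_def)
next
 case False thus ?thesis using assms by (intro exI[of _ i]) (simp add: uvec_def integral_iff)
qed

text \<open>Two basis vectors suffice, with \<open>x\<close> solved from their values. Some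
  extension that makes the form isotropic must be known before \<open>function_field_special\<close>
  says anything about the function field.\<close>

lemma (in field2) isotropic_extension:
 assumes s: "sform R q" and an: "aniso R q" and d: "2 \<le> qdim q"
 shows "\<exists>t\<in>carrier R. \<exists>x\<in>carrier R. field (quad_ext R t x) \<and> \<not> aniso (quad_ext R t x) (ext (\<lambda>a. (a, \<zero>)) q)"
proof -
 let ?v = "uvec R 0" and ?w = "uvec R 1"
 have v0: "bilin R q ?v ?v \<noteq> \<zero>"
 proof
  assume "bilin R q ?v ?v = \<zero>"
  hence "?v 0 = \<zero>" using an d unfolding aniso_iff[OF s] by (metis uvec_vec less_le_trans zero_less_numeral)
  thus False by (simp add: uvec_def)
 qed
 define x where "x = \<ominus> (bilin R q ?w ?w \<otimes> inv (bilin R q ?v ?v))"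
 have x: "x \<in> carrier R" using s v0 by (simp add: x_def)
 have "x \<otimes> bilin R q ?v ?v = \<ominus> bilin R q ?w ?w" using s v0 by (simp add: x_def l_minus m_assoc)
 hence "bilin R q ?w ?w \<oplus> x \<otimes> bilin R q ?v ?v = \<zero>" using s by (simp add: r_neg)
 thus ?thesis
  using quad_ext_isotropic[OF s an uvec_vec uvec_vec _ uvec_indep[of ?v 0 1 "qdim q"] x _ v0] d x
  by (fastforce simp: uvec_def)
qed

text \<open>If \<open>q(u) = -g q(v)\<close> with \<open>u\<close>, \<open>v\<close> dependent, replace \<open>u\<close> by its image under a reflection.\<close>

lemma (in field2) isotropic_sum_quad_ext:
 assumes s: "sform R q" and an: "aniso R q" and d: "2 \<le> qdim q" and g: "g \<in> carrier R" "g \<noteq> \<zero>"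
  and iso: "\<not> aniso R (orth R q (scl R g q))"
 shows "\<exists>t\<in>carrier R. field (quad_ext R t g) \<and> \<not> aniso (quad_ext R t g) (ext (\<lambda>a. (a, \<zero>)) q)"
proof -
 let ?S = "orth R q (scl R g q)"
 have sS: "sform R ?S" using s g by simp
 obtain z k where z: "z \<in> vec R" "bilin R ?S z z = \<zero>" "k < qdim ?S" "z k \<noteq> \<zero>"
  using iso unfolding aniso_iff[OF sS] by blast
 define v where "v = (\<lambda>i. z (i + qdim q))"
 have v: "v \<in> vec R" using z(1) by (simp add: v_def)
 have zv: "bilin R q z z \<oplus> g \<otimes> bilin R q v v = \<zero>"
  using z s g v by (simp add: bilin_orth bilin_scale v_def)
 have v0: "bilin R q v v \<noteq> \<zero>"
 proof
  assume v0: "bilin R q v v = \<zero>"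
  hence "bilin R q z z = \<zero>" using zv z(1) s g by simp
  hence "\<forall>i<qdim q. z i = \<zero>" "\<forall>i<qdim q. v i = \<zero>" using an v0 v z(1) unfolding aniso_iff[OF s] by blast+
  moreover have "k < qdim q \<or> (k - qdim q < qdim q \<and> k = (k - qdim q) + qdim q)" using z(3) by auto
  ultimately show False using z(4) unfolding v_def by metis
 qed
 obtain i where i: "i < qdim q" "v i \<noteq> \<zero>" using v0 bilin_zero_left[OF s v, of v] by blast
 show ?thesis
 proof (cases "\<forall>r\<in>carrier R. \<exists>i<qdim q. z i \<oplus> r \<otimes> v i \<noteq> \<zero>")
  case True
  thus ?thesis using quad_ext_isotropic[OF s an v z(1) _ _ g(1) zv v0] d by fastforce
 next
  case False
  then obtain r where r: "r \<in> carrier R" "\<And>i. i < qdim q \<Longrightarrow> z i \<oplus> r \<otimes> v i = \<zero>" by blast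
  have "z i = \<ominus> r \<otimes> v i" if "i < qdim q" for i
   using r(2)[OF that] r(1) z(1) v by (simp add: l_minus sum_zero_eq_neg)
  hence "bilin R q z z = bilin R q (smul R (\<ominus> r) v) (smul R (\<ominus> r) v)"
   using s v r(1) by (intro bilin_cong) (auto simp: smul_def)
  also have "\<dots> = r \<otimes> (r \<otimes> bilin R q v v)"
   using s v r(1) by (simp add: bilin_smul_left bilin_smul_right l_minus r_minus)
  finally have zr: "bilin R q z z = r \<otimes> (r \<otimes> bilin R q v v)" .
  have r0: "r \<noteq> \<zero>" using zv zr g v0 s v by (auto simp: integral_iff)
  obtain j where j: "j < qdim q" "j \<noteq> i"
   using d i(1) by (metis One_nat_def Suc_1 Suc_le_lessD less_le_trans not_numeral_le_zero zero_neq_one lessI zero_less_Suc)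
  \<comment> \<open>The axis of the reflection must be neither orthogonal nor proportional to
    \<open>v\<close>: a basis vector with index different from \<open>i\<close>, or its sum with
    \<open>v\<close>.\<close>
  obtain w where w: "w \<in> vec R" "bilin R q v w \<noteq> \<zero>" "\<And>r. r \<in> carrier R \<Longrightarrow> \<exists>k<qdim q. w k \<oplus> r \<otimes> v k \<noteq> \<zero>"
  proof (cases "bilin R q v (uvec R j) = \<zero>")
   case True
   have "\<exists>k<qdim q. vadd R (uvec R j) v k \<oplus> r \<otimes> v k \<noteq> \<zero>" if r: "r \<in> carrier R" for r
   proof -
    have "vadd R (uvec R j) v k \<oplus> r \<otimes> v k = uvec R j k \<oplus> (\<one> \<oplus> r) \<otimes> v k" for k
     using v r by (simp add: vadd_def l_distr a_assoc)
    thus ?thesis using uvec_indep[of v i j "qdim q" "\<one> \<oplus> r"] i j v r by simp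
   qed
   moreover have "bilin R q v (vadd R (uvec R j) v) \<noteq> \<zero>" using True s v v0 by (simp add: bilin_add_right)
   ultimately show ?thesis using v by (intro that[of "vadd R (uvec R j) v"]) auto
  next
   case False thus ?thesis using uvec_indep[of v i j "qdim q"] i j v by (intro that[of "uvec R j"]) auto
  qed
  have w0: "bilin R q w w \<noteq> \<zero>"
  proof
   assume "bilin R q w w = \<zero>"
   hence "\<forall>i<qdim q. w i = \<zero>" using an w(1) unfolding aniso_iff[OF s] by blast
   thus False using w(3)[of \<zero>] v w(1) by auto
  qed
  let ?a = "bilin R q v v" and ?b = "bilin R q v w" and ?n = "bilin R q w w"
  have abn [simp]: "?a \<in> carrier R" "?b \<in> carrier R" "?n \<in> carrier R" using s v w by auto
  define e where "e = (?b \<oplus> ?b) \<otimes> inv ?n"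
  have e: "e \<in> carrier R" using w0 by (simp add: e_def)
  have en: "e \<otimes> ?n = ?b \<oplus> ?b" using w0 by (simp add: e_def m_assoc)
  have b0: "?b \<oplus> ?b \<noteq> \<zero>" using double_zero[of ?b] w(2) by auto
  have e0: "e \<noteq> \<zero>" using b0 w0 by (auto simp: e_def integral_iff)
  \<comment> \<open>\<open>u\<close> is \<open>r\<close> times the image of \<open>v\<close> under
    the reflection in \<open>w\<close>. The vector \<open>z\<close> is \<open>- r v\<close> on the
    coordinates of \<open>q\<close>, so both have the same value.\<close>
  define u where "u = smul R r (vadd R v (smul R (\<ominus> e) w))"
  have u: "u \<in> vec R" using v w r e by (simp add: u_def)
  have vw: "vadd R v (smul R (\<ominus> e) w) \<in> vec R" using v w e by simp
  have "bilin R q u u = r \<otimes> (r \<otimes> bilin R q (vadd R v (smul R (\<ominus> e) w)) (vadd R v (smul R (\<ominus> e) w)))"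
   using s r vw unfolding u_def by (simp add: bilin_smul_left bilin_smul_right)
  also have "\<dots> = r \<otimes> (r \<otimes> ((?a \<oplus> \<ominus> e \<otimes> ?b) \<oplus> \<ominus> e \<otimes> (?b \<oplus> \<ominus> e \<otimes> ?n)))"
   using s v w r e
   by (simp add: bilin_add_left bilin_add_right bilin_smul_left bilin_smul_right bilin_sym[of q w v])
  also have "(?a \<oplus> \<ominus> e \<otimes> ?b) \<oplus> \<ominus> e \<otimes> (?b \<oplus> \<ominus> e \<otimes> ?n) = ?a"
  proof -
   have id: "(a \<oplus> \<ominus> e \<otimes> b) \<oplus> \<ominus> e \<otimes> (b \<oplus> \<ominus> y) = a \<oplus> e \<otimes> (y \<ominus> (b \<oplus> b))"
    if [simp]: "a \<in> carrier R" "b \<in> carrier R" "y \<in> carrier R" "e \<in> carrier R" for a b y e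
    by (simp add: ring_expand)
   have "\<ominus> e \<otimes> ?n = \<ominus> (?b \<oplus> ?b)" using e by (simp add: l_minus en)
   hence "(?a \<oplus> \<ominus> e \<otimes> ?b) \<oplus> \<ominus> e \<otimes> (?b \<oplus> \<ominus> e \<otimes> ?n) = ?a \<oplus> e \<otimes> ((?b \<oplus> ?b) \<ominus> (?b \<oplus> ?b))"
    using id[of ?a ?b "?b \<oplus> ?b" e] e by simp
   also have "(?b \<oplus> ?b) \<ominus> (?b \<oplus> ?b) = \<zero>" by (simp add: minus_eq r_neg)
   finally show ?thesis using e by simp
  qed
  finally have "bilin R q u u = bilin R q z z" using zr by simp
  hence uv: "bilin R q u u \<oplus> g \<otimes> bilin R q v v = \<zero>" using zv by simp
  \<comment> \<open>\<open>u\<close> has component \<open>- r e\<close> along \<open>w\<close>,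
    which is nonzero; a relation between \<open>u\<close> and \<open>v\<close> would therefore make
    \<open>w\<close> a multiple of \<open>v\<close>.\<close>
  have ind: "\<exists>i<qdim q. u i \<oplus> t \<otimes> v i \<noteq> \<zero>" if t: "t \<in> carrier R" for t
  proof -
   let ?c = "r \<otimes> e"
   have c: "?c \<in> carrier R" "?c \<noteq> \<zero>" using r e r0 e0 by (auto simp: integral_iff)
   let ?m = "\<ominus> (inv ?c \<otimes> (r \<oplus> t))"
   obtain k where k: "k < qdim q" "w k \<oplus> ?m \<otimes> v k \<noteq> \<zero>" using w(3)[of ?m] c r t by auto
   have id: "r \<otimes> (x \<oplus> \<ominus> e \<otimes> y) \<oplus> t \<otimes> x = \<ominus> (r \<otimes> e \<otimes> y) \<oplus> (r \<oplus> t) \<otimes> x"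
    if [simp]: "x \<in> carrier R" "y \<in> carrier R" "r \<in> carrier R" "e \<in> carrier R" "t \<in> carrier R" for x y r e t
    by (simp add: ring_expand)
   have "u k \<oplus> t \<otimes> v k = \<ominus> (?c \<otimes> w k) \<oplus> (r \<oplus> t) \<otimes> v k"
    unfolding u_def vadd_def smul_def using id[of "v k" "w k" r e t] v w r e t by simp
   also have "\<dots> = \<ominus> (?c \<otimes> (w k \<oplus> ?m \<otimes> v k))"
   proof -
    have id2: "c \<otimes> (\<ominus> (i \<otimes> y) \<otimes> x) = \<ominus> ((c \<otimes> i) \<otimes> (y \<otimes> x))"
     if [simp]: "c \<in> carrier R" "i \<in> carrier R" "y \<in> carrier R" "x \<in> carrier R" for c i y x
     by (simp add: ring_expand)
    have "?c \<otimes> (?m \<otimes> v k) = \<ominus> ((?c \<otimes> inv ?c) \<otimes> ((r \<oplus> t) \<otimes> v k))"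
     by (rule id2) (use c r t v in auto)
    also have "\<dots> = \<ominus> ((r \<oplus> t) \<otimes> v k)" unfolding inv_r_field[OF c] using r t v by simp
    finally show ?thesis using c r t v w by (simp add: r_distr minus_add)
   qed
   finally have "u k \<oplus> t \<otimes> v k = \<ominus> (?c \<otimes> (w k \<oplus> ?m \<otimes> v k))" .
   moreover have "?c \<otimes> (w k \<oplus> ?m \<otimes> v k) \<noteq> \<zero>" using c k r t v w by (auto simp: integral_iff)
   moreover have "?c \<otimes> (w k \<oplus> ?m \<otimes> v k) \<in> carrier R" using c r t v w by simp
   ultimately show ?thesis using k(1) by (metis minus_minus minus_zero)
  qed
  have "0 < qdim q" using d by simp
  from quad_ext_isotropic[OF s an v u this ind g(1) uv v0] show ?thesis .
 qed
qed

section \<open>First Witt indices through embeddings\<close>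

lemma (in field2) function_field_props:
 assumes "sform R q" "aniso R q" "2 \<le> qdim q"
 shows "field2 (function_field R q)" "function_field_embed R q \<in> ring_hom R (function_field R q)"
  "\<not> aniso (function_field R q) (ext (function_field_embed R q) q)"
proof -
 obtain t x where tx: "t \<in> carrier R" "x \<in> carrier R" "field (quad_ext R t x)"
  "\<not> aniso (quad_ext R t x) (ext (\<lambda>a. (a, \<zero>)) q)" using isotropic_extension[OF assms] by blast
 have "field2 (quad_ext R t x)" by (rule field2_hom[OF field2_axioms tx(3) quad_ext_hom[OF tx(2,1)]])
 note G = function_field_special[OF field_axioms this quad_ext_hom[OF tx(2,1)] assms tx(4)]
 show "field2 (function_field R q)" "function_field_embed R q \<in> ring_hom R (function_field R q)"
  "\<not> aniso (function_field R q) (ext (function_field_embed R q) q)" by (rule G)+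
qed

lemma (in field2) first_witt_index_iff:
 assumes "sform R q" "aniso R q" "2 \<le> qdim q"
 shows "m \<le> first_witt_index R q \<longleftrightarrow>
  emb (function_field R q) (hyp (function_field R q) m) (ext (function_field_embed R q) q)"
proof -
 interpret F: field2 "function_field R q" by (rule function_field_props[OF assms])
 show ?thesis unfolding first_witt_index_def
  by (rule F.witt_index_iff[OF regular_extend[OF field_axioms F.field_axioms function_field_props(2)[OF assms]
   aniso_regular[OF assms(1,2)]]])
qed

lemma (in field2) first_witt_index_specialise:
 fixes M :: "('m, 'n) ring_scheme"
 assumes q: "sform R q" "aniso R q" "2 \<le> qdim q"
  and "field2 M" "h \<in> ring_hom R M" "\<not> aniso M (ext h q)"
 shows "emb M (hyp M (first_witt_index R q)) (ext h q)"
 using function_field_special(4)[OF field_axioms assms(4,5) q assms(6)] first_witt_index_iff[OF q] by blast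

lemma not_aniso_emb:
 assumes "field M" "emb M p q" "sform M q" "regular M p" "\<not> aniso M p"
 shows "\<not> aniso M q"
proof -
 interpret M: field M by fact
 show ?thesis using M.aniso_emb assms by blast
qed

text \<open>The function field of \<open>r\<close> makes \<open>r\<close> isotropic, hence also
  \<open>p\<close>, which embeds mutually with it; there the index is at least the minimal one of
  \<open>p\<close>.\<close>

lemma first_witt_index_mono:
 fixes K :: "('a, 'b) ring_scheme" and N :: "('m, 'n) ring_scheme"
 assumes "field2 K" "field2 N" "j \<in> ring_hom K N"
  and p: "sform K p" "aniso K p" "2 \<le> qdim p" and r: "sform N r" "aniso N r" "2 \<le> qdim r"
  and e: "emb N (ext j p) r" "emb N r (ext j p)"
 shows "first_witt_index K p \<le> first_witt_index N r"
proof -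
 interpret K: field2 K by fact
 interpret N: field2 N by fact
 let ?F = "function_field N r" and ?e = "function_field_embed N r"
 interpret F: field2 ?F by (rule N.function_field_props[OF r])
 note he = N.function_field_props(2)[OF r]
 have sj: "sform N (ext j p)" by (rule sform_ext[OF assms(3) p(1)])
 have s: "sform ?F (ext ?e r)" "sform ?F (ext ?e (ext j p))"
  by (rule sform_ext[OF he r(1)], rule sform_ext[OF he sj])
 have reg: "regular ?F (ext ?e r)"
  by (rule regular_extend[OF N.field_axioms F.field_axioms he N.aniso_regular[OF r(1,2)]])
 have "\<not> aniso ?F (ext ?e (ext j p))"
  by (rule not_aniso_emb[OF F.field_axioms emb_extend[OF N.cring_axioms F.cring_axioms he sj e(2)] s(2) reg
    N.function_field_props(3)[OF r]])
 hence "emb ?F (hyp ?F (first_witt_index K p)) (ext ?e (ext j p))"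
  unfolding extend_extend
  by (rule K.first_witt_index_specialise[OF p F.field2_axioms ring_hom_comp[OF assms(3) he]])
 from F.emb_trans[OF this emb_extend[OF N.cring_axioms F.cring_axioms he r(1) e(1)] s(1)]
 show ?thesis unfolding N.first_witt_index_iff[OF r] .
qed

lemma emb_extend_laurent_sum:
 assumes "field K" "field E" "e \<in> ring_hom (laurent_ring K) E" and s: "sform K p" "sform K r"
 defines "g \<equiv> (\<lambda>a. e (laurent_const K a))"
 shows "emb E (ext e (cring.laurent_sum K p r))
   (orth E (ext g p) (scl E (e (laurent_var K)) (ext g r)))"
  and "emb E (orth E (ext g p) (scl E (e (laurent_var K)) (ext g r)))
   (ext e (cring.laurent_sum K p r))"
proof -
 interpret K: field K by fact
 interpret E: field E by fact
 let ?L = "laurent_ring K" and ?c = "laurent_const K" and ?X = "laurent_var K"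
 interpret L: field ?L by (rule K.laurent_field)
 have sl: "sform ?L (ext ?c p)" "sform ?L (ext ?c r)" "sform ?L (scl ?L ?X (ext ?c r))"
  using s by auto
 have eX: "e ?X \<in> carrier E" by (rule ring_hom_closed[OF assms(3)]) simp
 have g: "ext e (ext ?c p) = ext g p" "ext e (ext ?c r) = ext g r"
  by (simp_all add: extend_extend g_def)
 have sg: "sform E (ext g p)" "sform E (ext g r)"
  unfolding g[symmetric] by (rule sform_ext[OF assms(3)], rule sl)+
 have sx: "sform E (ext e (scl ?L ?X (ext ?c r)))" by (rule sform_ext[OF assms(3) sl(3)])
 have so: "sform E (ext e (K.laurent_sum p r))" by (rule sform_ext[OF assms(3)]) (use s in simp)
 note o = emb_extend_orth[OF L.field_axioms E.field_axioms assms(3) sl(1,3), folded K.laurent_sum_def, unfolded g]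
 note sc = emb_extend_scale[OF L.field_axioms E.field_axioms assms(3) sl(2) K.LX_closed, unfolded g]
 show "emb E (ext e (K.laurent_sum p r)) (orth E (ext g p) (scl E (e ?X) (ext g r)))"
  by (rule E.emb_trans[OF o(1) E.emb_orth[OF E.emb_refl[OF sg(1)] sc(1)]]) (use sg eX in simp_all)
 show "emb E (orth E (ext g p) (scl E (e ?X) (ext g r))) (ext e (K.laurent_sum p r))"
  by (rule E.emb_trans[OF E.emb_orth[OF E.emb_refl[OF sg(1)] sc(2)] o(2) so]) (use sg sx in simp_all)
qed

lemma (in field2) first_witt_index_laurent_sum_ge:
 assumes q: "sform R q" "aniso R q" "2 \<le> qdim q"
 shows "2 * first_witt_index R q \<le> first_witt_index L (laurent_sum q q)"
proof -
 interpret L: field L by (rule laurent_field)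
 have L2: "field2 L" by (rule field2_hom[OF field2_axioms L.field_axioms lc_hom])
 interpret L: field2 L by fact
 let ?\<phi> = "laurent_sum q q" and ?i = "first_witt_index R q"
 have \<phi>: "sform L ?\<phi>" "aniso L ?\<phi>" "2 \<le> qdim ?\<phi>" using q springer_aniso by auto
 let ?E = "function_field L ?\<phi>" and ?e = "function_field_embed L ?\<phi>"
 interpret E: field2 ?E by (rule L.function_field_props[OF \<phi>])
 note e = L.function_field_props(2)[OF \<phi>]
 define g where "g = (\<lambda>a. ?e (lc a))"
 define g0 where "g0 = ?e LX"
 have g: "g \<in> ring_hom R ?E" unfolding g_def by (rule ring_hom_comp[OF lc_hom e])
 have g0: "g0 \<in> carrier ?E" unfolding g0_def by (rule ring_hom_closed[OF e]) simp
 have "LX 1 = \<one>" "\<zero>\<^bsub>L\<^esub> 1 = \<zero>" by (simp_all add: laurent_var_def laurent_zero)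
 hence "LX \<noteq> \<zero>\<^bsub>L\<^esub>" by (metis one_not_zero)
 hence X0: "g0 \<noteq> \<zero>\<^bsub>?E\<^esub>" unfolding g0_def using field_hom_zero_iff[OF L.field_axioms E.field_axioms e LX_closed] by simp
 let ?q = "ext g q"
 let ?S = "orth ?E ?q (scl ?E g0 ?q)" and ?h = "hyp ?E ?i"
 have s: "sform ?E ?q" by (rule sform_ext[OF g q(1)])
 have sS: "sform ?E ?S" using s g0 by simp
 note sum = emb_extend_laurent_sum[OF field_axioms E.field_axioms e q(1) q(1), folded g_def g0_def]
 have iS: "\<not> aniso ?E ?S"
  by (rule not_aniso_emb[OF E.field_axioms sum(1) sS
     regular_extend[OF L.field_axioms E.field_axioms e L.aniso_regular[OF \<phi>(1,2)]] L.function_field_props(3)[OF \<phi>]])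
 \<comment> \<open>With \<open>h\<close> hyperbolic of index \<open>i\<^sub>1(q)\<close>, an
   embedding of \<open>h \<perp> x h\<close> yields twice as many planes, because multiples of
   hyperbolic forms are hyperbolic.\<close>
 have main: "emb ?E (orth ?E ?h (scl ?E g0 ?h)) ?S"
 proof (cases "aniso ?E ?q")
  case False
  have "emb ?E ?h ?q" by (rule first_witt_index_specialise[OF q E.field2_axioms g False])
  thus ?thesis using s g0 by (intro E.emb_orth E.emb_scale) auto
 next
  case True
  obtain t where t: "t \<in> carrier ?E" "field (quad_ext ?E t g0)"
   "\<not> aniso (quad_ext ?E t g0) (ext (\<lambda>a. (a, \<zero>\<^bsub>?E\<^esub>)) ?q)"
   using E.isotropic_sum_quad_ext[OF s True _ g0 X0 iS] q(3) by auto
  let ?N = "quad_ext ?E t g0" and ?d = "\<lambda>a. (a, \<zero>\<^bsub>?E\<^esub>)"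
  have dh: "?d \<in> ring_hom ?E ?N" by (rule E.quad_ext_hom[OF g0 t(1)])
  have "field2 ?N" by (rule field2_hom[OF E.field2_axioms t(2) dh])
  then interpret N: field2 ?N .
  have sN: "sform ?N (ext ?d ?q)" by (rule sform_ext[OF dh s])
  have h1: "emb ?N (hyp ?N ?i) (ext ?d ?q)"
   using t(3) unfolding extend_extend
   by (rule first_witt_index_specialise[OF q N.field2_axioms ring_hom_comp[OF g dh]])
  have "emb ?N (ext ?d ?h) (ext ?d ?q)"
   by (rule N.emb_trans[OF emb_extend_hyp(2)[OF E.field_axioms N.field_axioms dh] h1 sN])
  thus ?thesis by (rule E.emb_transfer[OF g0 t(1) E.sform_hyp s])
 qed
 have "emb ?E (hyp ?E (?i + ?i)) (orth ?E ?h ?h)" by (rule E.emb_hyp_add)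
 moreover have "emb ?E (orth ?E ?h ?h) (orth ?E ?h (scl ?E g0 ?h))"
  using g0 X0 by (intro E.emb_orth E.emb_refl E.emb_hyp_scale) auto
 ultimately have "emb ?E (hyp ?E (?i + ?i)) (ext ?e ?\<phi>)"
  using main sum(2) E.emb_trans sS sform_ext[OF e \<phi>(1)] E.sform_orth E.sform_scale E.sform_hyp g0
  by (metis (no_types, lifting))
 thus ?thesis unfolding L.first_witt_index_iff[OF \<phi>] by (simp add: mult_2)
qed

lemma (in field2) first_witt_index_laurent_sum_le:
 assumes q: "sform R q" "aniso R q" "2 \<le> qdim q"
 shows "first_witt_index L (laurent_sum q q) \<le> 2 * first_witt_index R q"
proof -
 interpret L: field L by (rule laurent_field)
 have L2: "field2 L" by (rule field2_hom[OF field2_axioms L.field_axioms lc_hom])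
 interpret L: field2 L by fact
 let ?\<phi> = "laurent_sum q q" and ?i = "first_witt_index R q"
 have \<phi>: "sform L ?\<phi>" "aniso L ?\<phi>" "2 \<le> qdim ?\<phi>" using q springer_aniso by auto
 let ?F = "function_field R q" and ?e = "function_field_embed R q"
 interpret F: field2 ?F by (rule function_field_props[OF q])
 note e = function_field_props(2)[OF q]
 let ?M = "laurent_ring ?F" and ?c = "laurent_const ?F"
 define Y where "Y = laurent_var ?F"
 interpret M: field ?M by (rule F.laurent_field)
 have M2: "field2 ?M" by (rule field2_hom[OF F.field2_axioms M.field_axioms F.lc_hom])
 interpret M: field2 ?M by fact
 let ?Q = "ext ?e q"
 \<comment> \<open>Extending coefficients keeps the variable, so the image of \<open>x\<close> still
   has order one and Springer's theorem applies over the function field.\<close>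
 define h where "h = (\<lambda>(f :: int \<Rightarrow> 'a) k. ?e (f k))"
 have h: "h \<in> ring_hom L ?M" unfolding h_def by (rule laurent_map_hom[OF field_axioms F.field_axioms e])
 have e01: "?e \<zero> = \<zero>\<^bsub>?F\<^esub>" "?e \<one> = \<one>\<^bsub>?F\<^esub>"
  using field_hom_zero_iff[OF field_axioms F.field_axioms e zero_closed] ring_hom_one[OF e] by auto
 have hc: "(\<lambda>a. h (lc a)) = (\<lambda>a. ?c (?e a))"
  by (auto simp: h_def laurent_const_def fun_eq_iff e01)
 have hX: "h LX = Y" by (auto simp: h_def laurent_var_def Y_def fun_eq_iff e01)
 have Y: "Y \<in> carrier ?M" unfolding Y_def by simp
 have sQ: "sform ?F ?Q" by (rule sform_ext[OF e q(1)])
 have Q: "regular ?F ?Q" by (rule regular_extend[OF field_axioms F.field_axioms e aniso_regular[OF q(1,2)]])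
 let ?q = "ext (\<lambda>a. ?c (?e a)) q"
 have qQ: "?q = ext ?c ?Q" by (simp add: extend_extend)
 have sq: "sform ?M ?q" unfolding qQ using sQ by simp
 let ?S = "orth ?M ?q (scl ?M Y ?q)"
 have sS: "sform ?M ?S" using sq Y by simp
 note sum = emb_extend_laurent_sum[OF field_axioms M.field_axioms h q(1) q(1), unfolded hc hX]
 have sh\<phi>: "sform ?M (ext h ?\<phi>)" by (rule sform_ext[OF h \<phi>(1)])
 have "\<not> aniso ?M ?q" unfolding qQ
  using aniso_descend[OF F.field_axioms M.field_axioms F.lc_hom sQ] function_field_props(3)[OF q] by blast
 moreover have "regular ?M ?q" unfolding qQ by (rule regular_extend[OF F.field_axioms M.field_axioms F.lc_hom Q])
 moreover have "emb ?M ?q (ext h ?\<phi>)"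
  by (rule M.emb_trans[OF M.emb_left sum(2) sh\<phi>]) (use sq Y in simp_all)
 ultimately have "\<not> aniso ?M (ext h ?\<phi>)" using not_aniso_emb[OF M.field_axioms _ sh\<phi>] by blast
 from L.first_witt_index_specialise[OF \<phi> M2 h this]
 have 1: "emb ?M (hyp ?M (first_witt_index L ?\<phi>)) (ext h ?\<phi>)" .
 obtain p where p: "regular ?F p" "aniso ?F p" "isometric ?F ?Q (orth ?F p (hyp ?F ?i))"
  using F.witt_indexE[OF Q] unfolding first_witt_index_def by blast
 have sp: "sform ?F p" using p(1) by (rule regular_sform)
 let ?p = "ext ?c p" and ?h = "hyp ?M ?i"
 have sp': "sform ?M ?p" using sp by simp
 let ?o = "orth ?M"
 have "emb ?M ?q (ext ?c (orth ?F p (hyp ?F ?i)))"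
  unfolding qQ by (rule emb_extend[OF F.cring_axioms M.cring_axioms F.lc_hom _ F.isometric_emb[OF p(3)]]) (use sp in simp)
 moreover have "emb ?M (ext ?c (orth ?F p (hyp ?F ?i))) (?o ?p (ext ?c (hyp ?F ?i)))"
  by (rule emb_extend_orth[OF F.field_axioms M.field_axioms F.lc_hom sp F.sform_hyp])
 moreover have "emb ?M (?o ?p (ext ?c (hyp ?F ?i))) (?o ?p ?h)"
  by (intro M.emb_orth M.emb_refl emb_extend_hyp[OF F.field_axioms M.field_axioms F.lc_hom] sp' M.sform_hyp)
 moreover have "sform ?M (?o ?p (ext ?c (hyp ?F ?i)))" "sform ?M (?o ?p ?h)" using sp' by simp_all
 ultimately have qp: "emb ?M ?q (?o ?p ?h)" using M.emb_trans by blast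
 have Yq: "emb ?M (scl ?M Y ?q) (?o (scl ?M Y ?p) ?h)"
 proof -
  have "emb ?M (scl ?M Y ?q) (scl ?M Y (?o ?p ?h))" using qp sp' Y by (intro M.emb_scale) auto
  moreover have "emb ?M (scl ?M Y (?o ?p ?h)) (?o (scl ?M Y ?p) (scl ?M Y ?h))"
   by (rule M.emb_scale_orth[OF sp' M.sform_hyp Y])
  moreover have "emb ?M (?o (scl ?M Y ?p) (scl ?M Y ?h)) (?o (scl ?M Y ?p) ?h)"
   using sp' Y by (intro M.emb_orth M.emb_refl M.emb_scale_hyp) auto
  moreover have "sform ?M (?o (scl ?M Y ?p) (scl ?M Y ?h))" "sform ?M (?o (scl ?M Y ?p) ?h)"
   using sp' Y by simp_all
  ultimately show ?thesis using M.emb_trans by blast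
 qed
 let ?Yp = "scl ?M Y ?p"
 have sY: "sform ?M ?Yp" using sp' Y by simp
 have shuffle: "emb ?M (?o (?o ?p ?h) (?o ?Yp ?h)) (?o (?o ?p ?Yp) (?o ?h ?h))"
  by (rule M.emb_orth_shuffle[OF sp' M.sform_hyp sY M.sform_hyp])
 have "emb ?M ?S (?o (?o ?p ?h) (?o ?Yp ?h))" using qp Yq sp' sY by (intro M.emb_orth) auto
 moreover have "emb ?M (?o (?o ?p ?Yp) (?o ?h ?h)) (?o (?o ?p ?Yp) (hyp ?M (?i + ?i)))"
  using sp' sY by (intro M.emb_orth M.emb_refl M.emb_hyp_add) auto
 moreover have "sform ?M (?o (?o ?p ?h) (?o ?Yp ?h))" "sform ?M (?o (?o ?p ?Yp) (?o ?h ?h))"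
  "sform ?M (?o (?o ?p ?Yp) (hyp ?M (?i + ?i)))" using sp' sY by simp_all
 ultimately have "emb ?M (hyp ?M (first_witt_index L ?\<phi>)) (?o (?o ?p ?Yp) (hyp ?M (?i + ?i)))"
  using 1 sum(1) shuffle sS sh\<phi> M.emb_trans by meson
 \<comment> \<open>What remains beside the hyperbolic planes is again a Laurent sum with anisotropic
   residues, now over the function field; so there are no further planes.\<close>
 moreover have "aniso ?M (?o ?p ?Yp)"
  using F.springer_aniso[OF sp sp p(2) p(2)] unfolding F.laurent_sum_def Y_def .
 moreover have "sform ?M (?o ?p ?Yp)" using sp' sY by simp
 ultimately have "first_witt_index L ?\<phi> \<le> ?i + ?i" using M.witt_index_le by blast
 thus ?thesis by simp
qed

lemma (in field2) maximal_splitting_laurent_sum: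
 assumes "maximal_splitting R q"
 shows "maximal_splitting L (laurent_sum q q)"
proof -
 interpret L: field L by (rule laurent_field)
 have q: "sform R q" "aniso R q" "2 \<le> qdim q" and "\<exists>k. qdim q - first_witt_index R q = 2 ^ k"
  using assms by (auto simp: maximal_splitting_def regular_sform)
 then obtain k where k: "qdim q - first_witt_index R q = 2 ^ k" by blast
 have \<phi>: "sform L (laurent_sum q q)" "aniso L (laurent_sum q q)" using q springer_aniso by auto
 have "first_witt_index L (laurent_sum q q) = 2 * first_witt_index R q"
  using first_witt_index_laurent_sum_ge[OF q] first_witt_index_laurent_sum_le[OF q] by simp
 hence "qdim (laurent_sum q q) - first_witt_index L (laurent_sum q q) = 2 ^ Suc k" using k by simp
 moreover have "2 \<le> qdim (laurent_sum q q)" using q by simp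
 ultimately show ?thesis unfolding maximal_splitting_def using \<phi> L.aniso_regular by blast
qed

text \<open>The round trip along \<open>j\<close> and \<open>j'\<close> returns \<open>p\<close> to
  itself, so \<open>first_witt_index_mono\<close> applies in both directions.\<close>

lemma maximal_splitting_transport:
 fixes K :: "('a, 'b) ring_scheme" and N :: "('m, 'n) ring_scheme"
 assumes "field2 K" "field2 N" and j: "j \<in> ring_hom K N" "j' \<in> ring_hom N K" "\<And>a. a \<in> carrier K \<Longrightarrow> j' (j a) = a"
  and p: "maximal_splitting K p" and r: "regular N r"
  and e: "emb N (ext j p) r" "emb N r (ext j p)"
 shows "maximal_splitting N r"
proof -
 interpret K: field2 K by fact
 interpret N: field2 N by fact
 have p': "sform K p" "aniso K p" "2 \<le> qdim p" "regular K p"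
  using p by (auto simp: maximal_splitting_def regular_sform)
 have r': "sform N r" using r by (rule regular_sform)
 have regj: "regular N (ext j p)" by (rule regular_extend[OF K.field_axioms N.field_axioms j(1) p'(4)])
 have sj: "sform N (ext j p)" using regj by (rule regular_sform)
 have d: "qdim r = qdim p"
  using N.regular_emb_dim_le[OF r e(2) sj] N.regular_emb_dim_le[OF regj e(1) r'] by simp
 have back1: "emb K (ext j' (ext j p)) p"
  by (rule K.emb_form_eq[OF _ _ p'(1)]) (use p'(1) j(3) in "auto simp: extend_form_def")
 have back2: "emb K p (ext j' (ext j p))"
  by (rule K.emb_form_eq[OF _ _ sform_ext[OF j(2) sj]]) (use p'(1) j(3) in "auto simp: extend_form_def")
 have jj: "emb K (ext j' r) (ext j' (ext j p))" "emb K (ext j' (ext j p)) (ext j' r)"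
  by (rule emb_extend[OF N.cring_axioms K.cring_axioms j(2) sj e(2)],
    rule emb_extend[OF N.cring_axioms K.cring_axioms j(2) r' e(1)])
 have srj: "sform K (ext j' r)" by (rule sform_ext[OF j(2) r'])
 have e': "emb K (ext j' r) p" "emb K p (ext j' r)"
  by (rule K.emb_trans[OF jj(1) back1 p'(1)], rule K.emb_trans[OF back2 jj(2) srj])
 have an: "aniso N r"
 proof (rule aniso_descend[OF N.field_axioms K.field_axioms j(2) r'])
  show "aniso K (ext j' r)"
   by (rule K.aniso_emb[OF e'(1) p'(1,2) regular_extend[OF N.field_axioms K.field_axioms j(2) r]])
 qed
 have r3: "2 \<le> qdim r" using d p' by simp
 have "first_witt_index K p \<le> first_witt_index N r"
  by (rule first_witt_index_mono[OF assms(1,2) j(1) p'(1-3) r' an r3 e])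
 moreover have "first_witt_index N r \<le> first_witt_index K p"
  by (rule first_witt_index_mono[OF assms(2,1) j(2) r' an r3 p'(1-3) e'])
 ultimately have "first_witt_index N r = first_witt_index K p" by simp
 thus ?thesis using p an r r3 d by (simp add: maximal_splitting_def)
qed

section \<open>Pfister forms\<close>

text \<open>The same form as \<open>pfister_form K as \<otimes> q\<close>, in a shape suited to induction.\<close>

definition pfister_mult :: "('a, 'b) ring_scheme \<Rightarrow> 'a list \<Rightarrow> 'a qform \<Rightarrow> 'a qform"
 where "pfister_mult K as q = foldr (\<lambda>a p. orth K p (scl K a p)) as q"

lemma pfister_mult_simps [simp]:
 "pfister_mult K [] q = q"
 "pfister_mult K (a # as) q = orth K (pfister_mult K as q) (scl K a (pfister_mult K as q))"
 by (simp_all add: pfister_mult_def)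

abbreviation pfister :: "('a, 'b) ring_scheme \<Rightarrow> 'a list \<Rightarrow> 'a qform"
 where "pfister K as \<equiv> pfister_mult K as (diag_form K [\<one>\<^bsub>K\<^esub>])"

context cring
begin

lemma sform_pfister_mult: "set as \<subseteq> carrier R \<Longrightarrow> sform R q \<Longrightarrow> sform R (pfister_mult R as q)"
 by (induction as) auto

lemma sform_pfister: "set as \<subseteq> carrier R \<Longrightarrow> sform R (pfister R as)"
 by (intro sform_pfister_mult) auto

lemma qdim_pfister_mult: "qdim (pfister_mult R as q) = 2 ^ length as * qdim q"
 by (induction as) auto

lemma qdim_pfister [simp]: "qdim (pfister R as) = 2 ^ length as"
 by (simp add: qdim_pfister_mult)

lemma emb_double_comm:
 assumes "sform R p" "sform R r" "y \<in> carrier R"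
 shows "emb R (orth R (orth R p (scl R y p)) (orth R r (scl R y r)))
  (orth R (orth R p r) (scl R y (orth R p r)))"
proof -
 have "emb R (orth R (orth R p r) (orth R (scl R y p) (scl R y r)))
  (orth R (orth R p r) (scl R y (orth R p r)))"
  using assms by (intro emb_orth[OF emb_refl emb_scale_orth(2)]) auto
 from emb_trans[OF emb_orth_shuffle this] show ?thesis using assms by simp
qed

lemma emb_scale_comm:
 assumes "sform R p" "a \<in> carrier R" "b \<in> carrier R"
 shows "emb R (scl R a (scl R b p)) (scl R b (scl R a p))"
proof -
 have "emb R (scl R (a \<otimes> b) p) (scl R b (scl R a p))"
  using emb_scale_scale(2)[OF assms(1,3,2)] assms by (simp add: m_comm)
 from emb_trans[OF emb_scale_scale(1)[OF assms] this] show ?thesis using assms by simp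
qed

lemma emb_pfister_mult:
 assumes "emb R p q" "sform R p" "sform R q" "set as \<subseteq> carrier R"
 shows "emb R (pfister_mult R as p) (pfister_mult R as q)"
 using assms(4)
 by (induction as) (auto intro!: emb_orth emb_scale sform_scale sform_pfister_mult assms)

text \<open>Multiplication by a list unfolds at its head, whereas the tower appends its newest
  variable at the end; this moves the last slot to the outside.\<close>

lemma emb_pfister_mult_append:
 assumes "sform R q" "set as \<subseteq> carrier R" "x \<in> carrier R"
 shows "emb R (pfister_mult R (as @ [x]) q) (orth R (pfister_mult R as q) (scl R x (pfister_mult R as q)))" (is ?A)
  and "emb R (orth R (pfister_mult R as q) (scl R x (pfister_mult R as q))) (pfister_mult R (as @ [x]) q)" (is ?B)
proof -
 have "?A \<and> ?B"
  using assms(2)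
 proof (induction as)
  case Nil thus ?case using assms by (simp add: emb_refl)
 next
  case (Cons a as)
  let ?Z = "pfister_mult R as q" and ?Y = "pfister_mult R (as @ [x]) q"
  let ?o = "orth R" and ?s = "scl R"
  have a [simp]: "a \<in> carrier R" "x \<in> carrier R" and as: "set as \<subseteq> carrier R" using Cons.prems assms(3) by auto
  have Z [simp]: "sform R ?Z" by (rule sform_pfister_mult[OF as assms(1)])
  have Y [simp]: "sform R ?Y" using as assms by (intro sform_pfister_mult) auto
  have IH: "emb R ?Y (?o ?Z (?s x ?Z))" "emb R (?o ?Z (?s x ?Z)) ?Y" using Cons.IH[OF as] by auto
  have c1: "emb R (?s a (?o ?Z (?s x ?Z))) (?o (?s a ?Z) (?s x (?s a ?Z)))"
   by (rule emb_trans[OF emb_scale_orth(1) emb_orth[OF emb_refl emb_scale_comm]]) simp_all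
  have c2: "emb R (?o (?s a ?Z) (?s x (?s a ?Z))) (?s a (?o ?Z (?s x ?Z)))"
   by (rule emb_trans[OF emb_orth[OF emb_refl emb_scale_comm] emb_scale_orth(2)]) simp_all
  have "emb R (?o ?Y (?s a ?Y)) (?o (?o ?Z (?s x ?Z)) (?o (?s a ?Z) (?s x (?s a ?Z))))"
   by (rule emb_orth[OF IH(1) emb_trans[OF emb_scale[OF IH(1)] c1]]) simp_all
  from emb_trans[OF this emb_double_comm]
  have 1: "emb R (?o ?Y (?s a ?Y)) (?o (?o ?Z (?s a ?Z)) (?s x (?o ?Z (?s a ?Z))))" by simp
  have "emb R (?o (?o ?Z (?s a ?Z)) (?s x (?o ?Z (?s a ?Z)))) (?o (?o ?Z (?s a ?Z)) (?o (?s x ?Z) (?s x (?s a ?Z))))"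
   by (rule emb_orth[OF emb_refl emb_scale_orth(1)]) simp_all
  from emb_trans[OF this emb_orth_shuffle]
  have "emb R (?o (?o ?Z (?s a ?Z)) (?s x (?o ?Z (?s a ?Z)))) (?o (?o ?Z (?s x ?Z)) (?o (?s a ?Z) (?s x (?s a ?Z))))" by simp
  from emb_trans[OF this emb_orth[OF IH(2) emb_trans[OF c2 emb_scale[OF IH(2)]]]]
  have 2: "emb R (?o (?o ?Z (?s a ?Z)) (?s x (?o ?Z (?s a ?Z)))) (?o ?Y (?s a ?Y))" by simp
  show ?case using 1 2 by simp
 qed
 thus ?A ?B by auto
qed

text \<open>The classical binary isometry of \<open>\<langle>x + b, (x + b) x b\<rangle>\<close>
  with \<open>\<langle>x, b\<rangle>\<close>, tensored with \<open>p\<close>: substitute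
  \<open>z + b z'\<close> and \<open>z - x z'\<close>, where \<open>z'\<close> is the second half of
  the vector.\<close>

lemma emb_binary_scale:
 assumes s: "sform R p" and x: "x \<in> carrier R" "b \<in> carrier R"
 shows "emb R (orth R (scl R (x \<oplus> b) p) (scl R ((x \<oplus> b) \<otimes> (x \<otimes> b)) p))
  (orth R (scl R x p) (scl R b p))"
proof -
 let ?d = "qdim p"
 let ?f = "\<lambda>z. vjoin ?d (vadd R z (smul R b (\<lambda>i. z (i + ?d)))) (vadd R z (smul R (\<ominus> x) (\<lambda>i. z (i + ?d))))"
 have sh: "(\<lambda>i. z (i + ?d)) \<in> vec R" if "z \<in> vec R" for z using that by (intro vecI) simp
 have id: "x \<otimes> ((p1 \<oplus> b \<otimes> p2) \<oplus> b \<otimes> (p3 \<oplus> b \<otimes> p4)) \<oplus> b \<otimes> ((p1 \<oplus> \<ominus> x \<otimes> p2) \<oplus> \<ominus> x \<otimes> (p3 \<oplus> \<ominus> x \<otimes> p4)) =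
   (x \<oplus> b) \<otimes> p1 \<oplus> ((x \<oplus> b) \<otimes> (x \<otimes> b)) \<otimes> p4"
  if [simp]: "x \<in> carrier R" "b \<in> carrier R" "p1 \<in> carrier R" "p2 \<in> carrier R" "p3 \<in> carrier R" "p4 \<in> carrier R"
  for x b p1 p2 p3 p4
  proof -
  have "x \<otimes> ((p1 \<oplus> b \<otimes> p2) \<oplus> b \<otimes> (p3 \<oplus> b \<otimes> p4)) \<oplus> b \<otimes> ((p1 \<oplus> \<ominus> x \<otimes> p2) \<oplus> \<ominus> x \<otimes> (p3 \<oplus> \<ominus> x \<otimes> p4)) =
   (x \<oplus> b) \<otimes> p1 \<oplus> ((x \<oplus> b) \<otimes> (x \<otimes> b)) \<otimes> p4 \<oplus>
   ((x \<otimes> b \<otimes> p2 \<oplus> \<ominus> (x \<otimes> b \<otimes> p2)) \<oplus> (x \<otimes> b \<otimes> p3 \<oplus> \<ominus> (x \<otimes> b \<otimes> p3)))"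
   by (simp add: ring_expand)
  thus ?thesis by (simp add: r_neg)
 qed
 show ?thesis
 proof (rule embI)
  show "sform R (orth R (scl R (x \<oplus> b) p) (scl R ((x \<oplus> b) \<otimes> (x \<otimes> b)) p))" using s x by simp
  show "?f z \<in> vec R" if "z \<in> vec R" for z using that x sh[OF that] by (intro vecI) (simp add: vjoin_def)
  fix v w :: "nat \<Rightarrow> 'a" assume v: "v \<in> vec R" "w \<in> vec R"
  note sv = sh[OF v(1)] sh[OF v(2)]
  let ?v = "\<lambda>i. v (i + ?d)" and ?w = "\<lambda>i. w (i + ?d)"
  have "bilin R (orth R (scl R x p) (scl R b p)) (?f v) (?f w) =
   x \<otimes> bilin R p (vadd R v (smul R b ?v)) (vadd R w (smul R b ?w)) \<oplus>
   b \<otimes> bilin R p (vadd R v (smul R (\<ominus> x) ?v)) (vadd R w (smul R (\<ominus> x) ?w))"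
   using bilin_vjoin[of "scl R x p" "scl R b p"] s x v sv by (simp add: bilin_scale)
  also have "\<dots> = x \<otimes> ((bilin R p v w \<oplus> b \<otimes> bilin R p ?v w) \<oplus> b \<otimes> (bilin R p v ?w \<oplus> b \<otimes> bilin R p ?v ?w)) \<oplus>
   b \<otimes> ((bilin R p v w \<oplus> \<ominus> x \<otimes> bilin R p ?v w) \<oplus> \<ominus> x \<otimes> (bilin R p v ?w \<oplus> \<ominus> x \<otimes> bilin R p ?v ?w))"
   using s x v sv by (simp add: bilin_add_left bilin_add_right bilin_smul_left bilin_smul_right)
  also have "\<dots> = (x \<oplus> b) \<otimes> bilin R p v w \<oplus> ((x \<oplus> b) \<otimes> (x \<otimes> b)) \<otimes> bilin R p ?v ?w"
   using s x v sv by (intro id) auto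
  also have "\<dots> = bilin R (orth R (scl R (x \<oplus> b) p) (scl R ((x \<oplus> b) \<otimes> (x \<otimes> b)) p)) v w"
   using s x v sv by (simp add: bilin_orth bilin_scale)
  finally show "bilin R (orth R (scl R x p) (scl R b p)) (?f v) (?f w) =
   bilin R (orth R (scl R (x \<oplus> b) p) (scl R ((x \<oplus> b) \<otimes> (x \<otimes> b)) p)) v w" .
 qed
qed

end

section \<open>Roundness and isotropy of Pfister forms\<close>

context field
begin

lemma regular_pfister_mult: "set as \<subseteq> carrier R - {\<zero>} \<Longrightarrow> regular R q \<Longrightarrow> regular R (pfister_mult R as q)"
 by (induction as) (auto intro!: regular_orth regular_scale)

lemma regular_pfister: "set as \<subseteq> carrier R - {\<zero>} \<Longrightarrow> regular R (pfister R as)"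
 by (intro regular_pfister_mult regular_diag) auto

text \<open>Division by \<open>x\<close> embeds \<open>p\<close> into \<open>x x p\<close>, and the
  hypothesis multiplied by \<open>x\<close> leads from there to \<open>x p\<close>.\<close>

lemma emb_scale_inverse:
 assumes s: "sform R p" and x: "x \<in> carrier R" "x \<noteq> \<zero>" and e: "emb R (scl R x p) p"
 shows "emb R p (scl R x p)"
proof -
 have i: "inv x \<in> carrier R" "x \<otimes> inv x = \<one>" using x by auto
 have "inv x \<otimes> inv x \<otimes> (x \<otimes> x) = (x \<otimes> inv x) \<otimes> (x \<otimes> inv x)" using i(1) x(1) by (simp add: m_ac del: inv_r_field)
 hence "inv x \<otimes> inv x \<otimes> (x \<otimes> x) = \<one>" unfolding i(2) by simp
 hence "emb R (scl R \<one> p) (scl R (x \<otimes> x) p)" using emb_scale_square[OF s, of "x \<otimes> x" "inv x"] i x by simp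
 from emb_trans[OF emb_scale_one(2)[OF s] this] have "emb R p (scl R (x \<otimes> x) p)" using s x by simp
 from emb_trans[OF this emb_scale_scale(2)] have "emb R p (scl R x (scl R x p))" using s x by simp
 from emb_trans[OF this emb_scale[OF e]] show ?thesis using s x by simp
qed

text \<open>Induction on the slots, with the value split as \<open>c = x + a y\<close> on
  \<open>P \<perp> a P\<close>; this is the roundness of Pfister forms. If \<open>x\<close> and
  \<open>y\<close> are nonzero, \<open>P\<close> embeds in \<open>x y P\<close> by induction, which
  leads from \<open>c P \<perp> c a P\<close> to \<open>c P \<perp> c x (a y) P\<close>, by the
  binary isometry to \<open>x P \<perp> a y P\<close>, and by induction to
  \<open>P \<perp> a P\<close>.\<close>

lemma pfister_round:
 assumes "set as \<subseteq> carrier R - {\<zero>}" "v \<in> vec R" "bilin R (pfister R as) v v \<noteq> \<zero>"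
 shows "emb R (scl R (bilin R (pfister R as) v v) (pfister R as)) (pfister R as)"
 using assms
proof (induction as arbitrary: v)
 case Nil
 let ?d = "diag_form R [\<one>]"
 have s: "sform R ?d" by simp
 have "bilin R ?d v v = v 0 \<otimes> v 0 \<otimes> \<one>" using Nil by (simp add: bilin_diag_Cons bilin_diag_Nil)
 hence "emb R (scl R (bilin R ?d v v) ?d) (scl R \<one> ?d)"
  using emb_scale_square[OF s, of \<one> "v 0"] Nil by simp
 from emb_trans[OF this emb_scale_one(1)] show ?case by simp
next
 case (Cons a as)
 let ?P = "pfister R as" and ?o = "orth R" and ?s = "scl R"
 have a [simp]: "a \<in> carrier R" and a0: "a \<noteq> \<zero>" and as: "set as \<subseteq> carrier R - {\<zero>}" using Cons.prems by auto
 have P [simp]: "sform R ?P" using as by (intro sform_pfister) auto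
 define w where "w = (\<lambda>i. v (i + qdim ?P))"
 have v: "v \<in> vec R" and w: "w \<in> vec R" using Cons.prems(2) by (auto simp: w_def)
 define x where "x = bilin R ?P v v"
 define y where "y = bilin R ?P w w"
 have xy [simp]: "x \<in> carrier R" "y \<in> carrier R" using v w by (auto simp: x_def y_def)
 define c where "c = x \<oplus> a \<otimes> y"
 have c [simp]: "c \<in> carrier R" by (simp add: c_def)
 have val: "bilin R (pfister R (a # as)) v v = c"
  using v w by (simp add: bilin_orth bilin_scale x_def y_def c_def w_def del: qdim_pfister)
 have c0: "c \<noteq> \<zero>" using Cons.prems(3) val by simp
 have rx: "emb R (?s x ?P) ?P" if "x \<noteq> \<zero>" using Cons.IH[OF as v] that by (simp add: x_def)
 have ry: "emb R (?s y ?P) ?P" if "y \<noteq> \<zero>" using Cons.IH[OF as w] that by (simp add: y_def)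
 have "emb R (?s c (?o ?P (?s a ?P))) (?o (?s c ?P) (?s c (?s a ?P)))" by (rule emb_scale_orth(1)) simp_all
 moreover have "emb R (?o (?s c ?P) (?s c (?s a ?P))) (?o ?P (?s a ?P))"
 proof (cases "y = \<zero>")
  case True
  hence "c = x" "x \<noteq> \<zero>" using c0 by (auto simp: c_def)
  hence r: "emb R (?s c ?P) ?P" using rx by simp
  have "emb R (?s c (?s a ?P)) (?s a ?P)"
   by (rule emb_trans[OF emb_scale_comm emb_scale[OF r]]) simp_all
  with r show ?thesis by (rule emb_orth) simp_all
 next
  case y: False
  show ?thesis
  proof (cases "x = \<zero>")
   case True
   hence cy: "c = a \<otimes> y" by (simp add: c_def)
   have 1: "emb R (?s c ?P) (?s a ?P)" unfolding cy
    by (rule emb_trans[OF emb_scale_scale(2) emb_scale[OF ry[OF y]]]) simp_all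
   have "c \<otimes> a = a \<otimes> a \<otimes> y" unfolding cy by (simp add: m_ac)
   hence "emb R (?s (c \<otimes> a) ?P) (?s y ?P)" using emb_scale_square[OF P xy(2) a] by simp
   from emb_trans[OF this ry[OF y]] have "emb R (?s (c \<otimes> a) ?P) ?P" by simp
   from emb_trans[OF emb_scale_scale(1) this] have "emb R (?s c (?s a ?P)) ?P" by simp
   from emb_trans[OF emb_orth[OF 1 this] emb_orth_comm] show ?thesis by simp
  next
   case x: False
   let ?b = "a \<otimes> y"
   have 1: "emb R ?P (?s x ?P)" by (rule emb_scale_inverse[OF P xy(1) x rx[OF x]])
   have 2: "emb R ?P (?s y ?P)" by (rule emb_scale_inverse[OF P xy(2) y ry[OF y]])
   have "emb R ?P (?s x (?s y ?P))" by (rule emb_trans[OF 1 emb_scale[OF 2]]) simp_all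
   from emb_trans[OF this emb_scale_scale(1)] have "emb R ?P (?s (x \<otimes> y) ?P)" by simp
   from emb_scale[OF this, of "c \<otimes> a"] have "emb R (?s (c \<otimes> a) ?P) (?s (c \<otimes> a) (?s (x \<otimes> y) ?P))" by simp
   from emb_trans[OF this emb_scale_scale(1)] have "emb R (?s (c \<otimes> a) ?P) (?s (c \<otimes> a \<otimes> (x \<otimes> y)) ?P)" by simp
   moreover have "c \<otimes> a \<otimes> (x \<otimes> y) = c \<otimes> (x \<otimes> ?b)" by (simp add: m_ac)
   ultimately have "emb R (?s (c \<otimes> a) ?P) (?s (c \<otimes> (x \<otimes> ?b)) ?P)" by simp
   from emb_trans[OF emb_scale_scale(1) this] have "emb R (?s c (?s a ?P)) (?s (c \<otimes> (x \<otimes> ?b)) ?P)" by simp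
   hence "emb R (?o (?s c ?P) (?s c (?s a ?P))) (?o (?s c ?P) (?s (c \<otimes> (x \<otimes> ?b)) ?P))"
    by (intro emb_orth[OF emb_refl]) simp_all
   moreover have "emb R (?o (?s c ?P) (?s (c \<otimes> (x \<otimes> ?b)) ?P)) (?o (?s x ?P) (?s ?b ?P))"
    unfolding c_def by (rule emb_binary_scale) simp_all
   ultimately have 3: "emb R (?o (?s c ?P) (?s c (?s a ?P))) (?o (?s x ?P) (?s ?b ?P))"
    by (rule emb_trans) simp
   have "emb R (?s ?b ?P) (?s a ?P)" by (rule emb_trans[OF emb_scale_scale(2) emb_scale[OF ry[OF y]]]) simp_all
   from emb_trans[OF 3 emb_orth[OF rx[OF x] this]] show ?thesis by simp
  qed
 qed
 ultimately have "emb R (?s c (?o ?P (?s a ?P))) (?o ?P (?s a ?P))" by (rule emb_trans) simp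
 thus ?case unfolding val by simp
qed

text \<open>At the slot where isotropy first appears, \<open>x + a y = 0\<close> with nonzero values
  \<open>x\<close>, \<open>y\<close> of the anisotropic form \<open>P\<close>; by roundness
  \<open>a P\<close> becomes \<open>a y P = - x P\<close> and then \<open>- P\<close>. Further slots
  preserve the shape \<open>p \<perp> - p\<close>.\<close>

lemma pfister_isotropic:
 assumes "set as \<subseteq> carrier R - {\<zero>}" "\<not> aniso R (pfister R as)"
 shows "\<exists>p. sform R p \<and> 2 * qdim p = 2 ^ length as \<and> emb R (pfister R as) (orth R p (scl R (\<ominus> \<one>) p))"
 using assms
proof (induction as)
 case Nil
 have s: "sform R (diag_form R [\<one>])" by simp
 have "aniso R (diag_form R [\<one>])" unfolding aniso_iff[OF s]
  by (auto simp: bilin_diag_Cons bilin_diag_Nil integral_iff)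
 thus ?case using Nil.prems by simp
next
 case (Cons a as)
 let ?P = "pfister R as" and ?o = "orth R" and ?s = "scl R"
 have a [simp]: "a \<in> carrier R" and a0: "a \<noteq> \<zero>" and as: "set as \<subseteq> carrier R - {\<zero>}" using Cons.prems by auto
 have P [simp]: "sform R ?P" using as by (intro sform_pfister) auto
 show ?case
 proof (cases "aniso R ?P")
  case False
  then obtain p where p [simp]: "sform R p" and d: "2 * qdim p = 2 ^ length as" and e: "emb R ?P (?o p (?s (\<ominus> \<one>) p))"
   using Cons.IH[OF as] by blast
  let ?m = "\<ominus> \<one>" and ?q = "?o p (?s a p)"
  have "emb R (?s a ?P) (?s a (?o p (?s ?m p)))" by (rule emb_scale[OF e]) simp_all
  from emb_trans[OF this emb_scale_orth(1)] have "emb R (?s a ?P) (?o (?s a p) (?s a (?s ?m p)))" by simp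
  from emb_trans[OF this emb_orth[OF emb_refl emb_scale_comm]]
  have "emb R (?s a ?P) (?o (?s a p) (?s ?m (?s a p)))" by simp
  from emb_trans[OF emb_orth[OF e this] emb_double_comm]
  have "emb R (?o ?P (?s a ?P)) (?o ?q (?s ?m ?q))" by simp
  thus ?thesis using d by (intro exI[of _ ?q]) simp
 next
  case True
  have sS: "sform R (?o ?P (?s a ?P))" by simp
  obtain v k where v: "v \<in> vec R" "bilin R (?o ?P (?s a ?P)) v v = \<zero>" "k < qdim (?o ?P (?s a ?P))" "v k \<noteq> \<zero>"
   using Cons.prems(2) unfolding pfister_mult_simps aniso_iff[OF sS] by blast
  define w where "w = (\<lambda>i. v (i + qdim ?P))"
  have w: "w \<in> vec R" using v(1) by (auto simp: w_def)
  define x where "x = bilin R ?P v v"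
  define y where "y = bilin R ?P w w"
  have xy [simp]: "x \<in> carrier R" "y \<in> carrier R" using v w by (auto simp: x_def y_def)
  have val: "x \<oplus> a \<otimes> y = \<zero>"
   using v w by (simp add: bilin_orth bilin_scale x_def y_def w_def del: qdim_pfister)
  have y: "y \<noteq> \<zero>"
  proof
   assume y: "y = \<zero>"
   hence "x = \<zero>" using val by simp
   hence "\<forall>i<qdim ?P. v i = \<zero>" "\<forall>i<qdim ?P. w i = \<zero>"
    using True y v(1) w unfolding aniso_iff[OF P] x_def y_def by blast+
   moreover have "k < qdim ?P \<or> (k - qdim ?P < qdim ?P \<and> k = (k - qdim ?P) + qdim ?P)" using v(3) by auto
   ultimately show False using v(4) unfolding w_def by metis
  qed
  have ay: "a \<otimes> y = \<ominus> x" using val by (intro minus_equality[symmetric]) (simp_all add: a_comm)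
  have x: "x \<noteq> \<zero>" using ay y a0 by (auto simp: integral_iff)
  have rx: "emb R (?s x ?P) ?P" unfolding x_def by (rule pfister_round[OF as v(1)]) (use x x_def in simp)
  have ry: "emb R (?s y ?P) ?P" unfolding y_def by (rule pfister_round[OF as w]) (use y y_def in simp)
  have "emb R (?s a ?P) (?s a (?s y ?P))" by (rule emb_scale[OF emb_scale_inverse[OF P xy(2) y ry]]) simp_all
  from emb_trans[OF this emb_scale_scale(1)] have "emb R (?s a ?P) (?s (\<ominus> \<one> \<otimes> x) ?P)" by (simp add: ay l_minus)
  from emb_trans[OF this emb_scale_scale(2)] have "emb R (?s a ?P) (?s (\<ominus> \<one>) (?s x ?P))" by simp
  from emb_trans[OF this emb_scale[OF rx]] have "emb R (?s a ?P) (?s (\<ominus> \<one>) ?P)" by simp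
  hence "emb R (?o ?P (?s a ?P)) (?o ?P (?s (\<ominus> \<one>) ?P))" by (rule emb_orth[OF emb_refl[OF P]]) simp_all
  thus ?thesis by (intro exI[of _ ?P]) simp
 qed
qed

lemma aniso_scale:
 assumes s: "sform R p" and "aniso R p" "b \<in> carrier R" "b \<noteq> \<zero>"
 shows "aniso R (scl R b p)"
proof -
 have sb: "sform R (scl R b p)" using s assms(3) by simp
 show ?thesis using assms unfolding aniso_iff[OF sb] aniso_iff[OF s] by (auto simp: bilin_scale integral_iff)
qed

text \<open>The diagonal of \<open>r \<perp> - r\<close> is totally isotropic and cut out by
  \<open>qdim r\<close> linear equations; the image of a larger space meets it at a nonzero vector
  of that space, which is isotropic for \<open>p\<close>.\<close>

lemma aniso_dim_split:
 assumes p: "sform R p" "aniso R p" and r: "sform R r" and b: "b \<in> carrier R"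
  and e: "emb R p (scl R b (orth R r (scl R (\<ominus> \<one>) r)))"
 shows "qdim p \<le> qdim r"
proof (rule ccontr)
 assume "\<not> qdim p \<le> qdim r"
 hence c: "card {..<qdim p} > qdim r" by simp
 let ?S = "orth R r (scl R (\<ominus> \<one>) r)"
 have S: "sform R ?S" "sform R (scl R b ?S)" using r b by simp_all
 obtain f where f: "linmap R (qdim p) f" "\<And>v w. v \<in> vec R \<Longrightarrow> w \<in> vec R \<Longrightarrow> bilin R (scl R b ?S) (f v) (f w) = bilin R p v w"
  using emb_linmap[OF e S(2)] by blast
 define d where "d = (\<lambda>v k. f v k \<oplus> \<ominus> f v (k + qdim r))"
 have fv: "f v \<in> vec R" if "v \<in> vec R" for v using linmapD(1)[OF f(1) that] .
 have dv: "d v \<in> vec R" if "v \<in> vec R" for v using fv[OF that] by (intro vecI) (simp add: d_def)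
 obtain c where c: "c \<in> vec R" "\<exists>j<qdim p. c j \<noteq> \<zero>" "\<forall>k<qdim r. lcomb R {..<qdim p} c (\<lambda>j. d (uvec R j)) k = \<zero>"
  using linear_dependent[OF finite_lessThan c, of "\<lambda>j. d (uvec R j)"] dv by auto
 let ?g = "f c"
 have fc: "f c = lcomb R {..<qdim p} c (\<lambda>j. f (uvec R j))" 
 proof -
  have "lcomb R {..<qdim p} c (uvec R) i = c i" if "i < qdim p" for i
  proof -
   have "lcomb R {..<qdim p} c (uvec R) i = (\<Oplus>j\<in>{..<qdim p}. if i = j then c j else \<zero>)"
    unfolding lcomb_def using c(1) by (intro finsum_cong') (auto simp: uvec_def)
   also have "\<dots> = c i" using add.finprod_singleton[of i "{..<qdim p}" c] that c(1) by (simp add: Pi_iff)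
   finally show ?thesis .
  qed
  hence "f c = f (lcomb R {..<qdim p} c (uvec R))" using c(1) by (intro linmapD(4)[OF f(1)]) auto
  also have "\<dots> = lcomb R {..<qdim p} c (\<lambda>j. f (uvec R j))"
   by (rule linmap_lcomb[OF f(1) finite_lessThan c(1) uvec_vec])
  finally show ?thesis .
 qed
 have eq: "f c k = f c (k + qdim r)" if k: "k < qdim r" for k
 proof -
  have cj: "c j \<in> carrier R" for j using c(1) by simp
  have u: "f (uvec R j) i \<in> carrier R" for i j using fv[OF uvec_vec] by simp
  have "(\<Oplus>j\<in>{..<qdim p}. c j \<otimes> (f (uvec R j) k \<oplus> \<ominus> f (uvec R j) (k + qdim r))) = \<zero>"
   using c(3) k by (simp add: lcomb_def d_def)
  moreover have "(\<Oplus>j\<in>{..<qdim p}. c j \<otimes> (f (uvec R j) k \<oplus> \<ominus> f (uvec R j) (k + qdim r))) =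
    (\<Oplus>j\<in>{..<qdim p}. c j \<otimes> f (uvec R j) k \<oplus> \<ominus> (c j \<otimes> f (uvec R j) (k + qdim r)))"
   using cj u by (intro finsum_cong') (auto simp: r_distr r_minus)
  moreover have "\<dots> = f c k \<oplus> \<ominus> f c (k + qdim r)"
   unfolding fc lcomb_def using cj u by (subst finsum_addf) (auto simp: finsum_uminus)
  ultimately have "f c k \<oplus> \<ominus> f c (k + qdim r) = \<zero>" by simp
  thus ?thesis using fv[OF c(1)] by (metis minus_eq r_right_minus_eq vec_closed)
 qed
 have "bilin R p c c = b \<otimes> bilin R ?S (f c) (f c)" using f(2)[OF c(1) c(1)] fv[OF c(1)] r b by (simp add: bilin_scale)
 also have "bilin R ?S (f c) (f c) = bilin R r (f c) (f c) \<oplus> \<ominus> \<one> \<otimes> bilin R r (\<lambda>i. f c (i + qdim r)) (\<lambda>i. f c (i + qdim r))"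
  using fv[OF c(1)] r by (simp add: bilin_orth bilin_scale)
 also have "bilin R r (\<lambda>i. f c (i + qdim r)) (\<lambda>i. f c (i + qdim r)) = bilin R r (f c) (f c)"
  using fv[OF c(1)] eq by (intro bilin_cong[OF r]) auto
 finally have "bilin R p c c = \<zero>" using fv[OF c(1)] r b by (simp add: l_minus r_neg)
 thus False using p c(1,2) unfolding aniso_iff[OF p(1)] by blast
qed

end

section \<open>Pfister neighbours\<close>

text \<open>The subform condition is replaced by an embedding, which is stable under base change and
  can be passed to residues.\<close>

definition pfister_emb :: "('a, 'b) ring_scheme \<Rightarrow> 'a qform \<Rightarrow> bool"
 where "pfister_emb K q \<longleftrightarrow> (\<exists>as b. set as \<subseteq> carrier K - {\<zero>\<^bsub>K\<^esub>} \<and> b \<in> carrier K - {\<zero>\<^bsub>K\<^esub>} \<and>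
  2 ^ length as < 2 * qdim q \<and> emb K q (scl K b (pfister K as)))"

lemma div_mod_second_half: "d \<le> i \<Longrightarrow> i < 2 * d \<Longrightarrow> i div d = 1 \<and> i mod d = i - (d :: nat)"
 by (simp add: le_div_geq le_mod_geq)

context cring
begin

lemma gram_tensor_diag:
 assumes "sform R p" "a \<in> carrier R" "i < 2 * qdim p" "j < 2 * qdim p"
 shows "gram (tensor_form R (diag_form R [\<one>, a]) p) i j = gram (orth R p (scl R a p)) i j"
proof -
 have l: "k < qdim p \<or> (qdim p \<le> k \<and> k - qdim p < qdim p \<and> k div qdim p = 1 \<and> k mod qdim p = k - qdim p)" if "k < 2 * qdim p" for k
  using div_mod_second_half[of "qdim p" k] that by linarith
 show ?thesis
  using l[OF assms(3)] l[OF assms(4)] assms(1,2) by (auto simp: tensor_form_def diag_form_def orth_sum_def scale_form_def)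
qed

lemma pfister_form_emb:
 assumes "set as \<subseteq> carrier R"
 shows "sform R (pfister_form R as)" (is ?A) "qdim (pfister_form R as) = 2 ^ length as" (is ?B)
  "emb R (pfister_form R as) (pfister R as)" (is ?C) "emb R (pfister R as) (pfister_form R as)" (is ?D)
proof -
 have "?A \<and> ?B \<and> ?C \<and> ?D"
  using assms
 proof (induction as)
  case Nil thus ?case by (simp add: pfister_form_def emb_refl)
 next
  case (Cons a as)
  let ?p = "pfister_form R as" and ?P = "pfister R as" and ?o = "orth R" and ?s = "scl R"
  let ?t = "tensor_form R (diag_form R [\<one>, a]) ?p"
  have IH: "sform R ?p" "qdim ?p = 2 ^ length as" "emb R ?p ?P" "emb R ?P ?p" and a: "a \<in> carrier R"
   and as: "set as \<subseteq> carrier R" using Cons by auto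
  have P: "sform R ?P" by (rule sform_pfister[OF as])
  have eq: "pfister_form R (a # as) = ?t" by (simp add: pfister_form_def)
  note g = gram_tensor_diag[OF IH(1) a]
  have s: "sform R (?o ?p (?s a ?p))" using IH a by simp
  have st: "sform R ?t" using s g unfolding sform_def by (simp add: mult_2)
  have "emb R ?t (?o ?p (?s a ?p))" by (rule emb_form_eq[OF _ _ s]) (use g in "auto simp: mult_2")
  moreover have "emb R (?o ?p (?s a ?p)) ?t" by (rule emb_form_eq[OF _ _ st]) (use g in "auto simp: mult_2")
  moreover have "emb R (?o ?p (?s a ?p)) (?o ?P (?s a ?P))" "emb R (?o ?P (?s a ?P)) (?o ?p (?s a ?p))"
   using IH P a by (auto intro!: emb_orth emb_scale)
  moreover have "sform R (?o ?P (?s a ?P))" using P a by simp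
  ultimately have "emb R ?t (?o ?P (?s a ?P))" "emb R (?o ?P (?s a ?P)) ?t" using emb_trans s st by blast+
  thus ?case unfolding eq using st IH(2) by simp
 qed
 thus ?A ?B ?C ?D by auto
qed

text \<open>If \<open>\<Sum> c\<^sub>j f(e\<^sub>j) + c v = 0\<close> with \<open>v\<close> in the radical, then pairing with the image of \<open>f\<close> kills the \<open>c\<^sub>j\<close>.\<close>

lemma (in field) regular_of_emb:
 assumes p: "regular R p" and r: "sform R r" and e: "emb R p r" and d: "qdim p = qdim r"
 shows "regular R r"
 unfolding regular_iff
proof (intro conjI r ballI impI allI)
 fix v i assume v: "v \<in> vec R" "\<forall>w\<in>vec R. bilin R r v w = \<zero>" and i: "i < qdim r"
 have sp: "sform R p" using p by (rule regular_sform)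
 let ?d = "qdim r"
 obtain f where f: "linmap R (qdim p) f" "\<And>v w. v \<in> vec R \<Longrightarrow> w \<in> vec R \<Longrightarrow> bilin R r (f v) (f w) = bilin R p v w"
  using emb_linmap[OF e r] by blast
 have fv: "f u \<in> vec R" if "u \<in> vec R" for u using linmapD(1)[OF f(1) that] .
 define w where "w = (\<lambda>j. if j < ?d then f (uvec R j) else v)"
 have w: "w j \<in> vec R" for j using fv v by (simp add: w_def)
 obtain c where c: "c \<in> vec R" "\<exists>j<Suc ?d. c j \<noteq> \<zero>" "\<forall>k<?d. lcomb R {..<Suc ?d} c w k = \<zero>"
  using linear_dependent[of "{..<Suc ?d}" ?d w] w by auto
 have cj: "c j \<in> carrier R" for j using c(1) by simp
 have "bilin R p c u = \<zero>" if u: "u \<in> vec R" for u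
 proof -
  have "\<zero> = bilin R r (lcomb R {..<Suc ?d} c w) (f u)" using c(3) fv[OF u] by (intro bilin_zero_left[OF r, symmetric]) auto
  also have "\<dots> = (\<Oplus>j\<in>{..<Suc ?d}. c j \<otimes> bilin R r (w j) (f u))"
   by (rule bilin_lcomb_left[OF finite_lessThan r c(1) w fv[OF u]])
  also have "\<dots> = c ?d \<otimes> bilin R r (w ?d) (f u) \<oplus> (\<Oplus>j\<in>{..<?d}. c j \<otimes> bilin R r (w j) (f u))"
   unfolding lessThan_Suc using cj w fv[OF u] r by (intro finsum_insert) auto
  also have "bilin R r (w ?d) (f u) = \<zero>" using v(2) fv[OF u] by (simp add: w_def)
  also have "(\<Oplus>j\<in>{..<?d}. c j \<otimes> bilin R r (w j) (f u)) = (\<Oplus>j\<in>{..<qdim p}. c j \<otimes> bilin R p (uvec R j) u)"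
   using cj u sp d f(2) by (intro finsum_cong') (auto simp: w_def)
  also have "\<dots> = bilin R p c u" by (rule bilin_expand[OF sp c(1) u, symmetric])
  finally show ?thesis using sp c(1) u cj by simp
 qed
 hence c0: "c j = \<zero>" if "j < ?d" for j using regularD[OF p c(1)] that d by simp
 hence cd: "c ?d \<noteq> \<zero>" using c(2) by (metis less_Suc_eq)
 have "lcomb R {..<Suc ?d} c w i = c ?d \<otimes> w ?d i \<oplus> (\<Oplus>j\<in>{..<?d}. c j \<otimes> w j i)"
  unfolding lcomb_def lessThan_Suc using cj w by (intro finsum_insert) auto
 also have "(\<Oplus>j\<in>{..<?d}. c j \<otimes> w j i) = \<zero>" using c0 w by (intro finsum_all_zero) auto
 finally have "c ?d \<otimes> v i = \<zero>" using c(3) i cj v(1) by (simp add: w_def)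
 thus "v i = \<zero>" using cd cj v(1) by (simp add: integral_iff)
qed

end

context field2
begin

lemma regular_pfister_form:
 assumes "set as \<subseteq> carrier R - {\<zero>}" shows "regular R (pfister_form R as)"
proof -
 have as: "set as \<subseteq> carrier R" using assms by blast
 show ?thesis
  by (rule regular_of_emb[OF regular_pfister[OF assms] pfister_form_emb(1,4)[OF as]]) (simp add: pfister_form_emb(2)[OF as])
qed

text \<open>One direction composes the isometries in the definition; for the other, an orthogonal
  complement supplies the missing summand.\<close>

lemma pfister_neighbour_iff:
 assumes q: "regular R q"
 shows "pfister_neighbour R q \<longleftrightarrow> pfister_emb R q"
proof
 have sq: "sform R q" using q by (rule regular_sform)
 {
  assume "pfister_neighbour R q"
  then obtain \<theta> a as where *: "regular R \<theta>" "set as \<subseteq> carrier R - {\<zero>}" "isometric R \<theta> (pfister_form R as)"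
   "a \<in> carrier R - {\<zero>}" "subform R q (scl R a \<theta>)" "2 * qdim q > qdim \<theta>"
   unfolding pfister_neighbour_def is_pfister_def by blast
  obtain r where r: "regular R r" "isometric R (scl R a \<theta>) (orth R q r)"
   using *(5) unfolding subform_def by blast
  have sr: "sform R r" using r(1) by (rule regular_sform)
  have s\<theta>: "sform R \<theta>" using *(1) by (rule regular_sform)
  have as: "set as \<subseteq> carrier R" "a \<in> carrier R" using *(2,4) by auto
  have so: "sform R (orth R q r)" "sform R (scl R a \<theta>)" using sq sr s\<theta> as by simp_all
  have 1: "emb R q (scl R a \<theta>)"
   by (rule emb_trans[OF emb_left[OF sq sr] isometric_emb[OF isometric_sym[OF r(2) so(1)]] so(2)])
  have "emb R \<theta> (pfister R as)"
   by (rule emb_trans[OF isometric_emb[OF *(3)] pfister_form_emb(3)[OF as(1)] sform_pfister[OF as(1)]])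
  hence "emb R (scl R a \<theta>) (scl R a (pfister R as))" by (rule emb_scale[OF _ sform_pfister[OF as(1)] as(2)])
  from emb_trans[OF 1 this] have "emb R q (scl R a (pfister R as))" using sform_pfister[OF as(1)] as(2) by simp
  moreover have "qdim \<theta> = 2 ^ length as" using *(3) pfister_form_emb(2)[OF as(1)] by (simp add: isometric_def)
  ultimately show "pfister_emb R q" unfolding pfister_emb_def using * by auto
 next
  assume "pfister_emb R q"
  then obtain as b where *: "set as \<subseteq> carrier R - {\<zero>}" "b \<in> carrier R - {\<zero>}" "2 ^ length as < 2 * qdim q"
   "emb R q (scl R b (pfister R as))" unfolding pfister_emb_def by blast
  have as: "set as \<subseteq> carrier R" "b \<in> carrier R" "b \<noteq> \<zero>" using * by auto
  let ?t = "pfister_form R as"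
  note t = pfister_form_emb[OF as(1)]
  have "emb R (scl R b (pfister R as)) (scl R b ?t)" by (rule emb_scale[OF t(4,1) as(2)])
  from emb_trans[OF *(4) this] have "emb R q (scl R b ?t)" using t(1) as by simp
  hence "subform R q (scl R b ?t)"
   by (rule subform_of_emb[OF q regular_scale[OF regular_pfister_form[OF *(1)] as(2,3)]])
  moreover have "is_pfister R (length as) ?t" unfolding is_pfister_def
   using regular_pfister_form[OF *(1)] *(1) isometric_of_emb[OF regular_pfister_form[OF *(1)] emb_refl[OF t(1)] t(1)] by auto
  ultimately show "pfister_neighbour R q" unfolding pfister_neighbour_def
   by (intro exI[of _ "length as"] exI[of _ ?t] exI[of _ b] conjI) (use *(2,3) t(2) in auto)
 }
qed

text \<open>An isotropic Pfister form embeds in \<open>r \<perp> - r\<close> with \<open>r\<close>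
  of half its dimension, too small for \<open>p\<close>. Anisotropy is what the residue argument
  over Laurent series requires.\<close>

lemma pfister_aniso:
 assumes p: "sform R p" "aniso R p" and as: "set as \<subseteq> carrier R - {\<zero>}" and b: "b \<in> carrier R"
  and e: "emb R p (scl R b (pfister R as))" and d: "2 ^ length as < 2 * qdim p"
 shows "aniso R (pfister R as)"
proof (rule ccontr)
 assume "\<not> aniso R (pfister R as)"
 then obtain r where r: "sform R r" "2 * qdim r = 2 ^ length as" "emb R (pfister R as) (orth R r (scl R (\<ominus> \<one>) r))"
  using pfister_isotropic[OF as] by blast
 let ?S = "orth R r (scl R (\<ominus> \<one>) r)"
 have S: "sform R ?S" using r(1) by simp
 have "emb R p (scl R b ?S)" by (rule emb_trans[OF e emb_scale[OF r(3) S b]]) (use S b in simp)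
 hence "qdim p \<le> qdim r" by (rule aniso_dim_split[OF p r(1) b])
 thus False using r(2) d by simp
qed

section \<open>Pfister forms over Laurent series fields\<close>

lemma emb_scale_lc:
 assumes "sform R p" "a \<in> carrier R"
 shows "emb L (scl L (lc a) (ext lc p)) (ext lc (scl R a p))"
  "emb L (scl L (LX \<otimes>\<^bsub>L\<^esub> lc a) (ext lc p)) (scl L LX (ext lc (scl R a p)))"
proof -
 interpret L: field L by (rule laurent_field)
 show 1: "emb L (scl L (lc a) (ext lc p)) (ext lc (scl R a p))"
  by (rule emb_extend_scale[OF field_axioms L.field_axioms lc_hom assms])
 have s: "sform L (ext lc p)" "sform L (ext lc (scl R a p))" using assms by simp_all
 show "emb L (scl L (LX \<otimes>\<^bsub>L\<^esub> lc a) (ext lc p)) (scl L LX (ext lc (scl R a p)))"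
  by (rule L.emb_trans[OF L.emb_scale_scale(2) L.emb_scale[OF 1]]) (use s assms in simp_all)
qed

lemma emb_lc_pfister_Cons:
 assumes as: "set as \<subseteq> carrier R" "a \<in> carrier R"
 shows "emb L (orth L (ext lc (pfister R as)) (scl L (lc a) (ext lc (pfister R as))))
  (ext lc (pfister R (a # as)))"
proof -
 interpret L: field L by (rule laurent_field)
 note P = sform_pfister[OF as(1)]
 have s: "sform R (scl R a (pfister R as))" using P as by simp
 note sE = sform_ext_lc[OF P] sform_ext_lc[OF s]
 have sc: "sform L (ext lc (orth R (pfister R as) (scl R a (pfister R as))))" using P as by simp
 show ?thesis unfolding pfister_mult_simps
  by (rule L.emb_trans[OF L.emb_orth[OF L.emb_refl[OF sE(1)] emb_scale_lc(1)[OF P as(2)] sE]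
   emb_extend_orth(2)[OF field_axioms L.field_axioms lc_hom P s] sc])
qed

text \<open>Up to squares each slot is a constant or a constant times the variable. If the variable
  has already occurred, so that the form is \<open>\<rho> = P \<perp> Y P\<close>, a further slot
  \<open>Y e\<close> may be replaced by the constant \<open>e\<close>: up to the square of
  \<open>Y\<close>, the form \<open>Y e \<rho>\<close> is \<open>e \<rho>\<close>.\<close>

lemma pfister_laurent:
 assumes "set bs \<subseteq> carrier L - {\<zero>\<^bsub>L\<^esub>}"
 shows "\<exists>as. set as \<subseteq> carrier R - {\<zero>} \<and>
  (length as = length bs \<and> emb L (pfister L bs) (ext lc (pfister R as)) \<or>
   length bs = Suc (length as) \<and> (\<exists>c\<in>carrier R - {\<zero>}. emb L (pfister L bs)
    (orth L (ext lc (pfister R as)) (scl L (lc c \<otimes>\<^bsub>L\<^esub> LX) (ext lc (pfister R as))))))"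
 using assms
proof (induction bs)
 case Nil
 interpret L: field L by (rule laurent_field)
 have s: "sform L (ext lc (diag_form R [\<one>]))" by simp
 have "lc \<one> = \<one>\<^bsub>L\<^esub>" by (rule ring_hom_one[OF lc_hom])
 hence "emb L (diag_form L [\<one>\<^bsub>L\<^esub>]) (ext lc (diag_form R [\<one>]))"
  by (intro L.emb_form_eq[OF _ _ s]) (auto simp: diag_form_def extend_form_def)
 thus ?case by (intro exI[of _ "[]"]) simp
next
 case (Cons b bs)
 interpret L: field L by (rule laurent_field)
 let ?E = "ext lc" and ?o = "orth L" and ?s = "scl L" and ?\<tau> = "pfister L bs"
 obtain as where as: "set as \<subseteq> carrier R - {\<zero>}" and cases: "length as = length bs \<and> emb L ?\<tau> (?E (pfister R as)) \<or>
  length bs = Suc (length as) \<and> (\<exists>c\<in>carrier R - {\<zero>}. emb L ?\<tau>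
    (?o (?E (pfister R as)) (?s (lc c \<otimes>\<^bsub>L\<^esub> LX) (?E (pfister R as)))))"
  using Cons.IH Cons.prems by auto
 have as': "set as \<subseteq> carrier R" using as by blast
 define P where "P = ?E (pfister R as)"
 have P [simp]: "sform L P" unfolding P_def by (rule sform_ext_lc[OF sform_pfister[OF as']])
 have b: "b \<in> carrier L" "b \<noteq> \<zero>\<^bsub>L\<^esub>" and bs: "set bs \<subseteq> carrier L" using Cons.prems by auto
 have \<tau> [simp]: "sform L ?\<tau>" by (rule L.sform_pfister[OF bs])
 obtain a s where a: "a \<in> carrier R - {\<zero>}" and s: "s \<in> carrier L"
  and bb: "b = s \<otimes>\<^bsub>L\<^esub> s \<otimes>\<^bsub>L\<^esub> lc a \<or> b = s \<otimes>\<^bsub>L\<^esub> s \<otimes>\<^bsub>L\<^esub> (lc a \<otimes>\<^bsub>L\<^esub> LX)"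
  using laurent_square_class[OF b] by blast
 have ac [simp]: "a \<in> carrier R" using a by simp
 have step: "emb L (pfister L (b # bs)) (?o \<rho> (?s z \<rho>))"
  if "emb L ?\<tau> \<rho>" "sform L \<rho>" "b = s \<otimes>\<^bsub>L\<^esub> s \<otimes>\<^bsub>L\<^esub> z" "z \<in> carrier L" for \<rho> z
 proof -
  have "emb L (?s b ?\<tau>) (?s z ?\<tau>)" unfolding that(3) using s that(4) by (intro L.emb_scale_square) auto
  from L.emb_trans[OF this L.emb_scale[OF that(1)]] have "emb L (?s b ?\<tau>) (?s z \<rho>)" using that by simp
  thus ?thesis unfolding pfister_mult_simps using that by (intro L.emb_orth) auto
 qed
 from cases show ?case
 proof (elim disjE conjE bexE)
  assume l: "length as = length bs" and e: "emb L ?\<tau> (?E (pfister R as))"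
  from bb show ?thesis
  proof
   assume "b = s \<otimes>\<^bsub>L\<^esub> s \<otimes>\<^bsub>L\<^esub> lc a"
   from step[OF e P[unfolded P_def] this]
   have "emb L (pfister L (b # bs)) (?o (?E (pfister R as)) (?s (lc a) (?E (pfister R as))))" by simp
   from L.emb_trans[OF this emb_lc_pfister_Cons[OF as' ac] sform_ext_lc[OF sform_pfister]]
   have "emb L (pfister L (b # bs)) (?E (pfister R (a # as)))" using as' by simp
   thus ?thesis using l a as by (intro exI[of _ "a # as"]) auto
  next
   assume "b = s \<otimes>\<^bsub>L\<^esub> s \<otimes>\<^bsub>L\<^esub> (lc a \<otimes>\<^bsub>L\<^esub> LX)"
   from step[OF e P[unfolded P_def] this]
   show ?thesis using l a as by (intro exI[of _ as]) auto
  qed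
 next
  fix c assume l: "length bs = Suc (length as)" and c: "c \<in> carrier R - {\<zero>}"
   and e: "emb L ?\<tau> (?o (?E (pfister R as)) (?s (lc c \<otimes>\<^bsub>L\<^esub> LX) (?E (pfister R as))))"
  define Y where "Y = lc c \<otimes>\<^bsub>L\<^esub> LX"
  have cc [simp]: "c \<in> carrier R" using c by simp
  have Y [simp]: "Y \<in> carrier L" by (simp add: Y_def)
  let ?\<rho> = "?o P (?s Y P)"
  have e: "emb L ?\<tau> ?\<rho>" using e by (simp add: P_def Y_def)
  have fin: "?thesis" if e: "e \<in> carrier R - {\<zero>}" and
   "emb L (pfister L (b # bs)) (?o (?o P (?s Y P)) (?o (?s (lc e) P) (?s Y (?s (lc e) P))))" for e
  proof -
   have ec [simp]: "e \<in> carrier R" using e by simp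
   let ?W = "?s (lc e) P" and ?P' = "?E (pfister R (e # as))"
   have P': "sform L ?P'" using as' by (intro sform_ext_lc sform_pfister) auto
   have PW: "emb L (?o P ?W) ?P'" unfolding P_def by (rule emb_lc_pfister_Cons[OF as' ec])
   from L.emb_trans[OF that(2) L.emb_double_comm]
   have "emb L (pfister L (b # bs)) (?o (?o P ?W) (?s Y (?o P ?W)))" by simp
   from L.emb_trans[OF this L.emb_orth[OF PW L.emb_scale[OF PW]]]
   have "emb L (pfister L (b # bs)) (?o ?P' (?s Y ?P'))" using P' by simp
   thus ?thesis using l e as c by (intro exI[of _ "e # as"]) (auto simp: Y_def)
  qed
  from bb show ?thesis
  proof
   assume "b = s \<otimes>\<^bsub>L\<^esub> s \<otimes>\<^bsub>L\<^esub> lc a"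
   from step[OF e _ this] have 1: "emb L (pfister L (b # bs)) (?o ?\<rho> (?s (lc a) ?\<rho>))" by simp
   have "emb L (?s (lc a) ?\<rho>) (?o (?s (lc a) P) (?s (lc a) (?s Y P)))" by (rule L.emb_scale_orth(1)) simp_all
   from L.emb_trans[OF this L.emb_orth[OF L.emb_refl L.emb_scale_comm]]
   have "emb L (?s (lc a) ?\<rho>) (?o (?s (lc a) P) (?s Y (?s (lc a) P)))" by simp
   from L.emb_trans[OF 1 L.emb_orth[OF L.emb_refl this]]
   show ?thesis by (intro fin[OF a]) simp
  next
   assume "b = s \<otimes>\<^bsub>L\<^esub> s \<otimes>\<^bsub>L\<^esub> (lc a \<otimes>\<^bsub>L\<^esub> LX)"
   from step[OF e _ this] have 1: "emb L (pfister L (b # bs)) (?o ?\<rho> (?s (lc a \<otimes>\<^bsub>L\<^esub> LX) ?\<rho>))" by simp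
   \<comment> \<open>With this constant the slot \<open>a x\<close> is \<open>Y e\<close>, and the
     factor \<open>Y\<close> is absorbed by \<open>P \<perp> Y P\<close>.\<close>
   define e where "e = a \<otimes> inv c"
   have ci: "inv c \<in> carrier R" "inv c \<noteq> \<zero>" using c by auto
   have e: "e \<in> carrier R - {\<zero>}" using a ci by (auto simp: e_def integral_iff)
   have ec [simp]: "e \<in> carrier R" using e by simp
   have "e \<otimes> c = a" using c ci by (simp add: e_def m_assoc m_comm[of "inv c"])
   hence "lc a = lc e \<otimes>\<^bsub>L\<^esub> lc c" using ring_hom_mult[OF lc_hom ec cc] by simp
   hence Z: "lc a \<otimes>\<^bsub>L\<^esub> LX = Y \<otimes>\<^bsub>L\<^esub> lc e" by (simp add: Y_def L.m_ac)
   let ?W = "?s (lc e) P"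
   have z1: "emb L (?s (Y \<otimes>\<^bsub>L\<^esub> lc e) P) (?s Y ?W)" by (rule L.emb_scale_scale(2)) simp_all
   have "(Y \<otimes>\<^bsub>L\<^esub> lc e) \<otimes>\<^bsub>L\<^esub> Y = Y \<otimes>\<^bsub>L\<^esub> Y \<otimes>\<^bsub>L\<^esub> lc e" by (simp add: L.m_ac)
   hence "emb L (?s ((Y \<otimes>\<^bsub>L\<^esub> lc e) \<otimes>\<^bsub>L\<^esub> Y) P) ?W" using L.emb_scale_square[OF P, of "lc e" Y] by simp
   from L.emb_trans[OF L.emb_scale_scale(1) this]
   have z2: "emb L (?s (Y \<otimes>\<^bsub>L\<^esub> lc e) (?s Y P)) ?W" by simp
   have "emb L (?s (Y \<otimes>\<^bsub>L\<^esub> lc e) ?\<rho>) (?o (?s (Y \<otimes>\<^bsub>L\<^esub> lc e) P) (?s (Y \<otimes>\<^bsub>L\<^esub> lc e) (?s Y P)))"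
    by (rule L.emb_scale_orth(1)) simp_all
   from L.emb_trans[OF this L.emb_orth[OF z1 z2]]
   have "emb L (?s (Y \<otimes>\<^bsub>L\<^esub> lc e) ?\<rho>) (?o (?s Y ?W) ?W)" by simp
   from L.emb_trans[OF this L.emb_orth_comm] have "emb L (?s (Y \<otimes>\<^bsub>L\<^esub> lc e) ?\<rho>) (?o ?W (?s Y ?W))" by simp
   from L.emb_trans[OF 1[unfolded Z] L.emb_orth[OF L.emb_refl this]]
   show ?thesis by (intro fin[OF e]) simp
  qed
 qed
qed

text \<open>Square classes of the slots and of \<open>b\<close> bring the multiple of the Pfister
  form into the shape of a Laurent sum whose residues are multiples of one Pfister form over the
  coefficient field, or empty; \<open>laurent_residue\<close> then embeds \<open>q\<close> in a
  residue.\<close>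

lemma pfister_emb_laurent_sum:
 assumes q: "sform R q" "aniso R q" and n: "pfister_emb L (laurent_sum q q)"
 shows "pfister_emb R q"
proof -
 interpret L: field L by (rule laurent_field)
 have "field2 L" by (rule field2_hom[OF field2_axioms L.field_axioms lc_hom])
 then interpret L: field2 L .
 let ?E = "ext lc" and ?o = "orth L" and ?s = "scl L" and ?\<phi> = "laurent_sum q q"
 obtain bs b where bs: "set bs \<subseteq> carrier L - {\<zero>\<^bsub>L\<^esub>}" and b: "b \<in> carrier L" "b \<noteq> \<zero>\<^bsub>L\<^esub>"
  and d: "2 ^ length bs < 2 * qdim ?\<phi>" and e: "emb L ?\<phi> (?s b (pfister L bs))"
  using n unfolding pfister_emb_def by blast
 have bs': "set bs \<subseteq> carrier L" using bs by blast
 let ?\<tau> = "pfister L bs"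
 have \<tau> [simp]: "sform L ?\<tau>" by (rule L.sform_pfister[OF bs'])
 have \<phi>: "sform L ?\<phi>" "aniso L ?\<phi>" using q springer_aniso by auto
 \<comment> \<open>Springer's theorem needs anisotropic residues, and these inherit anisotropy from
   the whole form.\<close>
 have a\<tau>: "aniso L ?\<tau>" by (rule L.pfister_aniso[OF \<phi> bs b(1) e d])
 obtain as where as: "set as \<subseteq> carrier R - {\<zero>}" and cases: "length as = length bs \<and> emb L ?\<tau> (?E (pfister R as)) \<or>
  length bs = Suc (length as) \<and> (\<exists>c\<in>carrier R - {\<zero>}. emb L ?\<tau>
    (?o (?E (pfister R as)) (?s (lc c \<otimes>\<^bsub>L\<^esub> LX) (?E (pfister R as)))))"
  using pfister_laurent[OF bs] by blast
 have as': "set as \<subseteq> carrier R" using as by blast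
 let ?\<pi> = "pfister R as"
 have \<pi> [simp]: "sform R ?\<pi>" by (rule sform_pfister[OF as'])
 define P where "P = ?E ?\<pi>"
 have P [simp]: "sform L P" unfolding P_def by (rule sform_ext_lc[OF \<pi>])
 \<comment> \<open>Equality of dimensions makes the embedding of \<open>?\<tau>\<close> in
   \<open>\<rho>\<close> an isometry, so \<open>P\<close> embeds in \<open>?\<tau>\<close> and
   inherits anisotropy, which then descends to the coefficient field.\<close>
 have an: "aniso R ?\<pi>" if r: "emb L ?\<tau> \<rho>" "sform L \<rho>" "qdim \<rho> = 2 ^ length bs" "emb L P \<rho>" for \<rho>
 proof -
  have "isometric L ?\<tau> \<rho>" using r by (intro L.isometric_of_emb L.regular_pfister bs) auto
  from L.isometric_emb[OF L.isometric_sym[OF this r(2)]] have "emb L \<rho> ?\<tau>" .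
  from L.emb_trans[OF r(4) this \<tau>] have "emb L P ?\<tau>" .
  moreover have "regular L P" unfolding P_def
   by (rule regular_extend[OF field_axioms L.field_axioms lc_hom regular_pfister[OF as]])
  ultimately have "aniso L P" using L.aniso_emb \<tau> a\<tau> by blast
  thus ?thesis unfolding P_def by (rule aniso_descend[OF field_axioms L.field_axioms lc_hom \<pi>])
 qed
 obtain a s where a: "a \<in> carrier R - {\<zero>}" and s: "s \<in> carrier L"
  and bb: "b = s \<otimes>\<^bsub>L\<^esub> s \<otimes>\<^bsub>L\<^esub> lc a \<or> b = s \<otimes>\<^bsub>L\<^esub> s \<otimes>\<^bsub>L\<^esub> (lc a \<otimes>\<^bsub>L\<^esub> LX)"
  using laurent_square_class[OF b] by blast
 have ac [simp]: "a \<in> carrier R" and a0: "a \<noteq> \<zero>" using a by auto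
 have step: "emb L ?\<phi> (?s z \<rho>)"
  if "emb L ?\<tau> \<rho>" "sform L \<rho>" "b = s \<otimes>\<^bsub>L\<^esub> s \<otimes>\<^bsub>L\<^esub> z" "z \<in> carrier L" for \<rho> z
 proof -
  have "emb L (?s b ?\<tau>) (?s z ?\<tau>)" unfolding that(3) using s that(4) by (intro L.emb_scale_square) auto
  from L.emb_trans[OF this L.emb_scale[OF that(1)]] have "emb L (?s b ?\<tau>) (?s z \<rho>)" using that by simp
  from L.emb_trans[OF e this] show ?thesis using that by simp
 qed
 let ?A = "scl R a ?\<pi>" and ?N = "diag_form R []"
 have A [simp]: "sform R ?A" by simp
 have N: "sform R ?N" "aniso R ?N" by (simp_all add: anisotropic_def)
 have aX: "lc a \<otimes>\<^bsub>L\<^esub> LX = LX \<otimes>\<^bsub>L\<^esub> lc a" by (simp add: L.m_comm)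
 note lcs = emb_scale_lc[OF \<pi> ac, folded P_def]
 have dq: "0 < qdim q" using d by (cases "qdim q") auto
 have no: "\<not> emb R q ?N" using regular_emb_dim_le[OF aniso_regular[OF q] _ N(1)] dq by auto
 from cases have "2 ^ length as < 2 * qdim q \<and> emb R q ?A"
 proof (elim disjE conjE bexE)
  \<comment> \<open>If the variable occurs in no slot, one of the two residue forms is empty, and
    \<open>q\<close> of positive dimension cannot embed in it.\<close>
  assume l: "length as = length bs" and e1: "emb L ?\<tau> (?E ?\<pi>)"
  have e1: "emb L ?\<tau> P" using e1 by (simp add: P_def)
  have "aniso R ?\<pi>" by (rule an[OF e1 P _ L.emb_refl[OF P]]) (simp add: P_def l)
  hence aA: "aniso R ?A" by (rule aniso_scale[OF \<pi> _ ac a0])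
  from bb have False
  proof
   assume "b = s \<otimes>\<^bsub>L\<^esub> s \<otimes>\<^bsub>L\<^esub> lc a"
   from step[OF e1 P this] have "emb L ?\<phi> (?s (lc a) P)" by simp
   from L.emb_trans[OF this lcs(1)] have "emb L ?\<phi> (?E ?A)" by simp
   from L.emb_trans[OF this L.emb_left] have "emb L ?\<phi> (laurent_sum ?A ?N)" unfolding laurent_sum_def by simp
   from laurent_residue(2)[OF A N(1) aA N(2) q(1) this] show False using no by blast
  next
   assume "b = s \<otimes>\<^bsub>L\<^esub> s \<otimes>\<^bsub>L\<^esub> (lc a \<otimes>\<^bsub>L\<^esub> LX)"
   from step[OF e1 P this] have "emb L ?\<phi> (?s (LX \<otimes>\<^bsub>L\<^esub> lc a) P)" by (simp add: aX)
   from L.emb_trans[OF this lcs(2)] have "emb L ?\<phi> (?s LX (?E ?A))" by simp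
   from L.emb_trans[OF this L.emb_right] have "emb L ?\<phi> (laurent_sum ?N ?A)" unfolding laurent_sum_def by simp
   from laurent_residue(1)[OF N(1) A N(2) aA q(1) this] show False using no by blast
  qed
  thus ?thesis ..
 next
  fix c assume l: "length bs = Suc (length as)" and c: "c \<in> carrier R - {\<zero>}"
   and e1: "emb L ?\<tau> (?o (?E ?\<pi>) (?s (lc c \<otimes>\<^bsub>L\<^esub> LX) (?E ?\<pi>)))"
  have cc [simp]: "c \<in> carrier R" and c0: "c \<noteq> \<zero>" using c by auto
  let ?Y = "lc c \<otimes>\<^bsub>L\<^esub> LX"
  let ?\<rho> = "?o P (?s ?Y P)"
  have e1: "emb L ?\<tau> ?\<rho>" using e1 by (simp add: P_def)
  have \<rho> [simp]: "sform L ?\<rho>" by simp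
  have "emb L P ?\<rho>" by (rule L.emb_left) simp_all
  hence "aniso R ?\<pi>" by (intro an[OF e1 \<rho>]) (simp_all add: P_def l)
  have ac0: "a \<otimes> c \<in> carrier R" "a \<otimes> c \<noteq> \<zero>" using a0 c0 by (auto simp: integral_iff)
  let ?C = "scl R (a \<otimes> c) ?\<pi>"
  have C [simp]: "sform R ?C" by simp
  have aA: "aniso R ?A" "aniso R ?C"
   by (rule aniso_scale[OF \<pi> \<open>aniso R ?\<pi>\<close> ac a0], rule aniso_scale[OF \<pi> \<open>aniso R ?\<pi>\<close> ac0])
  note lcc = emb_scale_lc[OF \<pi> ac0(1), folded P_def]
  have hm: "lc (a \<otimes> c) = lc a \<otimes>\<^bsub>L\<^esub> lc c" by (rule ring_hom_mult[OF lc_hom ac cc])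
  \<comment> \<open>The residues are \<open>a \<pi>\<close> and \<open>a c \<pi>\<close>; a factor
    \<open>x\<close> in \<open>b\<close> exchanges their places, so \<open>a \<pi>\<close> is
    reached through the first or the second residue.\<close>
  from bb have "emb R q ?A"
  proof
   assume "b = s \<otimes>\<^bsub>L\<^esub> s \<otimes>\<^bsub>L\<^esub> lc a"
   from step[OF e1 \<rho> this] have "emb L ?\<phi> (?s (lc a) ?\<rho>)" by simp
   from L.emb_trans[OF this L.emb_scale_orth(1)] have 1: "emb L ?\<phi> (?o (?s (lc a) P) (?s (lc a) (?s ?Y P)))" by simp
   have "lc a \<otimes>\<^bsub>L\<^esub> ?Y = LX \<otimes>\<^bsub>L\<^esub> lc (a \<otimes> c)" unfolding hm by (simp add: L.m_ac)
   hence "emb L (?s (lc a) (?s ?Y P)) (?s (LX \<otimes>\<^bsub>L\<^esub> lc (a \<otimes> c)) P)"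
    using L.emb_scale_scale(1)[of P "lc a" ?Y] by simp
   from L.emb_trans[OF this lcc(2)] have 2: "emb L (?s (lc a) (?s ?Y P)) (?s LX (?E ?C))" by simp
   from L.emb_trans[OF 1 L.emb_orth[OF lcs(1) 2]] have "emb L ?\<phi> (laurent_sum ?A ?C)" unfolding laurent_sum_def by simp
   from laurent_residue(1)[OF A C aA q(1) this] show ?thesis .
  next
   assume "b = s \<otimes>\<^bsub>L\<^esub> s \<otimes>\<^bsub>L\<^esub> (lc a \<otimes>\<^bsub>L\<^esub> LX)"
   from step[OF e1 \<rho> this] have "emb L ?\<phi> (?s (LX \<otimes>\<^bsub>L\<^esub> lc a) ?\<rho>)" by (simp add: aX)
   from L.emb_trans[OF this L.emb_scale_orth(1)]
   have 1: "emb L ?\<phi> (?o (?s (LX \<otimes>\<^bsub>L\<^esub> lc a) P) (?s (LX \<otimes>\<^bsub>L\<^esub> lc a) (?s ?Y P)))" by simp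
   have "(LX \<otimes>\<^bsub>L\<^esub> lc a) \<otimes>\<^bsub>L\<^esub> ?Y = LX \<otimes>\<^bsub>L\<^esub> LX \<otimes>\<^bsub>L\<^esub> lc (a \<otimes> c)" unfolding hm by (simp add: L.m_ac)
   hence "emb L (?s ((LX \<otimes>\<^bsub>L\<^esub> lc a) \<otimes>\<^bsub>L\<^esub> ?Y) P) (?s (lc (a \<otimes> c)) P)"
    using L.emb_scale_square[OF P, of "lc (a \<otimes> c)" LX] by simp
   from L.emb_trans[OF L.emb_scale_scale(1) this]
   have "emb L (?s (LX \<otimes>\<^bsub>L\<^esub> lc a) (?s ?Y P)) (?s (lc (a \<otimes> c)) P)" by simp
   from L.emb_trans[OF this lcc(1)] have 2: "emb L (?s (LX \<otimes>\<^bsub>L\<^esub> lc a) (?s ?Y P)) (?E ?C)" by simp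
   from L.emb_trans[OF 1 L.emb_orth[OF lcs(2) 2]] have "emb L ?\<phi> (?o (?s LX (?E ?A)) (?E ?C))" by simp
   from L.emb_trans[OF this L.emb_orth_comm] have "emb L ?\<phi> (laurent_sum ?C ?A)" unfolding laurent_sum_def by simp
   from laurent_residue(2)[OF C A aA(2,1) q(1) this] show ?thesis .
  qed
  \<comment> \<open>Both \<open>\<phi>\<close> and its Pfister form have twice the dimension of
    their residues, so the neighbour inequality survives.\<close>
  thus ?thesis using d l by simp
 qed
 thus ?thesis unfolding pfister_emb_def using as a by blast
qed

end

section \<open>Tensor products\<close>

lemma (in abelian_monoid) finsum_div_mod:
 assumes "\<And>i::nat. i < m * d \<Longrightarrow> f i \<in> carrier G"
 shows "(\<Oplus>i\<in>{..<m * d}. f i) = (\<Oplus>i\<in>{..<m}. \<Oplus>j\<in>{..<d}. f (j + i * d))"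
 using assms
proof (induction m)
 case (Suc m)
 have c: "f (j + i * d) \<in> carrier G" if "j < d" "i < Suc m" for i j
 proof -
  have "j + i * d < Suc i * d" using that by simp
  also have "\<dots> \<le> Suc m * d" using that by (intro mult_right_mono) auto
  finally show ?thesis by (rule Suc.prems)
 qed
 have "(\<Oplus>i\<in>{..<m * d + d}. f i) = (\<Oplus>i\<in>{..<m * d}. f i) \<oplus> (\<Oplus>j\<in>{..<d}. f (j + m * d))"
  using Suc.prems by (intro finsum_lessThan_add) (simp add: add.commute)
 also have "(\<Oplus>i\<in>{..<m * d}. f i) = (\<Oplus>i\<in>{..<m}. \<Oplus>j\<in>{..<d}. f (j + i * d))" using Suc by simp
 also have "\<dots> \<oplus> (\<Oplus>j\<in>{..<d}. f (j + m * d)) = (\<Oplus>i\<in>{..<Suc m}. \<Oplus>j\<in>{..<d}. f (j + i * d))"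
 proof -
  have "(\<Oplus>i\<in>insert m {..<m}. \<Oplus>j\<in>{..<d}. f (j + i * d)) =
    (\<Oplus>j\<in>{..<d}. f (j + m * d)) \<oplus> (\<Oplus>i\<in>{..<m}. \<Oplus>j\<in>{..<d}. f (j + i * d))"
   using c by (intro finsum_insert) (auto intro!: finsum_closed)
  moreover have "(\<Oplus>j\<in>{..<d}. f (j + m * d)) \<in> carrier G" "(\<Oplus>i\<in>{..<m}. \<Oplus>j\<in>{..<d}. f (j + i * d)) \<in> carrier G"
   using c by (auto intro!: finsum_closed)
  ultimately show ?thesis unfolding lessThan_Suc by (simp add: a_comm)
 qed
 finally show ?case by (simp add: add.commute)
qed simp

lemma div_mod_bounds: "i < m * d \<Longrightarrow> i div d < m \<and> i mod d < (d :: nat)"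
 by (cases "d = 0") (auto simp: less_mult_imp_div_less)

context cring
begin

lemma sform_tensor:
 assumes "sform R p" "sform R q" shows "sform R (tensor_form R p q)"
 using assms div_mod_bounds unfolding sform_def by (simp add: tensor_form_def)

lemma emb_tensor:
 assumes e: "emb R p p'" and s: "sform R p'" "sform R q"
 shows "emb R (tensor_form R p q) (tensor_form R p' q)"
proof -
 obtain T where T: "\<And>j k. j < qdim p \<Longrightarrow> k < qdim p' \<Longrightarrow> T j k \<in> carrier R"
  "\<And>i j. i < qdim p \<Longrightarrow> j < qdim p \<Longrightarrow> gram p i j = bilin R p' (T i) (T j)"
  using e unfolding emb_def by blast
 let ?d = "qdim q" and ?m = "qdim p'"
 \<comment> \<open>The Kronecker product of \<open>T\<close> with the identity matrix of size
   \<open>qdim q\<close>.\<close>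
 define U where "U = (\<lambda>i k. if k mod ?d = i mod ?d then T (i div ?d) (k div ?d) else \<zero>)"
 have U: "U i k \<in> carrier R" if "i < qdim p * ?d" "k < ?m * ?d" for i k
  using T(1) div_mod_bounds[OF that(1)] div_mod_bounds[OF that(2)] by (simp add: U_def)
 have "gram (tensor_form R p q) i j = bilin R (tensor_form R p' q) (U i) (U j)"
  if i: "i < qdim p * ?d" and j: "j < qdim p * ?d" for i j
 proof -
  let ?g = "gram (tensor_form R p' q)"
  define i1 i2 j1 j2 where ij: "i1 = i div ?d" "i2 = i mod ?d" "j1 = j div ?d" "j2 = j mod ?d"
  have b: "i1 < qdim p" "i2 < ?d" "j1 < qdim p" "j2 < ?d" unfolding ij using div_mod_bounds[OF i] div_mod_bounds[OF j] by auto
  have st: "sform R (tensor_form R p' q)" by (rule sform_tensor[OF s])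
  have gc: "?g k l \<in> carrier R" if "k < ?m * ?d" "l < ?m * ?d" for k l using st that by simp
  have lt: "b + a * ?d < ?m * ?d" if "a < ?m" "b < ?d" for a b
  proof -
   have "b + a * ?d < Suc a * ?d" using that by simp
   also have "\<dots> \<le> ?m * ?d" using that by (intro mult_right_mono) auto
   finally show ?thesis .
  qed
  have dm: "(b + a * ?d) div ?d = a" "(b + a * ?d) mod ?d = b" if "b < ?d" for a b using that by auto
  have Uv: "U i (k2 + k1 * ?d) = (if k2 = i2 then T i1 k1 else \<zero>)" if "k2 < ?d" for k1 k2
   using that by (simp add: U_def ij dm)
  have Uj: "U j (k2 + k1 * ?d) = (if k2 = j2 then T j1 k1 else \<zero>)" if "k2 < ?d" for k1 k2
   using that by (simp add: U_def ij dm)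
  have gv: "?g (k2 + k1 * ?d) (l2 + l1 * ?d) = gram p' k1 l1 \<otimes> gram q k2 l2" if "k2 < ?d" "l2 < ?d" for k1 k2 l1 l2
   using that by (simp add: tensor_form_def dm)
  have inner: "(\<Oplus>l\<in>{..<?m * ?d}. U i k \<otimes> ?g k l \<otimes> U j l) =
    (\<Oplus>l1\<in>{..<?m}. U i k \<otimes> ?g k (j2 + l1 * ?d) \<otimes> T j1 l1)" if k: "k < ?m * ?d" for k
  proof -
   have "(\<Oplus>l\<in>{..<?m * ?d}. U i k \<otimes> ?g k l \<otimes> U j l) =
     (\<Oplus>l1\<in>{..<?m}. \<Oplus>l2\<in>{..<?d}. U i k \<otimes> ?g k (l2 + l1 * ?d) \<otimes> U j (l2 + l1 * ?d))"
    using U[OF i k] gc[OF k] U[OF j] by (intro finsum_div_mod) auto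
   also have "\<dots> = (\<Oplus>l1\<in>{..<?m}. U i k \<otimes> ?g k (j2 + l1 * ?d) \<otimes> T j1 l1)"
   proof (rule finsum_cong'[OF refl])
    fix l1 assume l1: "l1 \<in> {..<?m}"
    have "(\<Oplus>l2\<in>{..<?d}. U i k \<otimes> ?g k (l2 + l1 * ?d) \<otimes> U j (l2 + l1 * ?d)) =
      U i k \<otimes> ?g k (j2 + l1 * ?d) \<otimes> U j (j2 + l1 * ?d)"
     using b l1 U[OF i k] gc[OF k lt] T(1)[of j1] by (intro finsum_delta) (auto simp: Uj)
    thus "(\<Oplus>l2\<in>{..<?d}. U i k \<otimes> ?g k (l2 + l1 * ?d) \<otimes> U j (l2 + l1 * ?d)) =
      U i k \<otimes> ?g k (j2 + l1 * ?d) \<otimes> T j1 l1" using b by (simp add: Uj)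
   qed (use b U[OF i k] gc[OF k lt] T(1) in auto)
   finally show ?thesis .
  qed
  have Q: "gram q i2 j2 \<in> carrier R" and G: "\<And>k l. k < ?m \<Longrightarrow> l < ?m \<Longrightarrow> gram p' k l \<in> carrier R" using s b by auto
  have "bilin R (tensor_form R p' q) (U i) (U j) =
    (\<Oplus>k\<in>{..<?m * ?d}. \<Oplus>l1\<in>{..<?m}. U i k \<otimes> ?g k (j2 + l1 * ?d) \<otimes> T j1 l1)"
   unfolding bilin_def qdim_simps
   by (rule finsum_cong'[OF refl]) (use U[OF i] gc[OF _ lt] T(1) b in "auto simp: inner intro!: finsum_closed")
  also have "\<dots> = (\<Oplus>k1\<in>{..<?m}. \<Oplus>k2\<in>{..<?d}. \<Oplus>l1\<in>{..<?m}.
    U i (k2 + k1 * ?d) \<otimes> ?g (k2 + k1 * ?d) (j2 + l1 * ?d) \<otimes> T j1 l1)"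
   using U[OF i] gc[OF _ lt] T(1) b by (intro finsum_div_mod) (auto intro!: finsum_closed)
  also have "\<dots> = (\<Oplus>k1\<in>{..<?m}. \<Oplus>l1\<in>{..<?m}. T i1 k1 \<otimes> gram p' k1 l1 \<otimes> T j1 l1 \<otimes> gram q i2 j2)"
  proof (rule finsum_cong'[OF refl])
   fix k1 assume k1: "k1 \<in> {..<?m}"
   have "(\<Oplus>k2\<in>{..<?d}. \<Oplus>l1\<in>{..<?m}. U i (k2 + k1 * ?d) \<otimes> ?g (k2 + k1 * ?d) (j2 + l1 * ?d) \<otimes> T j1 l1) =
     (\<Oplus>l1\<in>{..<?m}. U i (i2 + k1 * ?d) \<otimes> ?g (i2 + k1 * ?d) (j2 + l1 * ?d) \<otimes> T j1 l1)"
    using b k1 U[OF i lt] gc[OF lt lt] T(1)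
    by (intro finsum_delta) (auto simp: Uv intro!: finsum_closed finsum_all_zero)
   also have "\<dots> = (\<Oplus>l1\<in>{..<?m}. T i1 k1 \<otimes> gram p' k1 l1 \<otimes> T j1 l1 \<otimes> gram q i2 j2)"
    using b k1 T(1) G Q by (intro finsum_cong') (auto simp: Uv gv m_ac)
   finally show "(\<Oplus>k2\<in>{..<?d}. \<Oplus>l1\<in>{..<?m}. U i (k2 + k1 * ?d) \<otimes> ?g (k2 + k1 * ?d) (j2 + l1 * ?d) \<otimes> T j1 l1) =
     (\<Oplus>l1\<in>{..<?m}. T i1 k1 \<otimes> gram p' k1 l1 \<otimes> T j1 l1 \<otimes> gram q i2 j2)" .
  qed (use b T(1) G Q in "auto intro!: finsum_closed")
  also have "\<dots> = (\<Oplus>k1\<in>{..<?m}. (\<Oplus>l1\<in>{..<?m}. T i1 k1 \<otimes> gram p' k1 l1 \<otimes> T j1 l1) \<otimes> gram q i2 j2)"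
   using b T(1) G Q by (intro finsum_cong') (auto intro!: finsum_closed simp: finsum_ldistr Pi_iff)
  also have "\<dots> = bilin R p' (T i1) (T j1) \<otimes> gram q i2 j2"
   unfolding bilin_def using b T(1) G Q by (subst finsum_ldistr) (auto intro!: finsum_closed)
  also have "\<dots> = gram (tensor_form R p q) i j" using T(2) b by (simp add: tensor_form_def ij)
  finally show ?thesis by simp
 qed
 thus ?thesis unfolding emb_def using U by (intro exI[of _ U]) simp
qed

text \<open>The numbering of tensor bases puts the outermost factor first, so the indices split into
  two halves that belong to the entries 1 and \<open>a\<close>.\<close>

lemma gram_tensor_double:
 assumes p: "sform R p" and q: "sform R q" and a: "a \<in> carrier R"
  and ij: "i < 2 * (qdim p * qdim q)" "j < 2 * (qdim p * qdim q)"
 shows "gram (tensor_form R (tensor_form R (diag_form R [\<one>, a]) p) q) i j =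
  gram (orth R (tensor_form R p q) (scl R a (tensor_form R p q))) i j"
proof -
 let ?d = "qdim q" and ?m = "qdim p"
 have d: "0 < ?d" using ij by (cases "?d") auto
 have b: "k div ?d < 2 * ?m" "k mod ?d < ?d" "k div ?d < ?m \<longleftrightarrow> k < ?m * ?d" "\<not> k < ?m * ?d \<Longrightarrow> (k - ?m * ?d) div ?d = k div ?d - ?m \<and> (k - ?m * ?d) mod ?d = k mod ?d"
  if "k < 2 * (?m * ?d)" for k
 proof -
  have k: "k < (2 * ?m) * ?d" using that by (simp add: mult.assoc)
  show "k div ?d < 2 * ?m" "k mod ?d < ?d" using div_mod_bounds[OF k] by auto
  show "k div ?d < ?m \<longleftrightarrow> k < ?m * ?d" by (rule div_less_iff_less_mult[OF d])
  assume "\<not> k < ?m * ?d"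
  then obtain l where "k = l + ?m * ?d" by (metis le_add_diff_inverse2 linorder_not_less)
  thus "(k - ?m * ?d) div ?d = k div ?d - ?m \<and> (k - ?m * ?d) mod ?d = k mod ?d" using d by simp
 qed
 have q': "gram q (i mod ?d) (j mod ?d) \<in> carrier R" using q b(2)[OF ij(1)] b(2)[OF ij(2)] by simp
 have p': "gram p k l \<in> carrier R" if "k < ?m" "l < ?m" for k l using p that by simp
 have r: "k div ?d - ?m < ?m" if "k < 2 * (?m * ?d)" "\<not> k < ?m * ?d" for k
  using b(1,3)[OF that(1)] that(2) by linarith
 have "gram (tensor_form R (tensor_form R (diag_form R [\<one>, a]) p) q) i j =
   gram (orth R p (scl R a p)) (i div ?d) (j div ?d) \<otimes> gram q (i mod ?d) (j mod ?d)"
  unfolding gram_tensor_diag[OF p a b(1)[OF ij(1)] b(1)[OF ij(2)], symmetric] by (simp add: tensor_form_def[of R _ q])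
 also have "\<dots> = gram (orth R (tensor_form R p q) (scl R a (tensor_form R p q))) i j"
  using b(3,4)[OF ij(1)] b(3,4)[OF ij(2)] q' p' r[OF ij(1)] r[OF ij(2)] a
  by (auto simp: orth_sum_def tensor_form_def scale_form_def m_assoc)
 finally show ?thesis .
qed

lemma tensor_pfister_form_emb:
 assumes "set as \<subseteq> carrier R" "sform R q"
 shows "emb R (tensor_form R (pfister_form R as) q) (pfister_mult R as q)" (is ?A)
  "emb R (pfister_mult R as q) (tensor_form R (pfister_form R as) q)" (is ?B)
proof -
 have "?A \<and> ?B"
  using assms(1)
 proof (induction as)
  case Nil
  have st: "sform R (tensor_form R (diag_form R [\<one>]) q)" using assms by (intro sform_tensor) auto
  have g: "gram (tensor_form R (diag_form R [\<one>]) q) i j = gram q i j" if "i < qdim q" "j < qdim q" for i j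
   using that assms(2) by (simp add: tensor_form_def diag_form_def)
  have "emb R (tensor_form R (diag_form R [\<one>]) q) q" by (rule emb_form_eq[OF _ _ assms(2)]) (use g in auto)
  moreover have "emb R q (tensor_form R (diag_form R [\<one>]) q)" by (rule emb_form_eq[OF _ _ st]) (use g in auto)
  ultimately show ?case by (simp add: pfister_form_def)
 next
  case (Cons a as)
  let ?p = "pfister_form R as" and ?o = "orth R" and ?s = "scl R"
  have a: "a \<in> carrier R" and as: "set as \<subseteq> carrier R" using Cons.prems by auto
  let ?t = "tensor_form R (tensor_form R (diag_form R [\<one>, a]) ?p) q" and ?u = "tensor_form R ?p q" and ?P = "pfister_mult R as q"
  have eq: "tensor_form R (pfister_form R (a # as)) q = ?t" by (simp add: pfister_form_def)
  note p = pfister_form_emb(1)[OF as]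
  have st: "sform R ?t" by (intro sform_tensor sform_diag p assms(2)) (use a in simp)
  have u: "sform R ?u" by (rule sform_tensor[OF p assms(2)])
  have P: "sform R ?P" by (rule sform_pfister_mult[OF as assms(2)])
  have s: "sform R (?o ?u (?s a ?u))" "sform R (?o ?P (?s a ?P))" using u P a by simp_all
  note g = gram_tensor_double[OF p assms(2) a]
  have IH: "emb R ?u ?P" "emb R ?P ?u" using Cons.IH[OF as] by auto
  have "emb R ?t (?o ?u (?s a ?u))" by (rule emb_form_eq[OF _ _ s(1)]) (use g in "auto simp: mult_2 distrib_right")
  moreover have "emb R (?o ?u (?s a ?u)) ?t" by (rule emb_form_eq[OF _ _ st]) (use g in "auto simp: mult_2 distrib_right")
  moreover have "emb R (?o ?u (?s a ?u)) (?o ?P (?s a ?P))" "emb R (?o ?P (?s a ?P)) (?o ?u (?s a ?u))"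
   using IH u P a by (auto intro!: emb_orth emb_scale)
  ultimately have "emb R ?t (?o ?P (?s a ?P))" "emb R (?o ?P (?s a ?P)) ?t" using emb_trans s st by blast+
  thus ?case unfolding eq by simp
 qed
 thus ?A ?B by auto
qed

end

section \<open>Transport and induction\<close>

lemma emb_extend_pfister_mult:
 assumes "field K" "field M" "h \<in> ring_hom K M" "sform K q" "set as \<subseteq> carrier K"
 shows "emb M (ext h (pfister_mult K as q)) (pfister_mult M (map h as) (ext h q))" (is ?A)
  "emb M (pfister_mult M (map h as) (ext h q)) (ext h (pfister_mult K as q))" (is ?B)
proof -
 interpret K: field K by fact
 interpret M: field M by fact
 have "?A \<and> ?B"
  using assms(5)
 proof (induction as)
  case Nil thus ?case using sform_ext[OF assms(3,4)] by (simp add: M.emb_refl)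
 next
  case (Cons a as)
  have a: "a \<in> carrier K" and as: "set as \<subseteq> carrier K" using Cons.prems by auto
  let ?P = "pfister_mult K as q" and ?Q = "pfister_mult M (map h as) (ext h q)"
  let ?E = "ext h ?P" and ?o = "orth M" and ?s = "scl M"
  have ha: "h a \<in> carrier M" by (rule ring_hom_closed[OF assms(3) a])
  have P: "sform K ?P" by (rule K.sform_pfister_mult[OF as assms(4)])
  have aP: "sform K (scl K a ?P)" using P a by simp
  have E: "sform M ?E" by (rule sform_ext[OF assms(3) P])
  have hs: "set (map h as) \<subseteq> carrier M" using as ring_hom_closed[OF assms(3)] by auto
  have Q: "sform M ?Q" by (rule M.sform_pfister_mult[OF hs sform_ext[OF assms(3,4)]])
  have IH: "emb M ?E ?Q" "emb M ?Q ?E" using Cons.IH[OF as] by auto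
  have sE: "sform M (ext h (scl K a ?P))" "sform M (ext h (orth K ?P (scl K a ?P)))"
   using P a by (auto intro!: sform_ext[OF assms(3)])
  note o = emb_extend_orth[OF assms(1-3) P aP] and sc = emb_extend_scale[OF assms(1-3) P a]
  have sQ: "sform M (?s (h a) ?Q)" "sform M (?s (h a) ?E)" using Q E ha by simp_all
  have "emb M (ext h (scl K a ?P)) (?s (h a) ?Q)"
   by (rule M.emb_trans[OF sc(1) M.emb_scale[OF IH(1) Q ha] sQ(1)])
  from M.emb_trans[OF o(1) M.emb_orth[OF IH(1) this Q sQ(1)]]
  have 1: "emb M (ext h (orth K ?P (scl K a ?P))) (?o ?Q (?s (h a) ?Q))" using Q sQ by simp
  have "emb M (?s (h a) ?Q) (ext h (scl K a ?P))"
   by (rule M.emb_trans[OF M.emb_scale[OF IH(2) E ha] sc(2) sE(1)])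
  from M.emb_trans[OF M.emb_orth[OF IH(2) this E sE(1)] o(2) sE(2)]
  have 2: "emb M (?o ?Q (?s (h a) ?Q)) (ext h (orth K ?P (scl K a ?P)))" .
  show ?case using 1 2 by simp
 qed
 thus ?A ?B by auto
qed

text \<open>Slots and scaling factor stay nonzero under a homomorphism of fields, and the number of
  slots does not change.\<close>

lemma pfister_emb_hom:
 fixes K :: "('a, 'b) ring_scheme" and N :: "('m, 'n) ring_scheme"
 assumes "field K" "field N" and j: "j \<in> ring_hom N K" and r: "sform N r" and e: "emb K p (ext j r)"
  and d: "qdim r = qdim p" and n: "pfister_emb N r"
 shows "pfister_emb K p"
proof -
 interpret K: field K by fact
 interpret N: field N by fact
 obtain as b where as: "set as \<subseteq> carrier N - {\<zero>\<^bsub>N\<^esub>}" and b: "b \<in> carrier N" "b \<noteq> \<zero>\<^bsub>N\<^esub>"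
  and l: "2 ^ length as < 2 * qdim r" and er: "emb N r (scl N b (pfister N as))"
  using n unfolding pfister_emb_def by blast
 have as': "set as \<subseteq> carrier N" using as by blast
 have nz: "j x \<in> carrier K - {\<zero>\<^bsub>K\<^esub>}" if "x \<in> carrier N" "x \<noteq> \<zero>\<^bsub>N\<^esub>" for x
  using field_hom_zero_iff[OF assms(2,1) j that(1)] ring_hom_closed[OF j that(1)] that(2) by simp
 have has: "set (map j as) \<subseteq> carrier K - {\<zero>\<^bsub>K\<^esub>}" using as nz by auto
 have has': "set (map j as) \<subseteq> carrier K" using has by blast
 let ?P = "pfister N as" and ?d = "ext j (diag_form N [\<one>\<^bsub>N\<^esub>])"
 have P: "sform N ?P" by (rule N.sform_pfister[OF as'])
 have sd: "sform K (diag_form K [\<one>\<^bsub>K\<^esub>])" "sform K ?d" by (simp, rule sform_ext[OF j], simp)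
 have "emb K ?d (diag_form K [\<one>\<^bsub>K\<^esub>])"
  by (rule K.emb_form_eq[OF _ _ sd(1)]) (simp_all add: diag_form_def extend_form_def ring_hom_one[OF j])
 hence "emb K (pfister_mult K (map j as) ?d) (pfister K (map j as))" by (rule K.emb_pfister_mult[OF _ sd(2,1) has'])
 from K.emb_trans[OF emb_extend_pfister_mult(1)[OF assms(2,1) j _ as'] this]
 have 1: "emb K (ext j ?P) (pfister K (map j as))" using K.sform_pfister[OF has'] by simp
 have jb: "j b \<in> carrier K" "j b \<noteq> \<zero>\<^bsub>K\<^esub>" using nz[OF b] by auto
 have sbP: "sform N (scl N b ?P)" using P b by simp
 have sp: "sform K (ext j (scl N b ?P))" by (rule sform_ext[OF j sbP])
 have sEP: "sform K (ext j ?P)" by (rule sform_ext[OF j P])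
 have "emb K p (ext j (scl N b ?P))"
  by (rule K.emb_trans[OF e emb_extend[OF N.cring_axioms K.cring_axioms j sbP er] sp])
 from K.emb_trans[OF this emb_extend_scale(1)[OF assms(2,1) j P b(1)]]
 have "emb K p (scl K (j b) (ext j ?P))" using sEP jb by simp
 from K.emb_trans[OF this K.emb_scale[OF 1]]
 have "emb K p (scl K (j b) (pfister K (map j as)))" using K.sform_pfister[OF has'] jb by simp
 thus ?thesis unfolding pfister_emb_def using has jb l d by (intro exI[of _ "map j as"]) auto
qed

text \<open>Maximal splitting travels along \<open>j\<close>, and an embedding in a multiple of a
  Pfister form travels back along \<open>j'\<close>. This serves for the copies of rings made by
  \<open>Const\<close> and \<open>Series\<close>, and with identity maps for mutually embedding
  forms over one field.\<close>

lemma transport: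
 fixes K :: "('a, 'b) ring_scheme" and N :: "('m, 'n) ring_scheme"
 assumes "field2 K" "field N" and j: "j \<in> ring_hom K N" "j' \<in> ring_hom N K" "\<And>a. a \<in> carrier K \<Longrightarrow> j' (j a) = a"
  and r: "regular N r" and e: "emb N (ext j p) r" "emb N r (ext j p)"
  and p: "maximal_splitting K p" "\<not> pfister_emb K p"
 shows "maximal_splitting N r \<and> \<not> pfister_emb N r"
proof
 have N2: "field2 N" by (rule field2_hom[OF assms(1,2) j(1)])
 interpret K: field2 K by fact
 interpret N: field2 N by fact
 show "maximal_splitting N r" by (rule maximal_splitting_transport[OF assms(1) N2 j p(1) r e])
 have p': "regular K p" using p(1) by (simp add: maximal_splitting_def)
 have sp: "sform K p" and sr: "sform N r" using p' r by (auto intro: regular_sform)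
 have rj: "regular N (ext j p)" by (rule regular_extend[OF K.field_axioms N.field_axioms j(1) p'])
 have sj: "sform N (ext j p)" using rj by (rule regular_sform)
 have "qdim r = qdim p"
  using N.regular_emb_dim_le[OF r e(2) sj] N.regular_emb_dim_le[OF rj e(1) sr] by simp
 moreover have "emb K p (ext j' r)"
 proof (rule K.emb_trans)
  show "emb K p (ext j' (ext j p))"
   by (rule K.emb_form_eq[OF _ _ sform_ext[OF j(2) sj]]) (use sp j(3) in "auto simp: extend_form_def")
  show "emb K (ext j' (ext j p)) (ext j' r)"
   by (rule emb_extend[OF N.cring_axioms K.cring_axioms j(2) sr e(1)])
 qed (rule sform_ext[OF j(2) sr])
 ultimately show "\<not> pfister_emb N r"
  using pfister_emb_hom[OF K.field_axioms N.field_axioms j(2) sr] p(2) by blast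
qed

lemma iterated_laurent_vars_nonzero:
 assumes "field F"
 shows "set (iterated_laurent_vars F n) \<subseteq> carrier (iterated_laurent F n) - {\<zero>\<^bsub>iterated_laurent F n\<^esub>}"
proof (induction n)
 case (Suc n)
 let ?T = "iterated_laurent F n"
 interpret T: field ?T by (rule tower_field[OF assms])
 interpret L: field "laurent_ring ?T" by (rule T.laurent_field)
 note fL = L.field_axioms and j = tower_step_hom[OF assms] and T' = tower_field[OF assms, of "Suc n"]
 have 1: "Series x \<in> carrier (iterated_laurent F (Suc n)) - {\<zero>\<^bsub>iterated_laurent F (Suc n)\<^esub>}"
  if "x \<in> carrier (laurent_ring ?T)" "x \<noteq> \<zero>\<^bsub>laurent_ring ?T\<^esub>" for x
  using field_hom_zero_iff[OF fL T' j that(1)] ring_hom_closed[OF j that(1)] that(2) by blast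
 have "laurent_var ?T 1 = \<one>\<^bsub>?T\<^esub>" "\<zero>\<^bsub>laurent_ring ?T\<^esub> 1 = \<zero>\<^bsub>?T\<^esub>"
  by (simp_all add: laurent_var_def T.laurent_zero)
 hence v: "laurent_var ?T \<noteq> \<zero>\<^bsub>laurent_ring ?T\<^esub>" by (metis T.one_not_zero)
 have c: "laurent_const ?T x \<noteq> \<zero>\<^bsub>laurent_ring ?T\<^esub>" if "x \<in> set (iterated_laurent_vars F n)" for x
  using field_hom_zero_iff[OF T.field_axioms fL T.lc_hom, of x] that Suc by blast
 show ?case
  using 1[OF _ v] 1[OF T.lc_closed c] Suc unfolding iterated_laurent_vars.simps by (auto simp del: iterated_laurent.simps)
qed simp

lemma pfister_mult_tower:
 assumes "field2 F" "maximal_splitting F q" "\<not> pfister_emb F q"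
 defines "\<psi> \<equiv> \<lambda>n. pfister_mult (iterated_laurent F n) (iterated_laurent_vars F n) (ext (iterated_laurent_const F n) q)"
 shows "maximal_splitting (iterated_laurent F n) (\<psi> n) \<and> \<not> pfister_emb (iterated_laurent F n) (\<psi> n)"
proof -
 interpret F: field2 F by fact
 have q: "regular F q" "sform F q" using assms(2) by (auto simp: maximal_splitting_def regular_sform)
 have T: "field (iterated_laurent F n)" for n by (rule tower_field[OF F.field_axioms])
 have k: "iterated_laurent_const F n \<in> ring_hom F (iterated_laurent F n)" for n by (rule tower_const_hom[OF F.field_axioms])
 note vars = iterated_laurent_vars_nonzero[OF F.field_axioms]
 have reg: "regular (iterated_laurent F n) (\<psi> n)" for n
  unfolding \<psi>_def by (intro field.regular_pfister_mult[OF T] vars regular_extend[OF F.field_axioms T k q(1)])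
 show ?thesis
 proof (induction n)
  case 0
  let ?T = "iterated_laurent F 0" and ?k = "iterated_laurent_const F 0"
  interpret T: field ?T by (rule T)
  have "?k = tower.Const" by (simp add: fun_eq_iff)
  have \<psi>0: "\<psi> 0 = ext ?k q" by (simp add: \<psi>_def)
  have s: "sform ?T (ext ?k q)" by (rule sform_ext[OF k q(2)])
  have inv: "Hilbert_Choice.inv tower.Const \<in> ring_hom ?T F" "\<And>a. Hilbert_Choice.inv tower.Const (?k a) = a"
   by (simp_all add: image_ring_inv_hom inj_tower Hilbert_Choice.inv_f_f)
  show ?case
   by (rule transport[OF assms(1) T k inv reg _ _ assms(2,3)]) (simp_all only: \<psi>0 T.emb_refl[OF s])
 next
  case (Suc n)
  let ?T = "iterated_laurent F n" and ?T' = "iterated_laurent F (Suc n)" and ?k = "iterated_laurent_const F n"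
  let ?L = "laurent_ring ?T" and ?vs = "iterated_laurent_vars F n"
  have T2: "field2 ?T" by (rule field2_hom[OF assms(1) T k])
  interpret T: field2 ?T by (rule T2)
  interpret T': field ?T' by (rule T)
  interpret L: field ?L by (rule T.laurent_field)
  have L2: "field2 ?L" by (rule field2_hom[OF T2 L.field_axioms T.lc_hom])
  have \<psi>: "sform ?T (\<psi> n)" "aniso ?T (\<psi> n)" "maximal_splitting ?T (\<psi> n)" "\<not> pfister_emb ?T (\<psi> n)"
   using Suc by (auto simp: maximal_splitting_def regular_sform)
  let ?\<phi> = "T.laurent_sum (\<psi> n) (\<psi> n)"
  have \<phi>: "maximal_splitting ?L ?\<phi>" "\<not> pfister_emb ?L ?\<phi>"
   using T.maximal_splitting_laurent_sum[OF \<psi>(3)] T.pfister_emb_laurent_sum[OF \<psi>(1,2)] \<psi>(4) by auto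
  have j: "Series \<in> ring_hom ?L ?T'" using tower_step_hom[OF F.field_axioms] by simp
  have inv: "Hilbert_Choice.inv Series \<in> ring_hom ?T' ?L" "\<And>a. Hilbert_Choice.inv Series (Series a) = a"
   by (simp_all add: image_ring_inv_hom inj_tower Hilbert_Choice.inv_f_f)
  define g where "g = (\<lambda>a. Series (laurent_const ?T a))"
  define y where "y = Series (laurent_var ?T)"
  have g: "g \<in> ring_hom ?T ?T'" unfolding g_def by (rule ring_hom_comp[OF T.lc_hom j])
  have y: "y \<in> carrier ?T'" unfolding y_def by (rule ring_hom_closed[OF j]) simp
  let ?q = "ext (iterated_laurent_const F (Suc n)) q"
  have "iterated_laurent_const F (Suc n) = (\<lambda>a. g (?k a))" by (rule ext) (simp add: g_def)
  hence gq: "ext g (ext ?k q) = ?q" by (simp only: extend_extend)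
  have sq: "sform ?T' ?q" by (rule sform_ext[OF k q(2)])
  have vs: "set ?vs \<subseteq> carrier ?T" using vars by blast
  have gvs: "set (map g ?vs) \<subseteq> carrier ?T'" using vs ring_hom_closed[OF g] by auto
  let ?Z = "pfister_mult ?T' (map g ?vs) ?q" and ?o = "orth ?T'" and ?s = "scl ?T'" and ?E = "ext g (\<psi> n)"
  have Z: "sform ?T' ?Z" by (rule T'.sform_pfister_mult[OF gvs sq])
  have E: "sform ?T' ?E" by (rule sform_ext[OF g \<psi>(1)])
  have EZ: "emb ?T' ?E ?Z" "emb ?T' ?Z ?E"
   unfolding \<psi>_def using emb_extend_pfister_mult[OF T T g sform_ext[OF k q(2)] vs, unfolded gq] by auto
  have \<psi>S: "\<psi> (Suc n) = pfister_mult ?T' (map g ?vs @ [y]) ?q"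
   by (simp add: \<psi>_def g_def[abs_def] y_def)
  have s\<psi>S: "sform ?T' (\<psi> (Suc n))" by (rule regular_sform[OF reg])
  \<comment> \<open>The new variable is the last slot of the list but the outer factor of the
    Laurent sum; the two descriptions are matched here.\<close>
  note app = T'.emb_pfister_mult_append[OF sq gvs y, folded \<psi>S]
  note sum = emb_extend_laurent_sum[OF T.field_axioms T'.field_axioms j \<psi>(1) \<psi>(1), folded g_def y_def]
  have s2: "sform ?T' (?s y ?Z)" "sform ?T' (?s y ?E)" using Z E y T'.sform_scale by blast+
  have s1: "sform ?T' (?o ?Z (?s y ?Z))" "sform ?T' (?o ?E (?s y ?E))" using Z E s2 T'.sform_orth by blast+
  have sx: "sform ?T' (ext Series ?\<phi>)" by (rule sform_ext[OF j T.sform_laurent_sum[OF \<psi>(1) \<psi>(1)]])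
  have "emb ?T' (?o ?E (?s y ?E)) (?o ?Z (?s y ?Z))" by (rule T'.emb_orth[OF EZ(1) T'.emb_scale[OF EZ(1) Z y] Z s2(1)])
  from T'.emb_trans[OF T'.emb_trans[OF sum(1) this s1(1)] app(2) s\<psi>S]
  have 1: "emb ?T' (ext Series ?\<phi>) (\<psi> (Suc n))" .
  have "emb ?T' (?o ?Z (?s y ?Z)) (?o ?E (?s y ?E))" by (rule T'.emb_orth[OF EZ(2) T'.emb_scale[OF EZ(2) E y] E s2(2)])
  from T'.emb_trans[OF T'.emb_trans[OF app(1) this s1(2)] sum(2) sx]
  have 2: "emb ?T' (\<psi> (Suc n)) (ext Series ?\<phi>)" .
  show ?case by (rule transport[OF L2 T'.field_axioms j inv reg 1 2 \<phi>])
 qed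
qed

theorem proposition4p1:
  fixes F :: "('a, 'b) ring_scheme" and q :: "'a qform" and n :: nat and \<pi> :: "'a tower qform"
  assumes "field F" and "\<one>\<^bsub>F\<^esub> \<oplus>\<^bsub>F\<^esub> \<one>\<^bsub>F\<^esub> \<noteq> \<zero>\<^bsub>F\<^esub>"
    and "quadratic_form F q" and "anisotropic F q"
    and "maximal_splitting F q" and "\<not> pfister_neighbour F q"
    and "n \<ge> 1"
    and "quadratic_form (iterated_laurent F n) \<pi>"
    and "isometric (iterated_laurent F n) \<pi>
           (pfister_form (iterated_laurent F n) (iterated_laurent_vars F n))"
  shows "maximal_splitting (iterated_laurent F n)
           (tensor_form (iterated_laurent F n) \<pi> (extend_form (iterated_laurent_const F n) q)) \<and>
         \<not> pfister_neighbour (iterated_laurent F n)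
           (tensor_form (iterated_laurent F n) \<pi> (extend_form (iterated_laurent_const F n) q))"
proof -
  interpret F: field F by fact
  have F2: "field2 F" by unfold_locales (rule assms(2))
  interpret F: field2 F by (rule F2)
  have nq: "\<not> pfister_emb F q" using F.pfister_neighbour_iff[OF assms(3)] assms(6) by blast
  let ?T = "iterated_laurent F n" and ?k = "iterated_laurent_const F n" and ?vs = "iterated_laurent_vars F n"
  let ?q = "ext ?k q" and ?p = "pfister_form ?T ?vs"
  have T: "field ?T" by (rule tower_field[OF assms(1)])
  have k: "?k \<in> ring_hom F ?T" by (rule tower_const_hom[OF assms(1)])
  have T2: "field2 ?T" by (rule field2_hom[OF F2 T k])
  interpret T: field2 ?T by (rule T2)
  let ?\<psi> = "pfister_mult ?T ?vs ?q" and ?t = "tensor_form ?T \<pi> ?q"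
  have \<psi>: "maximal_splitting ?T ?\<psi>" "\<not> pfister_emb ?T ?\<psi>" using pfister_mult_tower[OF F2 assms(5) nq, of n] by auto
  have r\<psi>: "regular ?T ?\<psi>" using \<psi>(1) by (simp add: maximal_splitting_def)
  have s\<psi>: "sform ?T ?\<psi>" using r\<psi> by (rule regular_sform)
  have sq: "sform ?T ?q" by (rule sform_ext[OF k regular_sform[OF assms(3)]])
  have s\<pi>: "sform ?T \<pi>" using assms(8) by (rule regular_sform)
  have vs: "set ?vs \<subseteq> carrier ?T" using iterated_laurent_vars_nonzero[OF assms(1)] by blast
  note p = T.pfister_form_emb[OF vs] and tp = T.tensor_pfister_form_emb[OF vs sq]
  have st: "sform ?T ?t" by (rule T.sform_tensor[OF s\<pi> sq])
  have e: "emb ?T ?t ?\<psi>" "emb ?T ?\<psi> ?t"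
    by (rule T.emb_trans[OF T.emb_tensor[OF T.isometric_emb[OF assms(9)] p(1) sq] tp(1) s\<psi>],
        rule T.emb_trans[OF tp(2) T.emb_tensor[OF T.isometric_emb[OF T.isometric_sym[OF assms(9) p(1)]] s\<pi> sq] st])
  have "qdim \<pi> = 2 ^ length ?vs" using assms(9) p(2) by (simp add: isometric_def)
  hence "qdim ?\<psi> = qdim ?t" by (simp add: T.qdim_pfister_mult)
  hence rt: "regular ?T ?t" by (rule T.regular_of_emb[OF r\<psi> st e(2)])
  \<comment> \<open>With identity maps, \<open>transport\<close> passes from the inductive product
    to the tensor product with \<open>\<pi>\<close>, which embeds in it and conversely.\<close>
  have id: "(\<lambda>a. a) \<in> ring_hom ?T ?T" by (simp add: ring_hom_def)
  have "ext (\<lambda>a. a) ?\<psi> = ?\<psi>" by (cases ?\<psi>) (simp add: extend_form_def)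
  hence "maximal_splitting ?T ?t \<and> \<not> pfister_emb ?T ?t"
    using transport[OF T2 T id id refl rt _ _ \<psi>] e by simp
  thus ?thesis using T.pfister_neighbour_iff[OF rt] by blast
qed

end
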